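(* Let $r>0$, $\theta\in\mathbb{R}$, $\sigma>0$, let $Z\sim\mathrm{VG}(r,\theta,\sigma,0)$, let $n\ge1$, let $h\in C_b^n(\mathbb{R})$, put $\tilde h(x)=h(x)-\mathbb{E}h(Z)$, and let $f$ be the solution, given in the context, of the variance-gamma Stein equation $$\sigma^2xf''(x)+(\sigma^2r+2\theta x)f'(x)+(r\theta-x)f(x)=\tilde h(x).$$ For $j\ge0$ let $B_j=\frac{2}{r+j}+C(r+j,\theta,\sigma)$, where for $s>0$ $$C(s,\theta,\sigma)=\begin{cases}\dfrac{\sqrt\pi\,\Gamma(\frac s2)}{\Gamma(\frac{s+1}2)}\Big(1+\dfrac{\theta^2}{\sigma^2}\Big)^{s/2},& s\ge2,\\[2ex] 6\,\Gamma\big(\tfrac s2\big)\Big(1-\dfrac{1}{(1+\sigma^2/\theta^2)^{1/2}}\Big)^{-s/2},& 0<s<2,\end{cases}$$ with $1/(1+\sigma^2/\theta^2)^{1/2}$ read as $0$ when $\theta=0$. Then $$\|f^{(n+1)}\|\le\frac1{\sigma^2}\sum_{j=0}^{n-1}\Big(B_{n-j}\sum_{l\in I_j}A_{j,l}^{(n)}\Big)\|h^{(n-j)}\|+\frac{B_0}{\sigma^2}\Big(\sum_{l\in I_n}A_{n,l}^{(n)}+\frac{B_1}{\sqrt{\theta^2+\sigma^2}}\sum_{l\in I_{n-1}}A_{n-1,l}^{(n)}\Big)\|\tilde h\|,$$ where $I_j=\{j+1-\lfloor j/2\rfloor,\dots,j+1\}$, $$A_{j,l}^{(n)}=\sum_{M\in\mathcal{S}_{j,l}^{(n)}}\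 \prod_{i\in M\setminus\{n-j\}}\big(|\theta|1_{\{i-1\in M\}}+1_{\{i-1\notin M\}}\big)\frac{iB_i}{\sigma^2},$$ and $\mathcal{S}_{j,l}^{(n)}$ is the collection of those subsets $M$ of size $l$ of $\{n-j,n-j+1,\dots,n\}$ such that $\{n,n-j\}\subseteq M$ and $M\cap\{i,i+1\}\ne\emptyset$ for all $n-j\le i\le n-1$.
   Context: $\|\cdot\|$ denotes the supremum norm on $\mathbb{R}$ (values at $x=0$ understood by continuity, where needed). $h\in C_b^n(\mathbb{R})$ means that $h^{(n-1)}$ exists and is absolutely continuous, with derivatives of $h$ up to order $n$ bounded ($h$ itself included). Empty products equal $1$. $\mathrm{VG}(r,\theta,\sigma,0)$ is the distribution on $\mathbb{R}$ with density $$p(x)=\frac{1}{\sigma\sqrt\pi\,\Gamma(\frac r2)}e^{\theta x/\sigma^2}\Big(\frac{|x|}{2\sqrt{\theta^2+\sigma^2}}\Big)^{\frac{r-1}2}K_{\frac{r-1}2}\Big(\frac{\sqrt{\theta^2+\sigma^2}}{\sigma^2}|x|\Big),$$ where $K_\nu$ is the modified Bessel function of the second kind and $I_\nu(\cdot)$ below is the modified Bessel function of the first kind. With $\nu=\frac{r-1}2$ and $\alpha=\sqrt{\theta^2+\sigma^2}/\sigma^2$, the solution $f$ is $$f(x)=-\frac{e^{-\theta x/\sigma^2}}{\sigma^2|x|^\nu}K_\nu(\alpha|x|)\int_0^xe^{\theta t/\sigma^2}|t|^\nu I_\nu(\alpha|t|)\tilde h(t)\,dt-\frac{e^{-\theta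 x/\sigma^2}}{\sigma^2|x|^\nu}I_\nu(\alpha|x|)\int_x^\infty e^{\theta t/\sigma^2}|t|^\nu K_\nu(\alpha|t|)\tilde h(t)\,dt.$$ It is the unique solution such that $f$ and $f'$ are bounded. *)

theory Defs
  imports "HOL-Probability.Probability"
begin

text \<open>The reciprocal Gamma function \<^const>\<open>rGamma\<close> vanishes at the poles of \<^const>\<open>Gamma\<close>,
  as the series requires. Both functions are meant for arguments \<open>x > 0\<close>.\<close>

definition bessel_I :: "real \<Rightarrow> real \<Rightarrow> real" where
  "bessel_I \<nu> x = (\<Sum>k. rGamma (\<nu> + real k + 1) / fact k * (x / 2) powr (\<nu> + 2 * real k))"

definition bessel_K :: "real \<Rightarrow> real \<Rightarrow> real" where
  "bessel_K \<nu> x = (LBINT t=0..\<infinity>. exp (- x * cosh t) * cosh (\<nu> * t))"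

definition vg_density :: "real \<Rightarrow> real \<Rightarrow> real \<Rightarrow> real \<Rightarrow> real" where
  "vg_density r \<theta> \<sigma> x =
     1 / (\<sigma> * sqrt pi * Gamma (r / 2)) * exp (\<theta> * x / \<sigma>\<^sup>2)
     * (\<bar>x\<bar> / (2 * sqrt (\<theta>\<^sup>2 + \<sigma>\<^sup>2))) powr ((r - 1) / 2)
     * bessel_K ((r - 1) / 2) (sqrt (\<theta>\<^sup>2 + \<sigma>\<^sup>2) / \<sigma>\<^sup>2 * \<bar>x\<bar>)"

text \<open>In the following formula \<open>g\<close> is the right-hand side of the Stein equation. For \<open>x < 0\<close>
  the first integral is the oriented one, that is, minus the integral over \<open>{x<..<0}\<close>.\<close>

definition vg_stein_formula ::
    "real \<Rightarrow> real \<Rightarrow> real \<Rightarrow> (real \<Rightarrow> real) \<Rightarrow> real \<Rightarrow> real" where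
  "vg_stein_formula r \<theta> \<sigma> g x =
     (let \<nu> = (r - 1) / 2; \<alpha> = sqrt (\<theta>\<^sup>2 + \<sigma>\<^sup>2) / \<sigma>\<^sup>2 in
       - (exp (- \<theta> * x / \<sigma>\<^sup>2) / (\<sigma>\<^sup>2 * \<bar>x\<bar> powr \<nu>)) * bessel_K \<nu> (\<alpha> * \<bar>x\<bar>)
           * (LBINT t=0..x. exp (\<theta> * t / \<sigma>\<^sup>2) * \<bar>t\<bar> powr \<nu> * bessel_I \<nu> (\<alpha> * \<bar>t\<bar>) * g t)
       - (exp (- \<theta> * x / \<sigma>\<^sup>2) / (\<sigma>\<^sup>2 * \<bar>x\<bar> powr \<nu>)) * bessel_I \<nu> (\<alpha> * \<bar>x\<bar>)
           * (LBINT t=x..\<infinity>. exp (\<theta> * t / \<sigma>\<^sup>2) * \<bar>t\<bar> powr \<nu> * bessel_K \<nu> (\<alpha> * \<bar>t\<bar>) * g t))"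

definition vg_stein_sol ::
    "real \<Rightarrow> real \<Rightarrow> real \<Rightarrow> (real \<Rightarrow> real) \<Rightarrow> real \<Rightarrow> real" where
  "vg_stein_sol r \<theta> \<sigma> g x =
     (if x = 0 then Lim (at 0) (vg_stein_formula r \<theta> \<sigma> g) else vg_stein_formula r \<theta> \<sigma> g x)"

text \<open>\<open>deriv_dom k g\<close> is the set of points at which the \<open>k\<close>-th derivative of \<open>g\<close> exists. It is
  needed because \<^const>\<open>deriv\<close> has an unspecified value where there is no derivative, and the
  highest derivative considered need only exist almost everywhere.\<close>

primrec deriv_dom :: "nat \<Rightarrow> (real \<Rightarrow> real) \<Rightarrow> real set" where
  "deriv_dom 0 g = UNIV"
| "deriv_dom (Suc k) g =
     {x. (\<forall>\<^sub>F y in nhds x. y \<in> deriv_dom k g) \<and> (deriv ^^ k) g field_differentiable at x}"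

definition deriv_bounded :: "nat \<Rightarrow> (real \<Rightarrow> real) \<Rightarrow> bool" where
  "deriv_bounded k g \<longleftrightarrow> bounded ((deriv ^^ k) g ` deriv_dom k g)"

text \<open>The norm of the \<open>k\<close>-th derivative, meaningful only under \<^const>\<open>deriv_bounded\<close>.\<close>

definition deriv_norm :: "nat \<Rightarrow> (real \<Rightarrow> real) \<Rightarrow> real" where
  "deriv_norm k g = (SUP x\<in>deriv_dom k g. \<bar>(deriv ^^ k) g x\<bar>)"

definition abs_continuous_on :: "real set \<Rightarrow> (real \<Rightarrow> real) \<Rightarrow> bool" where
  "abs_continuous_on S g \<longleftrightarrow>
     (\<forall>\<epsilon>>0. \<exists>\<delta>>0. \<forall>(m::nat) a b.
        (\<forall>i<m. a i \<le> b i \<and> {a i..b i} \<subseteq> S) \<longrightarrow>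
        disjoint_family_on (\<lambda>i. {a i<..<b i}) {..<m} \<longrightarrow>
        (\<Sum>i<m. b i - a i) < \<delta> \<longrightarrow>
        (\<Sum>i<m. \<bar>g (b i) - g (a i)\<bar>) < \<epsilon>)"

text \<open>Absolute continuity on the real line is taken on every compact interval. Together with the
  boundedness of the \<open>n\<close>-th derivative this is the same as absolute continuity on \<^term>\<open>UNIV\<close>.
  The definition is meant for \<open>n \<ge> 1\<close>.\<close>

definition Cb :: "nat \<Rightarrow> (real \<Rightarrow> real) set" where
  "Cb n = {h. deriv_dom (n - 1) h = UNIV \<and>
              (\<forall>u v. abs_continuous_on {u..v} ((deriv ^^ (n - 1)) h)) \<and>
              (\<forall>k\<le>n. deriv_bounded k h)}"

text \<open>The case distinction on \<open>\<theta>\<close> is needed because division by zero gives zero.\<close>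

definition vg_C :: "real \<Rightarrow> real \<Rightarrow> real \<Rightarrow> real" where
  "vg_C s \<theta> \<sigma> =
     (if s \<ge> 2
      then sqrt pi * Gamma (s / 2) / Gamma ((s + 1) / 2) * (1 + \<theta>\<^sup>2 / \<sigma>\<^sup>2) powr (s / 2)
      else 6 * Gamma (s / 2)
           * (1 - (if \<theta> = 0 then 0 else 1 / sqrt (1 + \<sigma>\<^sup>2 / \<theta>\<^sup>2))) powr (- s / 2))"

definition vg_B :: "real \<Rightarrow> real \<Rightarrow> real \<Rightarrow> nat \<Rightarrow> real" where
  "vg_B r \<theta> \<sigma> j = 2 / (r + real j) + vg_C (r + real j) \<theta> \<sigma>"

definition vg_I :: "nat \<Rightarrow> nat set" where
  "vg_I j = {j + 1 - j div 2 .. j + 1}"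

definition vg_S :: "nat \<Rightarrow> nat \<Rightarrow> nat \<Rightarrow> nat set set" where
  "vg_S n j l = {M. M \<subseteq> {n - j..n} \<and> card M = l \<and> {n, n - j} \<subseteq> M \<and>
                    (\<forall>i\<in>{n - j..<n}. M \<inter> {i, i + 1} \<noteq> {})}"

definition vg_A :: "real \<Rightarrow> real \<Rightarrow> real \<Rightarrow> nat \<Rightarrow> nat \<Rightarrow> nat \<Rightarrow> real" where
  "vg_A r \<theta> \<sigma> n j l =
     (\<Sum>M\<in>vg_S n j l. \<Prod>i\<in>M - {n - j}.
        (\<bar>\<theta>\<bar> * of_bool (i - 1 \<in> M) + of_bool (i - 1 \<notin> M)) * (real i * vg_B r \<theta> \<sigma> i / \<sigma>\<^sup>2))"

end

theory Submission
  imports Defs "HOL-Real_Asymp.Real_Asymp"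
begin

text \<open>Write \<open>L\<^sub>s u = \<sigma>\<^sup>2 x u'' + (\<sigma>\<^sup>2 s + 2 \<theta> x) u' + (s \<theta> - x) u\<close>. If \<open>L\<^sub>s v = g\<close> then
  \<open>L\<^bsub>s+1\<^esub> v' = g' + v - \<theta> v'\<close>, so the \<open>k\<close>-th derivative of the solution \<open>f\<close> satisfies
  \<open>L\<^bsub>r+k\<^esub> f\<^bsup>(k)\<^esup> = h\<^bsup>(k)\<^esup> + k f\<^bsup>(k-1)\<^esup> - k \<theta> f\<^bsup>(k)\<^esup>\<close>. A bounded solution of \<open>L\<^sub>s w = g\<close> is given by
  variation of constants, and \<open>\<bar>w'\<bar> \<le> B \<parallel>g\<parallel> / \<sigma>\<^sup>2\<close> with \<open>B = 2 / s + C(s, \<theta>, \<sigma>)\<close>. The main point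
  of this estimate is that \<open>x \<mapsto> I(x) P(x + v)\<close> is decreasing, where \<open>I(x) = x\<^bsup>-\<nu>\<^esup> I\<^sub>\<nu>(\<alpha> x)\<close> and
  \<open>P(x) = x\<^sup>\<nu> K\<^sub>\<nu>(\<alpha> x)\<close> up to constants: the products of \<open>I\<close> with tail integrals of \<open>P\<close> are then
  bounded by their values at \<open>0\<close>, which are given by the normalisation of the variance-gamma
  density. Hence \<open>\<parallel>f\<^bsup>(k+1)\<^esup>\<parallel> \<le> B\<^sub>k / \<sigma>\<^sup>2 (\<parallel>h\<^bsup>(k)\<^esup>\<parallel> + k \<parallel>f\<^bsup>(k-1)\<^esup>\<parallel> + k \<bar>\<theta>\<bar> \<parallel>f\<^bsup>(k)\<^esup>\<parallel>)\<close>, and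
  unrolling this recursion from the top produces a sum over descending paths with steps \<open>1\<close> and
  \<open>2\<close>, which are the index sets of the theorem. The last derivative of \<open>h\<close> exists only almost
  everywhere; for this step the integrals in the variation of constants formula are replaced by
  comparisons of Lipschitz functions whose derivatives are ordered almost everywhere.\<close>

section \<open>Absolutely continuous functions\<close>

text \<open>Two obstacles shape the proof. \<open>Cb\<close> states absolute continuity in
  epsilon-delta form and bounds the n-th derivative of h only where it exists; making a Lipschitz
  constant of that bound takes almost everywhere differentiability, obtained here from Lebesgue's
  theorem on monotone functions. And the leading coefficient \<sigma>^2 x vanishes at 0: off 0 the
  equation, divided by x, yields one more derivative; at 0 each derivative is recovered as a limit,
  the regular solution being singled out by x^s w(x) tending to 0. Estimates are made for x > 0
  only. Reflecting x and \<theta> covers the rest, and the explicit formula respects the reflection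
  because htilde has mean zero under the density. In the constant B, the summand 2/s is the share of
  the K-term, bounded through the Wronskian; C is the share of the I-term, which is the mass of the
  density. For s < 2 its sharp value is relaxed by \<surd>\<pi> \<le> 2 and Gamma \<ge> 1/3, whose
  quotient is the factor 6. One B bounds both f and f', hence the two denominators beside B_0 and
  B_1 in the last term.\<close>

lemma sum_increments_le:
  fixes F :: "real \<Rightarrow> real"
  assumes "mono F" "finite C" "u \<le> v"
    and "\<And>i. i \<in> C \<Longrightarrow> a i \<le> b i \<and> {a i..b i} \<subseteq> {u..v}"
    and "pairwise (\<lambda>i j. disjnt {a i..b i} {a j..b j}) C"
  shows "(\<Sum>i\<in>C. F (b i) - F (a i)) \<le> F v - F u"
  using assms(2-5)
proof (induction "card C" arbitrary: C v)
  case 0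
  then show ?case using \<open>mono F\<close> by (auto simp: monoD)
next
  case (Suc n)
  have "C \<noteq> {}" using Suc by auto
  \<comment> \<open>Peel off the interval with the largest left endpoint \<open>a k\<close>:
    disjointness forces every other interval to end before \<open>a k\<close>, so the induction
    hypothesis applies on \<open>{u..a k}\<close>.\<close>
  have "Max (a ` C) \<in> a ` C" using Suc.prems(1) \<open>C \<noteq> {}\<close> by (intro Max_in) auto
  then obtain k where k: "k \<in> C" "\<And>j. j \<in> C \<Longrightarrow> a j \<le> a k"
    using that Suc.prems(1) by (metis (no_types, lifting) Max_ge finite_imageI image_iff)
  let ?C = "C - {k}"
  have sub: "b j < a k" "u \<le> a k" if "j \<in> ?C" for j
  proof -
    have "disjnt {a j..b j} {a k..b k}" using that k(1) Suc.prems(4) by (auto simp: pairwise_def)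
    then have "a k \<notin> {a j..b j}" using Suc.prems(3)[OF k(1)] by (auto simp: disjnt_def)
    then show "b j < a k" using k(2)[of j] that by auto
    show "u \<le> a k" using Suc.prems(3)[OF k(1)] by auto
  qed
  have ua: "u \<le> a k" "b k \<le> v" using Suc.prems(3)[OF k(1)] by auto
  have "(\<Sum>i\<in>?C. F (b i) - F (a i)) \<le> F (a k) - F u"
  proof (rule Suc.hyps(1))
    show "n = card ?C" using Suc.hyps(2) k(1) Suc.prems(1) by simp
    show "a i \<le> b i \<and> {a i..b i} \<subseteq> {u..a k}" if "i \<in> ?C" for i
      using sub[OF that] Suc.prems(3)[of i] that by auto
    show "pairwise (\<lambda>i j. disjnt {a i..b i} {a j..b j}) ?C"
      using Suc.prems(4) by (auto simp: pairwise_def)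
  qed (use Suc.prems ua in auto)
  moreover have "(\<Sum>i\<in>C. F (b i) - F (a i)) = (F (b k) - F (a k)) + (\<Sum>i\<in>?C. F (b i) - F (a i))"
    using k(1) Suc.prems(1) by (simp add: sum.remove)
  moreover have "F (b k) \<le> F v" using \<open>mono F\<close> ua by (auto simp: monoD)
  ultimately show ?case by linarith
qed

text \<open>Vitali: the short intervals with an endpoint in \<open>E\<close> on which
  \<open>F\<close> has slope at least \<open>q\<close> cover \<open>E\<close> finely, so countably
  many disjoint ones cover it up to a null set, and their increments add up to at most
  \<open>F v - F u\<close>. Since \<open>E\<close> may fail to be measurable, the conclusion speaks
  of a measurable cover, that is, of outer measure.\<close>

lemma mono_steep_set_measure:
  fixes F :: "real \<Rightarrow> real"
  assumes "mono F" "q > 0" "u < v" "E \<subseteq> {u<..<v}"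
    and steep: "\<And>x. x \<in> E \<Longrightarrow> \<exists>\<^sub>F y in at x. (F y - F x) / (y - x) \<ge> q"
  shows "\<exists>T\<in>lmeasurable. E \<subseteq> T \<and> measure lebesgue T \<le> (F v - F u) / q"
proof -
  define K where "K = {(c, r). r > 0 \<and> {c - r..c + r} \<subseteq> {u..v} \<and> q * (2 * r) \<le> F (c + r) - F (c - r)}"
  have ex: "\<exists>i. i \<in> K \<and> x \<in> cball (fst i) (snd i) \<and> snd i < d" if "x \<in> E" "d > 0" for x d
  proof -
    have xuv: "u < x" "x < v" using that assms(4) by auto
    define e where "e = Min {d, x - u, v - x}"
    have e: "e > 0" "e \<le> d" "e \<le> x - u" "e \<le> v - x" using that xuv by (auto simp: e_def)
    have "\<forall>\<^sub>F y in at x. y \<in> ball x e \<and> y \<noteq> x"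
      using \<open>e > 0\<close> by (auto simp: eventually_at intro!: exI[of _ e] simp: dist_commute)
    with steep[OF \<open>x \<in> E\<close>] have "\<exists>\<^sub>F y in at x. (F y - F x) / (y - x) \<ge> q \<and> (y \<in> ball x e \<and> y \<noteq> x)"
      using frequently_eventually_frequently by blast
    then obtain y where y: "(F y - F x) / (y - x) \<ge> q" "dist x y < e" "y \<noteq> x"
      by (auto dest: frequently_ex)
    \<comment> \<open>The interval between x and y is written as a ball, the shape that the covering
      theorem expects. The difference quotient is symmetric in its endpoints, so the slope is the
      same on whichever side y lies.\<close>
    define c where "c = (x + y) / 2"
    define r where "r = \<bar>y - x\<bar> / 2"
    have r: "r > 0" "r < d" using y e by (auto simp: r_def dist_real_def)
    have "q * (2 * r) \<le> F (c + r) - F (c - r)"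
    proof (cases "y > x")
      case True
      have "c + r = y" "c - r = x" using True by (auto simp: c_def r_def field_simps)
      then show ?thesis using y(1) True by (simp add: r_def field_simps)
    next
      case False
      then have lt: "y < x" using y by auto
      have "c + r = x" "c - r = y" using lt by (auto simp: c_def r_def field_simps)
      then show ?thesis using y(1) lt by (simp add: r_def field_simps)
    qed
    moreover have "{c - r..c + r} \<subseteq> {u..v}"
    proof -
      have "c - r \<ge> u" "c + r \<le> v" using y(2) e(3,4) xuv unfolding c_def r_def dist_real_def
        by (auto simp: abs_if field_simps split: if_splits)
      then show ?thesis by auto
    qed
    moreover have "x \<in> cball c r" by (auto simp: c_def r_def dist_real_def abs_if field_simps)
    ultimately show ?thesis using r by (intro exI[of _ "(c, r)"]) (auto simp: K_def)
  qed
  have pos: "snd i > 0" if "i \<in> K" for i using that by (auto simp: K_def)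
  obtain C where C: "countable C" "C \<subseteq> K"
     "pairwise (\<lambda>i j. disjnt (cball (fst i) (snd i)) (cball (fst j) (snd j))) C"
     "negligible (E - (\<Union>i\<in>C. cball (fst i) (snd i)))"
    using Vitali_covering_theorem_cballs[of K snd E fst] pos ex by blast
  let ?T = "\<Union>i\<in>C. cball (fst i) (snd i)"
  have fin: "measure lebesgue (\<Union>i\<in>I. cball (fst i) (snd i)) \<le> (F v - F u) / q"
    if I: "I \<subseteq> C" "finite I" for I
  proof -
    have "measure lebesgue (\<Union>i\<in>I. cball (fst i) (snd i))
      \<le> (\<Sum>i\<in>I. measure lebesgue (cball (fst i) (snd i)))"
      using I by (intro measure_UNION_le) auto
    also have "\<dots> \<le> (\<Sum>i\<in>I. (F (fst i + snd i) - F (fst i - snd i)) / q)"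
    proof (rule sum_mono)
      fix i assume "i \<in> I"
      then have "i \<in> K" using I C by auto
      then show "measure lebesgue (cball (fst i) (snd i)) \<le> (F (fst i + snd i) - F (fst i - snd i)) / q"
        using \<open>q > 0\<close> by (auto simp: K_def cball_eq_atLeastAtMost field_simps)
    qed
    also have "\<dots> = (\<Sum>i\<in>I. F (fst i + snd i) - F (fst i - snd i)) / q"
      by (simp add: sum_divide_distrib)
    also have "\<dots> \<le> (F v - F u) / q"
    proof (intro divide_right_mono sum_increments_le[OF \<open>mono F\<close>])
      show "pairwise (\<lambda>i j. disjnt {fst i - snd i..fst i + snd i} {fst j - snd j..fst j + snd j}) I"
        using C(3) I(1) unfolding pairwise_def cball_eq_atLeastAtMost by blast
      show "fst i - snd i \<le> fst i + snd i \<and> {fst i - snd i..fst i + snd i} \<subseteq> {u..v}" if "i \<in> I" for i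
        using that I(1) C(2) by (auto simp: K_def)
    qed (use I assms in auto)
    finally show ?thesis .
  qed
  have T: "?T \<in> lmeasurable" "measure lebesgue ?T \<le> (F v - F u) / q"
    using fmeasurable_UN_bound[OF C(1) _ fin] measure_UN_bound[OF C(1) _ fin] by auto
  let ?N = "E - ?T"
  have "?N \<in> null_sets lebesgue" using C(4) by (simp add: negligible_iff_null_sets)
  then have "?T \<union> ?N \<in> lmeasurable" "measure lebesgue (?T \<union> ?N) = measure lebesgue ?T"
    using fmeasurable.Un[OF T(1) fmeasurableI_null_sets] measure_Un_null_set[OF fmeasurableD[OF T(1)]] by blast+
  then show ?thesis using T by (intro bexI[of _ "?T \<union> ?N"]) auto
qed

text \<open>Vitali intervals inside \<open>U\<close> on which the slope of \<open>F\<close> is at most \<open>p\<close> cover \<open>E\<close> up to a null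
  set, and the steep points take up at most the fraction \<open>p / q\<close> of each of them.\<close>

lemma mono_shallow_cover:
  fixes F :: "real \<Rightarrow> real"
  assumes "mono F" "0 < p" "0 < q" "E \<subseteq> {u<..<v}" "open U" "E \<subseteq> U" "U \<in> lmeasurable"
    and shallow: "\<And>x. x \<in> E \<Longrightarrow> \<exists>\<^sub>F y in at x. (F y - F x) / (y - x) \<le> p"
    and steep: "\<And>x. x \<in> E \<Longrightarrow> \<exists>\<^sub>F y in at x. (F y - F x) / (y - x) \<ge> q"
  shows "\<exists>T\<in>lmeasurable. E \<subseteq> T \<and> measure lebesgue T \<le> p / q * measure lebesgue U"
proof -
  define K where "K = {(c, r). r > 0 \<and> {c - r..c + r} \<subseteq> U \<and> F (c + r) - F (c - r) \<le> p * (2 * r)}"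
  have ex: "\<exists>i. i \<in> K \<and> x \<in> cball (fst i) (snd i) \<and> snd i < d" if "x \<in> E" "d > 0" for x d
  proof -
    obtain e0 where e0: "e0 > 0" "ball x e0 \<subseteq> U" using assms(5,6) \<open>x \<in> E\<close>
      by (meson openE subsetD)
    define e where "e = min d e0"
    have e: "e > 0" "e \<le> d" "e \<le> e0" using that e0 by (auto simp: e_def)
    have "\<forall>\<^sub>F y in at x. y \<in> ball x e \<and> y \<noteq> x"
      using \<open>e > 0\<close> by (auto simp: eventually_at intro!: exI[of _ e] simp: dist_commute)
    with shallow[OF \<open>x \<in> E\<close>] have "\<exists>\<^sub>F y in at x. (F y - F x) / (y - x) \<le> p \<and> (y \<in> ball x e \<and> y \<noteq> x)"
      using frequently_eventually_frequently by blast
    then obtain y where y: "(F y - F x) / (y - x) \<le> p" "dist x y < e" "y \<noteq> x"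
      by (auto dest: frequently_ex)
    define c where "c = (x + y) / 2"
    define r where "r = \<bar>y - x\<bar> / 2"
    have r: "r > 0" "r < d" using y e by (auto simp: r_def dist_real_def)
    have "F (c + r) - F (c - r) \<le> p * (2 * r)"
    proof (cases "y > x")
      case True
      have "c + r = y" "c - r = x" using True by (auto simp: c_def r_def field_simps)
      then show ?thesis using y(1) True by (simp add: r_def field_simps)
    next
      case False
      then have lt: "y < x" using y by auto
      have "c + r = x" "c - r = y" using lt by (auto simp: c_def r_def field_simps)
      then show ?thesis using y(1) lt by (simp add: r_def field_simps)
    qed
    moreover have "{c - r..c + r} \<subseteq> ball x e0"
    proof
      fix z assume "z \<in> {c - r..c + r}"
      then have "\<bar>x - z\<bar> \<le> \<bar>x - y\<bar>" by (auto simp: c_def r_def abs_if field_simps split: if_splits)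
      then show "z \<in> ball x e0" using y(2) e by (auto simp: dist_real_def)
    qed
    moreover have "x \<in> cball c r" by (auto simp: c_def r_def dist_real_def abs_if field_simps)
    ultimately show ?thesis using r e0 by (intro exI[of _ "(c, r)"]) (auto simp: K_def)
  qed
  have pos: "snd i > 0" if "i \<in> K" for i using that by (auto simp: K_def)
  obtain C where C: "countable C" "C \<subseteq> K"
     "pairwise (\<lambda>i j. disjnt (cball (fst i) (snd i)) (cball (fst j) (snd j))) C"
     "negligible (E - (\<Union>i\<in>C. cball (fst i) (snd i)))"
    using Vitali_covering_theorem_cballs[of K snd E fst] pos ex by blast
  have "\<exists>T. T \<in> lmeasurable \<and> E \<inter> ball (fst i) (snd i) \<subseteq> T \<and>
      measure lebesgue T \<le> p / q * measure lebesgue (cball (fst i) (snd i))" if i: "i \<in> C" for i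
  proof -
    have i': "snd i > 0" "F (fst i + snd i) - F (fst i - snd i) \<le> p * (2 * snd i)"
      using i C(2) by (auto simp: K_def)
    have "\<exists>T\<in>lmeasurable. E \<inter> ball (fst i) (snd i) \<subseteq> T \<and>
        measure lebesgue T \<le> (F (fst i + snd i) - F (fst i - snd i)) / q"
      using i' assms(3) steep
      by (intro mono_steep_set_measure[OF \<open>mono F\<close>]) (auto simp: ball_eq_greaterThanLessThan)
    then obtain T where T: "T \<in> lmeasurable" "E \<inter> ball (fst i) (snd i) \<subseteq> T"
        "measure lebesgue T \<le> (F (fst i + snd i) - F (fst i - snd i)) / q" by blast
    have "(F (fst i + snd i) - F (fst i - snd i)) / q \<le> p * (2 * snd i) / q"
      using i' assms(3) by (intro divide_right_mono) auto
    then show ?thesis using T i' by (intro exI[of _ T]) (auto simp: cball_eq_atLeastAtMost field_simps)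
  qed
  then obtain T where T: "\<And>i. i \<in> C \<Longrightarrow> T i \<in> lmeasurable"
      "\<And>i. i \<in> C \<Longrightarrow> E \<inter> ball (fst i) (snd i) \<subseteq> T i"
      "\<And>i. i \<in> C \<Longrightarrow> measure lebesgue (T i) \<le> p / q * measure lebesgue (cball (fst i) (snd i))"
    by metis
  have fin: "measure lebesgue (\<Union>i\<in>I. T i) \<le> p / q * measure lebesgue U"
    if I: "I \<subseteq> C" "finite I" for I
  proof -
    have "measure lebesgue (\<Union>i\<in>I. T i) \<le> (\<Sum>i\<in>I. measure lebesgue (T i))"
      using I T(1) by (intro measure_UNION_le) (auto intro: fmeasurableD)
    also have "\<dots> \<le> (\<Sum>i\<in>I. p / q * measure lebesgue (cball (fst i) (snd i)))"
      using T(3) I by (intro sum_mono) auto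
    also have "\<dots> = p / q * (\<Sum>i\<in>I. measure lebesgue (cball (fst i) (snd i)))"
      by (simp add: sum_distrib_left)
    also have "(\<Sum>i\<in>I. measure lebesgue (cball (fst i) (snd i))) = measure lebesgue (\<Union>i\<in>I. cball (fst i) (snd i))"
      using I pairwise_subset[OF C(3) I(1)] by (intro measure_UNION'[symmetric]) auto
    also have "p / q * \<dots> \<le> p / q * measure lebesgue U"
    proof (intro mult_left_mono measure_mono_fmeasurable)
      show "(\<Union>i\<in>I. cball (fst i) (snd i)) \<subseteq> U"
        using I C(2) unfolding K_def cball_eq_atLeastAtMost by (auto 0 3)
    qed (use assms I in \<open>auto intro!: sets.finite_UN\<close>)
    finally show ?thesis .
  qed
  let ?T = "\<Union>i\<in>C. T i"
  have T': "?T \<in> lmeasurable" "measure lebesgue ?T \<le> p / q * measure lebesgue U"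
    using fmeasurable_UN_bound[OF C(1) T(1) fin] measure_UN_bound[OF C(1) T(1) fin] by auto
  \<comment> \<open>The estimate for steep points holds on open intervals, so the endpoints of the
    countably many closed ones join the uncovered null set.\<close>
  define N where "N = (E - (\<Union>i\<in>C. cball (fst i) (snd i))) \<union> (\<Union>i\<in>C. {fst i - snd i, fst i + snd i})"
  have "countable (\<Union>i\<in>C. {fst i - snd i, fst i + snd i})" using C(1) by blast
  then have "(\<Union>i\<in>C. {fst i - snd i, fst i + snd i}) \<in> null_sets lebesgue"
    by (intro null_sets_completionI countable_imp_null_set_lborel)
  then have "negligible N" unfolding N_def
    using negligible_Un[OF C(4)] by (simp add: negligible_iff_null_sets)
  then have "N \<in> null_sets lebesgue" by (simp add: negligible_iff_null_sets)
  then have "?T \<union> N \<in> lmeasurable" "measure lebesgue (?T \<union> N) = measure lebesgue ?T"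
    using fmeasurable.Un[OF T'(1) fmeasurableI_null_sets] measure_Un_null_set[OF fmeasurableD[OF T'(1)]] by blast+
  moreover have "E \<subseteq> ?T \<union> N"
  proof
    fix x assume "x \<in> E"
    show "x \<in> ?T \<union> N"
    proof (cases "x \<in> (\<Union>i\<in>C. ball (fst i) (snd i))")
      case True
      then show ?thesis using T(2) \<open>x \<in> E\<close> by blast
    next
      case False
      have "x \<in> N"
      proof (cases "x \<in> (\<Union>i\<in>C. cball (fst i) (snd i))")
        case True
        then obtain i where i: "i \<in> C" "x \<in> cball (fst i) (snd i)" by blast
        moreover have "x \<notin> ball (fst i) (snd i)" using False i by blast
        ultimately have "x = fst i - snd i \<or> x = fst i + snd i"
          by (auto simp: dist_real_def abs_if split: if_splits)
        then show ?thesis using i by (auto simp: N_def)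
      qed (use \<open>x \<in> E\<close> in \<open>auto simp: N_def\<close>)
      then show ?thesis by blast
    qed
  qed
  ultimately show ?thesis using T' by (intro bexI[of _ "?T \<union> N"]) auto
qed

text \<open>Let \<open>s\<close> be the outer measure of \<open>E\<close>. Covering \<open>E\<close>
  inside an open set of measure close to \<open>s\<close> gives \<open>s \<le> p / q * s\<close>,
  and \<open>p < q\<close> leaves only \<open>s \<le> 0\<close>.\<close>

lemma negligible_mono_oscillating:
  fixes F :: "real \<Rightarrow> real"
  assumes "mono F" "0 < p" "p < q" "E \<subseteq> {u<..<v}"
    and "\<And>x. x \<in> E \<Longrightarrow> \<exists>\<^sub>F y in at x. (F y - F x) / (y - x) \<le> p"
    and "\<And>x. x \<in> E \<Longrightarrow> \<exists>\<^sub>F y in at x. (F y - F x) / (y - x) \<ge> q"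
  shows "negligible E"
proof -
  define S where "S = {measure lebesgue T | T. T \<in> lmeasurable \<and> E \<subseteq> T}"
  define s where "s = Inf S"
  have ne: "S \<noteq> {}" using assms(4) by (auto simp: S_def intro!: exI[of _ "{u<..<v}"])
  have bdd: "bdd_below S" by (auto simp: S_def intro!: bdd_belowI[of _ 0])
  \<comment> \<open>One \<open>e\<close> is lost in passing to a measurable superset
    \<open>T\<close>, the other in passing to an open \<open>U\<close> around it.\<close>
  have sle: "s \<le> p / q * (s + 2 * e)" if "e > 0" for e
  proof -
    obtain T where T: "T \<in> lmeasurable" "E \<subseteq> T" "measure lebesgue T < s + e"
      using cInf_lessD[OF ne, of "s + e"] \<open>e > 0\<close> by (auto simp: s_def S_def)
    obtain U where U: "open U" "T \<subseteq> U" "U - T \<in> lmeasurable" "emeasure lebesgue (U - T) < ennreal e"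
      using sets_lebesgue_outer_open[of T e] T(1) \<open>e > 0\<close> by (auto intro: fmeasurableD)
    have "U = T \<union> (U - T)" using U by auto
    have Um: "U \<in> lmeasurable" by (subst \<open>U = _\<close>) (rule fmeasurable.Un[OF T(1) U(3)])
    have "measure lebesgue (U - T) < e"
      using U(4) emeasure_eq_measure2[OF U(3)] by (simp add: ennreal_less_iff)
    then have "measure lebesgue U < s + 2 * e"
      using T U(3) measure_Un_le[of T lebesgue "U - T"] unfolding \<open>U = T \<union> (U - T)\<close>[symmetric]
      by (auto dest: fmeasurableD)
    moreover obtain T' where T': "T' \<in> lmeasurable" "E \<subseteq> T'" "measure lebesgue T' \<le> p / q * measure lebesgue U"
      using mono_shallow_cover[OF assms(1,2) order.strict_trans[OF assms(2,3)] assms(4) U(1) order_trans[OF T(2) U(2)] Um assms(5,6)]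
      by blast
    moreover have "s \<le> measure lebesgue T'"
      unfolding s_def using T' by (intro cInf_lower bdd) (auto simp: S_def)
    moreover have "p / q > 0" using assms(2,3) by simp
    ultimately have "p / q * measure lebesgue U \<le> p / q * (s + 2 * e)" "s \<le> p / q * measure lebesgue U"
      using mult_left_mono[of "measure lebesgue U" "s + 2 * e" "p / q"] by linarith+
    then show ?thesis by linarith
  qed
  have "s \<le> p / q * s"
  proof (rule field_le_epsilon)
    fix e :: real assume "e > 0"
    define c where "c = p / q"
    have "c > 0" using assms(2,3) by (simp add: c_def)
    then have "s \<le> c * (s + 2 * (e / (2 * c)))" using sle[of "e / (2 * c)"] \<open>e > 0\<close>
      unfolding c_def[symmetric] by simp
    also have "\<dots> = c * s + e" using \<open>c > 0\<close> by (simp add: distrib_left)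
    finally show "s \<le> p / q * s + e" by (simp add: c_def)
  qed
  then have "s * (q - p) \<le> 0" using assms(2,3) by (simp add: divide_simps algebra_simps split: if_splits)
  then have "s \<le> 0" using assms(3) by (simp add: mult_le_0_iff)
  show ?thesis
  proof (unfold negligible_outer, intro allI impI)
    fix e :: real assume "e > 0"
    then show "\<exists>T. E \<subseteq> T \<and> T \<in> lmeasurable \<and> measure lebesgue T < e"
      using cInf_lessD[OF ne, of e] \<open>s \<le> 0\<close> by (auto simp: s_def S_def)
  qed
qed

text \<open>Lebesgue's theorem. If the nonnegative two-sided difference quotient \<open>Q x\<close>
  has no finite limit, then either it is frequently arbitrarily large, or two positive rationals
  separate its lower and upper limits. The first set is small because the total increase of
  \<open>F\<close> is finite; the second is a countable union of oscillation sets.\<close>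

lemma negligible_mono_not_differentiable:
  fixes F :: "real \<Rightarrow> real"
  assumes "mono F" "u < v"
  shows "negligible {x \<in> {u<..<v}. \<not> F differentiable at x}"
proof -
  define Q where "Q x y = (F y - F x) / (y - x)" for x y
  have Q0: "Q x y \<ge> 0" if "y \<noteq> x" for x y
    using \<open>mono F\<close> that unfolding Q_def by (cases "y > x") (auto simp: zero_le_divide_iff monoD)
  define Einf where "Einf = {x \<in> {u<..<v}. \<forall>q>0. \<exists>\<^sub>F y in at x. Q x y \<ge> q}"
  define E where "E p q = {x \<in> {u<..<v}. (\<exists>\<^sub>F y in at x. Q x y \<le> p) \<and> (\<exists>\<^sub>F y in at x. Q x y \<ge> q)}" for p q
  have "negligible Einf"
  proof (unfold negligible_outer_le, intro allI impI)
    fix e :: real assume "e > 0"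
    \<comment> \<open>The summand 1 keeps \<open>q\<close> positive when
      \<open>F u = F v\<close>.\<close>
    define q where "q = (F v - F u + 1) / e"
    have Fuv: "F u \<le> F v" using assms by (auto simp: monoD)
    then have "q > 0" using \<open>e > 0\<close> by (auto simp: q_def)
    have "\<exists>T\<in>lmeasurable. Einf \<subseteq> T \<and> measure lebesgue T \<le> (F v - F u) / q"
      using assms \<open>q > 0\<close> by (intro mono_steep_set_measure) (auto simp: Einf_def Q_def)
    moreover have "(F v - F u) / q \<le> e"
      using \<open>e > 0\<close> Fuv by (simp add: q_def field_simps)
    ultimately show "\<exists>T. Einf \<subseteq> T \<and> T \<in> lmeasurable \<and> measure lebesgue T \<le> e"
      by (meson order_trans)
  qed
  moreover have "negligible (E (of_rat p) (of_rat q))" if "0 < p" "p < q" for p q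
    using that assms
    by (intro negligible_mono_oscillating[of F "of_rat p" "of_rat q" _ u v])
       (auto simp: E_def Q_def of_rat_less)
  then have "negligible (\<Union>(p, q)\<in>{(p, q). 0 < p \<and> p < q}. E (of_rat p) (of_rat q))"
    by (intro negligible_countable_Union) auto
  ultimately have neg: "negligible (Einf \<union> (\<Union>(p, q)\<in>{(p, q). 0 < p \<and> p < q}. E (of_rat p) (of_rat q)))"
    by (rule negligible_Un)
  have "F differentiable at x"
    if x: "x \<in> {u<..<v}" "x \<notin> Einf" "\<And>p q. 0 < p \<Longrightarrow> p < q \<Longrightarrow> x \<notin> E (of_rat p) (of_rat q)" for x
  proof -
    obtain q0 where q0: "q0 > 0" "\<forall>\<^sub>F y in at x. Q x y < q0"
      using x(1,2) by (auto simp: Einf_def frequently_def not_le)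
    \<comment> \<open>\<open>Inf S\<close> is the upper limit of \<open>Q x\<close>. That the lower
      limit is no smaller follows from the absence of separating rationals.\<close>
    define S where "S = {q. \<forall>\<^sub>F y in at x. Q x y < q}"
    have ne: "S \<noteq> {}" using q0 by (auto simp: S_def)
    have Q0': "\<forall>\<^sub>F y in at x. Q x y \<ge> 0"
      by (auto simp: eventually_at_filter Q0)
    have lb: "q \<ge> 0" if "q \<in> S" for q
    proof (rule ccontr)
      assume "\<not> 0 \<le> q"
      then have "\<forall>\<^sub>F y in at x. False"
        using \<open>\<not> 0 \<le> q\<close> by (intro eventually_mono[OF eventually_conj[OF that[unfolded S_def mem_Collect_eq] Q0']]) auto
      then show False by simp
    qed
    have bdd: "bdd_below S" using lb by (auto intro!: bdd_belowI[of _ 0])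
    define s where "s = Inf S"
    have "(Q x \<longlongrightarrow> s) (at x)"
    proof (rule order_tendstoI)
      fix a assume "s < a"
      then obtain q where "q \<in> S" "q < a" using cInf_lessD[OF ne] unfolding s_def by blast
      then show "\<forall>\<^sub>F y in at x. Q x y < a" by (auto simp: S_def elim: eventually_mono)
    next
      fix a assume "a < s"
      show "\<forall>\<^sub>F y in at x. a < Q x y"
      proof (rule ccontr)
        assume "\<not> ?thesis"
        then have fr: "\<exists>\<^sub>F y in at x. Q x y \<le> a" by (simp add: not_eventually not_less)
        then have "\<exists>\<^sub>F y in at x. Q x y \<le> a \<and> Q x y \<ge> 0"
          using Q0' by (rule frequently_eventually_frequently)
        then have "a \<ge> 0" by (auto dest: frequently_ex)
        obtain p where p: "a < of_rat p" "of_rat p < s" using of_rat_dense[OF \<open>a < s\<close>] by blast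
        obtain q where q: "(of_rat p::real) < of_rat q" "of_rat q < s" using of_rat_dense[OF p(2)] by blast
        have "0 < (of_rat p::real)" using p \<open>a \<ge> 0\<close> by linarith
        then have pq: "0 < p" "p < q" using q by (auto simp: of_rat_less)
        have "\<exists>\<^sub>F y in at x. Q x y \<le> of_rat p" using fr by (rule frequently_elim1) (use p in auto)
        then have "\<forall>\<^sub>F y in at x. Q x y < of_rat q"
          using x(1) x(3)[OF pq] by (auto simp: E_def frequently_def not_le)
        then have "of_rat q \<in> S" by (simp add: S_def)
        then show False using q(2) cInf_lower[OF _ bdd] unfolding s_def by fastforce
      qed
    qed
    then have "(F has_field_derivative s) (at x)"
      by (simp add: has_field_derivative_iff Q_def[abs_def])
    then show ?thesis by (auto simp: real_differentiable_def)
  qed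
  then show ?thesis by (intro negligible_subset[OF neg]) blast
qed

section \<open>Almost everywhere derivatives of absolutely continuous functions\<close>

lemma sum_lengths_le:
  fixes a b :: "nat \<Rightarrow> real"
  assumes "\<And>i. i < m \<Longrightarrow> a i \<le> b i \<and> {a i..b i} \<subseteq> T" "T \<in> lmeasurable"
    and "disjoint_family_on (\<lambda>i. {a i<..<b i}) {..<m}"
  shows "(\<Sum>i<m. b i - a i) \<le> measure lebesgue T"
proof -
  have "(\<Sum>i<m. b i - a i) = (\<Sum>i<m. measure lebesgue {a i<..<b i})"
    using assms(1) by (intro sum.cong) auto
  also have "\<dots> = measure lebesgue (\<Union>i<m. {a i<..<b i})"
    using assms(3) by (intro measure_finite_Union[symmetric]) (use assms(1) in \<open>auto simp: emeasure_lborel_Ioo\<close>)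
  also have "\<dots> \<le> measure lebesgue T"
  proof (rule measure_mono_fmeasurable)
    have "{a i<..<b i} \<subseteq> T" if "i < m" for i
      using assms(1)[OF that] greaterThanLessThan_subseteq_atLeastAtMost_iff[of "a i" "b i" "a i" "b i"] by blast
    then show "(\<Union>i<m. {a i<..<b i}) \<subseteq> T" by blast
  qed (use assms in auto)
  finally show ?thesis .
qed

text \<open>\<open>G y\<close> is the supremum of \<open>\<Sum>i. F (b i) - F (a i)\<close> over the disjoint families of intervals to
  the left of \<open>y\<close>; on a short interval absolute continuity bounds it.\<close>

lemma abs_continuous_locally_mono_diff:
  fixes F :: "real \<Rightarrow> real"
  assumes ac: "abs_continuous_on {x - 1..x + 1} F"
  obtains G H e where "e > 0" "mono G" "mono H" "\<And>y. y \<in> {x - e<..<x + e} \<Longrightarrow> F y = G y - H y"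
proof -
  obtain d where d: "d > 0" and dF: "\<And>(m::nat) a b. \<lbrakk>\<forall>i<m. a i \<le> b i \<and> {a i..b i} \<subseteq> {x - 1..x + 1};
      disjoint_family_on (\<lambda>i. {a i<..<b i}) {..<m}; (\<Sum>i<m. b i - a i) < d\<rbrakk>
      \<Longrightarrow> (\<Sum>i<m. \<bar>F (b i) - F (a i)\<bar>) < 1"
    using ac[unfolded abs_continuous_on_def, rule_format, OF zero_less_one] by blast
  \<comment> \<open>Every disjoint family inside the interval of length \<open>2 * e\<close> has
    total length below \<open>d\<close>, so all its sums stay below 1 and the suprema are
    finite.\<close>
  define e where "e = min 1 (d / 3)"
  have e: "e > 0" "e \<le> 1" "2 * e < d" using d by (auto simp: e_def)
  define u where "u = x - e"
  define v where "v = x + e"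
  have uv: "u < v" using e by (simp add: u_def v_def)
  define P where "P y m a b \<longleftrightarrow> (\<forall>i<m. a i \<le> b i \<and> {a i..b i} \<subseteq> {u..y}) \<and>
     disjoint_family_on (\<lambda>i. {a i<..<b i}) {..<m}" for y :: real and m :: nat and a b :: "nat \<Rightarrow> real"
  define fam where "fam y = {\<Sum>i<m. F (b i) - F (a i) | m a b. P y m a b}" for y
  have mem: "(\<Sum>i<m. F (b i) - F (a i)) \<in> fam y" if "P y m a b" for y m a b
    using that unfolding fam_def by blast
  have ne: "fam y \<noteq> {}" for y
    using mem[of y 0] by (auto simp: P_def disjoint_family_on_def)
  have le1: "s \<le> 1" if s: "s \<in> fam y" and y: "y \<le> v" for s y
  proof -
    obtain m a b where sm: "s = (\<Sum>i<m. F (b i) - F (a i))" and P: "P y m a b"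
      using s unfolding fam_def by blast
    have sub: "\<forall>i<m. a i \<le> b i \<and> {a i..b i} \<subseteq> {u..v}"
      using P y unfolding P_def by (meson atLeastatMost_subset_iff order_refl order_trans)
    have "(\<Sum>i<m. b i - a i) \<le> measure lebesgue {u..v}"
      using sub P by (intro sum_lengths_le) (auto simp: P_def)
    then have "(\<Sum>i<m. b i - a i) < d" using e uv by (simp add: u_def v_def)
    moreover have "{u..v} \<subseteq> {x - 1..x + 1}" using e by (auto simp: u_def v_def)
    then have "\<forall>i<m. a i \<le> b i \<and> {a i..b i} \<subseteq> {x - 1..x + 1}" using sub by blast
    ultimately have "(\<Sum>i<m. \<bar>F (b i) - F (a i)\<bar>) < 1"
      using dF[OF _ conjunct2[OF P[unfolded P_def]]] by blast
    moreover have "s \<le> (\<Sum>i<m. \<bar>F (b i) - F (a i)\<bar>)" unfolding sm by (intro sum_mono) auto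
    ultimately show ?thesis by linarith
  qed
  have bdd: "bdd_above (fam y)" if "y \<le> v" for y using le1 that by (auto intro!: bdd_aboveI)
  have step: "Sup (fam y) + (F z - F y) \<le> Sup (fam z)" if "u \<le> y" "y \<le> z" "z \<le> v" for y z
  proof -
    have "Sup (fam y) \<le> Sup (fam z) - (F z - F y)"
    proof (rule cSup_least[OF ne])
      fix s assume "s \<in> fam y"
      then obtain m a b where sm: "s = (\<Sum>i<m. F (b i) - F (a i))" and P: "P y m a b"
        unfolding fam_def by blast
      have "P z (Suc m) (a(m := y)) (b(m := z))"
        unfolding P_def
      proof
        have ai: "a i \<le> b i" "u \<le> a i" "b i \<le> y" if "i < m" for i using P that by (auto simp: P_def)
        show "\<forall>i<Suc m. (a(m := y)) i \<le> (b(m := z)) i \<and> {(a(m := y)) i..(b(m := z)) i} \<subseteq> {u..z}"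
        proof (intro allI impI)
          fix i assume "i < Suc m"
          then show "(a(m := y)) i \<le> (b(m := z)) i \<and> {(a(m := y)) i..(b(m := z)) i} \<subseteq> {u..z}"
            using ai[of i] that by (cases "i = m") auto
        qed
        have dj: "{a i<..<b i} \<inter> {a j<..<b j} = {}" if "i < m" "j < m" "i \<noteq> j" for i j
          using P that by (simp add: P_def disjoint_family_on_def)
        show "disjoint_family_on (\<lambda>i. {(a(m := y)) i<..<(b(m := z)) i}) {..<Suc m}"
          unfolding disjoint_family_on_def
        proof (intro ballI impI)
          fix i j assume ij: "i \<in> {..<Suc m}" "j \<in> {..<Suc m}" "i \<noteq> j"
          then consider "i < m" "j < m" | "i = m" "j < m" | "i < m" "j = m" by fastforce
          then show "{(a(m := y)) i<..<(b(m := z)) i} \<inter> {(a(m := y)) j<..<(b(m := z)) j} = {}"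
          proof cases
            case 1 then show ?thesis using dj ij(3) by simp
          next
            case 2 then show ?thesis using ai(3)[of j] by auto
          next
            case 3 then show ?thesis using ai(3)[of i] by auto
          qed
        qed
      qed
      from mem[OF this] have "s + (F z - F y) \<in> fam z" by (simp add: sm)
      then have "s + (F z - F y) \<le> Sup (fam z)" by (rule cSup_upper[OF _ bdd[OF \<open>z \<le> v\<close>]])
      then show "s \<le> Sup (fam z) - (F z - F y)" by linarith
    qed
    then show ?thesis by linarith
  qed
  have step2: "Sup (fam y) \<le> Sup (fam z)" if "y \<le> z" "z \<le> v" for y z
  proof (rule cSup_subset_mono[OF ne bdd[OF \<open>z \<le> v\<close>]])
    have "P z m a b" if "P y m a b" for m a b
      using that atLeastatMost_subset_iff[of u y u z] \<open>y \<le> z\<close> unfolding P_def by (meson order_refl order_trans)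
    then show "fam y \<subseteq> fam z" unfolding fam_def by blast
  qed
  \<comment> \<open>Clamping to \<open>{u..v}\<close> makes both functions monotone on the whole
    line and leaves them unchanged on the interval.\<close>
  define c where "c t = max u (min v t)" for t
  have c: "u \<le> c t" "c t \<le> v" "s \<le> t \<Longrightarrow> c s \<le> c t" for s t using uv by (auto simp: c_def)
  show thesis
  proof (rule that)
    show "e > 0" by fact
    show "mono (\<lambda>t. Sup (fam (c t)))" using step2 c by (auto intro!: monoI)
    show "mono (\<lambda>t. Sup (fam (c t)) - F (c t))"
    proof (rule monoI)
      fix s t :: real assume "s \<le> t"
      from step[OF c(1) c(3)[OF this] c(2)]
      show "Sup (fam (c s)) - F (c s) \<le> Sup (fam (c t)) - F (c t)" by linarith
    qed
    show "F y = Sup (fam (c y)) - (Sup (fam (c y)) - F (c y))" if "y \<in> {x - e<..<x + e}" for y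
      using that by (simp add: c_def u_def v_def)
  qed
qed

text \<open>Negligibility is a local property, and near each point \<open>F\<close> is a difference
  of two monotone functions, each differentiable almost everywhere.\<close>

lemma abs_continuous_ae_differentiable:
  fixes F :: "real \<Rightarrow> real"
  assumes ac: "\<And>u v. abs_continuous_on {u..v} F"
  shows "negligible {x. \<not> F differentiable at x}" (is "negligible ?S")
proof (rule iffD2[OF locally_negligible_alt], intro ballI)
  fix x assume "x \<in> ?S"
  obtain G H e where *: "e > 0" "mono G" "mono H" "\<And>y. y \<in> {x - e<..<x + e} \<Longrightarrow> F y = G y - H y"
    using abs_continuous_locally_mono_diff[OF ac] by metis
  define I where "I = {x - e<..<x + e}"
  have "y \<in> {y \<in> I. \<not> G differentiable at y} \<union> {y \<in> I. \<not> H differentiable at y}"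
    if y: "y \<in> ?S" "y \<in> I" for y
  proof (rule ccontr)
    assume "\<not> ?thesis"
    then have "(\<lambda>t. G t - H t) differentiable at y" using y by auto
    then obtain D where "((\<lambda>t. G t - H t) has_derivative D) (at y)" by (auto simp: differentiable_def)
    then have "(F has_derivative D) (at y)"
      by (rule has_derivative_transform_within_open[of _ _ _ _ I]) (use y(2) *(4) in \<open>auto simp: I_def\<close>)
    then show False using y(1) by (auto simp: differentiable_def)
  qed
  moreover have "negligible ({y \<in> I. \<not> G differentiable at y} \<union> {y \<in> I. \<not> H differentiable at y})"
    using *(1-3) unfolding I_def by (intro negligible_Un negligible_mono_not_differentiable) auto
  ultimately have "negligible (?S \<inter> I)" by (meson IntD1 IntD2 negligible_subset subsetI)
  moreover have "openin (top_of_set ?S) (?S \<inter> I)" by (rule openin_open_Int) (simp add: I_def)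
  moreover have "x \<in> ?S \<inter> I" using \<open>x \<in> ?S\<close> *(1) by (auto simp: I_def)
  ultimately show "\<exists>U. openin (top_of_set ?S) U \<and> x \<in> U \<and> negligible U" by blast
qed

text \<open>A fine tagged division: tags outside the null set contribute at most \<open>c\<close> times the length,
  and the other intervals lie in an open set of measure less than \<open>d\<close>.\<close>

lemma abs_continuous_antimono:
  fixes F :: "real \<Rightarrow> real"
  assumes "a \<le> b" and ac: "abs_continuous_on {a..b} F" and "negligible N"
    and deriv: "\<And>x. x \<in> {a<..<b} - N \<Longrightarrow> \<exists>D\<le>0. (F has_real_derivative D) (at x)"
  shows "F b \<le> F a"
proof (rule field_le_epsilon)
  fix e :: real assume "e > 0"
  \<comment> \<open>Good tags will cost \<open>c * (b - a)\<close> and bad ones \<open>c\<close>,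
    together \<open>e\<close>.\<close>
  define c where "c = e / (b - a + 1)"
  have c: "c > 0" "c * (b - a + 1) = e" using \<open>e > 0\<close> \<open>a \<le> b\<close> by (auto simp: c_def)
  obtain d where d: "d > 0" and dF: "\<And>(m::nat) l u. \<lbrakk>\<forall>i<m. l i \<le> u i \<and> {l i..u i} \<subseteq> {a..b};
      disjoint_family_on (\<lambda>i. {l i<..<u i}) {..<m}; (\<Sum>i<m. u i - l i) < d\<rbrakk>
      \<Longrightarrow> (\<Sum>i<m. \<bar>F (u i) - F (l i)\<bar>) < c"
    using ac[unfolded abs_continuous_on_def, rule_format, OF \<open>c > 0\<close>] by blast
  \<comment> \<open>The derivative is given in the open interval only, so the endpoints count as bad
    tags.\<close>
  define N' where "N' = N \<union> {a, b}"
  have "N' \<in> null_sets lebesgue"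
    using \<open>negligible N\<close> negligible_Un[of N "{a,b}"] by (simp add: N'_def flip: negligible_iff_null_sets)
  then have "N' \<in> lmeasurable" "N' \<in> sets lebesgue" "measure lebesgue N' = 0"
    by (auto intro: fmeasurableI_null_sets simp: measure_eq_0_null_sets)
  then obtain U where U: "open U" "N' \<subseteq> U" "U - N' \<in> lmeasurable" "emeasure lebesgue (U - N') < ennreal d"
    using sets_lebesgue_outer_open[of N' d] \<open>d > 0\<close> by blast
  have "U = (U - N') \<union> N'" using U by auto
  then have Um: "U \<in> lmeasurable" "measure lebesgue U = measure lebesgue (U - N')"
    using fmeasurable.Un[OF U(3) \<open>N' \<in> lmeasurable\<close>]
      measure_Un_null_set[OF fmeasurableD[OF U(3)] \<open>N' \<in> null_sets lebesgue\<close>] by simp_all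
  have "measure lebesgue (U - N') < d"
    using U(4) emeasure_eq_measure2[OF U(3)] by (simp add: ennreal_less_iff)
  then have Ud: "measure lebesgue U < d" using Um by simp
  \<comment> \<open>At a good tag the increments to its left and to its right are bounded
    separately, so that an interval is estimated by splitting it at its tag.\<close>
  have "\<exists>r>0. (x \<in> N' \<longrightarrow> ball x r \<subseteq> U) \<and> (x \<notin> N' \<longrightarrow> x \<in> {a..b} \<longrightarrow>
      (\<forall>y. \<bar>y - x\<bar> < r \<longrightarrow> (x \<le> y \<longrightarrow> F y - F x \<le> c * (y - x)) \<and> (y \<le> x \<longrightarrow> F x - F y \<le> c * (x - y))))" for x
  proof (cases "x \<notin> N' \<and> x \<in> {a..b}")
    case True
    then have "x \<in> {a<..<b} - N" by (auto simp: N'_def)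
    from deriv[OF this] obtain D where D: "D \<le> 0" "(F has_real_derivative D) (at x)" by blast
    then have "((\<lambda>y. (F y - F x) / (y - x)) \<longlongrightarrow> D) (at x)" by (simp add: has_field_derivative_iff)
    then have "\<forall>\<^sub>F y in at x. (F y - F x) / (y - x) < c"
      using D(1) c(1) by (intro order_tendstoD(2)[of _ D]) auto
    then obtain r where r: "r > 0" "\<And>y. y \<noteq> x \<Longrightarrow> \<bar>y - x\<bar> < r \<Longrightarrow> (F y - F x) / (y - x) < c"
      by (auto simp: eventually_at dist_real_def)
    have "(x \<le> y \<longrightarrow> F y - F x \<le> c * (y - x)) \<and> (y \<le> x \<longrightarrow> F x - F y \<le> c * (x - y))" if "\<bar>y - x\<bar> < r" for y
    proof (cases "y = x")
      case False
      with r(2)[OF this that] show ?thesis by (cases "y > x") (auto simp: field_simps split: if_splits)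
    qed auto
    then show ?thesis using r(1) True by (intro exI[of _ r]) auto
  next
    case False
    show ?thesis
    proof (cases "x \<in> N'")
      case True
      then show ?thesis using U(1,2) by (meson openE subsetD)
    qed (use False in \<open>auto intro: exI[of _ 1]\<close>)
  qed
  then obtain r where r: "\<And>x. r x > 0" "\<And>x. x \<in> N' \<Longrightarrow> ball x (r x) \<subseteq> U"
    "\<And>x y. \<lbrakk>x \<notin> N'; x \<in> {a..b}; \<bar>y - x\<bar> < r x; x \<le> y\<rbrakk> \<Longrightarrow> F y - F x \<le> c * (y - x)"
    "\<And>x y. \<lbrakk>x \<notin> N'; x \<in> {a..b}; \<bar>y - x\<bar> < r x; y \<le> x\<rbrakk> \<Longrightarrow> F x - F y \<le> c * (x - y)"
    by metis
  have "gauge (\<lambda>x. ball x (r x))" using r(1) by (simp add: gauge_def)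
  then obtain p where p: "p tagged_division_of {a..b}" "(\<lambda>x. ball x (r x)) fine p"
    by (rule fine_division_exists_real)
  have finp: "finite p" using p(1) by blast
  have K: "x \<in> {a..b} \<and> Inf K \<le> x \<and> x \<le> Sup K \<and> K = {Inf K..Sup K} \<and> {Inf K..Sup K} \<subseteq> ball x (r x) \<and> {Inf K..Sup K} \<subseteq> {a..b}"
    if "(x, K) \<in> p" for x K
  proof -
    have *: "x \<in> K" "K \<subseteq> {a..b}" "K \<subseteq> ball x (r x)"
      using that tagged_division_ofD(2,3)[OF p(1)] p(2) by (auto simp: fine_def)
    obtain l m where "K = cbox l m" using tagged_division_ofD(4)[OF p(1) \<open>(x, K) \<in> p\<close>] by blast
    then show ?thesis using * by auto
  qed
  have tot: "(\<Sum>(x,K)\<in>p. G (Sup K) - G (Inf K)) = G b - G a" for G :: "real \<Rightarrow> real"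
    by (rule additive_tagged_division_1[OF \<open>a \<le> b\<close> p(1)])
  define p1 where "p1 = {(x,K) \<in> p. x \<notin> N'}"
  define p2 where "p2 = {(x,K) \<in> p. x \<in> N'}"
  have p12: "p = p1 \<union> p2" "p1 \<inter> p2 = {}" "finite p1" "finite p2"
    using finp by (auto simp: p1_def p2_def intro: finite_subset[OF _ finp])
  have "(\<Sum>(x,K)\<in>p1. F (Sup K) - F (Inf K)) \<le> (\<Sum>(x,K)\<in>p1. c * (Sup K - Inf K))"
  proof (rule sum_mono, clarify)
    fix x K assume xK: "(x, K) \<in> p1"
    then have xp: "(x, K) \<in> p" "x \<notin> N'" by (auto simp: p1_def)
    note k = K[OF xp(1)]
    then have "Sup K \<in> ball x (r x)" "Inf K \<in> ball x (r x)" by (meson atLeastAtMost_iff order_refl order_trans subsetD)+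
    then have "F (Sup K) - F x \<le> c * (Sup K - x)" "F x - F (Inf K) \<le> c * (x - Inf K)"
      using r(3,4) xp(2) k by (auto simp: dist_real_def abs_minus_commute)
    then show "F (Sup K) - F (Inf K) \<le> c * (Sup K - Inf K)" by (simp add: algebra_simps)
  qed
  also have "\<dots> \<le> (\<Sum>(x,K)\<in>p. c * (Sup K - Inf K))"
  proof (rule sum_mono2)
    fix y assume "y \<in> p - p1"
    then obtain x K where y: "y = (x, K)" "(x, K) \<in> p" by (cases y) auto
    have "Inf K \<le> Sup K" using K[OF y(2)] by linarith
    then show "0 \<le> (case y of (x, K) \<Rightarrow> c * (Sup K - Inf K))" using y(1) c(1) by simp
  qed (use p12 finp in auto)
  also have "\<dots> = c * (b - a)" using tot[of "\<lambda>x. c * x"] by (simp add: right_diff_distrib)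
  finally have 1: "(\<Sum>(x,K)\<in>p1. F (Sup K) - F (Inf K)) \<le> c * (b - a)" .
  \<comment> \<open>Absolute continuity speaks of families indexed by an initial segment of the
    naturals, so the intervals with bad tags are enumerated.\<close>
  obtain f where f: "bij_betw f {..<card p2} p2"
    using ex_bij_betw_nat_finite[OF p12(4)] by (auto simp: atLeast0LessThan)
  define l where "l i = Inf (snd (f i))" for i
  define u where "u i = Sup (snd (f i))" for i
  have fi: "(fst (f i), snd (f i)) \<in> p \<and> fst (f i) \<in> N'" if "i < card p2" for i
    using bij_betwE[OF f] that by (force simp: p2_def)
  have lu: "l i \<le> u i \<and> {l i..u i} \<subseteq> {a..b} \<and> {l i..u i} \<subseteq> U" if "i < card p2" for i
    using K[OF conjunct1[OF fi[OF that]]] r(2)[OF conjunct2[OF fi[OF that]]] unfolding l_def u_def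
    by (meson order_trans)
  have disj: "disjoint_family_on (\<lambda>i. {l i<..<u i}) {..<card p2}"
    unfolding disjoint_family_on_def
  proof (intro ballI impI)
    fix i j assume ij: "i \<in> {..<card p2}" "j \<in> {..<card p2}" "i \<noteq> j"
    then have "f i \<noteq> f j" using f by (auto simp: bij_betw_def inj_on_def)
    then have "interior (snd (f i)) \<inter> interior (snd (f j)) = {}"
      using tagged_division_ofD(5)[OF p(1)] fi ij by (metis lessThan_iff prod.collapse)
    moreover have "snd (f i) = {l i..u i}" "snd (f j) = {l j..u j}"
      using K fi ij unfolding l_def u_def by (meson lessThan_iff)+
    ultimately show "{l i<..<u i} \<inter> {l j<..<u j} = {}" by simp
  qed
  have "(\<Sum>i<card p2. u i - l i) \<le> measure lebesgue U"
    using lu disj Um(1) by (intro sum_lengths_le) auto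
  then have "(\<Sum>i<card p2. u i - l i) < d" using Ud by linarith
  then have "(\<Sum>i<card p2. \<bar>F (u i) - F (l i)\<bar>) < c" using lu disj by (intro dF) auto
  moreover have "(\<Sum>(x,K)\<in>p2. F (Sup K) - F (Inf K)) = (\<Sum>i<card p2. F (u i) - F (l i))"
    unfolding l_def u_def by (subst sum.reindex_bij_betw[OF f, symmetric]) (simp add: case_prod_beta)
  moreover have "(\<Sum>i<card p2. F (u i) - F (l i)) \<le> (\<Sum>i<card p2. \<bar>F (u i) - F (l i)\<bar>)"
    by (intro sum_mono) auto
  ultimately have 2: "(\<Sum>(x,K)\<in>p2. F (Sup K) - F (Inf K)) \<le> c" by linarith
  have "F b - F a = (\<Sum>(x,K)\<in>p1. F (Sup K) - F (Inf K)) + (\<Sum>(x,K)\<in>p2. F (Sup K) - F (Inf K))"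
    using tot[of F] sum.union_disjoint[OF p12(3,4,2), of "\<lambda>(x,K). F (Sup K) - F (Inf K)"] p12(1) by simp
  then show "F b \<le> F a + e" using 1 2 c(2) by (simp add: distrib_left)
qed

lemma lipschitz_imp_abs_continuous_on:
  assumes "\<And>x y. x \<in> S \<Longrightarrow> y \<in> S \<Longrightarrow> \<bar>F x - F y\<bar> \<le> L * \<bar>x - y\<bar>"
  shows "abs_continuous_on S F"
  unfolding abs_continuous_on_def
proof (intro allI impI)
  fix e :: real assume "e > 0"
  define d where "d = e / (\<bar>L\<bar> + 1)"
  have "d > 0" using \<open>e > 0\<close> by (auto simp: d_def intro!: divide_pos_pos)
  show "\<exists>d>0. \<forall>(m::nat) a b. (\<forall>i<m. a i \<le> b i \<and> {a i..b i} \<subseteq> S) \<longrightarrow>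
      disjoint_family_on (\<lambda>i. {a i<..<b i}) {..<m} \<longrightarrow> (\<Sum>i<m. b i - a i) < d \<longrightarrow>
      (\<Sum>i<m. \<bar>F (b i) - F (a i)\<bar>) < e"
  proof (intro exI[of _ d] conjI allI impI, fact \<open>d > 0\<close>)
    fix m :: nat and a b :: "nat \<Rightarrow> real"
    assume ab: "\<forall>i<m. a i \<le> b i \<and> {a i..b i} \<subseteq> S" and s: "(\<Sum>i<m. b i - a i) < d"
    have "(\<Sum>i<m. \<bar>F (b i) - F (a i)\<bar>) \<le> (\<Sum>i<m. (\<bar>L\<bar> + 1) * (b i - a i))"
    proof (rule sum_mono)
      fix i assume "i \<in> {..<m}"
      then have i: "a i \<le> b i" "{a i..b i} \<subseteq> S" using ab by auto
      then have "a i \<in> S" "b i \<in> S" by auto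
      have "\<bar>F (b i) - F (a i)\<bar> \<le> L * \<bar>b i - a i\<bar>" using assms \<open>a i \<in> S\<close> \<open>b i \<in> S\<close> by blast
      also have "\<dots> \<le> (\<bar>L\<bar> + 1) * (b i - a i)" using i by (simp add: mult_right_mono)
      finally show "\<bar>F (b i) - F (a i)\<bar> \<le> (\<bar>L\<bar> + 1) * (b i - a i)" .
    qed
    also have "\<dots> = (\<bar>L\<bar> + 1) * (\<Sum>i<m. b i - a i)" by (simp add: sum_distrib_left)
    also have "\<dots> < (\<bar>L\<bar> + 1) * d" using s by (intro mult_strict_left_mono) auto
    also have "\<dots> = e" by (simp add: d_def)
    finally show "(\<Sum>i<m. \<bar>F (b i) - F (a i)\<bar>) < e" .
  qed
qed

lemma abs_continuous_on_uminus: "abs_continuous_on S F \<Longrightarrow> abs_continuous_on S (\<lambda>x. - F x)"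
  unfolding abs_continuous_on_def by (simp add: abs_minus_commute)

lemma abs_continuous_on_add_linear:
  assumes "abs_continuous_on S F"
  shows "abs_continuous_on S (\<lambda>x. F x + L * x)"
  unfolding abs_continuous_on_def
proof (intro allI impI)
  fix e :: real assume "e > 0"
  have lin: "abs_continuous_on S (\<lambda>x. L * x)"
    by (rule lipschitz_imp_abs_continuous_on[of _ _ "\<bar>L\<bar>"]) (simp flip: right_diff_distrib add: abs_mult)
  obtain d1 where d1: "d1 > 0" "\<And>(m::nat) a b. \<lbrakk>\<forall>i<m. a i \<le> b i \<and> {a i..b i} \<subseteq> S;
      disjoint_family_on (\<lambda>i. {a i<..<b i}) {..<m}; (\<Sum>i<m. b i - a i) < d1\<rbrakk>
      \<Longrightarrow> (\<Sum>i<m. \<bar>F (b i) - F (a i)\<bar>) < e / 2"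
    using assms[unfolded abs_continuous_on_def, rule_format, OF half_gt_zero[OF \<open>e > 0\<close>]] by blast
  obtain d2 where d2: "d2 > 0" "\<And>(m::nat) a b. \<lbrakk>\<forall>i<m. a i \<le> b i \<and> {a i..b i} \<subseteq> S;
      disjoint_family_on (\<lambda>i. {a i<..<b i}) {..<m}; (\<Sum>i<m. b i - a i) < d2\<rbrakk>
      \<Longrightarrow> (\<Sum>i<m. \<bar>L * b i - L * a i\<bar>) < e / 2"
    using lin[unfolded abs_continuous_on_def, rule_format, OF half_gt_zero[OF \<open>e > 0\<close>]] by blast
  show "\<exists>d>0. \<forall>(m::nat) a b. (\<forall>i<m. a i \<le> b i \<and> {a i..b i} \<subseteq> S) \<longrightarrow>
      disjoint_family_on (\<lambda>i. {a i<..<b i}) {..<m} \<longrightarrow> (\<Sum>i<m. b i - a i) < d \<longrightarrow>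
      (\<Sum>i<m. \<bar>F (b i) + L * b i - (F (a i) + L * a i)\<bar>) < e"
  proof (intro exI[of _ "min d1 d2"] conjI allI impI)
    fix m :: nat and a b :: "nat \<Rightarrow> real"
    assume ab: "\<forall>i<m. a i \<le> b i \<and> {a i..b i} \<subseteq> S" "disjoint_family_on (\<lambda>i. {a i<..<b i}) {..<m}"
      "(\<Sum>i<m. b i - a i) < min d1 d2"
    have "(\<Sum>i<m. \<bar>F (b i) + L * b i - (F (a i) + L * a i)\<bar>)
        \<le> (\<Sum>i<m. \<bar>F (b i) - F (a i)\<bar> + \<bar>L * b i - L * a i\<bar>)" by (intro sum_mono) linarith
    also have "\<dots> < e" using d1(2)[OF ab(1,2)] d2(2)[OF ab(1,2)] ab(3) by (simp add: sum.distrib)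
    finally show "(\<Sum>i<m. \<bar>F (b i) + L * b i - (F (a i) + L * a i)\<bar>) < e" .
  qed (use d1 d2 in auto)
qed

text \<open>Wherever \<open>F\<close> is differentiable, hence almost everywhere,
  \<open>F x - L * x\<close> and \<open>- F x - L * x\<close> have nonpositive derivatives, so both
  decrease. This is the form in which the last derivative of h enters the proof.\<close>

lemma abs_continuous_lipschitz:
  fixes F :: "real \<Rightarrow> real"
  assumes ac: "\<And>u v. abs_continuous_on {u..v} F"
    and D: "\<And>x D. (F has_real_derivative D) (at x) \<Longrightarrow> \<bar>D\<bar> \<le> L"
  shows "\<bar>F x - F y\<bar> \<le> L * \<bar>x - y\<bar>"
proof -
  have neg: "negligible {x. \<not> F differentiable at x}" by (rule abs_continuous_ae_differentiable[OF ac])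
  have *: "\<bar>F v - F u\<bar> \<le> L * (v - u)" if "u \<le> v" for u v
  proof -
    have "F v + (- L) * v \<le> F u + (- L) * u"
    proof (rule abs_continuous_antimono[OF \<open>u \<le> v\<close> abs_continuous_on_add_linear[OF ac] neg])
      fix x assume "x \<in> {u<..<v} - {x. \<not> F differentiable at x}"
      then obtain D' where D': "(F has_real_derivative D') (at x)" by (auto simp: real_differentiable_def)
      then have "((\<lambda>x. F x + (- L) * x) has_real_derivative (D' - L)) (at x)"
        by (auto intro!: derivative_eq_intros)
      then show "\<exists>D\<le>0. ((\<lambda>x. F x + (- L) * x) has_real_derivative D) (at x)"
        using D[OF D'] by (intro exI[of _ "D' - L"]) auto
    qed
    moreover have "- F v + (- L) * v \<le> - F u + (- L) * u"
    proof (rule abs_continuous_antimono[OF \<open>u \<le> v\<close> abs_continuous_on_add_linear[OF abs_continuous_on_uminus[OF ac]] neg])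
      fix x assume "x \<in> {u<..<v} - {x. \<not> F differentiable at x}"
      then obtain D' where D': "(F has_real_derivative D') (at x)" by (auto simp: real_differentiable_def)
      then have "((\<lambda>x. - F x + (- L) * x) has_real_derivative (- D' - L)) (at x)"
        by (auto intro!: derivative_eq_intros)
      then show "\<exists>D\<le>0. ((\<lambda>x. - F x + (- L) * x) has_real_derivative D) (at x)"
        using D[OF D'] by (intro exI[of _ "- D' - L"]) auto
    qed
    ultimately show ?thesis by (simp add: algebra_simps abs_le_iff)
  qed
  show ?thesis using *[of x y] *[of y x] by (cases "x \<le> y") (auto simp: abs_minus_commute)
qed

section \<open>Modified Bessel functions\<close>

definition bessel_coeff :: "real \<Rightarrow> nat \<Rightarrow> real" where
  "bessel_coeff \<nu> k = rGamma (\<nu> + real k + 1) / fact k"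

text \<open>\<open>I\<^sub>\<nu>\<close> at x is (x/2)^\<nu> times this function at (x/2)^2.
  Splitting off the power leaves an entire function, so the regular homogeneous solution is defined
  and smooth at 0; differentiation raises the order by one.\<close>

definition bessel_E :: "real \<Rightarrow> real \<Rightarrow> real" where
  "bessel_E \<nu> z = (\<Sum>k. bessel_coeff \<nu> k * z ^ k)"

lemma rGamma_real_nonneg: "x > 0 \<Longrightarrow> rGamma x \<ge> (0::real)"
  by (simp add: rGamma_inverse_Gamma less_imp_le)

lemma bessel_coeff_nonneg: "\<nu> > -1 \<Longrightarrow> bessel_coeff \<nu> k \<ge> 0"
  by (auto simp: bessel_coeff_def intro!: divide_nonneg_pos rGamma_real_nonneg)

text \<open>From index 1 on, rGamma y = y * rGamma (y + 1) with y \<ge> 1 makes the values decrease.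
  Index 0 gets its own summand because \<nu> + 1 may be below 1.\<close>

lemma bessel_coeff_bound:
  assumes "\<nu> > -1"
  shows "bessel_coeff \<nu> k \<le> (rGamma (\<nu> + 1) + rGamma (\<nu> + 2)) / fact k"
proof -
  have "rGamma (\<nu> + real (Suc k) + 1) \<le> rGamma (\<nu> + 2)" for k
  proof (induction k)
    case (Suc k)
    have "rGamma (\<nu> + real (Suc k) + 1) = (\<nu> + real (Suc k) + 1) * rGamma (\<nu> + real (Suc (Suc k)) + 1)"
      using assms rGamma_plus1[of "\<nu> + real (Suc k) + 1"] by (simp add: algebra_simps)
    moreover have "1 * rGamma (\<nu> + real (Suc (Suc k)) + 1) \<le> (\<nu> + real (Suc k) + 1) * rGamma (\<nu> + real (Suc (Suc k)) + 1)"
      using assms by (intro mult_right_mono rGamma_real_nonneg) auto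
    ultimately show ?case using Suc.IH by linarith
  qed (simp add: algebra_simps)
  moreover have "rGamma (\<nu> + 1) \<ge> 0" "rGamma (\<nu> + 2) \<ge> 0"
    using assms by (auto intro!: rGamma_real_nonneg)
  ultimately have "rGamma (\<nu> + real k + 1) \<le> rGamma (\<nu> + 1) + rGamma (\<nu> + 2)"
    by (cases k) (auto simp: add_increasing2 intro: order_trans[OF _ le_add_same_cancel2[THEN iffD2]])
  then show ?thesis by (simp add: bessel_coeff_def divide_right_mono)
qed

lemma summable_bessel_E:
  assumes "\<nu> > -1"
  shows "summable (\<lambda>k. bessel_coeff \<nu> k * z ^ k)"
proof (rule summable_comparison_test')
  define C where "C = rGamma (\<nu> + 1) + rGamma (\<nu> + 2)"
  show "summable (\<lambda>k. C * (inverse (fact k) * \<bar>z\<bar> ^ k))"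
    by (intro summable_mult summable_exp)
  show "norm (bessel_coeff \<nu> k * z ^ k) \<le> C * (inverse (fact k) * \<bar>z\<bar> ^ k)" for k
    using mult_right_mono[OF bessel_coeff_bound[OF assms, of k], of "\<bar>z\<bar> ^ k"] bessel_coeff_nonneg[OF assms, of k]
    by (simp add: C_def abs_mult power_abs divide_inverse mult.assoc)
qed

lemma diffs_bessel_coeff: "diffs (bessel_coeff \<nu>) = bessel_coeff (\<nu> + 1)"
proof
  fix k
  have "real (Suc k) * (rGamma y / fact (Suc k)) = rGamma y / fact k" for y
    by (simp add: divide_simps del: of_nat_Suc)
  then show "diffs (bessel_coeff \<nu>) k = bessel_coeff (\<nu> + 1) k"
    by (simp add: diffs_def bessel_coeff_def add.commute add.left_commute del: fact_Suc of_nat_Suc)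
       (simp add: algebra_simps)
qed

lemma has_real_derivative_bessel_E:
  assumes "\<nu> > -1"
  shows "(bessel_E \<nu> has_real_derivative bessel_E (\<nu> + 1) z) (at z)"
  using termdiffs_strong_converges_everywhere[OF summable_bessel_E[OF assms], of z]
  by (simp add: diffs_bessel_coeff bessel_E_def[abs_def])

text \<open>As the orders \<nu> + 1 and \<nu> + 2 are the first two derivatives, this is the
  differential equation z E'' + (\<nu> + 1) E' = E, from which the equation of \<open>I\<close> will
  follow. The proof compares coefficients.\<close>

lemma bessel_E_rec:
  assumes "\<nu> > -1"
  shows "(\<nu> + 1) * bessel_E (\<nu> + 1) z + z * bessel_E (\<nu> + 2) z = bessel_E \<nu> z"
proof -
  have "(\<lambda>k. bessel_coeff (\<nu> + 2) k * z ^ k * z) sums (z * bessel_E (\<nu> + 2) z)"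
    using sums_mult2[OF summable_sums[OF summable_bessel_E[of "\<nu> + 2" z]], of z] assms
    by (simp add: bessel_E_def mult.commute)
  moreover have "bessel_coeff (\<nu> + 2) k * z ^ k * z = real (Suc k) * bessel_coeff (\<nu> + 1) (Suc k) * z ^ Suc k" for k
    using fun_cong[OF diffs_bessel_coeff, of "\<nu> + 1" k] by (simp add: diffs_def algebra_simps)
  ultimately have "(\<lambda>k. real (Suc k) * bessel_coeff (\<nu> + 1) (Suc k) * z ^ Suc k) sums (z * bessel_E (\<nu> + 2) z)"
    by simp
  from sums_Suc[OF this] have "(\<lambda>k. real k * bessel_coeff (\<nu> + 1) k * z ^ k) sums (z * bessel_E (\<nu> + 2) z)" by simp
  moreover have "(\<lambda>k. (\<nu> + 1) * (bessel_coeff (\<nu> + 1) k * z ^ k)) sums ((\<nu> + 1) * bessel_E (\<nu> + 1) z)"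
    unfolding bessel_E_def using assms by (intro sums_mult summable_sums summable_bessel_E) auto
  ultimately have "(\<lambda>k. (\<nu> + 1) * (bessel_coeff (\<nu> + 1) k * z ^ k) + real k * bessel_coeff (\<nu> + 1) k * z ^ k)
      sums ((\<nu> + 1) * bessel_E (\<nu> + 1) z + z * bessel_E (\<nu> + 2) z)"
    by (intro sums_add)
  moreover have "(\<nu> + 1) * (bessel_coeff (\<nu> + 1) k * z ^ k) + real k * bessel_coeff (\<nu> + 1) k * z ^ k
      = bessel_coeff \<nu> k * z ^ k" for k
  proof -
    have "bessel_coeff \<nu> k = (\<nu> + 1 + real k) * bessel_coeff (\<nu> + 1) k"
      using rGamma_plus1[of "\<nu> + real k + 1"] by (simp add: bessel_coeff_def algebra_simps flip: add_divide_distrib)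
    then show ?thesis by (simp add: algebra_simps)
  qed
  ultimately show ?thesis by (simp add: bessel_E_def sums_iff)
qed

lemma bessel_E_pos:
  assumes "\<nu> > -1" "z \<ge> 0"
  shows "bessel_E \<nu> z > 0"
proof -
  have "0 < bessel_coeff \<nu> 0 * z ^ 0"
    using assms by (simp add: bessel_coeff_def rGamma_inverse_Gamma)
  also have "\<dots> = (\<Sum>k\<in>{0}. bessel_coeff \<nu> k * z ^ k)" by simp
  also have "\<dots> \<le> bessel_E \<nu> z"
    unfolding bessel_E_def using assms
    by (intro sum_le_suminf summable_bessel_E) (auto intro!: mult_nonneg_nonneg bessel_coeff_nonneg)
  finally show ?thesis .
qed

lemma bessel_E_0: "bessel_E \<nu> 0 = rGamma (\<nu> + 1)"
  using powser_zero[of "bessel_coeff \<nu>"] by (simp add: bessel_E_def bessel_coeff_def)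

lemma bessel_I_eq_bessel_E:
  assumes "\<nu> > -1" "x > 0"
  shows "bessel_I \<nu> x = (x / 2) powr \<nu> * bessel_E \<nu> ((x / 2)\<^sup>2)"
proof -
  have "(x / 2) powr (\<nu> + 2 * real k) = (x / 2) powr \<nu> * ((x / 2)\<^sup>2) ^ k" for k
  proof -
    have "(x / 2) powr (2 * real k) = (x / 2) powr real (2 * k)" by simp
    also have "\<dots> = (x / 2) ^ (2 * k)" using assms by (subst powr_realpow) auto
    finally show ?thesis by (simp add: powr_add power_mult)
  qed
  then show ?thesis
    unfolding bessel_I_def bessel_E_def
    by (subst suminf_mult[symmetric, OF summable_bessel_E[OF assms(1)]])
       (simp add: bessel_coeff_def algebra_simps)
qed

section \<open>The modified Bessel function of the second kind\<close>

lemma exp_cosh_bound: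
  fixes x \<mu> :: real
  assumes "x > 0"
  obtains C where "C > 0" "\<And>t. t \<ge> 0 \<Longrightarrow> exp (- x * cosh t) * cosh (\<mu> * t) \<le> C * exp (- t)"
proof
  \<comment> \<open>\<open>m\<close> exceeds the growth rate of cosh (\<mu> t) by 1, and
    \<open>s\<close> is the point where x/2 exp t has slope \<open>m\<close>. The tangent there lies
    below x cosh t, and the surplus 1 yields the factor exp (- t).\<close>
  define m where "m = \<bar>\<mu>\<bar> + 1"
  define s where "s = ln (2 * m / x)"
  have m: "m > 0" by (simp add: m_def)
  have s: "x / 2 * exp s = m" using assms m by (simp add: s_def)
  show "exp (m * (s - 1)) > 0" by simp
  fix t :: real assume t: "t \<ge> 0"
  have "m * (1 + (t - s)) \<le> m * exp (t - s)" using m by (intro mult_left_mono exp_ge_add_one_self) auto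
  also have "\<dots> = x / 2 * exp t" using s by (simp flip: s add: exp_diff)
  also have "\<dots> \<le> x * cosh t" using assms by (simp add: cosh_field_def)
  finally have 1: "- x * cosh t \<le> m * (s - 1) - m * t" by (simp add: algebra_simps)
  have "cosh (\<mu> * t) = cosh \<bar>\<mu> * t\<bar>" by (simp add: abs_if)
  also have "\<dots> \<le> exp \<bar>\<mu> * t\<bar>" by (simp add: cosh_field_def)
  also have "\<dots> = exp (\<bar>\<mu>\<bar> * t)" using t by (simp add: abs_mult)
  finally have "exp (- x * cosh t) * cosh (\<mu> * t) \<le> exp (m * (s - 1) - m * t) * exp (\<bar>\<mu>\<bar> * t)"
    using 1 by (intro mult_mono) auto
  also have "\<dots> = exp (m * (s - 1)) * exp (- t)"
    by (simp add: m_def algebra_simps flip: exp_add)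
  finally show "exp (- x * cosh t) * cosh (\<mu> * t) \<le> exp (m * (s - 1)) * exp (- t)" .
qed

lemma set_integrable_exp_minus: "set_integrable lborel {0<..} (\<lambda>t::real. exp (- t))"
proof -
  have "((\<lambda>t::real. exp (- t)) has_integral 1) {0..}"
    using has_integral_exp_minus_to_infinity[of 1 0] by simp
  then have "(\<lambda>t::real. exp (- t)) absolutely_integrable_on {0..}"
    by (intro nonnegative_absolutely_integrable_1) (auto simp: has_integral_integrable)
  then have "set_integrable lborel {0..} (\<lambda>t::real. exp (- t))"
    unfolding absolutely_integrable_on_def set_integrable_def
    by (subst integrable_completion[symmetric]) (auto intro!: borel_measurable_continuous_on_indicator continuous_intros)
  then show ?thesis by (rule set_integrable_subset) auto
qed

lemma set_integrable_exp_cosh: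
  fixes x \<mu> :: real
  assumes "x > 0"
  shows "set_integrable lborel {0<..} (\<lambda>t::real. exp (- x * cosh t) * cosh (\<mu> * t))"
proof -
  obtain C where C: "C > 0" "\<And>t::real. t \<ge> 0 \<Longrightarrow> exp (- x * cosh t) * cosh (\<mu> * t) \<le> C * exp (- t)"
    using exp_cosh_bound[OF assms] by blast
  show ?thesis
  proof (rule set_integrable_bound)
    show "set_integrable lborel {0<..} (\<lambda>t::real. C * exp (- t))"
      using set_integrable_exp_minus by simp
    show "set_borel_measurable lborel {0<..} (\<lambda>t. exp (- x * cosh t) * cosh (\<mu> * t))"
      unfolding set_borel_measurable_def cosh_field_def by measurable
    show "AE t in lborel. t \<in> {0<..} \<longrightarrow> norm (exp (- x * cosh t) * cosh (\<mu> * t)) \<le> norm (C * exp (- t))"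
      using C by (auto simp: abs_mult)
  qed
qed

lemma bessel_K_set: "bessel_K \<mu> x = (LINT t:{0<..}|lborel. exp (- x * cosh t) * cosh (\<mu> * t))"
  unfolding bessel_K_def by (simp add: interval_lebesgue_integral_0_infty)

lemma bessel_K_mono:
  assumes "x > 0" "\<bar>\<mu>\<bar> \<le> \<bar>\<mu>'\<bar>"
  shows "bessel_K \<mu> x \<le> bessel_K \<mu>' x"
  unfolding bessel_K_set
proof (intro set_integral_mono set_integrable_exp_cosh assms)
  fix t :: real assume "t \<in> {0<..}"
  then have "\<bar>\<mu> * t\<bar> \<le> \<bar>\<mu>' * t\<bar>" using assms by (auto simp: abs_mult)
  then have "cosh \<bar>\<mu> * t\<bar> \<le> cosh \<bar>\<mu>' * t\<bar>" by (subst cosh_real_nonneg_le_iff) auto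
  then show "exp (- x * cosh t) * cosh (\<mu> * t) \<le> exp (- x * cosh t) * cosh (\<mu>' * t)"
    by (intro mult_left_mono) auto
qed

text \<open>Since cosh t \<ge> 1, the factor exp (- (x - 1) cosh t) is at most exp (1 - x) and
  leaves the integral; what remains is the value at 1.\<close>

lemma bessel_K_decay:
  assumes "x \<ge> 1"
  shows "bessel_K \<mu> x \<le> exp (1 - x) * bessel_K \<mu> 1"
proof -
  have "bessel_K \<mu> x \<le> (LINT t:{0<..}|lborel. exp (1 - x) * (exp (- 1 * cosh t) * cosh (\<mu> * t)))"
    unfolding bessel_K_set
  proof (intro set_integral_mono set_integrable_exp_cosh set_integrable_mult_right)
    fix t :: real
    have "(x - 1) * 1 \<le> (x - 1) * cosh t" using assms by (intro mult_left_mono cosh_real_ge_1) auto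
    then have "exp (- x * cosh t) \<le> exp (1 - x) * exp (- 1 * cosh t)"
      by (simp add: algebra_simps flip: exp_add)
    then show "exp (- x * cosh t) * cosh (\<mu> * t) \<le> exp (1 - x) * (exp (- 1 * cosh t) * cosh (\<mu> * t))"
      by (simp add: mult.assoc[symmetric] mult_right_mono)
  qed (use assms in auto)
  then show ?thesis by (simp add: bessel_K_set)
qed

lemma bessel_K_pos:
  assumes "x > 0"
  shows "bessel_K \<mu> x > 0"
proof -
  have "exp (- x * cosh 1) = (LINT t:{0<..<1::real}|lborel. exp (- x * cosh 1))"
    by (simp add: set_lebesgue_integral_def)
  also have "\<dots> \<le> (LINT t:{0<..<1::real}|lborel. exp (- x * cosh t) * cosh (\<mu> * t))"
  proof (intro set_integral_mono set_integrable_subset[OF set_integrable_exp_cosh[OF assms]])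
    fix t :: real assume "t \<in> {0<..<1}"
    then have "cosh t \<le> cosh 1" by (subst cosh_real_nonneg_le_iff) auto
    then have "exp (- x * cosh 1) * 1 \<le> exp (- x * cosh t) * cosh (\<mu> * t)"
      using assms cosh_real_ge_1[of "\<mu> * t"] by (intro mult_mono) auto
    then show "exp (- x * cosh 1) \<le> exp (- x * cosh t) * cosh (\<mu> * t)" by simp
  qed (auto simp: set_integrable_def)
  also have "\<dots> \<le> bessel_K \<mu> x"
    unfolding bessel_K_set set_lebesgue_integral_def
    using set_integrable_exp_cosh[OF assms, of \<mu>] set_integrable_subset[OF set_integrable_exp_cosh[OF assms, of \<mu>], of "{0<..<1}"]
    by (intro integral_mono) (auto simp: set_integrable_def indicator_def subset_eq)
  finally show ?thesis by (meson exp_gt_zero less_le_trans)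
qed

lemma cosh_mult_cosh: "cosh t * cosh (\<mu> * t) = (cosh ((\<mu> + 1) * t) + cosh ((\<mu> - 1) * t)) / (2::real)"
  by (simp add: cosh_add cosh_diff distrib_right left_diff_distrib)

lemma sinh_mult_sinh: "sinh t * sinh (\<mu> * t) = (cosh ((\<mu> + 1) * t) - cosh ((\<mu> - 1) * t)) / (2::real)"
  by (simp add: cosh_add cosh_diff distrib_right left_diff_distrib)

lemma set_integrable_exp_cosh_mult_cosh:
  fixes x \<mu> :: real
  assumes "x > 0"
  shows "set_integrable lborel {0<..} (\<lambda>t::real. exp (- x * cosh t) * (cosh t * cosh (\<mu> * t)))"
    and "(LINT t:{0<..}|lborel. exp (- x * cosh t) * (cosh t * cosh (\<mu> * t))) = (bessel_K (\<mu> + 1) x + bessel_K (\<mu> - 1) x) / 2"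
proof -
  have eq: "exp (- x * cosh t) * (cosh t * cosh (\<mu> * t)) =
     (1 / 2) * (exp (- x * cosh t) * cosh ((\<mu> + 1) * t)) + (1 / 2) * (exp (- x * cosh t) * cosh ((\<mu> - 1) * t))" for t
    unfolding cosh_mult_cosh by argo
  have *: "set_integrable lborel {0<..} (\<lambda>t::real. (1 / 2) * (exp (- x * cosh t) * cosh (\<mu>' * t)))" for \<mu>'
    by (rule set_integrable_mult_right) (use set_integrable_exp_cosh[OF assms] in auto)
  show "set_integrable lborel {0<..} (\<lambda>t::real. exp (- x * cosh t) * (cosh t * cosh (\<mu> * t)))"
    unfolding eq by (intro set_integral_add(1) *)
  show "(LINT t:{0<..}|lborel. exp (- x * cosh t) * (cosh t * cosh (\<mu> * t))) = (bessel_K (\<mu> + 1) x + bessel_K (\<mu> - 1) x) / 2"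
    unfolding eq by (subst set_integral_add(2)[OF * *]) (simp add: bessel_K_set add_divide_distrib)
qed

lemma set_integrable_exp_cosh_mult_cosh2:
  fixes x \<mu> :: real
  assumes "x > 0"
  shows "set_integrable lborel {0<..} (\<lambda>t::real. exp (- x * cosh t) * (cosh t ^ 2 * cosh (\<mu> * t)))"
proof -
  have eq: "exp (- x * cosh t) * (cosh t ^ 2 * cosh (\<mu> * t)) =
     (1 / 2) * (exp (- x * cosh t) * (cosh t * cosh ((\<mu> + 1) * t))) + (1 / 2) * (exp (- x * cosh t) * (cosh t * cosh ((\<mu> - 1) * t)))" for t
  proof -
    have "cosh t ^ 2 * cosh (\<mu> * t) = cosh t * ((cosh ((\<mu> + 1) * t) + cosh ((\<mu> - 1) * t)) / 2)"
      unfolding cosh_mult_cosh[symmetric] by (simp add: power2_eq_square)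
    then show ?thesis by (simp add: distrib_left add_divide_distrib)
  qed
  have *: "set_integrable lborel {0<..} (\<lambda>t::real. (1 / 2) * (exp (- x * cosh t) * (cosh t * cosh (\<mu>' * t))))" for \<mu>'
    by (rule set_integrable_mult_right) (use set_integrable_exp_cosh_mult_cosh(1)[OF assms] in auto)
  show ?thesis unfolding eq by (intro set_integral_add(1) *)
qed

lemma exp_taylor2: "\<bar>exp u - 1 - u\<bar> \<le> u\<^sup>2 / 2 * exp \<bar>u\<bar>" for u :: real
proof -
  obtain t where t: "\<bar>t\<bar> \<le> \<bar>u\<bar>" "exp u = (\<Sum>m<2. u ^ m / fact m) + exp t / fact 2 * u ^ 2"
    using Maclaurin_exp_le[of u 2] by blast
  then have "\<bar>exp u - 1 - u\<bar> = exp t / 2 * u\<^sup>2" by (simp add: numeral_2_eq_2 abs_mult)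
  moreover have "exp t / 2 * u\<^sup>2 \<le> exp \<bar>u\<bar> / 2 * u\<^sup>2"
    using t(1) by (intro mult_right_mono divide_right_mono) auto
  ultimately show ?thesis by (simp add: mult.commute)
qed

text \<open>Differentiation under the integral sign, made explicit: Taylor's bound leaves a
  remainder of order h^2 whose integrand carries cosh^2 and, for |h| \<le> x/2, is dominated by the
  exponential weight at x/2.\<close>

lemma has_real_derivative_bessel_K:
  assumes "x > 0"
  shows "(bessel_K \<mu> has_real_derivative - (bessel_K (\<mu> + 1) x + bessel_K (\<mu> - 1) x) / 2) (at x)"
proof -
  define D where "D = - (bessel_K (\<mu> + 1) x + bessel_K (\<mu> - 1) x) / 2"
  define B where "B = (LINT t:{0<..}|lborel. exp (- (x / 2) * cosh t) * (cosh t ^ 2 * cosh (\<mu> * t)))"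
  have bound: "\<bar>bessel_K \<mu> (x + h) - bessel_K \<mu> x - h * D\<bar> \<le> h\<^sup>2 / 2 * B" if h: "\<bar>h\<bar> \<le> x / 2" for h
  proof -
    have xh: "x + h > 0" using h assms by linarith
    define f where "f t = exp (- (x + h) * cosh t) * cosh (\<mu> * t) - exp (- x * cosh t) * cosh (\<mu> * t)
        + h * (exp (- x * cosh t) * (cosh t * cosh (\<mu> * t)))" for t
    have i1: "set_integrable lborel {0<..} (\<lambda>t::real. exp (- (x + h) * cosh t) * cosh (\<mu> * t) - exp (- x * cosh t) * cosh (\<mu> * t))"
      by (intro set_integral_diff(1) set_integrable_exp_cosh xh assms)
    have i2: "set_integrable lborel {0<..} (\<lambda>t::real. h * (exp (- x * cosh t) * (cosh t * cosh (\<mu> * t))))"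
      by (rule set_integrable_mult_right) (use set_integrable_exp_cosh_mult_cosh(1)[OF assms] in auto)
    have i3: "set_integrable lborel {0<..} f" unfolding f_def by (intro set_integral_add(1) i1 i2)
    have "(LINT t:{0<..}|lborel. f t) = bessel_K \<mu> (x + h) - bessel_K \<mu> x - h * D"
    proof -
      have e1: "(LINT t:{0<..}|lborel. exp (- (x + h) * cosh t) * cosh (\<mu> * t) - exp (- x * cosh t) * cosh (\<mu> * t))
          = bessel_K \<mu> (x + h) - bessel_K \<mu> x"
        unfolding bessel_K_set by (intro set_integral_diff(2) set_integrable_exp_cosh xh assms)
      have e2: "(LINT t:{0<..}|lborel. h * (exp (- x * cosh t) * (cosh t * cosh (\<mu> * t))))
          = h * ((bessel_K (\<mu> + 1) x + bessel_K (\<mu> - 1) x) / 2)"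
        by (simp only: set_integral_mult_right set_integrable_exp_cosh_mult_cosh(2)[OF assms])
      show ?thesis unfolding f_def set_integral_add(2)[OF i1 i2] e1 e2 D_def by argo
    qed
    moreover have "\<bar>LINT t:{0<..}|lborel. f t\<bar> \<le> (LINT t:{0<..}|lborel. h\<^sup>2 / 2 * (exp (- (x / 2) * cosh t) * (cosh t ^ 2 * cosh (\<mu> * t))))"
    proof -
      have "\<bar>LINT t:{0<..}|lborel. f t\<bar> \<le> (LINT t:{0<..}|lborel. \<bar>f t\<bar>)"
        using set_integral_norm_bound[OF i3] by simp
      also have "\<dots> \<le> (LINT t:{0<..}|lborel. h\<^sup>2 / 2 * (exp (- (x / 2) * cosh t) * (cosh t ^ 2 * cosh (\<mu> * t))))"
      proof (rule set_integral_mono)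
        show "set_integrable lborel {0<..} (\<lambda>t. \<bar>f t\<bar>)" using i3 by (rule set_integrable_abs)
        show "set_integrable lborel {0<..} (\<lambda>t::real. h\<^sup>2 / 2 * (exp (- (x / 2) * cosh t) * (cosh t ^ 2 * cosh (\<mu> * t))))"
          by (rule set_integrable_mult_right) (use set_integrable_exp_cosh_mult_cosh2[of "x / 2"] assms in auto)
        fix t :: real
        define c where "c = cosh t"
        have c: "c \<ge> 1" unfolding c_def by (rule cosh_real_ge_1)
        define u where "u = - h * c"
        have "f t = exp (- x * c) * cosh (\<mu> * t) * (exp u - 1 - u)"
          by (simp add: f_def c_def[symmetric] u_def algebra_simps exp_add exp_diff exp_minus field_simps)
        also have "\<bar>\<dots>\<bar> = exp (- x * c) * cosh (\<mu> * t) * \<bar>exp u - 1 - u\<bar>"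
          by (simp add: abs_mult)
        also have "\<dots> \<le> exp (- x * c) * cosh (\<mu> * t) * (u\<^sup>2 / 2 * exp \<bar>u\<bar>)"
          by (intro mult_left_mono exp_taylor2) auto
        also have "\<dots> \<le> exp (- x * c) * cosh (\<mu> * t) * (u\<^sup>2 / 2 * exp (x / 2 * c))"
          using h c by (intro mult_left_mono) (auto simp: u_def abs_mult mult_right_mono)
        also have "\<dots> = h\<^sup>2 / 2 * (exp (- (x / 2) * c) * (c ^ 2 * cosh (\<mu> * t)))"
        proof -
          have "exp (- x * c) * exp (x / 2 * c) = exp (- (x / 2) * c)" by (simp add: algebra_simps flip: exp_add)
          then show ?thesis by (simp add: u_def power_mult_distrib algebra_simps)
        qed
        finally show "\<bar>f t\<bar> \<le> h\<^sup>2 / 2 * (exp (- (x / 2) * cosh t) * (cosh t ^ 2 * cosh (\<mu> * t)))"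
          by (simp add: c_def)
      qed
      finally show ?thesis .
    qed
    ultimately show ?thesis by (simp add: B_def)
  qed
  have "((\<lambda>h. (bessel_K \<mu> (x + h) - bessel_K \<mu> x) / h) \<longlongrightarrow> D) (at 0)"
  proof (rule LIM_zero_cancel, rule Lim_null_comparison)
    have "\<forall>\<^sub>F h in at (0::real). \<bar>h\<bar> < x / 2 \<and> h \<noteq> 0"
      using assms by (auto simp: eventually_at intro!: exI[of _ "x/2"])
    then show "\<forall>\<^sub>F h in at 0. norm ((bessel_K \<mu> (x + h) - bessel_K \<mu> x) / h - D) \<le> \<bar>h\<bar> * (B / 2)"
    proof eventually_elim
      case (elim h)
      then have "\<bar>(bessel_K \<mu> (x + h) - bessel_K \<mu> x) / h - D\<bar> = \<bar>bessel_K \<mu> (x + h) - bessel_K \<mu> x - h * D\<bar> / \<bar>h\<bar>"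
        by (simp add: field_simps flip: abs_divide)
      also have "\<dots> \<le> (h\<^sup>2 / 2 * B) / \<bar>h\<bar>" using bound[of h] elim by (intro divide_right_mono) auto
      also have "\<dots> = \<bar>h\<bar> * (B / 2)" using elim by (simp add: power2_eq_square field_simps)
      finally show ?case by simp
    qed
    show "((\<lambda>h. \<bar>h\<bar> * (B / 2)) \<longlongrightarrow> 0) (at (0::real))" by (auto intro!: tendsto_eq_intros)
  qed
  then show ?thesis by (simp add: DERIV_def D_def)
qed

text \<open>Integrate the derivative of exp (- x cosh t) sinh (\<mu> t), which vanishes at 0 and at
  infinity; the product sinh t sinh (\<mu> t) splits into the neighbouring orders.\<close>

lemma bessel_K_rec:
  assumes "x > 0"
  shows "bessel_K (\<mu> + 1) x - bessel_K (\<mu> - 1) x = 2 * \<mu> / x * bessel_K \<mu> x"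
proof -
  let ?e = "\<lambda>t. exp (- x * cosh t)"
  obtain C where C: "C > 0" "\<And>t::real. t \<ge> 0 \<Longrightarrow> ?e t * cosh (\<mu> * t) \<le> C * exp (- t)"
    using exp_cosh_bound[OF assms] by blast
  define f where "f t = \<mu> * (?e t * cosh (\<mu> * t)) - (x / 2 * (?e t * cosh ((\<mu> + 1) * t)) - x / 2 * (?e t * cosh ((\<mu> - 1) * t)))" for t
  have i: "set_integrable lborel {0<..} (\<lambda>t::real. c * (?e t * cosh (\<mu>' * t)))" for c \<mu>'
    by (rule set_integrable_mult_right) (use set_integrable_exp_cosh[OF assms] in auto)
  have intf: "set_integrable lborel {0<..} f"
    unfolding f_def by (intro set_integral_diff(1) i)
  have "(LBINT t=0..\<infinity>. f t) = 0 - 0"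
  proof (rule interval_integral_FTC_integrable[where F = "\<lambda>t. ?e t * sinh (\<mu> * t)"])
    show "((\<lambda>t. ?e t * sinh (\<mu> * t)) has_vector_derivative f t) (at t)" for t
    proof -
      have "f t = \<mu> * (?e t * cosh (\<mu> * t)) - x * ?e t * (sinh t * sinh (\<mu> * t))"
        unfolding sinh_mult_sinh f_def by (simp add: right_diff_distrib diff_divide_distrib mult.assoc)
      moreover have "((\<lambda>t. ?e t * sinh (\<mu> * t)) has_real_derivative \<mu> * (?e t * cosh (\<mu> * t)) - x * ?e t * (sinh t * sinh (\<mu> * t))) (at t)"
        by (auto intro!: derivative_eq_intros simp: algebra_simps)
      ultimately show ?thesis by (simp add: has_real_derivative_iff_has_vector_derivative)
    qed
    show "set_integrable lborel (einterval 0 \<infinity>) f" using intf by (simp add: zero_ereal_def)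
    have "((\<lambda>t. ?e t * sinh (\<mu> * t)) \<longlongrightarrow> ?e 0 * sinh (\<mu> * 0)) (at_right 0)"
      by (intro tendsto_intros)
    then show "(((\<lambda>t. ?e t * sinh (\<mu> * t)) \<circ> real_of_ereal) \<longlongrightarrow> 0) (at_right 0)"
      by (simp add: zero_ereal_def ereal_tendsto_simps1)
    have "((\<lambda>t. ?e t * sinh (\<mu> * t)) \<longlongrightarrow> 0) at_top"
    proof (rule Lim_null_comparison)
      show "\<forall>\<^sub>F t in at_top. norm (?e t * sinh (\<mu> * t)) \<le> C * exp (- t)"
        using eventually_ge_at_top[of 0]
      proof eventually_elim
        case (elim t)
        have "norm (?e t * sinh (\<mu> * t)) \<le> ?e t * cosh (\<mu> * t)"
          by (simp add: abs_mult abs_le_iff sinh_le_cosh_real) (metis cosh_minus sinh_le_cosh_real sinh_minus)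
        then show ?case using C(2)[OF elim] by linarith
      qed
      show "((\<lambda>t. C * exp (- t)) \<longlongrightarrow> 0) at_top" by real_asymp
    qed
    then show "(((\<lambda>t. ?e t * sinh (\<mu> * t)) \<circ> real_of_ereal) \<longlongrightarrow> 0) (at_left \<infinity>)"
      by (simp add: ereal_tendsto_simps1)
    show "isCont f t" for t unfolding f_def by (intro continuous_intros)
  qed auto
  moreover have "(LBINT t=0..\<infinity>. f t) = (LINT t:{0<..}|lborel. f t)"
    by (simp add: interval_lebesgue_integral_0_infty)
  moreover have "\<dots> = \<mu> * bessel_K \<mu> x - (x / 2 * bessel_K (\<mu> + 1) x - x / 2 * bessel_K (\<mu> - 1) x)"
    unfolding f_def
    by (subst set_integral_diff(2)[OF i set_integral_diff(1)[OF i i]], subst set_integral_diff(2)[OF i i])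
       (simp add: bessel_K_set)
  ultimately show ?thesis using assms by (simp add: field_simps)
qed

section \<open>Integral representations of K and the mass of the density\<close>

lemma has_bochner_integral_half_line:
  fixes f :: "real \<Rightarrow> real"
  assumes "set_integrable lborel {0<..} f"
  shows "has_bochner_integral lborel (\<lambda>x. indicator {0..} x *\<^sub>R f x) (LINT x:{0<..}|lborel. f x)"
proof -
  have "has_bochner_integral lborel (\<lambda>x. indicator {0<..} x *\<^sub>R f x) (LINT x:{0<..}|lborel. f x)"
    using assms by (simp add: has_bochner_integral_iff set_integrable_def set_lebesgue_integral_def)
  moreover have "AE x in lborel. indicator {0..} x *\<^sub>R f x = indicator {0<..} x *\<^sub>R f x"
    using AE_lborel_singleton[of 0] by eventually_elim (auto simp: indicator_def)
  moreover have "(\<lambda>x. indicator {0..} x *\<^sub>R f x) \<in> borel_measurable lborel"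
  proof -
    have "(\<lambda>x. indicator {0<..} x *\<^sub>R f x + indicator {0} x *\<^sub>R f 0) \<in> borel_measurable lborel"
      using assms by (intro borel_measurable_add) (auto simp: set_integrable_def)
    moreover have "(\<lambda>x. indicator {0..} x *\<^sub>R f x) = (\<lambda>x. indicator {0<..} x *\<^sub>R f x + indicator {0} x *\<^sub>R f 0)"
      by (auto simp: indicator_def fun_eq_iff)
    ultimately show ?thesis by simp
  qed
  ultimately show ?thesis
    by (subst has_bochner_integral_cong_AE) (auto dest: borel_measurable_has_bochner_integral)
qed

text \<open>exp = cosh + sinh: the even part doubles the half-line integral and the odd part
  cancels. On the whole line, an exponential substitution can turn K into a gamma type
  integral.\<close>

lemma has_bochner_integral_exp_cosh_exp:
  assumes "x > 0"
  shows "has_bochner_integral lborel (\<lambda>t. exp (- x * cosh t) * exp (\<mu> * t)) (2 * bessel_K \<mu> x)"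
proof -
  have "has_bochner_integral lborel (\<lambda>t. exp (- x * cosh t) * cosh (\<mu> * t)) (2 *\<^sub>R bessel_K \<mu> x)"
    unfolding bessel_K_set
    by (intro has_bochner_integral_even_function has_bochner_integral_half_line set_integrable_exp_cosh assms) auto
  moreover have "set_integrable lborel {0<..} (\<lambda>t. exp (- x * cosh t) * sinh (\<mu> * t))"
  proof (rule set_integrable_bound[OF set_integrable_exp_cosh[OF assms, of \<mu>]])
    show "set_borel_measurable lborel {0<..} (\<lambda>t. exp (- x * cosh t) * sinh (\<mu> * t))"
      unfolding set_borel_measurable_def cosh_field_def sinh_field_def by measurable
    have "\<bar>sinh y\<bar> \<le> cosh y" for y :: real
      using sinh_le_cosh_real[of y] sinh_le_cosh_real[of "- y"] by (simp add: abs_le_iff)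
    then show "AE t in lborel. t \<in> {0<..} \<longrightarrow> norm (exp (- x * cosh t) * sinh (\<mu> * t)) \<le> norm (exp (- x * cosh t) * cosh (\<mu> * t))"
      by (auto simp: abs_mult)
  qed
  then have "has_bochner_integral lborel (\<lambda>t. exp (- x * cosh t) * sinh (\<mu> * t)) 0"
    by (intro has_bochner_integral_odd_function[OF has_bochner_integral_half_line]) auto
  ultimately have "has_bochner_integral lborel (\<lambda>t. exp (- x * cosh t) * cosh (\<mu> * t) + exp (- x * cosh t) * sinh (\<mu> * t)) (2 *\<^sub>R bessel_K \<mu> x + 0)"
    by (rule has_bochner_integral_add)
  moreover have "exp (- x * cosh t) * cosh (\<mu> * t) + exp (- x * cosh t) * sinh (\<mu> * t) = exp (- x * cosh t) * exp (\<mu> * t)" for t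
    by (simp add: distrib_left[symmetric] cosh_plus_sinh)
  ultimately show ?thesis by simp
qed

text \<open>Substitute \<open>v = x e\<^sup>t / 2\<close>.\<close>

lemma bessel_K_gamma_form:
  assumes "x > 0"
  shows "set_integrable lborel {0<..} (\<lambda>v. v powr (\<mu> - 1) * exp (- v - x\<^sup>2 / (4 * v)))"
    and "x powr \<mu> * bessel_K \<mu> x = 2 powr (\<mu> - 1) * (LINT v:{0<..}|lborel. v powr (\<mu> - 1) * exp (- v - x\<^sup>2 / (4 * v)))"
proof -
  define f where "f v = v powr (\<mu> - 1) * exp (- v - x\<^sup>2 / (4 * v))" for v
  define g where "g t = x / 2 * exp t" for t
  have fg: "f (g t) * g t = (x / 2) powr \<mu> * (exp (- x * cosh t) * exp (\<mu> * t))" for t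
  proof -
    have g: "g t > 0" using assms by (simp add: g_def)
    have "f (g t) * g t = g t powr \<mu> * exp (- g t - x\<^sup>2 / (4 * g t))"
      using g by (simp add: f_def powr_diff)
    also have "g t powr \<mu> = (x / 2) powr \<mu> * exp (\<mu> * t)"
    proof -
      have "g t powr \<mu> = (x / 2) powr \<mu> * exp t powr \<mu>" unfolding g_def by (rule powr_mult)
      then show ?thesis by (simp add: powr_def)
    qed
    also have "- g t - x\<^sup>2 / (4 * g t) = - x * cosh t"
      using assms by (simp add: g_def cosh_field_def exp_minus field_simps power2_eq_square)
    finally show ?thesis by simp
  qed
  have hb: "has_bochner_integral lborel (\<lambda>t. f (g t) * g t) ((x / 2) powr \<mu> * (2 * bessel_K \<mu> x))"
    unfolding fg by (intro has_bochner_integral_mult_right has_bochner_integral_exp_cosh_exp assms)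
  have int: "set_integrable lborel (einterval (-\<infinity>) \<infinity>) (\<lambda>t. f (g t) * g t)"
    using hb by (simp add: set_integrable_def has_bochner_integral_iff einterval_def)
  have A: "((ereal \<circ> g \<circ> real_of_ereal) \<longlongrightarrow> 0) (at_right (-\<infinity>))"
  proof -
    have "(g \<longlongrightarrow> 0) at_bot" unfolding g_def by real_asymp
    then have "((ereal \<circ> g) \<longlongrightarrow> ereal 0) at_bot" unfolding o_def by (rule tendsto_ereal)
    then show ?thesis by (simp add: ereal_tendsto_simps1 zero_ereal_def)
  qed
  have B: "((ereal \<circ> g \<circ> real_of_ereal) \<longlongrightarrow> \<infinity>) (at_left \<infinity>)"
  proof -
    have "filterlim g at_top at_top" unfolding g_def using assms by real_asymp
    then have "((ereal \<circ> g) \<longlongrightarrow> \<infinity>) at_top" by (simp add: ereal_tendsto_simps2)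
    then show ?thesis by (simp add: ereal_tendsto_simps1)
  qed
  note sub = interval_integral_substitution_nonneg[of "-\<infinity>" \<infinity> g g f, OF _ _ _ _ _ _ A B int]
  have gpos: "g t > 0" for t using assms by (simp add: g_def)
  have "isCont f v" if "v > 0" for v using that unfolding f_def by (intro continuous_intros) auto
  moreover have "DERIV g t :> g t" for t unfolding g_def by (auto intro!: derivative_eq_intros)
  moreover have "isCont g t" for t unfolding g_def by (intro continuous_intros) auto
  ultimately have prems: "DERIV g t :> g t" "isCont f (g t)" "isCont g t" "0 \<le> f (g t)" "0 \<le> g t" for t
    using gpos by (auto simp: f_def intro: less_imp_le)
  have "set_integrable lborel (einterval 0 \<infinity>) f" "(LBINT v=0..\<infinity>. f v) = (LBINT t=-\<infinity>..\<infinity>. f (g t) * g t)"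
    by (rule sub(1) sub(2); use prems in simp)+
  moreover have "(LBINT t=-\<infinity>..\<infinity>. f (g t) * g t) = (x / 2) powr \<mu> * (2 * bessel_K \<mu> x)"
    using hb by (simp add: interval_lebesgue_integral_def einterval_def has_bochner_integral_iff set_lebesgue_integral_def)
  moreover have "(LBINT v=0..\<infinity>. f v) = (LINT v:{0<..}|lborel. f v)"
    by (simp add: interval_lebesgue_integral_0_infty)
  ultimately have L: "(LINT v:{0<..}|lborel. f v) = (x / 2) powr \<mu> * (2 * bessel_K \<mu> x)" and "set_integrable lborel {0<..} f"
    by (simp_all add: zero_ereal_def)
  then show "set_integrable lborel {0<..} (\<lambda>v. v powr (\<mu> - 1) * exp (- v - x\<^sup>2 / (4 * v)))"
    by (simp add: f_def[abs_def])
  have "2 powr (\<mu> - 1) * ((x / 2) powr \<mu> * 2) = x powr \<mu>"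
    using assms by (simp add: powr_divide powr_diff)
  then show "x powr \<mu> * bessel_K \<mu> x = 2 powr (\<mu> - 1) * (LINT v:{0<..}|lborel. v powr (\<mu> - 1) * exp (- v - x\<^sup>2 / (4 * v)))"
    using L unfolding f_def by (metis mult.assoc)
qed

lemma has_bochner_integral_Gamma:
  assumes "s > (0::real)" "c > 0"
  shows "has_bochner_integral lborel (\<lambda>t. indicator {0<..} t * (t powr (s - 1) * exp (- c * t))) (Gamma s * c powr (- s))"
proof -
  have "has_bochner_integral lborel (\<lambda>t. indicator {0<..} t * (t powr (s - 1) * exp (- t))) (Gamma s)"
  proof (rule has_bochner_integral_nn_integral)
    have "(\<integral>\<^sup>+ t. ennreal (indicator {0<..} t * (t powr (s - 1) * exp (- t))) \<partial>lborel) =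
      (\<integral>\<^sup>+ t. ennreal (indicator {0..} t * t powr (s - 1) / exp t) \<partial>lborel)"
    proof (rule nn_integral_cong_AE)
      show "AE t in lborel. ennreal (indicator {0<..} t * (t powr (s - 1) * exp (- t))) = ennreal (indicator {0..} t * t powr (s - 1) / exp t)"
        using AE_lborel_singleton[of 0] by eventually_elim (auto simp: indicator_def exp_minus divide_inverse)
    qed
    then show "(\<integral>\<^sup>+ t. ennreal (indicator {0<..} t * (t powr (s - 1) * exp (- t))) \<partial>lborel) = ennreal (Gamma s)"
      using Gamma_conv_nn_integral_real[OF assms(1)] by simp
  qed (use assms in \<open>auto simp: Gamma_real_nonneg less_imp_le\<close>)
  from lborel_has_bochner_integral_real_affine_iff[THEN iffD1, OF _ this, of c 0]
  have "has_bochner_integral lborel (\<lambda>t. indicator {0<..} (c * t) * ((c * t) powr (s - 1) * exp (- (c * t)))) (Gamma s / c)"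
    using assms by (simp add: divide_inverse mult.commute)
  from has_bochner_integral_mult_right[OF this, of "c powr (1 - s)"]
  have "has_bochner_integral lborel (\<lambda>t. c powr (1 - s) * (indicator {0<..} (c * t) * ((c * t) powr (s - 1) * exp (- (c * t))))) (c powr (1 - s) * (Gamma s / c))"
    .
  moreover have "c powr (1 - s) * (indicator {0<..} (c * t) * ((c * t) powr (s - 1) * exp (- (c * t)))) = indicator {0<..} t * (t powr (s - 1) * exp (- c * t))" for t
  proof (cases "t > 0")
    case True
    have "c powr (1 - s) * (c * t) powr (s - 1) = t powr (s - 1)"
      using assms True by (simp add: powr_mult mult.assoc[symmetric] flip: powr_add)
    then show ?thesis using assms True by (simp add: indicator_def algebra_simps)
  qed (use assms in \<open>auto simp: indicator_def zero_less_mult_iff\<close>)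
  moreover have "c powr (1 - s) * (Gamma s / c) = Gamma s * c powr (- s)"
    using assms by (simp add: powr_diff powr_minus_divide)
  ultimately show ?thesis by simp
qed

text \<open>In the gamma form, x enters only through exp (- x^2 / (4 v)), which is at most 1 and
  tends to 1: dominated convergence with the gamma integrand as majorant.\<close>

lemma tendsto_bessel_K_0:
  assumes "\<mu> > 0"
  shows "((\<lambda>x. x powr \<mu> * bessel_K \<mu> x) \<longlongrightarrow> 2 powr (\<mu> - 1) * Gamma \<mu>) (at_right 0)"
proof -
  define f where "f x v = indicator {0<..} v * (v powr (\<mu> - 1) * exp (- v - x\<^sup>2 / (4 * v)))" for x v :: real
  define f0 where "f0 v = indicator {0<..} v * (v powr (\<mu> - 1) * exp (- 1 * v))" for v :: real
  have f0: "has_bochner_integral lborel f0 (Gamma \<mu>)"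
    using has_bochner_integral_Gamma[OF assms zero_less_one] by (simp add: f0_def[abs_def])
  have lim: "((\<lambda>x. LINT v|lborel. f x v) \<longlongrightarrow> (LINT v|lborel. f0 v)) (at_right 0)"
    unfolding tendsto_at_iff_sequentially
  proof (intro allI impI)
    fix X :: "nat \<Rightarrow> real" assume X: "\<forall>i. X i \<in> {0<..} - {0}" "X \<longlonglongrightarrow> 0"
    have "(\<lambda>i. LINT v|lborel. f (X i) v) \<longlonglongrightarrow> (LINT v|lborel. f0 v)"
    proof (rule integral_dominated_convergence)
      show "integrable lborel f0" using f0 by (simp add: has_bochner_integral_iff)
      show "f0 \<in> borel_measurable lborel" "\<And>i. f (X i) \<in> borel_measurable lborel"
        unfolding f0_def f_def by measurable
      show "AE v in lborel. (\<lambda>i. f (X i) v) \<longlonglongrightarrow> f0 v"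
      proof (rule AE_I2)
        fix v
        have "(\<lambda>i. - v - (X i)\<^sup>2 / (4 * v)) \<longlonglongrightarrow> - v - 0\<^sup>2 / (4 * v)" if "v \<noteq> 0"
          by (intro tendsto_intros X(2)) (use that in simp)
        then have "(\<lambda>i. f (X i) v) \<longlonglongrightarrow> indicator {0<..} v * (v powr (\<mu> - 1) * exp (- v - 0\<^sup>2 / (4 * v)))" if "v \<noteq> 0"
          unfolding f_def by (intro tendsto_mult tendsto_const tendsto_exp) (use that in blast)
        then show "(\<lambda>i. f (X i) v) \<longlonglongrightarrow> f0 v" by (cases "v = 0") (simp_all add: f0_def f_def)
      qed
      show "AE v in lborel. norm (f (X i) v) \<le> f0 v" for i
        by (rule AE_I2) (auto simp: f_def f0_def indicator_def)
    qed
    then show "((\<lambda>x. LINT v|lborel. f x v) \<circ> X) \<longlonglongrightarrow> (LINT v|lborel. f0 v)" by (simp add: o_def)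
  qed
  have "((\<lambda>x. 2 powr (\<mu> - 1) * (LINT v|lborel. f x v)) \<longlongrightarrow> 2 powr (\<mu> - 1) * Gamma \<mu>) (at_right 0)"
    using tendsto_mult_left[OF lim] f0 by (simp add: has_bochner_integral_iff)
  moreover have "\<forall>\<^sub>F x in at_right 0. 2 powr (\<mu> - 1) * (LINT v|lborel. f x v) = x powr \<mu> * bessel_K \<mu> x"
    using eventually_at_right_less[of 0]
    by eventually_elim (simp add: bessel_K_gamma_form(2) f_def set_lebesgue_integral_def)
  ultimately show ?thesis by (rule Lim_transform_eventually)
qed

text \<open>Completing the square produces a normal density with mean 2 v b / \<alpha>^2 and
  variance 2 v / \<alpha>^2.\<close>

lemma nn_integral_gauss_exp:
  assumes "v > 0" "\<alpha> > 0"
  shows "(\<integral>\<^sup>+ t. ennreal (exp (b * t) * exp (- (\<alpha> * t)\<^sup>2 / (4 * v))) \<partial>lborel)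
    = ennreal (2 * sqrt pi / \<alpha> * (sqrt v * exp (b\<^sup>2 * v / \<alpha>\<^sup>2)))"
proof -
  define s where "s = sqrt (2 * v) / \<alpha>"
  define m where "m = 2 * v * b / \<alpha>\<^sup>2"
  define c where "c = exp (b\<^sup>2 * v / \<alpha>\<^sup>2) * sqrt (2 * pi * s\<^sup>2)"
  have s: "s > 0" "s\<^sup>2 = 2 * v / \<alpha>\<^sup>2" using assms by (auto simp: s_def power_divide)
  have c: "c > 0" using s(1) by (simp add: c_def)
  have "exp (b * t) * exp (- (\<alpha> * t)\<^sup>2 / (4 * v)) = c * normal_density m s t" for t
  proof -
    have "b * t + (- (\<alpha> * t)\<^sup>2 / (4 * v)) = b\<^sup>2 * v / \<alpha>\<^sup>2 + (- (t - m)\<^sup>2 / (2 * s\<^sup>2))"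
      using assms unfolding s(2) m_def by (simp add: field_simps power2_eq_square)
    then have "exp (b * t) * exp (- (\<alpha> * t)\<^sup>2 / (4 * v)) = exp (b\<^sup>2 * v / \<alpha>\<^sup>2) * exp (- (t - m)\<^sup>2 / (2 * s\<^sup>2))"
      by (simp only: exp_add[symmetric])
    then show ?thesis using s(1) by (simp add: normal_density_def c_def)
  qed
  then have "(\<integral>\<^sup>+ t. ennreal (exp (b * t) * exp (- (\<alpha> * t)\<^sup>2 / (4 * v))) \<partial>lborel)
      = (\<integral>\<^sup>+ t. ennreal c * ennreal (normal_density m s t) \<partial>lborel)"
    using c by (simp add: ennreal_mult')
  also have "\<dots> = ennreal c * (\<integral>\<^sup>+ t. ennreal (normal_density m s t) \<partial>lborel)"
    by (rule nn_integral_cmult) simp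
  also have "(\<integral>\<^sup>+ t. ennreal (normal_density m s t) \<partial>lborel) = 1"
    using s(1) by (subst nn_integral_eq_integral) auto
  also have "c = 2 * sqrt pi / \<alpha> * (sqrt v * exp (b\<^sup>2 * v / \<alpha>\<^sup>2))"
    using assms unfolding c_def s(2) by (simp add: real_sqrt_divide real_sqrt_mult)
  finally show ?thesis by simp
qed

text \<open>Tonelli with the gamma form of K: the integral over t is Gaussian and leaves a gamma
  integral in v with rate 1 - b^2 / \<alpha>^2, positive because |b| < \<alpha>. This is the
  normalisation of the variance-gamma density.\<close>

lemma has_bochner_integral_exp_bessel_K:
  assumes "\<mu> > -1/2" "\<alpha> > 0" "\<bar>b\<bar> < \<alpha>"
  shows "has_bochner_integral lborel (\<lambda>t. exp (b * t) * ((\<alpha> * \<bar>t\<bar>) powr \<mu> * bessel_K \<mu> (\<alpha> * \<bar>t\<bar>)))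
    (2 powr \<mu> * sqrt pi / \<alpha> * (Gamma (\<mu> + 1/2) * (1 - b\<^sup>2 / \<alpha>\<^sup>2) powr (- (\<mu> + 1/2))))"
proof -
  define c where "c = 1 - b\<^sup>2 / \<alpha>\<^sup>2"
  have "b\<^sup>2 < \<alpha>\<^sup>2" using assms(2,3) by (metis abs_le_square_iff abs_of_pos not_less)
  then have c: "c > 0" using assms(2) by (simp add: c_def)
  define k where "k t = exp (b * t) * ((\<alpha> * \<bar>t\<bar>) powr \<mu> * bessel_K \<mu> (\<alpha> * \<bar>t\<bar>))" for t
  define \<phi> where "\<phi> t v = indicator {0<..} v * (v powr (\<mu> - 1) * exp (- v - (\<alpha> * t)\<^sup>2 / (4 * v))) * exp (b * t)" for t v :: real
  have \<phi>0: "\<phi> t v \<ge> 0" for t v by (simp add: \<phi>_def)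
  have \<phi>_int: "has_bochner_integral lborel (\<phi> t) (2 powr (1 - \<mu>) * k t)" if "t \<noteq> 0" for t
  proof -
    have x: "\<alpha> * \<bar>t\<bar> > 0" using assms that by simp
    have "has_bochner_integral lborel (\<lambda>v. indicator {0<..} v * (v powr (\<mu> - 1) * exp (- v - (\<alpha> * \<bar>t\<bar>)\<^sup>2 / (4 * v))))
        (2 powr (1 - \<mu>) * ((\<alpha> * \<bar>t\<bar>) powr \<mu> * bessel_K \<mu> (\<alpha> * \<bar>t\<bar>)))"
      using bessel_K_gamma_form[OF x, of \<mu>]
      by (simp add: has_bochner_integral_iff set_integrable_def set_lebesgue_integral_def mult.assoc[symmetric] flip: powr_add)
    then show ?thesis
      unfolding k_def \<phi>_def using has_bochner_integral_mult_left[of "exp (b * t)"]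
      by (fastforce simp: power_mult_distrib mult.commute mult.left_commute)
  qed
  have k0: "k t \<ge> 0" if "t \<noteq> 0" for t
    using bessel_K_pos[of "\<alpha> * \<bar>t\<bar>" \<mu>] assms that unfolding k_def by (intro mult_nonneg_nonneg) auto
  have meas: "(\<lambda>(t, v). ennreal (\<phi> t v)) \<in> borel_measurable (lborel \<Otimes>\<^sub>M lborel)"
    unfolding \<phi>_def by measurable
  have "(\<integral>\<^sup>+ t. ennreal (2 powr (1 - \<mu>) * k t) \<partial>lborel) = (\<integral>\<^sup>+ t. (\<integral>\<^sup>+ v. ennreal (\<phi> t v) \<partial>lborel) \<partial>lborel)"
  proof (rule nn_integral_cong_AE)
    show "AE t in lborel. ennreal (2 powr (1 - \<mu>) * k t) = (\<integral>\<^sup>+ v. ennreal (\<phi> t v) \<partial>lborel)"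
      using AE_lborel_singleton[of 0]
    proof eventually_elim
      case (elim t)
      then show ?case
        using \<phi>_int[OF elim] \<phi>0 by (subst nn_integral_eq_integral) (auto simp: has_bochner_integral_iff)
    qed
  qed
  also have "\<dots> = (\<integral>\<^sup>+ v. (\<integral>\<^sup>+ t. ennreal (\<phi> t v) \<partial>lborel) \<partial>lborel)"
    using lborel_pair.Fubini'[OF meas] by simp
  also have "\<dots> = (\<integral>\<^sup>+ v. ennreal (2 * sqrt pi / \<alpha> * (indicator {0<..} v * (v powr ((\<mu> + 1/2) - 1) * exp (- c * v)))) \<partial>lborel)"
  proof (intro nn_integral_cong)
    fix v :: real
    show "(\<integral>\<^sup>+ t. ennreal (\<phi> t v) \<partial>lborel) = ennreal (2 * sqrt pi / \<alpha> * (indicator {0<..} v * (v powr ((\<mu> + 1/2) - 1) * exp (- c * v))))"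
    proof (cases "v > 0")
      case True
      have "\<phi> t v = (v powr (\<mu> - 1) * exp (- v)) * (exp (b * t) * exp (- (\<alpha> * t)\<^sup>2 / (4 * v)))" for t
      proof -
        have "exp (- v - (\<alpha> * t)\<^sup>2 / (4 * v)) = exp (- v) * exp (- (\<alpha> * t)\<^sup>2 / (4 * v))"
          by (simp add: exp_add[symmetric])
        then show ?thesis using True by (simp add: \<phi>_def mult_ac)
      qed
      then have "(\<integral>\<^sup>+ t. ennreal (\<phi> t v) \<partial>lborel) =
          (\<integral>\<^sup>+ t. ennreal (v powr (\<mu> - 1) * exp (- v)) * ennreal (exp (b * t) * exp (- (\<alpha> * t)\<^sup>2 / (4 * v))) \<partial>lborel)"
        by (simp add: ennreal_mult')
      also have "\<dots> = ennreal (v powr (\<mu> - 1) * exp (- v)) * ennreal (2 * sqrt pi / \<alpha> * (sqrt v * exp (b\<^sup>2 * v / \<alpha>\<^sup>2)))"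
        by (subst nn_integral_cmult) (simp_all only: nn_integral_gauss_exp[OF True assms(2)], measurable)
      also have "\<dots> = ennreal (2 * sqrt pi / \<alpha> * ((v powr (\<mu> - 1) * sqrt v) * (exp (- v) * exp (b\<^sup>2 * v / \<alpha>\<^sup>2))))"
        by (subst ennreal_mult'[symmetric]) (auto simp: mult_ac)
      also have "v powr (\<mu> - 1) * sqrt v = v powr ((\<mu> + 1/2) - 1)"
        using True by (simp add: powr_half_sqrt[symmetric] flip: powr_add)
      also have "exp (- v) * exp (b\<^sup>2 * v / \<alpha>\<^sup>2) = exp (- c * v)"
        by (simp add: c_def algebra_simps flip: exp_add)
      finally show ?thesis using True by simp
    qed (simp add: \<phi>_def)
  qed
  also have "\<dots> = ennreal (2 * sqrt pi / \<alpha> * (Gamma (\<mu> + 1/2) * c powr (- (\<mu> + 1/2))))"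
  proof -
    have "has_bochner_integral lborel (\<lambda>v. 2 * sqrt pi / \<alpha> * (indicator {0<..} v * (v powr ((\<mu> + 1/2) - 1) * exp (- c * v))))
       (2 * sqrt pi / \<alpha> * (Gamma (\<mu> + 1/2) * c powr (- (\<mu> + 1/2))))"
      using assms c by (intro has_bochner_integral_mult_right has_bochner_integral_Gamma) auto
    then show ?thesis
      using assms by (subst nn_integral_eq_integral) (auto simp: has_bochner_integral_iff)
  qed
  finally have nn: "(\<integral>\<^sup>+ t. ennreal (2 powr (1 - \<mu>) * k t) \<partial>lborel) = ennreal (2 * sqrt pi / \<alpha> * (Gamma (\<mu> + 1/2) * c powr (- (\<mu> + 1/2))))" .
  have "continuous_on {0<..} (bessel_K \<mu>)"
    using has_real_derivative_bessel_K by (intro continuous_at_imp_continuous_on) (auto intro: DERIV_isCont)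
  then have "(\<lambda>x. indicator {0<..} x *\<^sub>R bessel_K \<mu> x) \<in> borel_measurable borel"
    by (intro borel_measurable_continuous_on_indicator) auto
  then have mK: "(\<lambda>t. indicator {0<..} (\<alpha> * \<bar>t\<bar>) *\<^sub>R bessel_K \<mu> (\<alpha> * \<bar>t\<bar>)) \<in> borel_measurable borel"
    by measurable
  have "(\<lambda>t. exp (b * t) * ((\<alpha> * \<bar>t\<bar>) powr \<mu> * (indicator {0<..} (\<alpha> * \<bar>t\<bar>) *\<^sub>R bessel_K \<mu> (\<alpha> * \<bar>t\<bar>)))) \<in> borel_measurable borel"
    by (intro borel_measurable_times mK) measurable
  \<comment> \<open>The indicator is there because K is known to be continuous on
    \<open>{0<..}\<close> only. It changes nothing: at t = 0 both sides vanish, as 0 powr \<mu> is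
    0.\<close>
  also have "(\<lambda>t. exp (b * t) * ((\<alpha> * \<bar>t\<bar>) powr \<mu> * (indicator {0<..} (\<alpha> * \<bar>t\<bar>) *\<^sub>R bessel_K \<mu> (\<alpha> * \<bar>t\<bar>)))) = k"
  proof
    fix t show "exp (b * t) * ((\<alpha> * \<bar>t\<bar>) powr \<mu> * (indicator {0<..} (\<alpha> * \<bar>t\<bar>) *\<^sub>R bessel_K \<mu> (\<alpha> * \<bar>t\<bar>))) = k t"
      using assms by (cases "t = 0") (auto simp: k_def)
  qed
  finally have km: "k \<in> borel_measurable borel" .
  have "has_bochner_integral lborel (\<lambda>t. 2 powr (1 - \<mu>) * k t) (2 * sqrt pi / \<alpha> * (Gamma (\<mu> + 1/2) * c powr (- (\<mu> + 1/2))))"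
  proof (rule has_bochner_integral_nn_integral[OF _ _ _ nn])
    show "AE t in lborel. 0 \<le> 2 powr (1 - \<mu>) * k t"
      using AE_lborel_singleton[of 0] by eventually_elim (simp add: k0)
    show "0 \<le> 2 * sqrt pi / \<alpha> * (Gamma (\<mu> + 1/2) * c powr (- (\<mu> + 1/2)))"
      using assms by (auto intro!: mult_nonneg_nonneg Gamma_real_nonneg)
  qed (use km in measurable)
  from has_bochner_integral_mult_right[of "2 powr (\<mu> - 1)", OF this]
  have "has_bochner_integral lborel (\<lambda>t. 2 powr (\<mu> - 1) * (2 powr (1 - \<mu>) * k t))
      (2 powr (\<mu> - 1) * (2 * sqrt pi / \<alpha> * (Gamma (\<mu> + 1/2) * c powr (- (\<mu> + 1/2)))))" .
  moreover have "2 powr (\<mu> - 1) * (2 powr (1 - \<mu>) * k t) = k t" for t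
    by (simp add: mult.assoc[symmetric] flip: powr_add)
  moreover have "2 powr (\<mu> - 1) * (2 * sqrt pi / \<alpha> * y) = 2 powr \<mu> * sqrt pi / \<alpha> * y" for y
    by (simp add: powr_diff)
  ultimately have "has_bochner_integral lborel k (2 powr \<mu> * sqrt pi / \<alpha> * (Gamma (\<mu> + 1/2) * c powr (- (\<mu> + 1/2))))"
    by (simp only:)
  then show ?thesis unfolding k_def[abs_def] c_def .
qed

section \<open>The homogeneous equation\<close>

lemma nonneg_of_deriv_nonneg:
  fixes F F' :: "real \<Rightarrow> real"
  assumes "\<And>x. x > 0 \<Longrightarrow> (F has_real_derivative F' x) (at x)" "\<And>x. x > 0 \<Longrightarrow> F' x \<ge> 0"
    and "(F \<longlongrightarrow> 0) (at_right 0)" "x > 0"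
  shows "F x \<ge> 0"
proof (rule tendsto_upperbound[OF assms(3)])
  show "\<forall>\<^sub>F y in at_right 0. F y \<le> F x"
    using eventually_at_right_less[of 0] eventually_at_right_real[OF \<open>x > 0\<close>]
  proof eventually_elim
    case (elim y)
    then have "\<exists>d. (F has_real_derivative d) (at z) \<and> 0 \<le> d" if "y \<le> z" for z
      using that assms(1)[of z] assms(2)[of z] by (intro exI[of _ "F' z"]) auto
    then show ?case using elim by (intro DERIV_nonneg_imp_nondecreasing[of y x F]) auto
  qed
qed simp

lemma nonneg_of_deriv_nonpos:
  fixes F F' :: "real \<Rightarrow> real"
  assumes "\<And>x. x > 0 \<Longrightarrow> (F has_real_derivative F' x) (at x)" "\<And>x. x > 0 \<Longrightarrow> F' x \<le> 0"
    and "(F \<longlongrightarrow> 0) at_top" "x > 0"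
  shows "F x \<ge> 0"
proof (rule tendsto_upperbound[OF assms(3)])
  show "\<forall>\<^sub>F y in at_top. F y \<le> F x"
    using eventually_ge_at_top[of x]
  proof eventually_elim
    case (elim y)
    have "\<exists>d. (F has_real_derivative d) (at z) \<and> d \<le> 0" if "x \<le> z" for z
      using that assms(1)[of z] assms(2)[of z] assms(4) by (intro exI[of _ "F' z"]) auto
    then show ?case using elim by (intro DERIV_nonpos_imp_nonincreasing[of x y F]) auto
  qed
qed simp

lemma DERIV_powr_const:
  fixes x :: real
  assumes "x > 0"
  shows "((\<lambda>x. x powr a) has_real_derivative a / x * x powr a) (at x)"
  using assms by (auto intro!: derivative_eq_intros simp: powr_diff)

lemma DERIV_powr_scaled:
  fixes x :: real
  assumes "x > 0" "c > 0"
  shows "((\<lambda>x. (c * x) powr a) has_real_derivative a / x * (c * x) powr a) (at x)"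
  by (rule DERIV_cong[OF DERIV_chain2[OF DERIV_powr_const DERIV_cmult_Id]]) (use assms in auto)

lemma DERIV_scaled:
  assumes "(f has_real_derivative D) (at (c * x))"
  shows "((\<lambda>x. f (c * x)) has_real_derivative D * c) (at x)"
  by (rule DERIV_chain2[OF assms DERIV_cmult_Id])

text \<open>\<open>I\<close> and \<open>K\<close> are the solutions of \<open>x u'' + r u' = \<alpha>\<^sup>2 x u\<close>, normalised so that
  \<open>x\<^sup>r (I' K - I K') = 1\<close>, and \<open>P = x\<^bsup>r-1\<^esup> K\<close>. The primed constants are their derivatives.\<close>

locale vg_kernel =
  fixes r \<nu> \<alpha> :: real
  assumes r_pos: "r > 0" and \<alpha>_pos: "\<alpha> > 0" and r_eq: "r = 2 * \<nu> + 1"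
begin

lemma \<nu>_gt: "\<nu> > - 1 / 2"
  using r_pos r_eq by simp

definition I where "I x = 2 powr (- \<nu>) * bessel_E \<nu> ((\<alpha> * x / 2)\<^sup>2)"
definition I' where "I' x = 2 powr (- \<nu>) * (\<alpha>\<^sup>2 * x / 2) * bessel_E (\<nu> + 1) ((\<alpha> * x / 2)\<^sup>2)"
definition P where "P x = (\<alpha> * x) powr \<nu> * bessel_K \<nu> (\<alpha> * x)"
definition P' where "P' x = - \<alpha> * (\<alpha> * x) powr \<nu> * bessel_K (\<nu> - 1) (\<alpha> * x)"
definition K where "K x = x powr (1 - r) * P x"
definition K' where "K' x = - \<alpha> * x powr (1 - r) * ((\<alpha> * x) powr \<nu> * bessel_K (\<nu> + 1) (\<alpha> * x))"

lemma has_deriv_E: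
  assumes "\<mu> > -1"
  shows "((\<lambda>x. bessel_E \<mu> ((\<alpha> * x / 2)\<^sup>2)) has_real_derivative bessel_E (\<mu> + 1) ((\<alpha> * x / 2)\<^sup>2) * (\<alpha>\<^sup>2 * x / 2)) (at x)"
proof -
  have "((\<lambda>x. (\<alpha> * x / 2)\<^sup>2) has_real_derivative \<alpha>\<^sup>2 * x / 2) (at x)"
    by (auto intro!: derivative_eq_intros simp: power2_eq_square)
  from DERIV_chain2[OF has_real_derivative_bessel_E[OF assms] this] show ?thesis .
qed

lemma has_deriv_I: "(I has_real_derivative I' x) (at x)"
  unfolding I_def[abs_def] I'_def using \<nu>_gt
  by (intro DERIV_cong[OF DERIV_cmult[OF has_deriv_E]]) auto

lemma has_deriv_I':
  assumes "x \<noteq> 0"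
  shows "(I' has_real_derivative \<alpha>\<^sup>2 * I x - r / x * I' x) (at x)"
proof -
  define z where "z = (\<alpha> * x / 2)\<^sup>2"
  have "((\<lambda>x. 2 powr (- \<nu>) * (\<alpha>\<^sup>2 * x / 2)) has_real_derivative 2 powr (- \<nu>) * (\<alpha>\<^sup>2 / 2)) (at x)"
    by (auto intro!: derivative_eq_intros)
  from DERIV_mult[OF this has_deriv_E[of "\<nu> + 1"]] \<nu>_gt
  have "(I' has_real_derivative 2 powr (- \<nu>) * (\<alpha>\<^sup>2 / 2) * bessel_E (\<nu> + 1) z +
      bessel_E (\<nu> + 1 + 1) z * (\<alpha>\<^sup>2 * x / 2) * (2 powr (- \<nu>) * (\<alpha>\<^sup>2 * x / 2))) (at x)"
    unfolding I'_def[abs_def] z_def by simp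
  moreover have "bessel_E \<nu> z = (\<nu> + 1) * bessel_E (\<nu> + 1) z + z * bessel_E (\<nu> + 1 + 1) z"
    using \<nu>_gt bessel_E_rec[of \<nu> z] by (simp add: add.assoc)
  moreover have "c * (\<alpha>\<^sup>2 / 2) * A + B * (\<alpha>\<^sup>2 * x / 2) * (c * (\<alpha>\<^sup>2 * x / 2)) =
      \<alpha>\<^sup>2 * (c * ((\<nu> + 1) * A + (\<alpha> * x / 2)\<^sup>2 * B)) - (2 * \<nu> + 1) / x * (c * (\<alpha>\<^sup>2 * x / 2) * A)" for A B c
    using assms by (simp add: field_simps power2_eq_square)
  ultimately show ?thesis
    unfolding I_def I'_def z_def[symmetric] r_eq by (simp add: z_def)
qed

lemma I_pos: "I x > 0"
  unfolding I_def using \<nu>_gt by (intro mult_pos_pos bessel_E_pos) auto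

lemma I'_0: "I' 0 = 0"
  by (simp add: I'_def)

lemma I'_nonneg: "x \<ge> 0 \<Longrightarrow> I' x \<ge> 0"
  unfolding I'_def using \<nu>_gt by (intro mult_nonneg_nonneg less_imp_le[OF bessel_E_pos]) auto

lemma isCont_I: "isCont I x"
  using has_deriv_I DERIV_isCont by blast

lemma isCont_I': "isCont I' x"
proof -
  have "isCont (\<lambda>x. bessel_E (\<nu> + 1) ((\<alpha> * x / 2)\<^sup>2)) x"
    using \<nu>_gt by (intro DERIV_isCont[OF has_deriv_E]) auto
  then show ?thesis unfolding I'_def[abs_def] by (intro continuous_intros) auto
qed

lemma tendsto_I: "(I \<longlongrightarrow> I 0) (at_right 0)" and tendsto_I': "(I' \<longlongrightarrow> 0) (at_right 0)"
  using isCont_I[of 0] isCont_I'[of 0] by (auto simp: isCont_def I'_0 filterlim_at_split)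

lemma tendsto_powr_0: "a > 0 \<Longrightarrow> ((\<lambda>x. x powr a) \<longlongrightarrow> 0) (at_right (0::real))"
  by real_asymp

text \<open>The weight exp (\<alpha> x) x^r makes \<alpha> I - I' increase from the value 0: by the
  equation for \<open>I\<close>, only the nonnegative term with r/x \<alpha> I survives in the
  derivative.\<close>

lemma I'_le:
  assumes "x > 0"
  shows "I' x \<le> \<alpha> * I x"
proof -
  define F where "F x = exp (\<alpha> * x) * (x powr r * (\<alpha> * I x - I' x))" for x
  have "F x \<ge> 0"
  proof (rule nonneg_of_deriv_nonneg[where F = F and F' = "\<lambda>x. exp (\<alpha> * x) * x powr r * (r / x * (\<alpha> * I x))"])
    fix x :: real assume x: "x > 0"
    have "((\<lambda>x. \<alpha> * I x - I' x) has_real_derivative \<alpha> * I' x - (\<alpha>\<^sup>2 * I x - r / x * I' x)) (at x)"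
      using x by (intro DERIV_diff DERIV_cmult has_deriv_I has_deriv_I') auto
    moreover have "((\<lambda>x. exp (\<alpha> * x)) has_real_derivative exp (\<alpha> * x) * \<alpha>) (at x)"
      by (auto intro!: derivative_eq_intros)
    ultimately show "(F has_real_derivative exp (\<alpha> * x) * x powr r * (r / x * (\<alpha> * I x))) (at x)"
      unfolding F_def using x
      by (intro DERIV_cong[OF DERIV_mult[OF _ DERIV_mult[OF DERIV_powr_const]]]) (auto simp: field_simps power2_eq_square)
    show "0 \<le> exp (\<alpha> * x) * x powr r * (r / x * (\<alpha> * I x))"
      using r_pos \<alpha>_pos I_pos[of x] x by simp
  next
    have "(F \<longlongrightarrow> exp (\<alpha> * 0) * (0 * (\<alpha> * I 0 - 0))) (at_right 0)"
      unfolding F_def using r_pos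
      by (intro tendsto_intros tendsto_I tendsto_I' tendsto_powr_0)
    then show "(F \<longlongrightarrow> 0) (at_right 0)" by simp
  qed (use assms in auto)
  then show ?thesis using assms by (auto simp: F_def zero_le_mult_iff)
qed

lemma has_deriv_bessel_K_up:
  assumes "y > 0"
  shows "(bessel_K \<mu> has_real_derivative \<mu> / y * bessel_K \<mu> y - bessel_K (\<mu> + 1) y) (at y)"
  by (rule DERIV_cong[OF has_real_derivative_bessel_K[OF assms]])
     (use bessel_K_rec[OF assms, of \<mu>] in \<open>simp add: field_simps\<close>)

lemma has_deriv_bessel_K_down:
  assumes "y > 0"
  shows "(bessel_K \<mu> has_real_derivative - \<mu> / y * bessel_K \<mu> y - bessel_K (\<mu> - 1) y) (at y)"
  by (rule DERIV_cong[OF has_real_derivative_bessel_K[OF assms]])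
     (use bessel_K_rec[OF assms, of \<mu>] in \<open>simp add: field_simps\<close>)

lemma has_deriv_P:
  assumes "x > 0"
  shows "(P has_real_derivative P' x) (at x)"
  unfolding P_def[abs_def] P'_def using assms \<alpha>_pos
  by (intro DERIV_cong[OF DERIV_mult[OF DERIV_powr_scaled DERIV_scaled[OF has_deriv_bessel_K_down]]])
     (auto simp: field_simps)

lemma has_deriv_P':
  assumes "x > 0"
  shows "(P' has_real_derivative (r - 2) / x * P' x + \<alpha>\<^sup>2 * P x) (at x)"
  unfolding P_def P'_def[abs_def] using assms \<alpha>_pos
  by (intro DERIV_cong[OF DERIV_mult[OF DERIV_cmult[OF DERIV_powr_scaled] DERIV_scaled[OF has_deriv_bessel_K_up]]])
     (auto simp: field_simps power2_eq_square r_eq)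

lemma P_eq_K: "x > 0 \<Longrightarrow> P x = x powr (r - 1) * K x"
  by (simp add: K_def mult.assoc[symmetric] flip: powr_add)

lemma has_deriv_K:
  assumes "x > 0"
  shows "(K has_real_derivative K' x) (at x)"
  unfolding K_def[abs_def] K'_def P_def[abs_def] using assms \<alpha>_pos
  by (intro DERIV_cong[OF DERIV_mult[OF DERIV_powr_const DERIV_mult[OF DERIV_powr_scaled DERIV_scaled[OF has_deriv_bessel_K_up]]]])
     (auto simp: field_simps r_eq)

lemma has_deriv_K':
  assumes "x > 0"
  shows "(K' has_real_derivative \<alpha>\<^sup>2 * K x - r / x * K' x) (at x)"
  unfolding K_def K'_def[abs_def] P_def[abs_def] using assms \<alpha>_pos
  by (intro DERIV_cong[OF DERIV_mult[OF DERIV_cmult[OF DERIV_powr_const] DERIV_mult[OF DERIV_powr_scaled DERIV_scaled[OF has_deriv_bessel_K_down]]]])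
     (auto simp: field_simps r_eq power2_eq_square)

lemma P_pos: "x > 0 \<Longrightarrow> P x > 0"
  unfolding P_def using \<alpha>_pos by (intro mult_pos_pos bessel_K_pos) auto

lemma P'_neg: "x > 0 \<Longrightarrow> P' x < 0"
  unfolding P'_def using \<alpha>_pos bessel_K_pos[of "\<alpha> * x" "\<nu> - 1"] by simp

lemma K_pos: "x > 0 \<Longrightarrow> K x > 0"
  using P_pos by (simp add: K_def)

text \<open>Up to sign and the factor \<alpha>, \<open>K'\<close> is \<open>K\<close> with the
  Bessel order raised by one; K grows with the modulus of the order, and |\<nu>| \<le> |\<nu> + 1|
  as \<nu> > -1/2.\<close>

lemma K'_le:
  assumes "x > 0"
  shows "\<alpha> * K x \<le> - K' x"
proof -
  have "bessel_K \<nu> (\<alpha> * x) \<le> bessel_K (\<nu> + 1) (\<alpha> * x)"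
    using assms \<alpha>_pos \<nu>_gt by (intro bessel_K_mono) (auto simp: abs_if)
  then have "(\<alpha> * x powr (1 - r) * (\<alpha> * x) powr \<nu>) * bessel_K \<nu> (\<alpha> * x) \<le> (\<alpha> * x powr (1 - r) * (\<alpha> * x) powr \<nu>) * bessel_K (\<nu> + 1) (\<alpha> * x)"
    using assms \<alpha>_pos by (intro mult_left_mono) auto
  then show ?thesis by (simp add: K_def K'_def P_def mult_ac)
qed

text \<open>Here the Bessel order drops to \<nu> - 1, and |\<nu>| \<le> |\<nu> - 1| means \<nu>
  \<le> 1/2, that is r \<le> 2. For larger r a Turan type bound takes over.\<close>

lemma P'_le_of_r_le_2:
  assumes "x > 0" "r \<le> 2"
  shows "\<alpha> * P x \<le> - P' x"
proof -
  have "bessel_K \<nu> (\<alpha> * x) \<le> bessel_K (\<nu> - 1) (\<alpha> * x)"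
    using assms \<alpha>_pos \<nu>_gt r_eq by (intro bessel_K_mono) (auto simp: abs_if)
  then have "(\<alpha> * (\<alpha> * x) powr \<nu>) * bessel_K \<nu> (\<alpha> * x) \<le> (\<alpha> * (\<alpha> * x) powr \<nu>) * bessel_K (\<nu> - 1) (\<alpha> * x)"
    using assms \<alpha>_pos by (intro mult_left_mono) auto
  then show ?thesis by (simp add: P_def P'_def mult_ac)
qed

lemma K'_eq:
  assumes "x > 0"
  shows "x powr r * K' x = - ((\<alpha> * x) powr (\<nu> + 1) * bessel_K (\<nu> + 1) (\<alpha> * x))"
  using assms \<alpha>_pos unfolding K'_def by (simp add: powr_add powr_diff)

lemma tendsto_K'_0: "((\<lambda>x. x powr r * K' x) \<longlongrightarrow> - (2 powr \<nu> * Gamma (\<nu> + 1))) (at_right 0)"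
proof -
  have "filterlim (\<lambda>x. \<alpha> * x) (at_right 0) (at_right 0)" using \<alpha>_pos by real_asymp
  then have "((\<lambda>x. - ((\<alpha> * x) powr (\<nu> + 1) * bessel_K (\<nu> + 1) (\<alpha> * x))) \<longlongrightarrow> - (2 powr (\<nu> + 1 - 1) * Gamma (\<nu> + 1))) (at_right 0)"
    using \<nu>_gt by (intro tendsto_minus filterlim_compose[OF tendsto_bessel_K_0]) auto
  moreover have "\<forall>\<^sub>F x in at_right 0. - ((\<alpha> * x) powr (\<nu> + 1) * bessel_K (\<nu> + 1) (\<alpha> * x)) = x powr r * K' x"
    using eventually_at_right_less[of 0] by eventually_elim (simp add: K'_eq)
  ultimately show ?thesis by (auto intro: Lim_transform_eventually)
qed

lemma tendsto_K_0: "((\<lambda>x. x powr r * K x) \<longlongrightarrow> 0) (at_right 0)"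
proof -
  \<comment> \<open>A positive order strictly below \<nu> + 1 and at least |\<nu>|: K of order \<nu>
    is majorised by K of order \<mu>, whose behaviour at 0 is known, and a positive power of x is
    left over. The order \<nu> itself may be zero or negative.\<close>
  define \<mu> where "\<mu> = (\<bar>\<nu>\<bar> + (\<nu> + 1)) / 2"
  have \<mu>: "\<mu> > 0" "\<bar>\<nu>\<bar> \<le> \<bar>\<mu>\<bar>" "\<mu> < \<nu> + 1" using \<nu>_gt by (auto simp: \<mu>_def abs_if)
  have f: "filterlim (\<lambda>x. \<alpha> * x) (at_right 0) (at_right 0)" using \<alpha>_pos by real_asymp
  have "((\<lambda>x. (\<alpha> * x) powr (\<nu> + 1 - \<mu>) * ((\<alpha> * x) powr \<mu> * bessel_K \<mu> (\<alpha> * x)) / \<alpha>) \<longlongrightarrow> 0 * (2 powr (\<mu> - 1) * Gamma \<mu>) / \<alpha>) (at_right 0)"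
    using \<mu> \<alpha>_pos
    by (intro tendsto_mult tendsto_divide tendsto_const filterlim_compose[OF tendsto_powr_0 f] filterlim_compose[OF tendsto_bessel_K_0 f]) auto
  then have "((\<lambda>x. (\<alpha> * x) powr (\<nu> + 1 - \<mu>) * ((\<alpha> * x) powr \<mu> * bessel_K \<mu> (\<alpha> * x)) / \<alpha>) \<longlongrightarrow> 0) (at_right 0)" by simp
  moreover have "\<forall>\<^sub>F x in at_right 0. norm (x powr r * K x) \<le> (\<alpha> * x) powr (\<nu> + 1 - \<mu>) * ((\<alpha> * x) powr \<mu> * bessel_K \<mu> (\<alpha> * x)) / \<alpha>"
    using eventually_at_right_less[of 0]
  proof eventually_elim
    case (elim x)
    have "x powr r * K x = x * P x" using elim by (simp add: K_def powr_diff)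
    also have "\<dots> = ((\<alpha> * x) powr (\<nu> + 1) / \<alpha>) * bessel_K \<nu> (\<alpha> * x)" using elim \<alpha>_pos by (simp add: P_def powr_add)
    also have "\<dots> \<le> ((\<alpha> * x) powr (\<nu> + 1) / \<alpha>) * bessel_K \<mu> (\<alpha> * x)"
      using elim \<alpha>_pos \<mu> by (intro mult_left_mono bessel_K_mono) auto
    also have "(\<alpha> * x) powr (\<nu> + 1) = (\<alpha> * x) powr (\<nu> + 1 - \<mu>) * (\<alpha> * x) powr \<mu>" by (simp flip: powr_add)
    finally show ?case using elim K_pos[of x] by (simp add: mult_ac)
  qed
  ultimately show ?thesis by (rule Lim_null_comparison[rotated])
qed

lemma I_0: "I 0 = 2 powr (- \<nu>) / Gamma (\<nu> + 1)"
proof -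
  have "(\<alpha> * 0 / 2)\<^sup>2 = 0" by simp
  then show ?thesis unfolding I_def by (simp only: bessel_E_0 rGamma_inverse_Gamma divide_inverse)
qed

text \<open>The weighted Wronskian is constant because both functions solve the same equation. Its
  value is the limit at 0, where only \<open>I 0\<close> times the limit of x^r K'
  contributes.\<close>

lemma wronskian:
  assumes "x > 0"
  shows "x powr r * (I' x * K x - I x * K' x) = 1"
proof -
  define W where "W x = x powr r * (I' x * K x - I x * K' x)" for x
  have dW: "(W has_real_derivative 0) (at x)" if "x > 0" for x
    unfolding W_def using that
    by (intro DERIV_cong[OF DERIV_mult[OF DERIV_powr_const DERIV_diff[OF
          DERIV_mult[OF has_deriv_I' has_deriv_K] DERIV_mult[OF has_deriv_I has_deriv_K']]]])
       (auto simp: field_simps)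
  have "((\<lambda>x. I' x * (x powr r * K x) - I x * (x powr r * K' x)) \<longlongrightarrow> 0 * 0 - I 0 * - (2 powr \<nu> * Gamma (\<nu> + 1))) (at_right 0)"
    by (intro tendsto_intros tendsto_I tendsto_I' tendsto_K_0 tendsto_K'_0)
  moreover have "0 * 0 - I 0 * - (2 powr \<nu> * Gamma (\<nu> + 1)) = 1"
  proof -
    have "Gamma (\<nu> + 1) > 0" using \<nu>_gt by (intro Gamma_real_pos) auto
    then show ?thesis by (simp add: I_0 powr_minus)
  qed
  moreover have "(\<lambda>x. I' x * (x powr r * K x) - I x * (x powr r * K' x)) = W"
    by (auto simp: W_def algebra_simps)
  ultimately have lim: "(W \<longlongrightarrow> 1) (at_right 0)" by simp
  have "\<forall>\<^sub>F y in at_right 0. W y = W x"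
    using eventually_at_right_less[of 0]
  proof eventually_elim
    case (elim y)
    show ?case
      by (rule DERIV_isconst3[of "min x y / 2" "x + y + 1"])
         (use dW assms elim in \<open>auto simp: min_def split: if_splits\<close>)
  qed
  then have "(W \<longlongrightarrow> W x) (at_right 0)" by (simp add: tendsto_eventually)
  then show ?thesis using tendsto_unique[OF _ lim] by (simp add: W_def)
qed

lemma exp_decay:
  assumes "\<bar>b\<bar> < \<alpha>"
  shows "((\<lambda>x. x powr a * exp (b * x) * bessel_K \<mu> (\<alpha> * x)) \<longlongrightarrow> 0) at_top"
proof -
  define C where "C = bessel_K \<mu> 1 * exp 1"
  define d where "d = \<alpha> - b"
  have "d > 0" using assms by (auto simp: d_def)
  then have "((\<lambda>x. x powr a * exp (- d * x)) \<longlongrightarrow> 0) at_top" by real_asymp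
  then have "((\<lambda>x. C * (x powr a * exp (- (\<alpha> - b) * x))) \<longlongrightarrow> 0) at_top"
    unfolding d_def by (rule tendsto_mult_right_zero)
  moreover have "\<forall>\<^sub>F x in at_top. norm (x powr a * exp (b * x) * bessel_K \<mu> (\<alpha> * x)) \<le> C * (x powr a * exp (- (\<alpha> - b) * x))"
    using eventually_ge_at_top[of "1 / \<alpha>"]
  proof eventually_elim
    case (elim x)
    then have x: "\<alpha> * x \<ge> 1" using \<alpha>_pos by (simp add: field_simps)
    have "norm (x powr a * exp (b * x) * bessel_K \<mu> (\<alpha> * x)) = x powr a * exp (b * x) * bessel_K \<mu> (\<alpha> * x)"
      using bessel_K_pos[of "\<alpha> * x" \<mu>] x by (simp add: abs_mult)
    also have "\<dots> \<le> x powr a * exp (b * x) * (exp (1 - \<alpha> * x) * bessel_K \<mu> 1)"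
      by (intro mult_left_mono bessel_K_decay x) auto
    also have "\<dots> = bessel_K \<mu> 1 * (x powr a * (exp (b * x) * exp (1 - \<alpha> * x)))" by (simp add: mult_ac)
    also have "exp (b * x) * exp (1 - \<alpha> * x) = exp 1 * exp (- (\<alpha> - b) * x)" by (simp add: algebra_simps flip: exp_add)
    finally show ?case by (simp add: C_def mult_ac)
  qed
  ultimately show ?thesis by (rule Lim_null_comparison[rotated])
qed

lemma decay_K:
  assumes "\<bar>b\<bar> < \<alpha>"
  shows "((\<lambda>x. x powr a * exp (b * x) * K x) \<longlongrightarrow> 0) at_top"
proof -
  have "((\<lambda>x. \<alpha> powr \<nu> * (x powr (a + 1 - r + \<nu>) * exp (b * x) * bessel_K \<nu> (\<alpha> * x))) \<longlongrightarrow> \<alpha> powr \<nu> * 0) at_top"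
    by (intro tendsto_mult tendsto_const exp_decay assms)
  moreover have "\<forall>\<^sub>F x in at_top. \<alpha> powr \<nu> * (x powr (a + 1 - r + \<nu>) * exp (b * x) * bessel_K \<nu> (\<alpha> * x)) = x powr a * exp (b * x) * K x"
    using eventually_gt_at_top[of 0]
    by eventually_elim (use \<alpha>_pos in \<open>simp add: K_def P_def powr_mult powr_add powr_diff\<close>)
  ultimately show ?thesis by (auto intro: Lim_transform_eventually)
qed

lemma decay_K':
  assumes "\<bar>b\<bar> < \<alpha>"
  shows "((\<lambda>x. x powr a * exp (b * x) * K' x) \<longlongrightarrow> 0) at_top"
proof -
  have "((\<lambda>x. (- \<alpha> * \<alpha> powr \<nu>) * (x powr (a + 1 - r + \<nu>) * exp (b * x) * bessel_K (\<nu> + 1) (\<alpha> * x))) \<longlongrightarrow> (- \<alpha> * \<alpha> powr \<nu>) * 0) at_top"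
    by (intro tendsto_mult tendsto_const exp_decay assms)
  moreover have "\<forall>\<^sub>F x in at_top. (- \<alpha> * \<alpha> powr \<nu>) * (x powr (a + 1 - r + \<nu>) * exp (b * x) * bessel_K (\<nu> + 1) (\<alpha> * x)) = x powr a * exp (b * x) * K' x"
    using eventually_gt_at_top[of 0]
    by eventually_elim (use \<alpha>_pos in \<open>simp add: K'_def powr_mult powr_add powr_diff\<close>)
  ultimately show ?thesis by (auto intro: Lim_transform_eventually)
qed

end

section \<open>Integrals from 0 and to infinity as functions of the endpoint\<close>

lemma head_integral_has_deriv:
  fixes \<phi> :: "real \<Rightarrow> real"
  assumes cont: "continuous_on {0<..} \<phi>" and int: "\<And>y. y > 0 \<Longrightarrow> set_integrable lborel {0<..<y} \<phi>" and x: "x > 0"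
  shows "((\<lambda>x. LBINT t=0..ereal x. \<phi> t) has_real_derivative \<phi> x) (at x)"
proof -
  define c where "c = x / 2"
  define d where "d = 2 * x"
  have cd: "0 < c" "c < x" "x < d" using x by (auto simp: c_def d_def)
  have "continuous_on {c..d} \<phi>" using cd by (intro continuous_on_subset[OF cont]) auto
  then have "((\<lambda>u. LBINT y=c..u. \<phi> y) has_vector_derivative \<phi> x) (at x within {c..d})"
    using cd by (intro interval_integral_FTC2) auto
  then have "((\<lambda>u. (LBINT t=0..ereal c. \<phi> t) + (LBINT y=c..u. \<phi> y)) has_vector_derivative (0 + \<phi> x)) (at x within {c..d})"
    by (intro has_vector_derivative_add has_vector_derivative_const)
  moreover have "(LBINT t=0..ereal c. \<phi> t) + (LBINT y=c..u. \<phi> y) = (LBINT t=0..ereal u. \<phi> t)" if "u \<in> {c..d}" for u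
    using that cd int[of u] by (intro interval_integral_sum) (auto simp: interval_lebesgue_integrable_def min_def max_def zero_ereal_def)
  ultimately have "((\<lambda>x. LBINT t=0..ereal x. \<phi> t) has_vector_derivative (0 + \<phi> x)) (at x within {c..d})"
    using cd by (elim has_vector_derivative_weaken) auto
  then show ?thesis using cd by (simp add: has_real_derivative_iff_has_vector_derivative at_within_Icc_at)
qed

lemma tail_integral_has_deriv:
  fixes \<phi> :: "real \<Rightarrow> real"
  assumes cont: "continuous_on {0<..} \<phi>" and int: "set_integrable lborel {0<..} \<phi>" and x: "x > 0"
  shows "((\<lambda>x. LBINT t=ereal x..\<infinity>. \<phi> t) has_real_derivative - \<phi> x) (at x)"
proof -
  define c where "c = x / 2"
  define d where "d = 2 * x"
  have cd: "0 < c" "c < x" "x < d" using x by (auto simp: c_def d_def)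
  have "continuous_on {c..d} \<phi>" using cd by (intro continuous_on_subset[OF cont]) auto
  then have "((\<lambda>u. LBINT y=c..u. \<phi> y) has_vector_derivative \<phi> x) (at x within {c..d})"
    using cd by (intro interval_integral_FTC2) auto
  then have "((\<lambda>u. (LBINT t=ereal c..\<infinity>. \<phi> t) - (LBINT y=c..u. \<phi> y)) has_vector_derivative (0 - \<phi> x)) (at x within {c..d})"
    by (intro has_vector_derivative_diff has_vector_derivative_const)
  moreover have "(LBINT t=ereal c..\<infinity>. \<phi> t) - (LBINT y=c..u. \<phi> y) = (LBINT t=ereal u..\<infinity>. \<phi> t)" if "u \<in> {c..d}" for u
  proof -
    have "set_integrable lborel {c<..} \<phi>" using cd by (intro set_integrable_subset[OF int]) auto
    then have "(LBINT y=c..u. \<phi> y) + (LBINT t=ereal u..\<infinity>. \<phi> t) = (LBINT t=ereal c..\<infinity>. \<phi> t)"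
      using that cd by (intro interval_integral_sum) (auto simp: interval_lebesgue_integrable_def min_def max_def)
    then show ?thesis by simp
  qed
  ultimately have "((\<lambda>x. LBINT t=ereal x..\<infinity>. \<phi> t) has_vector_derivative (0 - \<phi> x)) (at x within {c..d})"
    using cd by (elim has_vector_derivative_weaken) auto
  then show ?thesis using cd by (simp add: has_real_derivative_iff_has_vector_derivative at_within_Icc_at)
qed

lemma head_integral_tendsto_0:
  fixes \<phi> :: "real \<Rightarrow> real"
  assumes int: "\<And>y. y > 0 \<Longrightarrow> set_integrable lborel {0<..<y} \<phi>"
  shows "((\<lambda>x. LBINT t=0..ereal x. \<phi> t) \<longlongrightarrow> 0) (at_right 0)"
proof -
  have int1: "set_integrable lborel {0<..1} \<phi>" using int[of 2] by (rule set_integrable_subset) auto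
  have "((\<lambda>x. set_lebesgue_integral lborel {x..1} \<phi>) \<longlongrightarrow> set_lebesgue_integral lborel {0<..1} \<phi>) (at_right 0)"
    by (rule tendsto_set_lebesgue_integral_at_right[OF _ _ int1]) auto
  then have "((\<lambda>x. set_lebesgue_integral lborel {0<..1} \<phi> - set_lebesgue_integral lborel {x..1} \<phi>) \<longlongrightarrow> set_lebesgue_integral lborel {0<..1} \<phi> - set_lebesgue_integral lborel {0<..1} \<phi>) (at_right 0)"
    by (intro tendsto_diff tendsto_const)
  moreover have "\<forall>\<^sub>F x in at_right 0. set_lebesgue_integral lborel {0<..1} \<phi> - set_lebesgue_integral lborel {x..1} \<phi> = (LBINT t=0..ereal x. \<phi> t)"
    using eventually_at_right_real[OF zero_less_one]
  proof eventually_elim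
    case (elim x)
    have "{0<..1} = {0<..<x} \<union> {x..1}" using elim by auto
    then have "set_lebesgue_integral lborel {0<..1} \<phi> = set_lebesgue_integral lborel {0<..<x} \<phi> + set_lebesgue_integral lborel {x..1} \<phi>"
      using elim by (simp only:) (intro set_integral_Un set_integrable_subset[OF int1], auto)
    then show ?case using elim by (simp add: interval_integral_Ioo zero_ereal_def)
  qed
  ultimately show ?thesis by (auto intro: Lim_transform_eventually)
qed

lemma tail_integral_split:
  fixes \<phi> :: "real \<Rightarrow> real"
  assumes int: "set_integrable lborel {0<..} \<phi>" and x: "x > 0"
  shows "(LBINT t=ereal x..\<infinity>. \<phi> t) = (LBINT t=0..\<infinity>. \<phi> t) - (LBINT t=0..ereal x. \<phi> t)"
proof -
  have "(LBINT t=0..ereal x. \<phi> t) + (LBINT t=ereal x..\<infinity>. \<phi> t) = (LBINT t=0..\<infinity>. \<phi> t)"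
    using x int by (intro interval_integral_sum) (auto simp: interval_lebesgue_integrable_def min_def max_def zero_ereal_def)
  then show ?thesis by simp
qed

lemma tail_integral_tendsto_0:
  fixes \<phi> :: "real \<Rightarrow> real"
  assumes int: "set_integrable lborel {0<..} \<phi>"
  shows "((\<lambda>x. LBINT t=ereal x..\<infinity>. \<phi> t) \<longlongrightarrow> (LBINT t=0..\<infinity>. \<phi> t)) (at_right 0)"
proof -
  have "((\<lambda>x. (LBINT t=0..\<infinity>. \<phi> t) - (LBINT t=0..ereal x. \<phi> t)) \<longlongrightarrow> (LBINT t=0..\<infinity>. \<phi> t) - 0) (at_right 0)"
    by (intro tendsto_diff tendsto_const head_integral_tendsto_0 set_integrable_subset[OF int]) auto
  moreover have "\<forall>\<^sub>F x in at_right 0. (LBINT t=0..\<infinity>. \<phi> t) - (LBINT t=0..ereal x. \<phi> t) = (LBINT t=ereal x..\<infinity>. \<phi> t)"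
    using eventually_at_right_less[of 0] by eventually_elim (simp add: tail_integral_split[OF int])
  ultimately show ?thesis by (auto intro: Lim_transform_eventually)
qed

lemma tail_integral_tendsto_top:
  fixes \<phi> :: "real \<Rightarrow> real"
  assumes int: "set_integrable lborel {0<..} \<phi>"
  shows "((\<lambda>x. LBINT t=ereal x..\<infinity>. \<phi> t) \<longlongrightarrow> 0) at_top"
proof -
  define s where "s x t = indicator {x<..} t * (indicator {0<..} t * \<phi> t)" for x t :: real
  have m: "(\<lambda>t. indicator {0<..} t * \<phi> t) \<in> borel_measurable lborel" using int by (simp add: set_integrable_def)
  have "((\<lambda>x. integral\<^sup>L lborel (s x)) \<longlongrightarrow> integral\<^sup>L lborel (\<lambda>t::real. 0)) at_top"
  proof (rule integral_dominated_convergence_at_top[where w = "\<lambda>t. norm (indicator {0<..} t * \<phi> t)"])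
    show "integrable lborel (\<lambda>t. norm (indicator {0<..} t * \<phi> t))"
      using int unfolding set_integrable_def real_scaleR_def by (rule integrable_norm)
    show "s x \<in> borel_measurable lborel" for x
      unfolding s_def by (intro borel_measurable_times m) auto
    show "AE t in lborel. ((\<lambda>x. s x t) \<longlongrightarrow> 0) at_top"
    proof (rule AE_I2)
      fix t :: real
      have "\<forall>\<^sub>F x in at_top. s x t = 0"
        using eventually_ge_at_top[of t] by eventually_elim (auto simp: s_def indicator_def)
      then show "((\<lambda>x. s x t) \<longlongrightarrow> 0) at_top" by (rule tendsto_eventually)
    qed
    show "\<forall>\<^sub>F x in at_top. AE t in lborel. norm (s x t) \<le> norm (indicator {0<..} t * \<phi> t)"
      by (intro always_eventually allI AE_I2) (auto simp: s_def indicator_def)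
  qed auto
  moreover have "\<forall>\<^sub>F x in at_top. integral\<^sup>L lborel (s x) = (LBINT t=ereal x..\<infinity>. \<phi> t)"
    using eventually_ge_at_top[of 0]
  proof eventually_elim
    case (elim x)
    then have "s x = (\<lambda>t. indicator {x<..} t *\<^sub>R \<phi> t)"
      by (auto simp: s_def indicator_def fun_eq_iff)
    then show ?case by (simp add: interval_integral_to_infinity_eq set_lebesgue_integral_def)
  qed
  ultimately show ?thesis by (auto intro: Lim_transform_eventually)
qed

text \<open>The constant that the estimates produce for every positive parameter; \<open>c\<close>
  stands for 1 - b^2 / \<alpha>^2. \<open>vg_C\<close> equals it for parameters at least 2 and
  dominates it below 2.\<close>

definition vg_C1 :: "real \<Rightarrow> real \<Rightarrow> real" where
  "vg_C1 r c = sqrt pi * Gamma (r / 2) / Gamma ((r + 1) / 2) * c powr (- r / 2)"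

section \<open>Products of the homogeneous solutions with their integrals\<close>

context vg_kernel
begin

definition J where "J b x = (LBINT t=ereal x..\<infinity>. exp (b * t) * P t)"

lemma continuous_P: "continuous_on {0<..} P"
  using has_deriv_P by (intro continuous_at_imp_continuous_on) (auto intro: DERIV_isCont)

text \<open>The Gamma factor is absorbed into \<open>I 0\<close>, so that the mass of the weight
  times \<open>I 0\<close>, the quantity met below, is just \<open>vg_C1\<close> over
  \<alpha>.\<close>

lemma has_bochner_integral_P:
  assumes "\<bar>b\<bar> < \<alpha>"
  shows "has_bochner_integral lborel (\<lambda>t. exp (b * t) * P \<bar>t\<bar>) (vg_C1 r (1 - b\<^sup>2 / \<alpha>\<^sup>2) / (\<alpha> * I 0))"
proof -
  have "2 powr \<nu> * sqrt pi / \<alpha> * (Gamma (\<nu> + 1/2) * (1 - b\<^sup>2 / \<alpha>\<^sup>2) powr (- (\<nu> + 1/2))) = vg_C1 r (1 - b\<^sup>2 / \<alpha>\<^sup>2) / (\<alpha> * I 0)"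
  proof -
    have e: "(r + 1) / 2 = \<nu> + 1" "r / 2 = \<nu> + 1 / 2" "- r / 2 = - (\<nu> + 1 / 2)" by (simp_all add: r_eq)
    have "Gamma (\<nu> + 1) > 0" using \<nu>_gt by (intro Gamma_real_pos) auto
    then show ?thesis unfolding vg_C1_def e I_0 by (simp add: powr_minus field_simps)
  qed
  then show ?thesis
    using has_bochner_integral_exp_bessel_K[OF _ \<alpha>_pos assms, of \<nu>] \<nu>_gt by (simp add: P_def)
qed

lemma set_integrable_P:
  assumes "\<bar>b\<bar> < \<alpha>"
  shows "set_integrable lborel {0<..} (\<lambda>t. exp (b * t) * P t)"
proof -
  have "set_integrable lborel UNIV (\<lambda>t. exp (b * t) * P \<bar>t\<bar>)"
    using has_bochner_integral_P[OF assms] by (simp add: set_integrable_def has_bochner_integral_iff)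
  then have "set_integrable lborel {0<..} (\<lambda>t. exp (b * t) * P \<bar>t\<bar>)" by (rule set_integrable_subset) auto
  then show ?thesis by (subst set_integrable_cong[where f' = "\<lambda>t. exp (b * t) * P \<bar>t\<bar>"]) auto
qed

lemma J_0: "J b 0 = (LINT t:{0<..}|lborel. exp (b * t) * P t)"
  by (simp add: J_def interval_integral_to_infinity_eq)

lemma J_nonneg: "x \<ge> 0 \<Longrightarrow> J b x \<ge> 0"
  unfolding J_def interval_integral_to_infinity_eq set_lebesgue_integral_def
  by (intro integral_nonneg_AE AE_I2) (auto simp: indicator_def less_imp_le[OF P_pos])

lemma J_total:
  assumes "\<bar>b\<bar> < \<alpha>"
  shows "I 0 * (J b 0 + J (- b) 0) = vg_C1 r (1 - b\<^sup>2 / \<alpha>\<^sup>2) / \<alpha>"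
proof -
  let ?f = "\<lambda>t. exp (b * t) * P \<bar>t\<bar>"
  have hb: "has_bochner_integral lborel ?f (vg_C1 r (1 - b\<^sup>2 / \<alpha>\<^sup>2) / (\<alpha> * I 0))"
    by (rule has_bochner_integral_P[OF assms])
  then have int: "set_integrable lborel S ?f" if "S \<in> sets borel" for S
    using set_integrable_subset[of lborel UNIV ?f S] that by (simp add: set_integrable_def has_bochner_integral_iff)
  have "(LINT t|lborel. ?f t) = (LINT t:{0<..} \<union> {..<0}|lborel. ?f t)"
    unfolding set_lebesgue_integral_def
  proof (rule integral_cong_AE)
    show "?f \<in> borel_measurable lborel" using hb by (rule borel_measurable_has_bochner_integral)
    then show "(\<lambda>t. indicator ({0<..} \<union> {..<0}) t *\<^sub>R ?f t) \<in> borel_measurable lborel" by measurable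
    show "AE t in lborel. ?f t = indicator ({0<..} \<union> {..<0}) t *\<^sub>R ?f t"
      using AE_lborel_singleton[of 0] by eventually_elim (auto simp: indicator_def)
  qed
  also have "\<dots> = (LINT t:{0<..}|lborel. ?f t) + (LINT t:{..<0}|lborel. ?f t)"
    by (intro set_integral_Un int) auto
  also have "(LINT t:{0<..}|lborel. ?f t) = J b 0"
    unfolding J_0 by (intro set_lebesgue_integral_cong) auto
  also have "(LINT t:{..<0}|lborel. ?f t) = (LINT t|lborel. indicator {..<0} (0 + (- 1) * t) *\<^sub>R ?f (0 + (- 1) * t))"
    unfolding set_lebesgue_integral_def by (subst lborel_integral_real_affine[where c = "- 1" and t = 0]) auto
  also have "\<dots> = J (- b) 0"
    unfolding J_0 set_lebesgue_integral_def by (intro Bochner_Integration.integral_cong) (auto simp: indicator_def)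
  finally have "J b 0 + J (- b) 0 = vg_C1 r (1 - b\<^sup>2 / \<alpha>\<^sup>2) / (\<alpha> * I 0)"
    using hb by (simp add: has_bochner_integral_iff)
  then show ?thesis using I_pos[of 0] by simp
qed

text \<open>A Turan type inequality: \<open>M\<close> vanishes at \<open>0\<close> and is increasing. In \<open>P'_sqrt_bound\<close> the
  analogous function vanishes at infinity and is decreasing.\<close>

lemma I'_sqrt_bound:
  assumes x: "x > 0"
  shows "I' x ^ 2 + r / x * I x * I' x \<le> \<alpha>\<^sup>2 * I x ^ 2"
proof -
  define M where "M x = x powr r * (\<alpha>\<^sup>2 * (I x)\<^sup>2 - (I' x)\<^sup>2) - r * (x powr (r - 1) * (I x * I' x))" for x
  have Mx: "M x = x powr r * (\<alpha>\<^sup>2 * (I x)\<^sup>2 - (I' x)\<^sup>2 - r / x * I x * I' x)" if "x > 0" for x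
    using that by (simp add: M_def powr_diff field_simps)
  define M1 where "M1 x = x powr r * (\<alpha>\<^sup>2 * (I x)\<^sup>2 - (I' x)\<^sup>2)" for x
  define M2 where "M2 x = x powr (r - 1) * (I x * I' x)" for x
  have "M x \<ge> 0"
  proof (rule nonneg_of_deriv_nonneg[where F = M and F' = "\<lambda>x. r / x\<^sup>2 * x powr r * I x * I' x"])
    fix y :: real assume y: "y > 0"
    have dI2: "((\<lambda>x. (I x)\<^sup>2) has_real_derivative 2 * I y * I' y) (at y)"
      by (rule DERIV_cong[OF DERIV_power[OF has_deriv_I]]) simp
    have dI'2: "((\<lambda>x. (I' x)\<^sup>2) has_real_derivative 2 * I' y * (\<alpha>\<^sup>2 * I y - r / y * I' y)) (at y)"
      by (rule DERIV_cong[OF DERIV_power[OF has_deriv_I']]) (use y in auto)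
    have dII': "((\<lambda>x. I x * I' x) has_real_derivative I' y * I' y + (\<alpha>\<^sup>2 * I y - r / y * I' y) * I y) (at y)"
      using y by (intro DERIV_mult has_deriv_I has_deriv_I') auto
    have d1: "(M1 has_real_derivative r / y * y powr r * (\<alpha>\<^sup>2 * (I y)\<^sup>2 - (I' y)\<^sup>2) +
        (\<alpha>\<^sup>2 * (2 * I y * I' y) - 2 * I' y * (\<alpha>\<^sup>2 * I y - r / y * I' y)) * y powr r) (at y)"
      unfolding M1_def by (intro DERIV_mult DERIV_powr_const y DERIV_diff DERIV_cmult dI2 dI'2)
    have d2: "(M2 has_real_derivative (r - 1) / y * y powr (r - 1) * (I y * I' y) +
        (I' y * I' y + (\<alpha>\<^sup>2 * I y - r / y * I' y) * I y) * y powr (r - 1)) (at y)"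
      unfolding M2_def by (intro DERIV_mult DERIV_powr_const y dII')
    have e: "y powr (r - 1) = y powr r / y" using y by (simp add: powr_diff)
    have "(r / y * y powr r * (\<alpha>\<^sup>2 * (I y)\<^sup>2 - (I' y)\<^sup>2) +
        (\<alpha>\<^sup>2 * (2 * I y * I' y) - 2 * I' y * (\<alpha>\<^sup>2 * I y - r / y * I' y)) * y powr r) -
        r * ((r - 1) / y * y powr (r - 1) * (I y * I' y) +
        (I' y * I' y + (\<alpha>\<^sup>2 * I y - r / y * I' y) * I y) * y powr (r - 1)) = r / y\<^sup>2 * y powr r * I y * I' y"
      unfolding e using y by (simp add: field_simps power2_eq_square)
    then show "(M has_real_derivative r / y\<^sup>2 * y powr r * I y * I' y) (at y)"
      using DERIV_diff[OF d1 DERIV_cmult[OF d2, of r]] by (simp add: M_def[abs_def] M1_def M2_def)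
    show "r / y\<^sup>2 * y powr r * I y * I' y \<ge> 0"
      using y r_pos I_pos[of y] I'_nonneg[of y] by (intro mult_nonneg_nonneg) auto
  next
    \<comment> \<open>\<open>E\<close> is I'(x)/x continued to 0. It turns x^(r-1) I', whose power
      is unbounded at 0 for r < 1, into x^r E.\<close>
    define E where "E x = 2 powr (- \<nu>) * (\<alpha>\<^sup>2 / 2) * bessel_E (\<nu> + 1) ((\<alpha> * x / 2)\<^sup>2)" for x
    have "isCont E 0" unfolding E_def
      using \<nu>_gt by (intro continuous_intros DERIV_isCont[OF has_deriv_E]) auto
    then have E: "(E \<longlongrightarrow> E 0) (at_right 0)" by (auto simp: isCont_def filterlim_at_split)
    have "((\<lambda>x. x powr r * (\<alpha>\<^sup>2 * (I x)\<^sup>2 - (I' x)\<^sup>2) - r * (x powr r * (I x * E x))) \<longlongrightarrow>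
       0 * (\<alpha>\<^sup>2 * (I 0)\<^sup>2 - 0\<^sup>2) - r * (0 * (I 0 * E 0))) (at_right 0)"
      by (intro tendsto_intros tendsto_powr_0 r_pos tendsto_I tendsto_I' E)
    moreover have "\<forall>\<^sub>F x in at_right 0. x powr r * (\<alpha>\<^sup>2 * (I x)\<^sup>2 - (I' x)\<^sup>2) - r * (x powr r * (I x * E x)) = M x"
      using eventually_at_right_less[of 0]
    proof eventually_elim
      case (elim x)
      have "I' x = x * E x" by (simp add: I'_def E_def)
      moreover have "x powr (r - 1) * x = x powr r" using elim by (simp add: powr_diff)
      ultimately show ?case by (simp add: M_def mult_ac)
    qed
    ultimately show "(M \<longlongrightarrow> 0) (at_right 0)" by (auto intro: Lim_transform_eventually)
  qed (use x in auto)
  then show ?thesis using x by (simp add: Mx zero_le_mult_iff)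
qed

lemma P'_sqrt_bound:
  assumes x: "x > 0" and r2: "r \<ge> 2"
  shows "\<alpha>\<^sup>2 * P x ^ 2 \<le> P' x ^ 2 - (r - 2) / x * P x * P' x"
proof -
  \<comment> \<open>\<open>P\<close> solves x P'' - a P' = \<alpha>^2 x P, the equation of
    \<open>I\<close> and \<open>K\<close> with -a in the role of r.\<close>
  define a where "a = r - 2"
  have a: "a \<ge> 0" using r2 by (simp add: a_def)
  define N where "N x = x powr (- a) * ((P' x)\<^sup>2 - \<alpha>\<^sup>2 * (P x)\<^sup>2) - a * (x powr (- a - 1) * (P x * P' x))" for x
  have Nx: "N x = x powr (- a) * ((P' x)\<^sup>2 - \<alpha>\<^sup>2 * (P x)\<^sup>2 - a / x * P x * P' x)" if "x > 0" for x
    using that by (simp add: N_def powr_diff field_simps)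
  define N1 where "N1 x = x powr (- a) * ((P' x)\<^sup>2 - \<alpha>\<^sup>2 * (P x)\<^sup>2)" for x
  define N2 where "N2 x = x powr (- a - 1) * (P x * P' x)" for x
  have "N x \<ge> 0"
  proof (rule nonneg_of_deriv_nonpos[where F = N and F' = "\<lambda>x. a / x\<^sup>2 * x powr (- a) * P x * P' x"])
    fix y :: real assume y: "y > 0"
    have dP': "(P' has_real_derivative a / y * P' y + \<alpha>\<^sup>2 * P y) (at y)" using has_deriv_P'[OF y] by (simp add: a_def)
    have dP2: "((\<lambda>x. (P x)\<^sup>2) has_real_derivative 2 * P y * P' y) (at y)"
      by (rule DERIV_cong[OF DERIV_power[OF has_deriv_P[OF y]]]) simp
    have dP'2: "((\<lambda>x. (P' x)\<^sup>2) has_real_derivative 2 * P' y * (a / y * P' y + \<alpha>\<^sup>2 * P y)) (at y)"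
      by (rule DERIV_cong[OF DERIV_power[OF dP']]) simp
    have dPP': "((\<lambda>x. P x * P' x) has_real_derivative P' y * P' y + (a / y * P' y + \<alpha>\<^sup>2 * P y) * P y) (at y)"
      using y by (intro DERIV_mult has_deriv_P dP') auto
    have d1: "(N1 has_real_derivative - a / y * y powr (- a) * ((P' y)\<^sup>2 - \<alpha>\<^sup>2 * (P y)\<^sup>2) +
        (2 * P' y * (a / y * P' y + \<alpha>\<^sup>2 * P y) - \<alpha>\<^sup>2 * (2 * P y * P' y)) * y powr (- a)) (at y)"
      unfolding N1_def by (intro DERIV_mult DERIV_powr_const y DERIV_diff DERIV_cmult dP2 dP'2)
    have d2: "(N2 has_real_derivative (- a - 1) / y * y powr (- a - 1) * (P y * P' y) +
        (P' y * P' y + (a / y * P' y + \<alpha>\<^sup>2 * P y) * P y) * y powr (- a - 1)) (at y)"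
      unfolding N2_def by (intro DERIV_mult DERIV_powr_const y dPP')
    have e: "y powr (- a - 1) = y powr (- a) / y" using y by (simp add: powr_diff)
    have "(- a / y * y powr (- a) * ((P' y)\<^sup>2 - \<alpha>\<^sup>2 * (P y)\<^sup>2) +
        (2 * P' y * (a / y * P' y + \<alpha>\<^sup>2 * P y) - \<alpha>\<^sup>2 * (2 * P y * P' y)) * y powr (- a)) -
        a * ((- a - 1) / y * y powr (- a - 1) * (P y * P' y) +
        (P' y * P' y + (a / y * P' y + \<alpha>\<^sup>2 * P y) * P y) * y powr (- a - 1)) = a / y\<^sup>2 * y powr (- a) * P y * P' y"
      unfolding e using y by (simp add: field_simps power2_eq_square)
    then show "(N has_real_derivative a / y\<^sup>2 * y powr (- a) * P y * P' y) (at y)"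
      using DERIV_diff[OF d1 DERIV_cmult[OF d2, of a]] by (simp add: N_def[abs_def] N1_def N2_def)
    show "a / y\<^sup>2 * y powr (- a) * P y * P' y \<le> 0"
      using y a P_pos[of y] P'_neg[of y] by (intro mult_nonneg_nonpos) (auto intro!: mult_nonneg_nonneg)
  next
    have pP: "((\<lambda>x. x powr c * P x) \<longlongrightarrow> 0) at_top" for c
    proof -
      have "((\<lambda>x. \<alpha> powr \<nu> * (x powr (c + \<nu>) * exp (0 * x) * bessel_K \<nu> (\<alpha> * x))) \<longlongrightarrow> \<alpha> powr \<nu> * 0) at_top"
        by (intro tendsto_mult tendsto_const exp_decay) (use \<alpha>_pos in auto)
      moreover have "\<forall>\<^sub>F x in at_top. \<alpha> powr \<nu> * (x powr (c + \<nu>) * exp (0 * x) * bessel_K \<nu> (\<alpha> * x)) = x powr c * P x"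
        using eventually_gt_at_top[of 0]
        by eventually_elim (use \<alpha>_pos in \<open>simp add: P_def powr_mult powr_add\<close>)
      ultimately show ?thesis by (auto intro: Lim_transform_eventually)
    qed
    have pP': "((\<lambda>x. x powr c * P' x) \<longlongrightarrow> 0) at_top" for c
    proof -
      have "((\<lambda>x. (- \<alpha> * \<alpha> powr \<nu>) * (x powr (c + \<nu>) * exp (0 * x) * bessel_K (\<nu> - 1) (\<alpha> * x))) \<longlongrightarrow> (- \<alpha> * \<alpha> powr \<nu>) * 0) at_top"
        by (intro tendsto_mult tendsto_const exp_decay) (use \<alpha>_pos in auto)
      moreover have "\<forall>\<^sub>F x in at_top. (- \<alpha> * \<alpha> powr \<nu>) * (x powr (c + \<nu>) * exp (0 * x) * bessel_K (\<nu> - 1) (\<alpha> * x)) = x powr c * P' x"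
        using eventually_gt_at_top[of 0]
        by eventually_elim (use \<alpha>_pos in \<open>simp add: P'_def powr_mult powr_add\<close>)
      ultimately show ?thesis by (auto intro: Lim_transform_eventually)
    qed
    have "((\<lambda>x. (x powr (- a) * P' x) * (x powr 0 * P' x) - \<alpha>\<^sup>2 * ((x powr (- a) * P x) * (x powr 0 * P x)) - a * ((x powr (- a - 1) * P x) * (x powr 0 * P' x))) \<longlongrightarrow>
       0 * 0 - \<alpha>\<^sup>2 * (0 * 0) - a * (0 * 0)) at_top"
      by (intro tendsto_intros pP pP')
    moreover have "\<forall>\<^sub>F x in at_top. (x powr (- a) * P' x) * (x powr 0 * P' x) - \<alpha>\<^sup>2 * ((x powr (- a) * P x) * (x powr 0 * P x)) - a * ((x powr (- a - 1) * P x) * (x powr 0 * P' x)) = N x"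
      using eventually_gt_at_top[of 0]
      by eventually_elim (simp add: N_def power2_eq_square algebra_simps)
    ultimately show "(N \<longlongrightarrow> 0) at_top" by (auto intro: Lim_transform_eventually)
  qed (use x in auto)
  then show ?thesis using x by (simp add: Nx zero_le_mult_iff a_def)
qed

text \<open>A comparison of logarithmic derivatives, I'/I at x against -P'/P at y. For r \<le> 2 the
  constant \<alpha> separates them. For r > 2 the Turan type bounds put their values at x on either
  side of the positive root of z^2 + (r - 2) z / x = \<alpha>^2, and -P'/P increases by its Riccati
  equation.\<close>

lemma I'_P_le:
  assumes x: "x > 0" and xy: "x \<le> y"
  shows "I' x * P y \<le> - (I x * P' y)"
proof (cases "r \<le> 2")
  case True
  have y: "y > 0" using assms by simp
  have "I' x * P y \<le> \<alpha> * I x * P y" using I'_le[OF x] P_pos[OF y] by (intro mult_right_mono) auto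
  also have "\<dots> = I x * (\<alpha> * P y)" by simp
  also have "\<dots> \<le> I x * - P' y" using P'_le_of_r_le_2[OF y True] I_pos[of x] by (intro mult_left_mono) auto
  finally show ?thesis by simp
next
  case False
  define a where "a = r - 2"
  have a: "a > 0" using False by (simp add: a_def)
  define q where "q = I' x / I x"
  define \<rho> where "\<rho> y = - P' y / P y" for y
  have \<rho>_pos: "\<rho> y > 0" if "y > 0" for y using P_pos[OF that] P'_neg[OF that] by (simp add: \<rho>_def divide_neg_pos)
  have \<rho>2: "(\<rho> y)\<^sup>2 + a / y * \<rho> y \<ge> \<alpha>\<^sup>2" if "y > 0" for y
  proof -
    have "\<alpha>\<^sup>2 * P y ^ 2 \<le> P' y ^ 2 - a / y * P y * P' y"
      using P'_sqrt_bound[OF that] False by (simp add: a_def)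
    then have "\<alpha>\<^sup>2 \<le> (P' y ^ 2 - a / y * P y * P' y) / P y ^ 2"
      using P_pos[OF that] by (simp add: pos_le_divide_eq)
    also have "\<dots> = (\<rho> y)\<^sup>2 + a / y * \<rho> y"
      using P_pos[OF that] that by (simp add: \<rho>_def power2_eq_square field_simps)
    finally show ?thesis .
  qed
  have q0: "q \<ge> 0" using I_pos[of x] I'_nonneg[of x] x by (simp add: q_def)
  have "q\<^sup>2 + r / x * q \<le> \<alpha>\<^sup>2"
  proof -
    have "q\<^sup>2 + r / x * q = (I' x ^ 2 + r / x * I x * I' x) / I x ^ 2"
      using I_pos[of x] x by (simp add: q_def power2_eq_square field_simps)
    also have "\<dots> \<le> \<alpha>\<^sup>2" using I'_sqrt_bound[OF x] I_pos[of x] by (simp add: pos_divide_le_eq)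
    finally show ?thesis .
  qed
  \<comment> \<open>The bound for \<open>I\<close> carries r, the one for \<open>P\<close> only r -
    2; lowering r to \<open>a\<close> makes both refer to the same quadratic.\<close>
  moreover have "a / x * q \<le> r / x * q" using q0 x by (intro mult_right_mono divide_right_mono) (auto simp: a_def)
  ultimately have q2: "q\<^sup>2 + a / x * q \<le> \<alpha>\<^sup>2" by linarith
  have "q \<le> \<rho> x"
  proof (rule ccontr)
    assume "\<not> q \<le> \<rho> x"
    then have lt: "\<rho> x < q" by simp
    then have "(\<rho> x)\<^sup>2 < q\<^sup>2" using \<rho>_pos[OF x] by (intro power_strict_mono) auto
    moreover have "a / x * \<rho> x \<le> a / x * q" using lt a x by (intro mult_left_mono) auto
    ultimately show False using q2 \<rho>2[OF x] by linarith
  qed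
  also have "\<rho> x \<le> \<rho> y"
  proof (rule DERIV_nonneg_imp_nondecreasing[OF xy])
    fix z assume "x \<le> z" "z \<le> y"
    then have z: "z > 0" using x by simp
    have "(\<rho> has_real_derivative (- (a / z * P' z + \<alpha>\<^sup>2 * P z) * P z - - P' z * P' z) / (P z * P z)) (at z)"
      unfolding \<rho>_def using P_pos[OF z] has_deriv_P'[OF z] z
      by (intro DERIV_divide DERIV_minus has_deriv_P) (auto simp: a_def)
    moreover have "(- (a / z * P' z + \<alpha>\<^sup>2 * P z) * P z - - P' z * P' z) / (P z * P z) = (\<rho> z)\<^sup>2 + a / z * \<rho> z - \<alpha>\<^sup>2"
      using P_pos[OF z] z by (simp add: \<rho>_def power2_eq_square field_simps)
    ultimately show "\<exists>d. (\<rho> has_real_derivative d) (at z) \<and> 0 \<le> d"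
      using \<rho>2[OF z] by (intro exI[of _ "(\<rho> z)\<^sup>2 + a / z * \<rho> z - \<alpha>\<^sup>2"]) simp
  qed
  finally have "I' x / I x \<le> - P' y / P y" by (simp add: q_def \<rho>_def)
  then show ?thesis using I_pos[of x] P_pos[of y] assms by (simp add: field_simps)
qed

text \<open>In z, the derivative of I(z) P(z + v) is nonpositive by the comparison of logarithmic
  derivatives at z and z + v. The shift v is kept fixed so that the inequality can be integrated
  over it.\<close>

lemma I_P_decreasing:
  assumes x: "x > 0" and v: "v > 0"
  shows "I x * P (x + v) \<le> I 0 * P v"
proof -
  have "I x * P (x + v) \<le> I 0 * P (0 + v)"
  proof (rule DERIV_nonpos_imp_nonincreasing[of 0 x "\<lambda>z. I z * P (z + v)"])
    fix z assume z: "0 \<le> z" "z \<le> x"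
    have "((\<lambda>z. P (z + v)) has_real_derivative P' (z + v)) (at z)"
      using z v has_deriv_P[of "z + v"] by (simp add: DERIV_shift)
    then have d: "((\<lambda>z. I z * P (z + v)) has_real_derivative I' z * P (z + v) + P' (z + v) * I z) (at z)"
      by (intro DERIV_mult has_deriv_I)
    have "I' z * P (z + v) + P' (z + v) * I z \<le> 0"
    proof (cases "z = 0")
      case True
      then show ?thesis using I'_0 P'_neg[of v] I_pos[of 0] v by (simp add: mult_nonpos_nonneg less_imp_le)
    next
      case False
      then show ?thesis using I'_P_le[of z "z + v"] z v by (simp add: mult.commute)
    qed
    then show "\<exists>y. ((\<lambda>z. I z * P (z + v)) has_real_derivative y) (at z) \<and> y \<le> 0" using d by blast
  qed (use x in simp)
  then show ?thesis by simp
qed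

text \<open>Both sides are integrals over \<open>v = t - x\<close>, compared pointwise.\<close>

lemma I_J_le:
  assumes b: "\<bar>b\<bar> < \<alpha>" and x: "x > 0"
  shows "exp (- b * x) * (I x * J b x) \<le> I 0 * J b 0"
proof -
  have "J b x = (LINT t|lborel. indicator {x<..} (x + 1 * t) *\<^sub>R (exp (b * (x + 1 * t)) * P (x + 1 * t)))"
    unfolding J_def interval_integral_to_infinity_eq set_lebesgue_integral_def
    by (subst lborel_integral_real_affine[where c = 1 and t = x]) auto
  also have "\<dots> = (LINT t|lborel. exp (b * x) * (indicator {0<..} t *\<^sub>R (exp (b * t) * P (x + t))))"
    by (intro Bochner_Integration.integral_cong) (auto simp: indicator_def algebra_simps exp_add)
  also have "\<dots> = exp (b * x) * (LINT t:{0<..}|lborel. exp (b * t) * P (x + t))"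
    by (simp add: set_lebesgue_integral_def)
  finally have "exp (- b * x) * (I x * J b x) = I x * (LINT t:{0<..}|lborel. exp (b * t) * P (x + t))"
    by (simp add: exp_minus field_simps)
  also have "\<dots> = (LINT t:{0<..}|lborel. I x * (exp (b * t) * P (x + t)))" by simp
  also have "\<dots> \<le> (LINT t:{0<..}|lborel. I 0 * (exp (b * t) * P t))"
  \<comment> \<open>A non-integrable function has integral 0 by convention and the right-hand side
    is nonnegative, so the inequality holds in that case too and integrability of the shifted kernel
    need not be shown.\<close>
  proof (cases "set_integrable lborel {0<..} (\<lambda>t. I x * (exp (b * t) * P (x + t)))")
    case True
    show ?thesis
    proof (rule set_integral_mono[OF True])
      show "set_integrable lborel {0<..} (\<lambda>t. I 0 * (exp (b * t) * P t))"
        by (intro set_integrable_mult_right set_integrable_P b)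
      fix t :: real assume "t \<in> {0<..}"
      then have "exp (b * t) * (I x * P (x + t)) \<le> exp (b * t) * (I 0 * P t)"
        using I_P_decreasing[OF x] by (intro mult_left_mono) auto
      then show "I x * (exp (b * t) * P (x + t)) \<le> I 0 * (exp (b * t) * P t)" by (simp add: mult_ac)
    qed
  next
    case False
    then have "(LINT t:{0<..}|lborel. I x * (exp (b * t) * P (x + t))) = 0"
      unfolding set_integrable_def set_lebesgue_integral_def by (rule not_integrable_integral_eq)
    moreover have "0 \<le> I 0 * J b 0" using I_pos[of 0] J_nonneg[of 0 b] by simp
    moreover have "(LINT t:{0<..}|lborel. I 0 * (exp (b * t) * P t)) = I 0 * J b 0" by (simp add: J_0)
    ultimately show ?thesis by linarith
  qed
  also have "\<dots> = I 0 * J b 0" by (simp add: J_0)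
  finally show ?thesis .
qed

definition C1 where "C1 b = vg_C1 r (1 - b\<^sup>2 / \<alpha>\<^sup>2)"

text \<open>The total mass splits into \<open>J b 0\<close> and \<open>J (- b) 0\<close>. For b
  \<ge> 0 both I' and b I lie between 0 and \<alpha> I, so their difference costs one factor
  \<alpha>. For b < 0 it costs 2 \<alpha>, but then \<open>J b 0\<close> is the smaller of the two
  parts, hence at most half of the total.\<close>

lemma I_J_bounds:
  assumes b: "\<bar>b\<bar> < \<alpha>" and x: "x > 0"
  shows "exp (- b * x) * (I x * J b x) \<le> C1 b / \<alpha>"
    and "exp (- b * x) * (\<bar>I' x - b * I x\<bar> * J b x) \<le> C1 b"
proof -
  have tot: "I 0 * J b 0 + I 0 * J (- b) 0 = C1 b / \<alpha>"
    using J_total[OF b] by (simp add: C1_def distrib_left)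
  have nn: "I 0 * J b 0 \<ge> 0" "I 0 * J (- b) 0 \<ge> 0"
    using I_pos[of 0] J_nonneg[of 0] by (auto intro!: mult_nonneg_nonneg)
  show 1: "exp (- b * x) * (I x * J b x) \<le> C1 b / \<alpha>"
    using I_J_le[OF b x] tot nn by linarith
  have I'0: "0 \<le> I' x" "I' x \<le> \<alpha> * I x" using I'_nonneg[of x] I'_le[OF x] x by auto
  have J0: "J b x \<ge> 0" using x by (intro J_nonneg) auto
  show "exp (- b * x) * (\<bar>I' x - b * I x\<bar> * J b x) \<le> C1 b"
  proof (cases "b \<ge> 0")
    case True
    have "b * I x \<le> \<alpha> * I x" using b I_pos[of x] by (intro mult_right_mono) auto
    moreover have "0 \<le> b * I x" using True I_pos[of x] by simp
    ultimately have "\<bar>I' x - b * I x\<bar> \<le> \<alpha> * I x" using I'0 by linarith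
    then have "exp (- b * x) * (\<bar>I' x - b * I x\<bar> * J b x) \<le> exp (- b * x) * (\<alpha> * I x * J b x)"
      using J0 by (intro mult_left_mono mult_right_mono) auto
    also have "\<dots> = \<alpha> * (exp (- b * x) * (I x * J b x))" by simp
    also have "\<dots> \<le> \<alpha> * (C1 b / \<alpha>)" using \<alpha>_pos by (intro mult_left_mono 1) auto
    finally show ?thesis using \<alpha>_pos by simp
  next
    case False
    have "J b 0 \<le> J (- b) 0"
      unfolding J_0
    proof (intro set_integral_mono set_integrable_P)
      fix t :: real assume "t \<in> {0<..}"
      then have "exp (b * t) \<le> exp (- b * t)" using False by (simp add: mult_nonpos_nonneg)
      then show "exp (b * t) * P t \<le> exp (- b * t) * P t"
        using \<open>t \<in> _\<close> P_pos[of t] by (intro mult_right_mono) auto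
    qed (use b in auto)
    then have "I 0 * J b 0 \<le> I 0 * J (- b) 0" using I_pos[of 0] by (intro mult_left_mono) auto
    then have half: "2 * (I 0 * J b 0) \<le> C1 b / \<alpha>" using tot by linarith
    have "- b * I x \<le> \<alpha> * I x" using b I_pos[of x] by (intro mult_right_mono) auto
    moreover have "b * I x \<le> 0" using False I_pos[of x] by (simp add: mult_nonpos_nonneg)
    ultimately have "\<bar>I' x - b * I x\<bar> \<le> 2 * \<alpha> * I x" using I'0 by simp
    then have "exp (- b * x) * (\<bar>I' x - b * I x\<bar> * J b x) \<le> exp (- b * x) * (2 * \<alpha> * I x * J b x)"
      using J0 by (intro mult_left_mono mult_right_mono) auto
    also have "\<dots> = \<alpha> * (2 * (exp (- b * x) * (I x * J b x)))" by simp
    also have "\<dots> \<le> \<alpha> * (2 * (I 0 * J b 0))"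
      using \<alpha>_pos I_J_le[OF b x] by (intro mult_left_mono) auto
    also have "\<dots> \<le> \<alpha> * (C1 b / \<alpha>)" using \<alpha>_pos half by (intro mult_left_mono) auto
    finally show ?thesis using \<alpha>_pos by simp
  qed
qed

text \<open>\<open>U b\<close> dominates the integral of \<open>exp (b t) t\<^sup>r\<^sup>-\<^sup>1 I(t)\<close> over \<open>{0<..<x}\<close>, with equality for
  \<open>b = - \<alpha>\<close>.\<close>

definition U where "U b x = exp (b * x) * (x powr r * (I x + I' x / \<alpha>)) / r"

lemma has_deriv_U:
  assumes "x > 0"
  shows "(U b has_real_derivative (b + \<alpha>) * U b x + exp (b * x) * (x powr (r - 1) * I x)) (at x)"
proof -
  have e: "((\<lambda>x. exp (b * x)) has_real_derivative exp (b * x) * b) (at x)"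
    by (auto intro!: derivative_eq_intros)
  have i: "((\<lambda>x. I x + I' x / \<alpha>) has_real_derivative I' x + (\<alpha>\<^sup>2 * I x - r / x * I' x) / \<alpha>) (at x)"
    using assms by (intro DERIV_add DERIV_cdivide has_deriv_I has_deriv_I') auto
  have p: "x powr (r - 1) = x powr r / x" using assms by (simp add: powr_diff)
  show ?thesis
    unfolding U_def[abs_def] p
    by (rule DERIV_cong[OF DERIV_cdivide[OF DERIV_mult[OF e DERIV_mult[OF DERIV_powr_const i]]]])
       (use assms \<alpha>_pos r_pos in \<open>auto simp: field_simps power2_eq_square\<close>)
qed

lemma U_nonneg: "x > 0 \<Longrightarrow> U b x \<ge> 0"
  unfolding U_def using r_pos \<alpha>_pos I_pos[of x] I'_nonneg[of x]
  by (intro divide_nonneg_nonneg mult_nonneg_nonneg add_nonneg_nonneg) auto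

lemma tendsto_U: "(U b \<longlongrightarrow> 0) (at_right 0)"
proof -
  have "(U b \<longlongrightarrow> exp (b * 0) * (0 * (I 0 + 0 / \<alpha>)) / r) (at_right 0)"
    unfolding U_def[abs_def] using r_pos \<alpha>_pos
    by (intro tendsto_intros tendsto_powr_0 tendsto_I tendsto_I') auto
  then show ?thesis by simp
qed

text \<open>Up to the exponential, \<open>U b\<close> is x^r (\<alpha> I + I') / (\<alpha> r). The
  inequality \<alpha> K \<le> -K' turns its product with K into the Wronskian, which is 1; the
  product with K' - b K is bounded by twice \<alpha> times the Wronskian. This is the origin of
  2/r.\<close>

lemma K_U_bounds:
  assumes b: "\<bar>b\<bar> < \<alpha>" and x: "x > 0"
  shows "exp (- b * x) * (K x * U b x) \<le> 1 / (\<alpha> * r)"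
    and "exp (- b * x) * (\<bar>K' x - b * K x\<bar> * U b x) \<le> 2 / r"
proof -
  define p where "p = x powr r"
  have p: "p > 0" using x by (simp add: p_def)
  have K0: "K x > 0" "\<alpha> * K x \<le> - K' x" using K_pos[OF x] K'_le[OF x] by auto
  have I0: "I x > 0" "0 \<le> I' x" "I' x \<le> \<alpha> * I x" using I_pos[of x] I'_nonneg[of x] I'_le[OF x] x by auto
  have W: "p * (I' x * K x) + p * (I x * - K' x) = 1" using wronskian[OF x] by (simp add: p_def algebra_simps)
  have eU: "exp (- b * x) * (c * U b x) = c * (p * (\<alpha> * I x + I' x)) / (\<alpha> * r)" for c
  proof -
    have "exp (- b * x) * exp (b * x) = 1" by (simp flip: exp_add)
    moreover have "exp (- b * x) * (c * U b x) = (exp (- b * x) * exp (b * x)) * (c * (p * (I x + I' x / \<alpha>)) / r)"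
      unfolding U_def p_def[symmetric] by simp
    ultimately have "exp (- b * x) * (c * U b x) = c * (p * (I x + I' x / \<alpha>)) / r" by simp
    then show ?thesis using \<alpha>_pos by (simp add: field_simps)
  qed
  have "K x * (p * (\<alpha> * I x + I' x)) = p * (I x * (\<alpha> * K x)) + p * (I' x * K x)" by (simp add: algebra_simps)
  also have "\<dots> \<le> p * (I x * - K' x) + p * (I' x * K x)"
    using p I0 K0 by (intro add_right_mono mult_left_mono) auto
  also have "\<dots> = 1" using W by simp
  finally show "exp (- b * x) * (K x * U b x) \<le> 1 / (\<alpha> * r)"
    unfolding eU using \<alpha>_pos r_pos by (intro divide_right_mono) auto
  have "- b * K x \<le> \<alpha> * K x" "b * K x \<le> \<alpha> * K x" using b K0(1) mult_right_mono[of "- b" \<alpha> "K x"] mult_right_mono[of b \<alpha> "K x"] by auto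
  then have "\<bar>K' x - b * K x\<bar> \<le> - K' x + \<alpha> * K x" using K0 by simp
  then have "\<bar>K' x - b * K x\<bar> * (p * (\<alpha> * I x + I' x)) \<le> (- K' x + \<alpha> * K x) * (p * (\<alpha> * I x + I' x))"
    using p I0 \<alpha>_pos by (intro mult_right_mono) auto
  also have "\<dots> = \<alpha> * (p * (I' x * K x) + p * (I x * - K' x)) + p * (I' x * - K' x + \<alpha> * (I x * (\<alpha> * K x)))"
    by (simp add: algebra_simps)
  also have "\<dots> \<le> \<alpha> * (p * (I' x * K x) + p * (I x * - K' x)) + p * (\<alpha> * (I x * - K' x) + I' x * (\<alpha> * K x))"
  proof -
    \<comment> \<open>Both factors are nonnegative by the logarithmic bounds for K and I. Expanding
      trades the products I' K' and I K for the two products that occur in the Wronskian.\<close>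
    have "0 \<le> (- K' x - \<alpha> * K x) * (\<alpha> * I x - I' x)" using K0 I0 by (intro mult_nonneg_nonneg) auto
    then have "I' x * - K' x + \<alpha> * (I x * (\<alpha> * K x)) \<le> \<alpha> * (I x * - K' x) + I' x * (\<alpha> * K x)"
      by (simp add: algebra_simps)
    then show ?thesis using p by (intro add_left_mono mult_left_mono) auto
  qed
  also have "\<dots> = \<alpha> * 2 * (p * (I' x * K x) + p * (I x * - K' x))" by (simp add: algebra_simps)
  finally have "\<bar>K' x - b * K x\<bar> * (p * (\<alpha> * I x + I' x)) \<le> 2 * \<alpha>" using W by simp
  then have "\<bar>K' x - b * K x\<bar> * (p * (\<alpha> * I x + I' x)) / (\<alpha> * r) \<le> 2 * \<alpha> / (\<alpha> * r)"
    using \<alpha>_pos r_pos by (intro divide_right_mono) auto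
  then show "exp (- b * x) * (\<bar>K' x - b * K x\<bar> * U b x) \<le> 2 / r"
    unfolding eU using \<alpha>_pos by simp
qed

text \<open>\<open>L\<close> and \<open>M\<close> are arbitrary values obeying the bounds of the
  head and tail integrals, because they will also come from a solution that is not given by an
  integral. In the first bound 1/r is enlarged to 2/r so that one constant serves the solution and
  its derivative.\<close>

lemma representation_bounds:
  assumes b: "\<bar>b\<bar> < \<alpha>" and x: "x > 0" and L: "\<bar>L\<bar> \<le> G * U b x" and M: "\<bar>M\<bar> \<le> G * J b x" and "G \<ge> 0"
  shows "\<bar>exp (- b * x) * (K x * L + I x * M)\<bar> \<le> G * (2 / r + C1 b) / \<alpha>"
    and "\<bar>exp (- b * x) * ((K' x - b * K x) * L + (I' x - b * I x) * M)\<bar> \<le> G * (2 / r + C1 b)"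
proof -
  have *: "\<bar>exp (- b * x) * (k * L + i * M)\<bar> \<le> G * (exp (- b * x) * (\<bar>k\<bar> * U b x) + exp (- b * x) * (\<bar>i\<bar> * J b x))" for k i
  proof -
    have "\<bar>exp (- b * x) * (k * L + i * M)\<bar> = exp (- b * x) * \<bar>k * L + i * M\<bar>" by (simp add: abs_mult)
    also have "\<dots> \<le> exp (- b * x) * (\<bar>k\<bar> * \<bar>L\<bar> + \<bar>i\<bar> * \<bar>M\<bar>)"
      by (intro mult_left_mono) (auto simp flip: abs_mult)
    also have "\<dots> \<le> exp (- b * x) * (\<bar>k\<bar> * (G * U b x) + \<bar>i\<bar> * (G * J b x))"
      using L M by (intro mult_left_mono add_mono) auto
    finally show ?thesis by (simp add: algebra_simps)
  qed
  have "exp (- b * x) * (K x * U b x) + exp (- b * x) * (I x * J b x) \<le> 1 / (\<alpha> * r) + C1 b / \<alpha>"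
    by (intro add_mono K_U_bounds I_J_bounds b x)
  also have "\<dots> \<le> (2 / r + C1 b) / \<alpha>" using r_pos \<alpha>_pos by (simp add: field_simps)
  finally have "G * (exp (- b * x) * (\<bar>K x\<bar> * U b x) + exp (- b * x) * (\<bar>I x\<bar> * J b x)) \<le> G * ((2 / r + C1 b) / \<alpha>)"
    using \<open>G \<ge> 0\<close> K_pos[OF x] I_pos[of x] by (intro mult_left_mono) auto
  then show "\<bar>exp (- b * x) * (K x * L + I x * M)\<bar> \<le> G * (2 / r + C1 b) / \<alpha>"
    using *[of "K x" "I x"] by simp
  have "exp (- b * x) * (\<bar>K' x - b * K x\<bar> * U b x) + exp (- b * x) * (\<bar>I' x - b * I x\<bar> * J b x) \<le> 2 / r + C1 b"
    by (intro add_mono K_U_bounds I_J_bounds b x)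
  then have "G * (exp (- b * x) * (\<bar>K' x - b * K x\<bar> * U b x) + exp (- b * x) * (\<bar>I' x - b * I x\<bar> * J b x)) \<le> G * (2 / r + C1 b)"
    using \<open>G \<ge> 0\<close> by (intro mult_left_mono)
  then show "\<bar>exp (- b * x) * ((K' x - b * K x) * L + (I' x - b * I x) * M)\<bar> \<le> G * (2 / r + C1 b)"
    using *[of "K' x - b * K x" "I' x - b * I x"] by simp
qed

end

section \<open>Comparison of the sharp constant with \<open>vg_C\<close>\<close>

lemma Gamma_ge_third:
  assumes "(z::real) > 1 / 2" "z < 2"
  shows "Gamma z \<ge> 1 / 3"
proof -
  \<comment> \<open>With this \<open>l\<close>, the point 2 is the convex combination of 3 and z.
    Log-convexity and Gamma 2 = 1, Gamma 3 = 2 give Gamma z \<ge> 2^(z - 2), which exceeds 2^(-3/2),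
    and 2^3 \<le> 3^2 finishes.\<close>
  define l where "l = 1 / (3 - z)"
  have l: "0 < l" "l < 1" "l * (3 - z) = 1" using assms by (auto simp: l_def)
  have "(ln \<circ> Gamma) ((1 - l) *\<^sub>R 3 + l *\<^sub>R z) \<le> (1 - l) * (ln \<circ> Gamma) 3 + l * (ln \<circ> Gamma) z"
    using l assms by (intro convex_onD[OF log_convex_Gamma_real]) auto
  moreover have "(1 - l) *\<^sub>R 3 + l *\<^sub>R z = 2" using l(3) by (simp add: algebra_simps)
  moreover have "Gamma (2::real) = 1" "Gamma (3::real) = 2"
    using Gamma_fact[of 1, where 'a = real] Gamma_fact[of 2, where 'a = real] by (auto simp: numeral_2_eq_2)
  ultimately have "0 \<le> (1 - l) * ln 2 + l * ln (Gamma z)" by (simp only: o_def) simp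
  then have "0 \<le> ((1 - l) * ln 2 + l * ln (Gamma z)) * (3 - z)" using assms by (intro mult_nonneg_nonneg) auto
  also have "\<dots> = ((3 - z) - l * (3 - z)) * ln 2 + l * (3 - z) * ln (Gamma z)" by (simp add: algebra_simps)
  also have "\<dots> = (2 - z) * ln 2 + ln (Gamma z)" unfolding l(3) by simp
  finally have "ln (Gamma z) \<ge> - ((2 - z) * ln 2)" by simp
  moreover have "(2 - z) * ln 2 \<le> 3 / 2 * ln (2::real)" using assms by (intro mult_right_mono) auto
  moreover have "3 / 2 * ln (2::real) \<le> ln 3"
  proof -
    have "ln ((2::real) ^ 3) \<le> ln (3 ^ 2)" by (subst ln_le_cancel_iff) auto
    then show ?thesis by (subst (asm) (1 2) ln_realpow) auto
  qed
  ultimately have "- ln 3 \<le> ln (Gamma z)" by linarith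
  then have "ln (1 / 3) \<le> ln (Gamma z)" by (simp add: ln_div)
  then show ?thesis using assms by (simp add: Gamma_real_pos)
qed

text \<open>1 - b^2 / \<alpha>^2 is \<sigma>^2 / (\<theta>^2 + \<sigma>^2). For s \<ge> 2 this is an
  equality. For s < 2, put t = |\<theta>| / sqrt (\<theta>^2 + \<sigma>^2): the base 1 - t^2 is
  lowered to 1 - t, and sqrt pi \<le> 2 with Gamma \<ge> 1/3 gives the factor 6.\<close>

lemma vg_C1_le_vg_C:
  fixes s \<theta> \<sigma> :: real
  assumes "s > 0" "\<sigma> > 0"
  defines "b \<equiv> \<theta> / \<sigma>\<^sup>2" and "\<alpha> \<equiv> sqrt (\<theta>\<^sup>2 + \<sigma>\<^sup>2) / \<sigma>\<^sup>2"
  shows "vg_C1 s (1 - b\<^sup>2 / \<alpha>\<^sup>2) \<le> vg_C s \<theta> \<sigma>"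
proof -
  define q where "q = sqrt (\<theta>\<^sup>2 + \<sigma>\<^sup>2)"
  have q: "q > 0" "q\<^sup>2 = \<theta>\<^sup>2 + \<sigma>\<^sup>2" using assms(2) by (auto simp: q_def sum_power2_gt_zero_iff)
  have lt: "\<bar>\<theta>\<bar> < q" unfolding q_def using assms(2) by (intro real_less_rsqrt) auto
  have c: "1 - b\<^sup>2 / \<alpha>\<^sup>2 = \<sigma>\<^sup>2 / q\<^sup>2"
    using assms(2) q unfolding b_def \<alpha>_def q_def[symmetric] by (simp add: power_divide field_simps)
  show ?thesis
  proof (cases "s \<ge> 2")
    case True
    have "(\<sigma>\<^sup>2 / q\<^sup>2) powr (- s / 2) = (1 + \<theta>\<^sup>2 / \<sigma>\<^sup>2) powr (s / 2)"
    proof -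
      have "1 + \<theta>\<^sup>2 / \<sigma>\<^sup>2 = inverse (\<sigma>\<^sup>2 / q\<^sup>2)" unfolding q(2) using assms(2) by (simp add: field_simps)
      then show ?thesis using assms(2) q(1) by (simp add: powr_minus powr_divide field_simps)
    qed
    then show ?thesis using True by (simp add: vg_C_def vg_C1_def c)
  next
    case False
    have G: "Gamma (s / 2) > 0" "Gamma ((s + 1) / 2) \<ge> 1 / 3"
      by (rule Gamma_real_pos Gamma_ge_third; use assms(1) False in simp)+
    have \<beta>: "(if \<theta> = 0 then 0 else 1 / sqrt (1 + \<sigma>\<^sup>2 / \<theta>\<^sup>2)) = \<bar>\<theta>\<bar> / q"
    proof (cases "\<theta> = 0")
      case False
      have "sqrt (1 + \<sigma>\<^sup>2 / \<theta>\<^sup>2) = sqrt ((\<theta>\<^sup>2 + \<sigma>\<^sup>2) / \<theta>\<^sup>2)" using False by (simp add: field_simps)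
      also have "\<dots> = q / \<bar>\<theta>\<bar>" by (simp add: real_sqrt_divide q_def)
      finally show ?thesis using False by simp
    qed simp
    define t where "t = \<bar>\<theta>\<bar> / q"
    have t: "0 \<le> t" "t < 1" using lt q(1) by (auto simp: t_def)
    have "\<sigma>\<^sup>2 / q\<^sup>2 = (1 - t) * (1 + t)"
    proof -
      have "\<sigma>\<^sup>2 = q\<^sup>2 - \<bar>\<theta>\<bar>\<^sup>2" using q(2) by simp
      then have "\<sigma>\<^sup>2 / q\<^sup>2 = 1 - t\<^sup>2" using q(1) by (simp add: t_def power_divide diff_divide_distrib)
      then show ?thesis by (simp add: power2_eq_square algebra_simps)
    qed
    moreover have "(1 - t) * 1 \<le> (1 - t) * (1 + t)" using t by (intro mult_left_mono) auto
    ultimately have "1 - t \<le> \<sigma>\<^sup>2 / q\<^sup>2" by simp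
    then have pw: "(\<sigma>\<^sup>2 / q\<^sup>2) powr (- s / 2) \<le> (1 - t) powr (- s / 2)"
      using t assms(1) by (intro powr_mono2') auto
    have "sqrt pi \<le> 2" using pi_less_4 by (intro real_le_lsqrt) auto
    then have "sqrt pi / Gamma ((s + 1) / 2) \<le> 2 / (1 / 3)" using G(2) by (intro frac_le) auto
    then have "sqrt pi / Gamma ((s + 1) / 2) * (Gamma (s / 2) * (\<sigma>\<^sup>2 / q\<^sup>2) powr (- s / 2)) \<le> 6 * (Gamma (s / 2) * (1 - t) powr (- s / 2))"
      using G pw by (intro mult_mono) auto
    then show ?thesis using False unfolding vg_C_def vg_C1_def c \<beta> t_def[symmetric] by (simp add: mult_ac)
  qed
qed

section \<open>The inhomogeneous equation on the half-line\<close>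

lemma set_borel_measurable_continuous_mult:
  fixes f :: "real \<Rightarrow> real"
  assumes "continuous_on S f" "S \<in> sets borel"
  shows "set_borel_measurable lborel S f"
  using borel_measurable_continuous_on_indicator[OF assms(2,1)] by (simp add: set_borel_measurable_def)

lemma set_integrable_powr_0:
  assumes "r > 0" "y > 0"
  shows "set_integrable lborel {0<..<y} (\<lambda>t::real. t powr (r - 1))"
proof -
  have "((\<lambda>t. t powr r / r) \<longlongrightarrow> 0) (at_right 0)" using assms(1) by real_asymp
  moreover have "((\<lambda>t. t powr r / r) \<longlongrightarrow> y powr r / r) (at_left y)"
    using assms by (intro tendsto_intros) auto
  ultimately have "set_integrable lborel (einterval (ereal 0) (ereal y)) (\<lambda>t. t powr (r - 1))"
    using assms
    by (intro interval_integral_FTC_nonneg(1)[where F = "\<lambda>t. t powr r / r" and A = 0 and B = "y powr r / r"])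
       (auto simp: ereal_tendsto_simps1 intro!: derivative_eq_intros continuous_intros)
  then show ?thesis by simp
qed

context vg_kernel
begin

lemma continuous_head:
  assumes "continuous_on {0<..} g"
  shows "continuous_on {0<..} (\<lambda>t. exp (b * t) * (t powr (r - 1) * I t) * g t)"
  by (intro continuous_intros assms continuous_at_imp_continuous_on isCont_I) (auto intro: isCont_I)

lemma continuous_tail:
  assumes "continuous_on {0<..} g"
  shows "continuous_on {0<..} (\<lambda>t. exp (b * t) * P t * g t)"
  by (intro continuous_intros assms continuous_P)

lemma set_integrable_head:
  assumes cont: "continuous_on {0<..} g" and bd: "\<And>t. t > 0 \<Longrightarrow> \<bar>g t\<bar> \<le> G" and y: "y > 0"
  shows "set_integrable lborel {0<..<y} (\<lambda>t. exp (b * t) * (t powr (r - 1) * I t) * g t)"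
proof -
  have "continuous_on {0..y} (\<lambda>t. exp (b * t) * I t)"
    by (intro continuous_intros continuous_at_imp_continuous_on) (auto intro: isCont_I)
  then have "bounded ((\<lambda>t. exp (b * t) * I t) ` {0..y})" by (intro compact_imp_bounded compact_continuous_image) auto
  then obtain C where "\<forall>z\<in>(\<lambda>t. exp (b * t) * I t) ` {0..y}. norm z \<le> C" by (auto simp only: bounded_iff)
  then have C: "\<bar>exp (b * t) * I t\<bar> \<le> C" if "t \<in> {0..y}" for t using that by auto
  show ?thesis
  proof (rule set_integrable_bound)
    show "set_integrable lborel {0<..<y} (\<lambda>t. (C * G) * t powr (r - 1))"
      by (intro set_integrable_mult_right set_integrable_powr_0 r_pos y)
    show "set_borel_measurable lborel {0<..<y} (\<lambda>t. exp (b * t) * (t powr (r - 1) * I t) * g t)"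
      by (intro set_borel_measurable_continuous_mult continuous_on_subset[OF continuous_head[OF cont]]) auto
    show "AE t in lborel. t \<in> {0<..<y} \<longrightarrow> norm (exp (b * t) * (t powr (r - 1) * I t) * g t) \<le> norm (C * G * t powr (r - 1))"
    proof (intro AE_I2 impI)
      fix t assume t: "t \<in> {0<..<y}"
      have "norm (exp (b * t) * (t powr (r - 1) * I t) * g t) = \<bar>exp (b * t) * I t\<bar> * \<bar>g t\<bar> * t powr (r - 1)"
        by (simp add: abs_mult mult_ac)
      also have "\<dots> \<le> C * G * t powr (r - 1)"
        using t C[of t] bd[of t] by (intro mult_right_mono mult_mono) (auto intro: order_trans[OF abs_ge_zero])
      also have "\<dots> \<le> norm (C * G * t powr (r - 1))" by simp
      finally show "norm (exp (b * t) * (t powr (r - 1) * I t) * g t) \<le> norm (C * G * t powr (r - 1))" .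
    qed
  qed
qed

lemma set_integrable_tail:
  assumes cont: "continuous_on {0<..} g" and bd: "\<And>t. t > 0 \<Longrightarrow> \<bar>g t\<bar> \<le> G" and b: "\<bar>b\<bar> < \<alpha>"
  shows "set_integrable lborel {0<..} (\<lambda>t. exp (b * t) * P t * g t)"
proof (rule set_integrable_bound)
  show "set_integrable lborel {0<..} (\<lambda>t. G * (exp (b * t) * P t))"
    by (intro set_integrable_mult_right set_integrable_P b)
  show "set_borel_measurable lborel {0<..} (\<lambda>t. exp (b * t) * P t * g t)"
    by (intro set_borel_measurable_continuous_mult continuous_tail cont) auto
  show "AE t in lborel. t \<in> {0<..} \<longrightarrow> norm (exp (b * t) * P t * g t) \<le> norm (G * (exp (b * t) * P t))"
  proof (intro AE_I2 impI)
    fix t :: real assume t: "t \<in> {0<..}"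
    have "norm (exp (b * t) * P t * g t) = \<bar>g t\<bar> * (exp (b * t) * P t)"
      using t P_pos[of t] by (simp add: abs_mult)
    also have "\<dots> \<le> G * (exp (b * t) * P t)" using t P_pos[of t] bd[of t] by (intro mult_right_mono) auto
    also have "\<dots> \<le> norm (G * (exp (b * t) * P t))" by simp
    finally show "norm (exp (b * t) * P t * g t) \<le> norm (G * (exp (b * t) * P t))" .
  qed
qed

text \<open>G U - L and G U + L start from 0 and increase: the derivative of U is the integrand plus
  (b + \<alpha>) U, and this extra term is nonnegative. The number \<open>s\<close> is the sign of
  L.\<close>

lemma U_dominates:
  assumes b: "\<bar>b\<bar> < \<alpha>" and L: "\<And>x. x > 0 \<Longrightarrow> (L has_real_derivative exp (b * x) * (x powr (r - 1) * I x) * g x) (at x)"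
    and L0: "(L \<longlongrightarrow> 0) (at_right 0)" and bd: "\<And>t. t > 0 \<Longrightarrow> \<bar>g t\<bar> \<le> G" and x: "x > 0"
  shows "\<bar>L x\<bar> \<le> G * U b x"
proof -
  have G: "G \<ge> 0" using bd[OF x] by linarith
  have *: "0 \<le> G * U b x - s * L x" if s: "\<bar>s\<bar> = 1" for s
  proof (rule nonneg_of_deriv_nonneg[where F = "\<lambda>x. G * U b x - s * L x"])
    fix y :: real assume y: "y > 0"
    show "((\<lambda>x. G * U b x - s * L x) has_real_derivative G * ((b + \<alpha>) * U b y + exp (b * y) * (y powr (r - 1) * I y)) - s * (exp (b * y) * (y powr (r - 1) * I y) * g y)) (at y)"
      by (intro DERIV_diff DERIV_cmult has_deriv_U L y)
    have "s * g y \<le> G" using bd[OF y] s by (auto simp: abs_if split: if_splits)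
    then have "(exp (b * y) * (y powr (r - 1) * I y)) * (s * g y) \<le> (exp (b * y) * (y powr (r - 1) * I y)) * G"
      using I_pos[of y] by (intro mult_left_mono) auto
    moreover have "0 \<le> G * ((b + \<alpha>) * U b y)" using G b U_nonneg[OF y, of b] by (intro mult_nonneg_nonneg) auto
    moreover have "0 \<le> G * (A + c) - s * (c * d)" if "c * (s * d) \<le> c * G" "0 \<le> G * A" for A c d
      using that by (simp add: algebra_simps)
    ultimately show "0 \<le> G * ((b + \<alpha>) * U b y + exp (b * y) * (y powr (r - 1) * I y)) - s * (exp (b * y) * (y powr (r - 1) * I y) * g y)"
      by blast
  next
    have "((\<lambda>x. G * U b x - s * L x) \<longlongrightarrow> G * 0 - s * 0) (at_right 0)" by (intro tendsto_intros tendsto_U L0)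
    then show "((\<lambda>x. G * U b x - s * L x) \<longlongrightarrow> 0) (at_right 0)" by simp
  qed fact
  from *[of 1] *[of "-1"] show ?thesis by (simp add: abs_le_iff)
qed

lemma has_deriv_J:
  assumes "\<bar>b\<bar> < \<alpha>" "x > 0"
  shows "(J b has_real_derivative - (exp (b * x) * P x)) (at x)"
  unfolding J_def[abs_def]
  by (intro tail_integral_has_deriv set_integrable_P assms continuous_intros continuous_P)

lemma tendsto_J:
  assumes "\<bar>b\<bar> < \<alpha>"
  shows "(J b \<longlongrightarrow> 0) at_top"
  unfolding J_def[abs_def] by (intro tail_integral_tendsto_top set_integrable_P assms)

lemma J_dominates:
  assumes b: "\<bar>b\<bar> < \<alpha>" and M: "\<And>x. x > 0 \<Longrightarrow> (M has_real_derivative - (exp (b * x) * P x * g x)) (at x)"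
    and M0: "(M \<longlongrightarrow> 0) at_top" and bd: "\<And>t. t > 0 \<Longrightarrow> \<bar>g t\<bar> \<le> G" and x: "x > 0"
  shows "\<bar>M x\<bar> \<le> G * J b x"
proof -
  have *: "0 \<le> G * J b x - s * M x" if s: "\<bar>s\<bar> = 1" for s
  proof (rule nonneg_of_deriv_nonpos[where F = "\<lambda>x. G * J b x - s * M x"])
    fix y :: real assume y: "y > 0"
    show "((\<lambda>x. G * J b x - s * M x) has_real_derivative G * - (exp (b * y) * P y) - s * - (exp (b * y) * P y * g y)) (at y)"
      by (intro DERIV_diff DERIV_cmult has_deriv_J M y b)
    have "s * g y \<le> G" using bd[OF y] s by (auto simp: abs_if split: if_splits)
    then have "(exp (b * y) * P y) * (s * g y) \<le> (exp (b * y) * P y) * G"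
      using P_pos[OF y] by (intro mult_left_mono) auto
    then show "G * - (exp (b * y) * P y) - s * - (exp (b * y) * P y * g y) \<le> 0"
      by (simp add: algebra_simps)
  next
    have "((\<lambda>x. G * J b x - s * M x) \<longlongrightarrow> G * 0 - s * 0) at_top" by (intro tendsto_intros tendsto_J M0 b)
    then show "((\<lambda>x. G * J b x - s * M x) \<longlongrightarrow> 0) at_top" by simp
  qed fact
  from *[of 1] *[of "-1"] show ?thesis by (simp add: abs_le_iff)
qed

definition head where "head b g x = (LBINT t=0..ereal x. exp (b * t) * (t powr (r - 1) * I t) * g t)"
definition tail where "tail b g x = (LBINT t=ereal x..\<infinity>. exp (b * t) * P t * g t)"
text \<open>Variation of constants for x w'' + (r + 2 b x) w' + (r b - (\<alpha>^2 - b^2) x) w = g,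
  whose left side is that of the Stein equation divided by \<sigma>^2. The factor exp (- b x)
  removes the drift 2 b x. In the derivative \<open>sol'\<close>, the terms from differentiating the
  two integrals cancel.\<close>

definition sol where "sol b g x = - (exp (- b * x) * (K x * head b g x + I x * tail b g x))"
definition sol' where "sol' b g x = - (exp (- b * x) * ((K' x - b * K x) * head b g x + (I' x - b * I x) * tail b g x))"

context
  fixes b G :: real and g :: "real \<Rightarrow> real"
  assumes b: "\<bar>b\<bar> < \<alpha>" and cont: "continuous_on {0<..} g" and bd: "\<And>t. t > 0 \<Longrightarrow> \<bar>g t\<bar> \<le> G"
begin

lemma has_deriv_head:
  assumes "x > 0"
  shows "(head b g has_real_derivative exp (b * x) * (x powr (r - 1) * I x) * g x) (at x)"
  unfolding head_def[abs_def]
  by (intro head_integral_has_deriv continuous_head cont set_integrable_head[OF cont bd] assms)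

lemma tendsto_head: "(head b g \<longlongrightarrow> 0) (at_right 0)"
  unfolding head_def[abs_def] by (intro head_integral_tendsto_0 set_integrable_head[OF cont bd])

lemma has_deriv_tail:
  assumes "x > 0"
  shows "(tail b g has_real_derivative - (exp (b * x) * P x * g x)) (at x)"
  unfolding tail_def[abs_def]
  by (intro tail_integral_has_deriv continuous_tail cont set_integrable_tail[OF cont bd] assms b)

lemma tendsto_tail: "(tail b g \<longlongrightarrow> 0) at_top"
  unfolding tail_def[abs_def] by (intro tail_integral_tendsto_top set_integrable_tail[OF cont bd] b)

lemma G_nonneg: "G \<ge> 0"
  using bd[of 1] by simp

lemma sol_bounds:
  assumes "x > 0"
  shows "\<bar>sol b g x\<bar> \<le> G * (2 / r + C1 b) / \<alpha>" and "\<bar>sol' b g x\<bar> \<le> G * (2 / r + C1 b)"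
proof -
  have "\<bar>head b g x\<bar> \<le> G * U b x"
    by (rule U_dominates[OF b has_deriv_head tendsto_head bd assms])
  moreover have "\<bar>tail b g x\<bar> \<le> G * J b x"
    by (rule J_dominates[OF b has_deriv_tail tendsto_tail bd assms])
  ultimately show "\<bar>sol b g x\<bar> \<le> G * (2 / r + C1 b) / \<alpha>" "\<bar>sol' b g x\<bar> \<le> G * (2 / r + C1 b)"
    unfolding sol_def sol'_def abs_minus_cancel by (intro representation_bounds b assms G_nonneg; simp)+
qed

lemma has_deriv_sol:
  assumes x: "x > 0"
  shows "(sol b g has_real_derivative sol' b g x) (at x)"
proof -
  have e: "((\<lambda>x. exp (- b * x)) has_real_derivative exp (- b * x) * - b) (at x)"
    by (auto intro!: derivative_eq_intros)
  show ?thesis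
    unfolding sol_def[abs_def] sol'_def
    by (rule DERIV_cong[OF DERIV_minus[OF DERIV_mult[OF e DERIV_add[OF
          DERIV_mult[OF has_deriv_K[OF x] has_deriv_head[OF x]] DERIV_mult[OF has_deriv_I has_deriv_tail[OF x]]]]]])
       (simp add: P_eq_K[OF x] algebra_simps)
qed

text \<open>Differentiating the integrals inside \<open>sol'\<close> contributes g x^(r-1) (I' K - I
  K'), which the Wronskian identity turns into g/x; the remaining terms are the homogeneous
  equation.\<close>

lemma has_deriv_sol':
  assumes x: "x > 0"
  shows "(sol' b g has_real_derivative (g x - (r + 2 * b * x) * sol' b g x - (r * b - (\<alpha>\<^sup>2 - b\<^sup>2) * x) * sol b g x) / x) (at x)"
proof -
  have e: "((\<lambda>x. exp (- b * x)) has_real_derivative exp (- b * x) * - b) (at x)"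
    by (auto intro!: derivative_eq_intros)
  define k where "k = K x" define k' where "k' = K' x" define i where "i = I x" define i' where "i' = I' x"
  define L where "L = head b g x" define M where "M = tail b g x" define p where "p = x powr (r - 1)"
  define w where "w = exp (b * x)" define v where "v = exp (- b * x)"
  have vw: "v * w = 1" by (simp add: v_def w_def flip: exp_add)
  have W: "p * (i' * k - i * k') = 1 / x"
    using wronskian[OF x] x by (simp add: p_def k_def i_def k'_def i'_def powr_diff field_simps)
  have dK: "((\<lambda>x. K' x - b * K x) has_real_derivative \<alpha>\<^sup>2 * k - r / x * k' - b * k') (at x)"
    unfolding k_def k'_def by (intro DERIV_diff DERIV_cmult has_deriv_K has_deriv_K' x)
  have dI: "((\<lambda>x. I' x - b * I x) has_real_derivative \<alpha>\<^sup>2 * i - r / x * i' - b * i') (at x)"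
    unfolding i_def i'_def using x by (intro DERIV_diff DERIV_cmult has_deriv_I has_deriv_I') auto
  have "- (v * - b * ((k' - b * k) * L + (i' - b * i) * M) +
      ((\<alpha>\<^sup>2 * k - r / x * k' - b * k') * L + w * (p * i) * g x * (k' - b * k) +
       ((\<alpha>\<^sup>2 * i - r / x * i' - b * i') * M + - (w * (p * k) * g x) * (i' - b * i))) * v) =
     (g x - (r + 2 * b * x) * - (v * ((k' - b * k) * L + (i' - b * i) * M)) - (r * b - (\<alpha>\<^sup>2 - b\<^sup>2) * x) * - (v * (k * L + i * M))) / x"
    (is "?l = ?r")
  proof -
    have "?l = (v * w) * g x * (p * (i' * k - i * k')) + (v * (b * ((k' - b * k) * L + (i' - b * i) * M) -
         ((\<alpha>\<^sup>2 * k - r / x * k' - b * k') * L + (\<alpha>\<^sup>2 * i - r / x * i' - b * i') * M)))"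
      by (simp add: algebra_simps)
    also have "\<dots> = ?r" unfolding W vw using x by (simp add: field_simps power2_eq_square)
    finally show ?thesis .
  qed
  moreover have "P x = p * k" by (simp add: p_def k_def P_eq_K[OF x])
  ultimately show ?thesis
    using DERIV_minus[OF DERIV_mult[OF e DERIV_add[OF DERIV_mult[OF dK has_deriv_head[OF x]] DERIV_mult[OF dI has_deriv_tail[OF x]]]]]
    unfolding sol'_def[abs_def] sol_def L_def M_def p_def i_def i'_def k_def k'_def v_def w_def by simp
qed

text \<open>\<open>K\<close> may be unbounded at 0, but the head integral is dominated by a multiple
  of \<open>U\<close>, which carries x^r, and x^r K tends to 0. So only the term with
  \<open>I\<close> and the full tail integral survives; its value decides whether the two half-lines
  fit together.\<close>

lemma tendsto_sol: "(sol b g \<longlongrightarrow> - (I 0 * (LBINT t=0..\<infinity>. exp (b * t) * P t * g t))) (at_right 0)"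
proof -
  define A where "A x = G * (exp (b * x) * ((x powr r * K x) * (I x + I' x / \<alpha>)) / r)" for x
  have "((\<lambda>x. A x) \<longlongrightarrow> G * (exp (b * 0) * (0 * (I 0 + 0 / \<alpha>)) / r)) (at_right 0)"
    unfolding A_def using r_pos \<alpha>_pos by (intro tendsto_intros tendsto_K_0 tendsto_I tendsto_I') auto
  then have A0: "(A \<longlongrightarrow> 0) (at_right 0)" by simp
  have KL: "((\<lambda>x. K x * head b g x) \<longlongrightarrow> 0) (at_right 0)"
  proof (rule Lim_null_comparison[OF _ A0])
    show "\<forall>\<^sub>F x in at_right 0. norm (K x * head b g x) \<le> A x"
      using eventually_at_right_less[of 0]
    proof eventually_elim
      case (elim x)
      have "\<bar>head b g x\<bar> \<le> G * U b x" by (rule U_dominates[OF b has_deriv_head tendsto_head bd elim])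
      then have "\<bar>K x\<bar> * \<bar>head b g x\<bar> \<le> K x * (G * U b x)" using K_pos[OF elim] by (intro mult_mono) auto
      then show ?case by (simp add: A_def U_def abs_mult mult_ac)
    qed
  qed
  have T: "(tail b g \<longlongrightarrow> (LBINT t=0..\<infinity>. exp (b * t) * P t * g t)) (at_right 0)"
    unfolding tail_def[abs_def] by (intro tail_integral_tendsto_0 set_integrable_tail[OF cont bd] b)
  have "(sol b g \<longlongrightarrow> - (exp (- b * 0) * (0 + I 0 * (LBINT t=0..\<infinity>. exp (b * t) * P t * g t)))) (at_right 0)"
    unfolding sol_def[abs_def] by (intro tendsto_intros KL T tendsto_I)
  then show ?thesis by simp
qed

end

end

section \<open>Lipschitz functions whose derivative is known almost everywhere\<close>

definition lip_on :: "real set \<Rightarrow> (real \<Rightarrow> real) \<Rightarrow> bool" where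
  "lip_on S f \<longleftrightarrow> (\<exists>L. \<forall>x\<in>S. \<forall>y\<in>S. \<bar>f x - f y\<bar> \<le> L * \<bar>x - y\<bar>)"

lemma lip_onI_deriv:
  assumes "\<And>x. x \<in> {u..v} \<Longrightarrow> (f has_real_derivative f' x) (at x)" "continuous_on {u..v} f'"
  shows "lip_on {u..v} f"
proof -
  have "bounded (f' ` {u..v})" by (intro compact_imp_bounded compact_continuous_image assms) auto
  then obtain B where "\<forall>z\<in>f' ` {u..v}. norm z \<le> B" by (auto simp only: bounded_iff)
  then have B: "norm (f' x) \<le> B" if "x \<in> {u..v}" for x using that by auto
  have "norm (f x - f y) \<le> B * norm (x - y)" if "x \<in> {u..v}" "y \<in> {u..v}" for x y
    by (rule field_differentiable_bound[where f' = f' and S = "{u..v}"])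
       (use assms(1) B that in \<open>auto intro: has_field_derivative_at_within\<close>)
  then show ?thesis unfolding lip_on_def real_norm_def by blast
qed

lemma lip_on_add:
  assumes "lip_on S f" "lip_on S g"
  shows "lip_on S (\<lambda>x. f x + g x)"
proof -
  obtain L M where L: "\<forall>x\<in>S. \<forall>y\<in>S. \<bar>f x - f y\<bar> \<le> L * \<bar>x - y\<bar>" and M: "\<forall>x\<in>S. \<forall>y\<in>S. \<bar>g x - g y\<bar> \<le> M * \<bar>x - y\<bar>"
    using assms by (auto simp: lip_on_def)
  have "\<bar>f x + g x - (f y + g y)\<bar> \<le> (L + M) * \<bar>x - y\<bar>" if xy: "x \<in> S" "y \<in> S" for x y
  proof -
    have "\<bar>f x - f y\<bar> \<le> L * \<bar>x - y\<bar>" "\<bar>g x - g y\<bar> \<le> M * \<bar>x - y\<bar>" using L M xy by auto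
    then show ?thesis unfolding distrib_right by linarith
  qed
  then show ?thesis unfolding lip_on_def by blast
qed

lemma lip_on_mult:
  assumes "lip_on {u..v} f" "lip_on {u..v} g"
  shows "lip_on {u..v} (\<lambda>x. f x * g x)"
proof -
  have bd: "\<exists>B\<ge>0. \<forall>x\<in>{u..v}. \<bar>h x\<bar> \<le> B" if h: "lip_on {u..v} h" for h
  proof -
    obtain L where L: "\<forall>x\<in>{u..v}. \<forall>y\<in>{u..v}. \<bar>h x - h y\<bar> \<le> L * \<bar>x - y\<bar>" using h by (auto simp: lip_on_def)
    have "\<bar>h x\<bar> \<le> \<bar>h u\<bar> + \<bar>L\<bar> * (v - u)" if "x \<in> {u..v}" for x
    proof -
      have "\<bar>h x - h u\<bar> \<le> L * \<bar>x - u\<bar>" using L[rule_format, of x u] that by simp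
      also have "\<dots> \<le> \<bar>L\<bar> * (v - u)" using that by (intro mult_mono) auto
      finally show ?thesis by linarith
    qed
    then have "\<forall>x\<in>{u..v}. \<bar>h x\<bar> \<le> \<bar>\<bar>h u\<bar> + \<bar>L\<bar> * (v - u)\<bar>" by force
    then show ?thesis by (intro exI[of _ "\<bar>\<bar>h u\<bar> + \<bar>L\<bar> * (v - u)\<bar>"]) simp
  qed
  obtain A where A: "A \<ge> 0" "\<forall>x\<in>{u..v}. \<bar>f x\<bar> \<le> A" using bd[OF assms(1)] by blast
  obtain B where B: "B \<ge> 0" "\<forall>x\<in>{u..v}. \<bar>g x\<bar> \<le> B" using bd[OF assms(2)] by blast
  obtain L where L: "\<forall>x\<in>{u..v}. \<forall>y\<in>{u..v}. \<bar>f x - f y\<bar> \<le> L * \<bar>x - y\<bar>" using assms(1) by (auto simp: lip_on_def)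
  obtain M where M: "\<forall>x\<in>{u..v}. \<forall>y\<in>{u..v}. \<bar>g x - g y\<bar> \<le> M * \<bar>x - y\<bar>" using assms(2) by (auto simp: lip_on_def)
  have "\<bar>f x * g x - f y * g y\<bar> \<le> (L * B + A * M) * \<bar>x - y\<bar>" if xy: "x \<in> {u..v}" "y \<in> {u..v}" for x y
  proof -
    have "f x * g x - f y * g y = (f x - f y) * g x + f y * (g x - g y)" by (simp add: algebra_simps)
    then have "\<bar>f x * g x - f y * g y\<bar> \<le> \<bar>f x - f y\<bar> * \<bar>g x\<bar> + \<bar>f y\<bar> * \<bar>g x - g y\<bar>"
      by (simp flip: abs_mult)
    also have "\<dots> \<le> (L * \<bar>x - y\<bar>) * B + A * (M * \<bar>x - y\<bar>)"
    proof (intro add_mono mult_mono)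
      show "0 \<le> L * \<bar>x - y\<bar>" using L xy by (meson abs_ge_zero order_trans)
    qed (use A B L M xy in auto)
    finally show ?thesis by (simp add: algebra_simps)
  qed
  then show ?thesis unfolding lip_on_def by blast
qed

lemma lip_on_const: "lip_on S (\<lambda>x. c)"
  unfolding lip_on_def by (intro exI[of _ 0]) auto

lemma lip_on_cmult: "lip_on {u..v} f \<Longrightarrow> lip_on {u..v} (\<lambda>x. c * f x)"
  by (intro lip_on_mult lip_on_const)

lemma lip_on_diff: "lip_on {u..v} f \<Longrightarrow> lip_on {u..v} g \<Longrightarrow> lip_on {u..v} (\<lambda>x. f x - g x)"
  using lip_on_add[of "{u..v}" f "\<lambda>x. (- 1) * g x"] lip_on_cmult[of u v g "- 1"] by simp

lemma lip_on_ae_mono: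
  assumes lip: "lip_on {u..v} F" and "u \<le> v" "negligible N"
    and D: "\<And>x. x \<in> {u<..<v} - N \<Longrightarrow> \<exists>d\<ge>0. (F has_real_derivative d) (at x)"
  shows "F u \<le> F v"
proof -
  have "lip_on {u..v} (\<lambda>x. - F x)" using lip_on_cmult[OF lip, of "- 1"] by simp
  then obtain L where "\<And>x y. x \<in> {u..v} \<Longrightarrow> y \<in> {u..v} \<Longrightarrow> \<bar>- F x - - F y\<bar> \<le> L * \<bar>x - y\<bar>"
    unfolding lip_on_def by blast
  then have "abs_continuous_on {u..v} (\<lambda>x. - F x)" by (rule lipschitz_imp_abs_continuous_on)
  then have "- F v \<le> - F u"
  proof (rule abs_continuous_antimono[OF \<open>u \<le> v\<close> _ \<open>negligible N\<close>])
    fix x assume "x \<in> {u<..<v} - N"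
    from D[OF this] obtain d where d: "d \<ge> 0" "(F has_real_derivative d) (at x)" by blast
    then show "\<exists>D\<le>0. ((\<lambda>x. - F x) has_real_derivative D) (at x)"
      by (intro exI[of _ "- d"]) (auto intro: DERIV_minus)
  qed
  then show ?thesis by simp
qed

lemma nonneg_of_ae_deriv_nonneg:
  assumes lip: "\<And>u v. 0 < u \<Longrightarrow> lip_on {u..v} F" and "negligible N"
    and D: "\<And>x. x > 0 \<Longrightarrow> x \<notin> N \<Longrightarrow> \<exists>d\<ge>0. (F has_real_derivative d) (at x)"
    and lim: "(F \<longlongrightarrow> 0) (at_right 0)" and "x > 0"
  shows "F x \<ge> 0"
proof (rule tendsto_upperbound[OF lim])
  show "\<forall>\<^sub>F y in at_right 0. F y \<le> F x"
    using eventually_at_right_less[of 0] eventually_at_right_real[OF \<open>x > 0\<close>]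
  proof eventually_elim
    case (elim y)
    show ?case
      by (rule lip_on_ae_mono[OF lip _ \<open>negligible N\<close>]) (use elim D in auto)
  qed
qed simp

lemma nonneg_of_ae_deriv_nonpos:
  assumes lip: "\<And>u v. 0 < u \<Longrightarrow> lip_on {u..v} F" and "negligible N"
    and D: "\<And>x. x > 0 \<Longrightarrow> x \<notin> N \<Longrightarrow> \<exists>d\<le>0. (F has_real_derivative d) (at x)"
    and lim: "(F \<longlongrightarrow> 0) at_top" and "x > 0"
  shows "F x \<ge> 0"
proof (rule tendsto_upperbound[OF lim])
  show "\<forall>\<^sub>F y in at_top. F y \<le> F x"
    using eventually_ge_at_top[of x]
  proof eventually_elim
    case (elim y)
    have "(- 1) * F x \<le> (- 1) * F y"
    proof (rule lip_on_ae_mono[OF lip_on_cmult[OF lip] elim \<open>negligible N\<close>])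
      fix z assume "z \<in> {x<..<y} - N"
      then obtain d where "d \<le> 0" "(F has_real_derivative d) (at z)" using D[of z] \<open>x > 0\<close> by auto
      then show "\<exists>d\<ge>0. ((\<lambda>x. (- 1) * F x) has_real_derivative d) (at z)"
        using DERIV_cmult[of F d z UNIV "- 1"] by (intro exI[of _ "- d"]) auto
    qed fact
    then show ?case by simp
  qed
qed simp

section \<open>Solutions that satisfy the equation almost everywhere\<close>

context vg_kernel
begin

lemma has_deriv_exp_mult: "((\<lambda>x. exp (b * x)) has_real_derivative exp (b * x) * b) (at (x::real))"
  by (auto intro!: derivative_eq_intros)

lemma lip_weight:
  assumes "0 < u" and F: "\<And>x. x > 0 \<Longrightarrow> (F has_real_derivative F' x) (at x)" and F': "continuous_on {0<..} F'"
  shows "lip_on {u..v} (\<lambda>x. exp (b * x) * (x powr r * F x))"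
proof (rule lip_onI_deriv)
  fix x assume "x \<in> {u..v}"
  then have "x > 0" using assms(1) by auto
  then show "((\<lambda>x. exp (b * x) * (x powr r * F x)) has_real_derivative
      exp (b * x) * b * (x powr r * F x) + (r / x * x powr r * F x + F' x * x powr r) * exp (b * x)) (at x)"
    by (intro DERIV_mult has_deriv_exp_mult DERIV_powr_const F)
next
  have "continuous_on {0<..} F" using F by (intro continuous_at_imp_continuous_on) (auto intro: DERIV_isCont)
  then have "continuous_on {0<..} (\<lambda>x. exp (b * x) * b * (x powr r * F x) + (r / x * x powr r * F x + F' x * x powr r) * exp (b * x))"
    by (intro continuous_intros F') auto
  then show "continuous_on {u..v} (\<lambda>x. exp (b * x) * b * (x powr r * F x) + (r / x * x powr r * F x + F' x * x powr r) * exp (b * x))"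
    by (rule continuous_on_subset) (use assms(1) in auto)
qed

lemma continuous_kernels:
  shows "continuous_on {0<..} I" "continuous_on {0<..} I'" "continuous_on {0<..} K" "continuous_on {0<..} K'"
    "continuous_on {0<..} (\<lambda>x. \<alpha>\<^sup>2 * I x - r / x * I' x)" "continuous_on {0<..} (\<lambda>x. \<alpha>\<^sup>2 * K x - r / x * K' x)"
proof -
  show c: "continuous_on {0<..} I" "continuous_on {0<..} I'" "continuous_on {0<..} K" "continuous_on {0<..} K'"
    by (auto intro!: continuous_at_imp_continuous_on isCont_I isCont_I' DERIV_isCont[OF has_deriv_K] DERIV_isCont[OF has_deriv_K'])
  show "continuous_on {0<..} (\<lambda>x. \<alpha>\<^sup>2 * I x - r / x * I' x)" "continuous_on {0<..} (\<lambda>x. \<alpha>\<^sup>2 * K x - r / x * K' x)"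
    by (intro continuous_intros c; simp)+
qed

lemma lip_U:
  assumes "0 < u"
  shows "lip_on {u..v} (U b)"
proof -
  have "lip_on {u..v} (\<lambda>x. (1 / r) * (exp (b * x) * (x powr r * I x)) + (1 / (r * \<alpha>)) * (exp (b * x) * (x powr r * I' x)))"
    by (intro lip_on_add lip_on_cmult lip_weight[OF assms has_deriv_I continuous_kernels(2)]
        lip_weight[OF assms has_deriv_I' continuous_kernels(5)]) auto
  moreover have "U b = (\<lambda>x. (1 / r) * (exp (b * x) * (x powr r * I x)) + (1 / (r * \<alpha>)) * (exp (b * x) * (x powr r * I' x)))"
    using r_pos \<alpha>_pos by (auto simp: U_def fun_eq_iff field_simps)
  ultimately show ?thesis by simp
qed

lemma lip_J:
  assumes "0 < u" "\<bar>b\<bar> < \<alpha>"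
  shows "lip_on {u..v} (J b)"
proof (rule lip_onI_deriv)
  show "(J b has_real_derivative - (exp (b * x) * P x)) (at x)" if "x \<in> {u..v}" for x
    using that assms by (intro has_deriv_J) auto
  show "continuous_on {u..v} (\<lambda>x. - (exp (b * x) * P x))"
    by (intro continuous_intros continuous_on_subset[OF continuous_P]) (use assms in auto)
qed

text \<open>Green's identity against the two homogeneous solutions gives the variation of constants
  formula for \<open>w\<close> and \<open>w1\<close>. The equation is only required almost everywhere, because its
  right-hand side is the derivative of a Lipschitz function in the application.\<close>

lemma ae_solution_deriv_bound:
  assumes b: "\<bar>b\<bar> < \<alpha>"
    and w: "\<And>x. x > 0 \<Longrightarrow> (w has_real_derivative w1 x) (at x)"
    and lip: "\<And>u v. 0 < u \<Longrightarrow> lip_on {u..v} w1"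
    and N: "negligible N"
    and ode: "\<And>x. x > 0 \<Longrightarrow> x \<notin> N \<Longrightarrow> \<exists>w2 \<gamma>. (w1 has_real_derivative w2) (at x) \<and> \<bar>\<gamma>\<bar> \<le> G \<and>
        x * w2 + (r + 2 * b * x) * w1 x + (r * b - (\<alpha>\<^sup>2 - b\<^sup>2) * x) * w x = \<gamma>"
    and G: "G \<ge> 0"
    and w0: "(w \<longlongrightarrow> c) (at_right 0)" and w10: "((\<lambda>x. x powr r * w1 x) \<longlongrightarrow> 0) (at_right 0)"
    and top: "\<forall>\<^sub>F x in at_top. \<bar>w x\<bar> \<le> B" "\<forall>\<^sub>F x in at_top. \<bar>w1 x\<bar> \<le> B"
    and x: "x > 0"
  shows "\<bar>w1 x\<bar> \<le> G * (2 / r + C1 b)"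
proof -
  \<comment> \<open>With u = exp (b x) w this is x^r (F u' - F' u), the weighted Wronskian of u and
    a homogeneous solution F. In its derivative only the right-hand side of the equation, weighted
    by F, remains.\<close>
  define D where "D F F' x = (exp (b * x) * (x powr r * F x)) * (w1 x + b * w x) - (exp (b * x) * (x powr r * F' x)) * w x"
    for F F' :: "real \<Rightarrow> real" and x
  have contw1: "continuous_on {0<..} w1"
  proof (intro continuous_at_imp_continuous_on ballI)
    fix y :: real assume "y \<in> {0<..}"
    then have y: "0 < y / 2" "y / 2 < y" "y < 2 * y" by auto
    obtain L where L: "\<forall>s\<in>{y / 2..2 * y}. \<forall>t\<in>{y / 2..2 * y}. \<bar>w1 s - w1 t\<bar> \<le> L * \<bar>s - t\<bar>"
      using lip[OF y(1)] unfolding lip_on_def by blast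
    have "(w1 \<longlongrightarrow> w1 y) (at y)"
    proof (rule LIM_zero_cancel, rule Lim_null_comparison)
      have "\<forall>\<^sub>F s in at y. s \<in> {y / 2<..<2 * y}" using y by (intro eventually_at_in_open') auto
      then show "\<forall>\<^sub>F s in at y. norm (w1 s - w1 y) \<le> L * \<bar>s - y\<bar>"
        by eventually_elim (use L y in auto)
      have "((\<lambda>s. L * \<bar>s - y\<bar>) \<longlongrightarrow> L * \<bar>y - y\<bar>) (at y)" by (intro tendsto_intros)
      then show "((\<lambda>s. L * \<bar>s - y\<bar>) \<longlongrightarrow> 0) (at y)" by simp
    qed
    then show "isCont w1 y" by (simp add: isCont_def)
  qed
  have lipw: "lip_on {u..v} w" if "0 < u" for u v
    using that by (intro lip_onI_deriv[of _ _ _ w1] w continuous_on_subset[OF contw1]) auto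
  have lipD: "lip_on {u..v} (D F F')" if "0 < u" "lip_on {u..v} (\<lambda>x. exp (b * x) * (x powr r * F x))"
      "lip_on {u..v} (\<lambda>x. exp (b * x) * (x powr r * F' x))" for u v F F'
    unfolding D_def by (intro lip_on_diff lip_on_mult[OF that(2)] lip_on_mult[OF that(3)] lip_on_add lip_on_cmult lip lipw that(1))
  have dD: "\<exists>\<gamma>. \<bar>\<gamma>\<bar> \<le> G \<and> (D F F' has_real_derivative exp (b * y) * (y powr (r - 1) * F y) * \<gamma>) (at y)"
    if y: "y > 0" "y \<notin> N" and F: "(F has_real_derivative F' y) (at y)"
      and F': "(F' has_real_derivative \<alpha>\<^sup>2 * F y - r / y * F' y) (at y)" for y F F'
  proof -
    obtain w2 \<gamma> where w2: "(w1 has_real_derivative w2) (at y)" "\<bar>\<gamma>\<bar> \<le> G"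
      and eq: "y * w2 + (r + 2 * b * y) * w1 y + (r * b - (\<alpha>\<^sup>2 - b\<^sup>2) * y) * w y = \<gamma>"
      using ode[OF y] by blast
    have w2': "w2 = (\<gamma> - (r + 2 * b * y) * w1 y - (r * b - (\<alpha>\<^sup>2 - b\<^sup>2) * y) * w y) / y"
      using eq y by (simp add: field_simps)
    define p where "p = y powr r"
    have p: "y powr (r - 1) = p / y" using y by (simp add: powr_diff p_def)
    have "(D F F' has_real_derivative exp (b * y) * (y powr (r - 1) * F y) * \<gamma>) (at y)"
      unfolding D_def[abs_def] p
      by (rule DERIV_cong[OF DERIV_diff[OF
            DERIV_mult[OF DERIV_mult[OF has_deriv_exp_mult DERIV_mult[OF DERIV_powr_const[OF y(1)] F]] DERIV_add[OF w2(1) DERIV_cmult[OF w[OF y(1)]]]]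
            DERIV_mult[OF DERIV_mult[OF has_deriv_exp_mult DERIV_mult[OF DERIV_powr_const[OF y(1)] F']] w[OF y(1)]]]])
         (use y(1) in \<open>simp add: w2' p_def[symmetric] field_simps power2_eq_square\<close>)
    then show ?thesis using w2(2) by blast
  qed
  define L where "L = D I I'"
  define M where "M = D K K'"
  have L_le: "\<bar>L x\<bar> \<le> G * U b x"
  proof -
    have *: "0 \<le> G * U b x - s * L x" if s: "\<bar>s\<bar> = 1" for s
    proof (rule nonneg_of_ae_deriv_nonneg[where F = "\<lambda>x. G * U b x - s * L x", OF _ N])
      show "lip_on {u..v} (\<lambda>x. G * U b x - s * L x)" if "0 < u" for u v
        unfolding L_def using that
        by (intro lip_on_diff lip_on_cmult lip_U lipD lip_weight[OF that has_deriv_I continuous_kernels(2)]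
            lip_weight[OF that has_deriv_I' continuous_kernels(5)]) auto
      fix y :: real assume y: "y > 0" "y \<notin> N"
      obtain \<gamma> where \<gamma>: "\<bar>\<gamma>\<bar> \<le> G" "(L has_real_derivative exp (b * y) * (y powr (r - 1) * I y) * \<gamma>) (at y)"
        unfolding L_def using dD[OF y has_deriv_I has_deriv_I'] y by auto
      have "s * \<gamma> \<le> G" using \<gamma>(1) s by (auto simp: abs_if split: if_splits)
      then have "(exp (b * y) * (y powr (r - 1) * I y)) * (s * \<gamma>) \<le> (exp (b * y) * (y powr (r - 1) * I y)) * G"
        using I_pos[of y] by (intro mult_left_mono) auto
      moreover have "0 \<le> G * ((b + \<alpha>) * U b y)" using G b U_nonneg[OF y(1), of b] by (intro mult_nonneg_nonneg) auto
      moreover have "0 \<le> G * (A + c) - s * (c * d)" if "c * (s * d) \<le> c * G" "0 \<le> G * A" for A c d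
        using that by (simp add: algebra_simps)
      ultimately have "0 \<le> G * ((b + \<alpha>) * U b y + exp (b * y) * (y powr (r - 1) * I y)) - s * (exp (b * y) * (y powr (r - 1) * I y) * \<gamma>)"
        by blast
      moreover have "((\<lambda>x. G * U b x - s * L x) has_real_derivative G * ((b + \<alpha>) * U b y + exp (b * y) * (y powr (r - 1) * I y)) - s * (exp (b * y) * (y powr (r - 1) * I y) * \<gamma>)) (at y)"
        by (intro DERIV_diff DERIV_cmult has_deriv_U y \<gamma>(2))
      ultimately show "\<exists>d\<ge>0. ((\<lambda>x. G * U b x - s * L x) has_real_derivative d) (at y)" by blast
    next
      have "((\<lambda>x. G * U b x - s * (exp (b * x) * I x * (x powr r * w1 x) + exp (b * x) * I x * b * (x powr r * w x) - exp (b * x) * I' x * (x powr r * w x)))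
          \<longlongrightarrow> G * 0 - s * (exp (b * 0) * I 0 * 0 + exp (b * 0) * I 0 * b * (0 * c) - exp (b * 0) * 0 * (0 * c))) (at_right 0)"
        by (intro tendsto_intros tendsto_U tendsto_I tendsto_I' w10 w0 tendsto_powr_0 r_pos)
      then show "((\<lambda>x. G * U b x - s * L x) \<longlongrightarrow> 0) (at_right 0)"
        unfolding L_def D_def by (simp add: algebra_simps)
    qed fact
    from *[of 1] *[of "-1"] show ?thesis by (simp add: abs_le_iff)
  qed
  have M_le: "\<bar>M x\<bar> \<le> G * J b x"
  proof -
    have *: "0 \<le> G * J b x - s * M x" if s: "\<bar>s\<bar> = 1" for s
    proof (rule nonneg_of_ae_deriv_nonpos[where F = "\<lambda>x. G * J b x - s * M x", OF _ N])
      show "lip_on {u..v} (\<lambda>x. G * J b x - s * M x)" if "0 < u" for u v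
        unfolding M_def using that b
        by (intro lip_on_diff lip_on_cmult lip_J lipD lip_weight[OF that has_deriv_K continuous_kernels(4)]
            lip_weight[OF that has_deriv_K' continuous_kernels(6)]) auto
      fix y :: real assume y: "y > 0" "y \<notin> N"
      obtain \<gamma> where \<gamma>: "\<bar>\<gamma>\<bar> \<le> G" "(M has_real_derivative exp (b * y) * P y * \<gamma>) (at y)"
        unfolding M_def using dD[OF y has_deriv_K has_deriv_K'] y by (auto simp: P_eq_K)
      have "- s * \<gamma> \<le> G" using \<gamma>(1) s by (auto simp: abs_if split: if_splits)
      then have "(exp (b * y) * P y) * (- s * \<gamma>) \<le> (exp (b * y) * P y) * G"
        using P_pos[OF y(1)] by (intro mult_left_mono) auto
      then have "G * - (exp (b * y) * P y) - s * (exp (b * y) * P y * \<gamma>) \<le> 0" by (simp add: algebra_simps)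
      moreover have "((\<lambda>x. G * J b x - s * M x) has_real_derivative G * - (exp (b * y) * P y) - s * (exp (b * y) * P y * \<gamma>)) (at y)"
        by (intro DERIV_diff DERIV_cmult has_deriv_J y \<gamma>(2) b)
      ultimately show "\<exists>d\<le>0. ((\<lambda>x. G * J b x - s * M x) has_real_derivative d) (at y)" by blast
    next
      \<comment> \<open>Boundedness of w and w1 against the exponential decay of \<open>K\<close>
        makes the Wronskian with \<open>K\<close> vanish at infinity; this excludes the growing
        homogeneous solution.\<close>
      have B: "\<forall>\<^sub>F x in at_top. norm (w x) \<le> B" "\<forall>\<^sub>F x in at_top. norm (w1 x) \<le> B" using top by auto
      have "((\<lambda>x. G * J b x - s * ((x powr r * exp (b * x) * K x) * w1 x + b * ((x powr r * exp (b * x) * K x) * w x) - (x powr r * exp (b * x) * K' x) * w x))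
          \<longlongrightarrow> G * 0 - s * (0 + b * 0 - 0)) at_top"
        by (intro tendsto_diff tendsto_add tendsto_mult tendsto_const tendsto_J b
            lim_null_mult_right_bounded[OF decay_K[OF b] B(1)] lim_null_mult_right_bounded[OF decay_K[OF b] B(2)]
            lim_null_mult_right_bounded[OF decay_K'[OF b] B(1)])
      then show "((\<lambda>x. G * J b x - s * M x) \<longlongrightarrow> 0) at_top"
        unfolding M_def D_def by (simp add: algebra_simps)
    qed fact
    from *[of 1] *[of "-1"] show ?thesis by (simp add: abs_le_iff)
  qed
  \<comment> \<open>The two Wronskians are solved for w1. \<open>L\<close> plays the part of the
    head integral and \<open>- M\<close> that of the tail integral.\<close>
  have "w1 x = - (exp (- b * x) * ((K' x - b * K x) * L x + (I' x - b * I x) * - M x))"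
  proof -
    define k where "k = K x" define k' where "k' = K' x" define i where "i = I x" define i' where "i' = I' x"
    define p where "p = x powr r"
    define e where "e = exp (b * x)" define v where "v = exp (- b * x)"
    have ve: "v * e = 1" by (simp add: v_def e_def flip: exp_add)
    have W: "p * (i' * k - i * k') = 1"
      using wronskian[OF x] by (simp add: p_def k_def i_def k'_def i'_def)
    have "- (v * ((k' - b * k) * ((e * (p * i)) * (w1 x + b * w x) - (e * (p * i')) * w x) + (i' - b * i) * - ((e * (p * k)) * (w1 x + b * w x) - (e * (p * k')) * w x)))
      = (v * e) * (p * (i' * k - i * k')) * w1 x" by (simp add: algebra_simps)
    also have "\<dots> = w1 x" by (simp add: ve W)
    finally show ?thesis
      unfolding L_def M_def D_def k_def k'_def i_def i'_def p_def e_def v_def by simp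
  qed
  then show ?thesis
    using representation_bounds(2)[OF b x L_le, of "- M x"] M_le G by simp
qed

end

section \<open>The Stein equation\<close>

lemma lip_on_cong: "lip_on S f \<Longrightarrow> (\<And>x. x \<in> S \<Longrightarrow> f x = g x) \<Longrightarrow> lip_on S g"
  unfolding lip_on_def by (metis (no_types, lifting))

text \<open>Off 0 the equation can be solved for \<open>w1\<close>, as \<open>R\<close> divided by
  \<sigma>^2 x, and \<open>R\<close> is differentiable; so the existence of a further derivative is
  a conclusion, and the new equation is the product rule.\<close>

lemma stein_differentiate:
  fixes s \<theta> \<sigma> :: real
  assumes \<sigma>: "\<sigma> > 0" and S: "open S" "0 \<notin> S" "x \<in> S"
    and ode: "\<And>x. x \<in> S \<Longrightarrow> \<sigma>\<^sup>2 * x * w1 x + (\<sigma>\<^sup>2 * s + 2 * \<theta> * x) * w x + (s * \<theta> - x) * v x = g x"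
    and v: "(v has_real_derivative w x) (at x)" and w: "(w has_real_derivative w1 x) (at x)"
    and g: "(g has_real_derivative \<gamma>) (at x)"
  shows "\<exists>w2. (w1 has_real_derivative w2) (at x) \<and>
    \<sigma>\<^sup>2 * x * w2 + (\<sigma>\<^sup>2 * (s + 1) + 2 * \<theta> * x) * w1 x + ((s + 1) * \<theta> - x) * w x = \<gamma> + v x - \<theta> * w x"
proof -
  define R where "R x = g x - (\<sigma>\<^sup>2 * s + 2 * \<theta> * x) * w x - (s * \<theta> - x) * v x" for x
  have x: "x \<noteq> 0" using S by auto
  have w1: "w1 y = R y * (1 / (\<sigma>\<^sup>2 * y))" if "y \<in> S" for y
  proof -
    have "R y = \<sigma>\<^sup>2 * y * w1 y" unfolding R_def ode[OF that, symmetric] by simp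
    moreover have "y \<noteq> 0" using S(2) that by auto
    ultimately show ?thesis using \<sigma> by simp
  qed
  define w2 where "w2 = (\<gamma> - (2 * \<theta>) * w x - (\<sigma>\<^sup>2 * s + 2 * \<theta> * x) * w1 x + v x - (s * \<theta> - x) * w x - \<sigma>\<^sup>2 * w1 x) / (\<sigma>\<^sup>2 * x)"
  have a: "((\<lambda>x. c + d * x) has_real_derivative d) (at x)" for c d :: real
    by (auto intro!: derivative_eq_intros)
  have dR: "(R has_real_derivative \<gamma> - (2 * \<theta> * w x + w1 x * (\<sigma>\<^sup>2 * s + 2 * \<theta> * x)) - (- 1 * v x + w x * (s * \<theta> + (- 1) * x))) (at x)"
    using DERIV_diff[OF DERIV_diff[OF g DERIV_mult[OF a[of "\<sigma>\<^sup>2 * s" "2 * \<theta>"] w]] DERIV_mult[OF a[of "s * \<theta>" "- 1"] v]]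
    by (simp add: R_def[abs_def])
  have "((\<lambda>x. 1 / (\<sigma>\<^sup>2 * x)) has_real_derivative - 1 / (\<sigma>\<^sup>2 * x\<^sup>2)) (at x)"
    using x \<sigma> by (auto intro!: derivative_eq_intros simp: field_simps power2_eq_square)
  from DERIV_mult[OF dR this]
  have "((\<lambda>x. R x * (1 / (\<sigma>\<^sup>2 * x))) has_real_derivative w2) (at x)"
  proof (rule DERIV_cong)
    have R: "R x = \<sigma>\<^sup>2 * x * w1 x" unfolding R_def ode[OF S(3), symmetric] by simp
    show "(\<gamma> - (2 * \<theta> * w x + w1 x * (\<sigma>\<^sup>2 * s + 2 * \<theta> * x)) - (- 1 * v x + w x * (s * \<theta> + (- 1) * x))) * (1 / (\<sigma>\<^sup>2 * x)) + - 1 / (\<sigma>\<^sup>2 * x\<^sup>2) * R x = w2"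
      unfolding R w2_def using x \<sigma> by (simp add: field_simps power2_eq_square)
  qed
  then have "(w1 has_real_derivative w2) (at x)"
    by (rule has_field_derivative_transform_within_open[OF _ S(1,3)]) (simp add: w1)
  moreover have "\<sigma>\<^sup>2 * x * w2 = \<gamma> - (2 * \<theta>) * w x - (\<sigma>\<^sup>2 * s + 2 * \<theta> * x) * w1 x + v x - (s * \<theta> - x) * w x - \<sigma>\<^sup>2 * w1 x"
    using x \<sigma> by (simp add: w2_def)
  ultimately show ?thesis by (intro exI[of _ w2]) (simp add: algebra_simps)
qed

section \<open>The bound for the derivative in the parameters \<theta> and \<sigma>\<close>

locale vg_parameters =
  fixes \<theta> \<sigma> :: real
  assumes \<sigma>_pos: "\<sigma> > 0"
begin

definition \<alpha> where "\<alpha> = sqrt (\<theta>\<^sup>2 + \<sigma>\<^sup>2) / \<sigma>\<^sup>2"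
definition b where "b = \<theta> / \<sigma>\<^sup>2"

lemma \<alpha>_pos: "\<alpha> > 0"
  using \<sigma>_pos by (auto simp: \<alpha>_def sum_power2_gt_zero_iff)

lemma b_less: "\<bar>b\<bar> < \<alpha>"
proof -
  have "\<bar>\<theta>\<bar> < sqrt (\<theta>\<^sup>2 + \<sigma>\<^sup>2)" using \<sigma>_pos by (intro real_less_rsqrt) auto
  then show ?thesis using \<sigma>_pos by (simp add: \<alpha>_def b_def divide_strict_right_mono)
qed

lemma \<alpha>2_b2: "\<alpha>\<^sup>2 - b\<^sup>2 = 1 / \<sigma>\<^sup>2"
proof -
  have "\<alpha>\<^sup>2 - b\<^sup>2 = \<sigma>\<^sup>2 / (\<sigma>\<^sup>2)\<^sup>2" by (simp add: \<alpha>_def b_def power_divide flip: diff_divide_distrib)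
  then show ?thesis using \<sigma>_pos by (simp add: power2_eq_square)
qed

lemma \<theta>_eq: "\<theta> = \<sigma>\<^sup>2 * b"
  using \<sigma>_pos by (simp add: b_def)

lemma kernel: "r > 0 \<Longrightarrow> vg_kernel r ((r - 1) / 2) \<alpha>"
  using \<alpha>_pos by unfold_locales (auto simp: field_simps)

lemma C1_le:
  assumes "r > 0"
  shows "vg_kernel.C1 r \<alpha> b \<le> vg_C r \<theta> \<sigma>"
  unfolding vg_kernel.C1_def[OF kernel[OF assms]] using vg_C1_le_vg_C[OF assms \<sigma>_pos, of \<theta>] by (simp add: \<alpha>_def b_def)

text \<open>The bound is applied to w, the derivative of v, which solves the equation with s + 1
  almost everywhere. As g is merely Lipschitz, \<open>w1\<close> may fail to be differentiable at
  some points; the equation for v, solved for \<open>w1\<close>, still makes \<open>w1\<close>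
  Lipschitz on compact intervals and controls it at 0 and at infinity.\<close>

lemma stein_deriv_bound_pos:
  assumes s: "s > 0"
    and v: "\<And>x. x > 0 \<Longrightarrow> (v has_real_derivative w x) (at x)" and v0: "(v \<longlongrightarrow> v\<^sub>0) (at_right 0)"
    and w: "\<And>x. x > 0 \<Longrightarrow> (w has_real_derivative w1 x) (at x)" and w0: "(w \<longlongrightarrow> w\<^sub>0) (at_right 0)"
    and ode: "\<And>x. x > 0 \<Longrightarrow> \<sigma>\<^sup>2 * x * w1 x + (\<sigma>\<^sup>2 * s + 2 * \<theta> * x) * w x + (s * \<theta> - x) * v x = g x"
    and g: "\<And>x y. \<bar>g x - g y\<bar> \<le> L * \<bar>x - y\<bar>"
    and B: "\<And>x. x > 0 \<Longrightarrow> \<bar>v x\<bar> \<le> B" "\<And>x. x > 0 \<Longrightarrow> \<bar>w x\<bar> \<le> B"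
    and N: "negligible N"
    and \<gamma>: "\<And>x. x > 0 \<Longrightarrow> x \<notin> N \<Longrightarrow> \<exists>\<gamma>. (g has_real_derivative \<gamma>) (at x) \<and> \<bar>\<gamma> + v x - \<theta> * w x\<bar> \<le> G"
    and G: "G \<ge> 0" and x: "x > 0"
  shows "\<bar>w1 x\<bar> \<le> (2 / (s + 1) + vg_C (s + 1) \<theta> \<sigma>) / \<sigma>\<^sup>2 * G"
proof -
  have r: "s + 1 > 0" using s by simp
  interpret vg_kernel "s + 1" "(s + 1 - 1) / 2" \<alpha> by (rule kernel[OF r])
  define R where "R x = g x - (\<sigma>\<^sup>2 * s + 2 * \<theta> * x) * w x - (s * \<theta> - x) * v x" for x
  have w1: "w1 y = R y * (1 / (\<sigma>\<^sup>2 * y))" if "y > 0" for y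
    using ode[OF that] \<sigma>_pos that by (simp add: R_def field_simps)
  have contg: "isCont g y" for y
  proof -
    have "(g \<longlongrightarrow> g y) (at y)"
    proof (rule LIM_zero_cancel, rule Lim_null_comparison)
      show "\<forall>\<^sub>F z in at y. norm (g z - g y) \<le> L * \<bar>z - y\<bar>" using g by (intro always_eventually) simp
      have "((\<lambda>s. L * \<bar>s - y\<bar>) \<longlongrightarrow> L * \<bar>y - y\<bar>) (at y)" by (intro tendsto_intros)
      then show "((\<lambda>s. L * \<bar>s - y\<bar>) \<longlongrightarrow> 0) (at y)" by simp
    qed
    then show ?thesis by (simp add: isCont_def)
  qed
  have contv: "isCont v y" "isCont w y" if "y > 0" for y using v w that by (auto intro: DERIV_isCont)
  have "continuous_on {0<..} (\<lambda>y. R y * (1 / (\<sigma>\<^sup>2 * y)))"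
    unfolding R_def using \<sigma>_pos
    by (intro continuous_intros continuous_at_imp_continuous_on) (auto intro: contg contv)
  then have contw1: "continuous_on {0<..} w1"
    by (rule continuous_on_eq) (simp add: w1)
  have lipw1: "lip_on {u..u'} w1" if u: "0 < u" for u u'
  proof -
    have sub: "{u..u'} \<subseteq> {0<..}" using u by auto
    have lg: "lip_on {u..u'} g" unfolding lip_on_def using g by blast
    have lw: "lip_on {u..u'} w"
      using u by (intro lip_onI_deriv[of _ _ _ w1] w continuous_on_subset[OF contw1 sub]) auto
    have lv: "lip_on {u..u'} v"
      using u by (intro lip_onI_deriv[of _ _ _ w] v continuous_at_imp_continuous_on) (auto intro: contv)
    have la: "lip_on {u..u'} (\<lambda>x. c + d * x)" for c d
      by (rule lip_onI_deriv[where f' = "\<lambda>_. d"]) (auto intro!: derivative_eq_intros)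
    have li: "lip_on {u..u'} (\<lambda>x. 1 / (\<sigma>\<^sup>2 * x))"
      using u \<sigma>_pos by (intro lip_onI_deriv[where f' = "\<lambda>x. - 1 / (\<sigma>\<^sup>2 * x\<^sup>2)"])
        (auto intro!: derivative_eq_intros continuous_intros simp: field_simps power2_eq_square)
    have "lip_on {u..u'} (\<lambda>x. (g x - (\<sigma>\<^sup>2 * s + (2 * \<theta>) * x) * w x - (s * \<theta> + (- 1) * x) * v x) * (1 / (\<sigma>\<^sup>2 * x)))"
      by (intro lip_on_mult lip_on_diff lg lw lv la li)
    then show ?thesis
      by (rule lip_on_cong) (use u in \<open>simp add: w1 R_def\<close>)
  qed
  have gx: "\<bar>g x\<bar> \<le> \<bar>g 0\<bar> + L * \<bar>x\<bar>" for x using g[of x 0] by simp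
  have "\<bar>w1 x\<bar> \<le> (G / \<sigma>\<^sup>2) * (2 / (s + 1) + C1 b)"
  proof (rule ae_solution_deriv_bound[OF b_less w lipw1 N _ _ w0 _ _ _ x])
    fix y assume y: "y > 0" "y \<notin> N"
    obtain \<gamma>' where \<gamma>': "(g has_real_derivative \<gamma>') (at y)" "\<bar>\<gamma>' + v y - \<theta> * w y\<bar> \<le> G" using \<gamma>[OF y] by blast
    obtain w2 where w2: "(w1 has_real_derivative w2) (at y)"
      "\<sigma>\<^sup>2 * y * w2 + (\<sigma>\<^sup>2 * (s + 1) + 2 * \<theta> * y) * w1 y + ((s + 1) * \<theta> - y) * w y = \<gamma>' + v y - \<theta> * w y"
      using stein_differentiate[OF \<sigma>_pos open_greaterThan _ _ ode v w \<gamma>'(1), of 0] y by auto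
    have "y * w2 + (s + 1 + 2 * b * y) * w1 y + ((s + 1) * b - (\<alpha>\<^sup>2 - b\<^sup>2) * y) * w y = (\<gamma>' + v y - \<theta> * w y) / \<sigma>\<^sup>2"
      unfolding \<alpha>2_b2 w2(2)[symmetric] unfolding b_def using \<sigma>_pos by (simp add: field_simps)
    moreover have "\<bar>(\<gamma>' + v y - \<theta> * w y) / \<sigma>\<^sup>2\<bar> \<le> G / \<sigma>\<^sup>2"
      using \<gamma>'(2) \<sigma>_pos by (simp add: abs_divide divide_right_mono)
    ultimately show "\<exists>w2 \<gamma>. (w1 has_real_derivative w2) (at y) \<and> \<bar>\<gamma>\<bar> \<le> G / \<sigma>\<^sup>2 \<and>
        y * w2 + (s + 1 + 2 * b * y) * w1 y + ((s + 1) * b - (\<alpha>\<^sup>2 - b\<^sup>2) * y) * w y = \<gamma>"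
      using w2(1) by blast
  next
    show "0 \<le> G / \<sigma>\<^sup>2" using G by simp
  next
    \<comment> \<open>\<open>w1\<close> is \<open>R\<close> over \<sigma>^2 x and \<open>R\<close>
      has a limit at 0, so x^(s+1) \<open>w1\<close> is x^s times a convergent function.\<close>
    have "(g \<longlongrightarrow> g 0) (at_right 0)" using contg[of 0] by (auto simp: isCont_def filterlim_at_split)
    then have "((\<lambda>x. x powr s * R x / \<sigma>\<^sup>2) \<longlongrightarrow> 0 * (g 0 - (\<sigma>\<^sup>2 * s + 2 * \<theta> * 0) * w\<^sub>0 - (s * \<theta> - 0) * v\<^sub>0) / \<sigma>\<^sup>2) (at_right 0)"
      unfolding R_def using \<sigma>_pos by (intro tendsto_intros tendsto_powr_0 s w0 v0) auto
    moreover have "\<forall>\<^sub>F x in at_right 0. x powr s * R x / \<sigma>\<^sup>2 = x powr (s + 1) * w1 x"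
      using eventually_at_right_less[of 0] by eventually_elim (simp add: w1 powr_add)
    ultimately show "((\<lambda>x. x powr (s + 1) * w1 x) \<longlongrightarrow> 0) (at_right 0)" by (auto intro: Lim_transform_eventually)
  next
    \<comment> \<open>For x \<ge> 1 the constant terms in the bound for \<open>R\<close> may be
      multiplied by x, and dividing by \<sigma>^2 x leaves this number.\<close>
    define B' where "B' = (\<bar>g 0\<bar> + L + (\<sigma>\<^sup>2 * s + 2 * \<bar>\<theta>\<bar>) * B + (s * \<bar>\<theta>\<bar> + 1) * B) / \<sigma>\<^sup>2"
    have L0: "L \<ge> 0" using g[of 0 1] by (auto intro: order_trans[OF abs_ge_zero])
    have B0: "B \<ge> 0" using B(1)[of 1] by simp
    show "\<forall>\<^sub>F x in at_top. \<bar>w x\<bar> \<le> max B B'"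
      using eventually_gt_at_top[of 0] by eventually_elim (use B(2) in \<open>auto simp: le_max_iff_disj\<close>)
    show "\<forall>\<^sub>F x in at_top. \<bar>w1 x\<bar> \<le> max B B'"
      using eventually_ge_at_top[of 1]
    proof eventually_elim
      case (elim x)
      have "\<bar>R x\<bar> \<le> \<bar>g x\<bar> + \<bar>\<sigma>\<^sup>2 * s + 2 * \<theta> * x\<bar> * \<bar>w x\<bar> + \<bar>s * \<theta> - x\<bar> * \<bar>v x\<bar>"
        unfolding R_def abs_mult[symmetric] by linarith
      also have "\<dots> \<le> (\<bar>g 0\<bar> * x + L * x) + ((\<sigma>\<^sup>2 * s + 2 * \<bar>\<theta>\<bar>) * x) * B + ((s * \<bar>\<theta>\<bar> + 1) * x) * B"
      proof (intro add_mono mult_mono)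
        show "\<bar>g x\<bar> \<le> \<bar>g 0\<bar> * x + L * x" using gx[of x] elim mult_left_mono[of 1 x "\<bar>g 0\<bar>"] by simp
        have "\<bar>\<sigma>\<^sup>2 * s + 2 * \<theta> * x\<bar> \<le> \<sigma>\<^sup>2 * s * 1 + 2 * \<bar>\<theta>\<bar> * x" using s elim by (simp add: abs_mult order_trans[OF abs_triangle_ineq])
        also have "\<dots> \<le> \<sigma>\<^sup>2 * s * x + 2 * \<bar>\<theta>\<bar> * x" using s elim by (intro add_right_mono mult_left_mono) auto
        finally show "\<bar>\<sigma>\<^sup>2 * s + 2 * \<theta> * x\<bar> \<le> (\<sigma>\<^sup>2 * s + 2 * \<bar>\<theta>\<bar>) * x" by (simp add: algebra_simps)
        have "\<bar>s * \<theta> - x\<bar> \<le> s * \<bar>\<theta>\<bar> * 1 + x" using s elim by (simp add: abs_mult order_trans[OF abs_triangle_ineq4])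
        also have "\<dots> \<le> s * \<bar>\<theta>\<bar> * x + x" using s elim by (intro add_right_mono mult_left_mono) auto
        finally show "\<bar>s * \<theta> - x\<bar> \<le> (s * \<bar>\<theta>\<bar> + 1) * x" by (simp add: algebra_simps)
      qed (use B[of x] elim s B0 in auto)
      also have "\<dots> = B' * (\<sigma>\<^sup>2 * x)" using \<sigma>_pos by (simp add: B'_def field_simps)
      finally have "\<bar>R x\<bar> / (\<sigma>\<^sup>2 * x) \<le> B'" using \<sigma>_pos elim by (simp add: pos_divide_le_eq)
      then show ?case using elim by (simp add: w1 abs_mult le_max_iff_disj)
    qed
  qed
  also have "\<dots> \<le> (G / \<sigma>\<^sup>2) * (2 / (s + 1) + vg_C (s + 1) \<theta> \<sigma>)"
    using G C1_le[OF r] by (intro mult_left_mono) auto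
  finally show ?thesis by (simp add: mult_ac)
qed

end

lemma vg_C_minus: "vg_C s (- \<theta>) \<sigma> = vg_C s \<theta> \<sigma>"
  by (simp add: vg_C_def)

lemma DERIV_reflect: "(f has_real_derivative d) (at (- x)) \<Longrightarrow> ((\<lambda>x. f (- x)) has_real_derivative - d) (at (x::real))"
  using DERIV_mirror[of f d x] by simp

text \<open>For x < 0 the functions v(-x), -w(-x), w1(-x) and -g(-x) satisfy the equation with
  -\<theta>, and \<open>vg_C\<close> is even in \<theta>.\<close>

lemma stein_deriv_bound:
  fixes s \<theta> \<sigma> :: real
  assumes \<sigma>: "\<sigma> > 0" and s: "s > 0"
    and v: "\<And>x. (v has_real_derivative w x) (at x)"
    and w: "\<And>x. x \<noteq> 0 \<Longrightarrow> (w has_real_derivative w1 x) (at x)" and w0: "isCont w 0"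
    and ode: "\<And>x. x \<noteq> 0 \<Longrightarrow> \<sigma>\<^sup>2 * x * w1 x + (\<sigma>\<^sup>2 * s + 2 * \<theta> * x) * w x + (s * \<theta> - x) * v x = g x"
    and g: "\<And>x y. \<bar>g x - g y\<bar> \<le> L * \<bar>x - y\<bar>"
    and B: "\<And>x. \<bar>v x\<bar> \<le> B" "\<And>x. \<bar>w x\<bar> \<le> B"
    and N: "negligible N"
    and \<gamma>: "\<And>x. x \<notin> N \<Longrightarrow> \<exists>\<gamma>. (g has_real_derivative \<gamma>) (at x) \<and> \<bar>\<gamma> + v x - \<theta> * w x\<bar> \<le> G"
    and G: "G \<ge> 0" and x: "x \<noteq> 0"
  shows "\<bar>w1 x\<bar> \<le> (2 / (s + 1) + vg_C (s + 1) \<theta> \<sigma>) / \<sigma>\<^sup>2 * G"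
proof -
  have v0: "isCont v 0" using v by (rule DERIV_isCont)
  show ?thesis
  proof (cases "x > 0")
    case True
    interpret vg_parameters \<theta> \<sigma> using \<sigma> by unfold_locales
    show ?thesis
      by (rule stein_deriv_bound_pos[OF s v _ w _ ode g B N \<gamma> G True, of "v 0" "w 0"])
         (use v0 w0 in \<open>auto simp: isCont_def filterlim_at_split\<close>)
  next
    case False
    interpret vg_parameters "- \<theta>" \<sigma> using \<sigma> by unfold_locales
    have "\<bar>w1 (- (- x))\<bar> \<le> (2 / (s + 1) + vg_C (s + 1) (- \<theta>) \<sigma>) / \<sigma>\<^sup>2 * G"
    proof (rule stein_deriv_bound_pos[OF s, where v = "\<lambda>x. v (- x)" and w = "\<lambda>x. - w (- x)" and g = "\<lambda>x. - g (- x)" and v\<^sub>0 = "v 0" and w\<^sub>0 = "- w 0" and N = "uminus ` N" and ?w1.0 = "\<lambda>x. w1 (- x)" and B = B and L = L])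
      fix y :: real assume y: "y > 0"
      show "((\<lambda>x. v (- x)) has_real_derivative - w (- y)) (at y)" by (rule DERIV_reflect[OF v])
      show "((\<lambda>x. - w (- x)) has_real_derivative w1 (- y)) (at y)"
        using DERIV_minus[OF DERIV_reflect[OF w[of "- y"]]] y by simp
      show "\<sigma>\<^sup>2 * y * w1 (- y) + (\<sigma>\<^sup>2 * s + 2 * - \<theta> * y) * - w (- y) + (s * - \<theta> - y) * v (- y) = - g (- y)"
        using ode[of "- y"] y by (simp add: algebra_simps)
      assume "y \<notin> uminus ` N"
      then have "- y \<notin> N" by (metis image_eqI minus_minus)
      then obtain \<gamma>' where "(g has_real_derivative \<gamma>') (at (- y))" "\<bar>\<gamma>' + v (- y) - \<theta> * w (- y)\<bar> \<le> G" using \<gamma> by blast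
      then show "\<exists>\<gamma>. ((\<lambda>x. - g (- x)) has_real_derivative \<gamma>) (at y) \<and> \<bar>\<gamma> + v (- y) - - \<theta> * - w (- y)\<bar> \<le> G"
        using DERIV_minus[OF DERIV_reflect] by (intro exI[of _ \<gamma>']) fastforce
    next
      show "((\<lambda>x. v (- x)) \<longlongrightarrow> v 0) (at_right 0)" "((\<lambda>x. - w (- x)) \<longlongrightarrow> - w 0) (at_right 0)"
        using v0 w0 filterlim_at_left_to_right[of v "nhds (v 0)" 0] filterlim_at_left_to_right[of w "nhds (w 0)" 0]
        by (auto simp: isCont_def filterlim_at_split intro!: tendsto_minus)
      show "\<bar>- g (- x) - - g (- y)\<bar> \<le> L * \<bar>x - y\<bar>" for x y using g[of "- y" "- x"] by (simp add: abs_minus_commute algebra_simps)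
      show "negligible (uminus ` N)" by (rule negligible_differentiable_image_negligible[OF _ N]) (auto simp: differentiable_on_def)
    qed (use B G False x in auto)
    then show ?thesis by (simp add: vg_C_minus)
  qed
qed

text \<open>The integrating factor exp (2 b x) x^s absorbs w' and w: the derivative of
  \<open>q\<close> is x^(s-1) times a function with a limit at 0, and L'Hopital applies to
  \<open>q\<close> over x^s. The hypothesis that x^s w tends to 0 discards the singular solution,
  which behaves like x^(-s).\<close>

lemma stein_tendsto_right_0:
  fixes s \<theta> \<sigma> :: real
  assumes \<sigma>: "\<sigma> > 0" and s: "s > 0"
    and v: "(v \<longlongrightarrow> v\<^sub>0) (at_right 0)" and g: "(g \<longlongrightarrow> g\<^sub>0) (at_right 0)"
    and w: "\<And>x. x > 0 \<Longrightarrow> (w has_real_derivative w' x) (at x)"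
    and ode: "\<And>x. x > 0 \<Longrightarrow> \<sigma>\<^sup>2 * x * w' x + (\<sigma>\<^sup>2 * s + 2 * \<theta> * x) * w x + (s * \<theta> - x) * v x = g x"
    and w0: "((\<lambda>x. x powr s * w x) \<longlongrightarrow> 0) (at_right 0)"
  shows "(w \<longlongrightarrow> (g\<^sub>0 - s * \<theta> * v\<^sub>0) / (\<sigma>\<^sup>2 * s)) (at_right 0)"
proof -
  define b where "b = \<theta> / \<sigma>\<^sup>2"
  define q where "q x = exp (2 * b * x) * (x powr s * w x)" for x
  define q' where "q' x = x powr s / x * (exp (2 * b * x) * (g x - (s * \<theta> - x) * v x) / \<sigma>\<^sup>2)" for x
  have dq: "(q has_real_derivative q' x) (at x)" if x: "x > 0" for x
  proof -
    have e: "((\<lambda>x. exp (2 * b * x)) has_real_derivative exp (2 * b * x) * (2 * b)) (at x)"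
      by (auto intro!: derivative_eq_intros)
    have w': "w' x = (g x - (\<sigma>\<^sup>2 * s + 2 * \<theta> * x) * w x - (s * \<theta> - x) * v x) / (\<sigma>\<^sup>2 * x)"
      using ode[OF x] x \<sigma> by (simp add: field_simps)
    have \<theta>: "\<theta> = \<sigma>\<^sup>2 * b" using \<sigma> by (simp add: b_def)
    show ?thesis
      unfolding q_def[abs_def] q'_def
      by (intro DERIV_cong[OF DERIV_mult[OF e DERIV_mult[OF DERIV_powr_const[OF x] w[OF x]]]], unfold w' \<theta>)
         (use x \<sigma> in \<open>simp add: field_simps\<close>)
  qed
  have "((\<lambda>x. q x / x powr s) \<longlongrightarrow> (g\<^sub>0 - s * \<theta> * v\<^sub>0) / (\<sigma>\<^sup>2 * s)) (at_right 0)"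
  proof (rule lhopital_right_0[where f' = q' and g' = "\<lambda>x. s / x * x powr s"])
    have "(q \<longlongrightarrow> exp (2 * b * 0) * 0) (at_right 0)" unfolding q_def[abs_def] by (intro tendsto_intros w0)
    then show "(q \<longlongrightarrow> 0) (at_right 0)" by simp
    show "((\<lambda>x. x powr s) \<longlongrightarrow> 0) (at_right 0)" using s by real_asymp
    have "((\<lambda>x. exp (2 * b * x) * (g x - (s * \<theta> - x) * v x) / (\<sigma>\<^sup>2 * s)) \<longlongrightarrow> exp (2 * b * 0) * (g\<^sub>0 - (s * \<theta> - 0) * v\<^sub>0) / (\<sigma>\<^sup>2 * s)) (at_right 0)"
      using \<sigma> s by (intro tendsto_intros v g) auto
    moreover have "\<forall>\<^sub>F x in at_right 0. exp (2 * b * x) * (g x - (s * \<theta> - x) * v x) / (\<sigma>\<^sup>2 * s) = q' x / (s / x * x powr s)"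
      using eventually_at_right_less[of 0] by eventually_elim (use s \<sigma> in \<open>simp add: q'_def\<close>)
    ultimately show "((\<lambda>x. q' x / (s / x * x powr s)) \<longlongrightarrow> (g\<^sub>0 - s * \<theta> * v\<^sub>0) / (\<sigma>\<^sup>2 * s)) (at_right 0)"
      using Lim_transform_eventually by fastforce
    show "\<forall>\<^sub>F x in at_right 0. x powr s \<noteq> 0" "\<forall>\<^sub>F x in at_right 0. s / x * x powr s \<noteq> 0"
      "\<forall>\<^sub>F x in at_right 0. (q has_real_derivative q' x) (at x)"
      "\<forall>\<^sub>F x in at_right 0. ((\<lambda>x. x powr s) has_real_derivative s / x * x powr s) (at x)"
      by (rule eventually_mono[OF eventually_at_right_less[of "0::real"]]; use s in \<open>simp add: dq DERIV_powr_const[simplified]\<close>)+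
  qed
  moreover have "((\<lambda>x. exp (- (2 * b * x))) \<longlongrightarrow> exp (- (2 * b * 0))) (at_right 0)" by (intro tendsto_intros)
  ultimately have "((\<lambda>x. exp (- (2 * b * x)) * (q x / x powr s)) \<longlongrightarrow> exp (- (2 * b * 0)) * ((g\<^sub>0 - s * \<theta> * v\<^sub>0) / (\<sigma>\<^sup>2 * s))) (at_right 0)"
    by (intro tendsto_mult)
  moreover have "\<forall>\<^sub>F x in at_right 0. exp (- (2 * b * x)) * (q x / x powr s) = w x"
    using eventually_at_right_less[of 0]
    by eventually_elim (simp add: q_def exp_minus)
  ultimately show ?thesis using Lim_transform_eventually by fastforce
qed

text \<open>The limit of \<open>w\<close> at \<open>0\<close> is read off the equation, since \<open>x w'(x)\<close> tends to \<open>0\<close>.\<close>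

lemma stein_deriv_at_0:
  fixes s \<theta> \<sigma> :: real
  assumes \<sigma>: "\<sigma> > 0" and s: "s > 0"
    and v0: "isCont v 0" and g0: "isCont g 0"
    and v: "\<And>x. x \<noteq> 0 \<Longrightarrow> (v has_real_derivative w x) (at x)"
    and w: "\<And>x. x \<noteq> 0 \<Longrightarrow> (w has_real_derivative w' x) (at x)"
    and ode: "\<And>x. x \<noteq> 0 \<Longrightarrow> \<sigma>\<^sup>2 * x * w' x + (\<sigma>\<^sup>2 * s + 2 * \<theta> * x) * w x + (s * \<theta> - x) * v x = g x"
    and w0: "((\<lambda>x. \<bar>x\<bar> powr s * w x) \<longlongrightarrow> 0) (at 0)"
  shows "\<exists>c. (w \<longlongrightarrow> c) (at 0) \<and> (v has_real_derivative c) (at 0)"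
proof -
  define c where "c = (g 0 - s * \<theta> * v 0) / (\<sigma>\<^sup>2 * s)"
  have abs_right: "((\<lambda>x. x powr s * f x) \<longlongrightarrow> 0) (at_right 0)" if "((\<lambda>x. \<bar>x\<bar> powr s * f x) \<longlongrightarrow> 0) (at_right (0::real))" for f
    using that by (rule Lim_transform_eventually) (auto intro: eventually_mono[OF eventually_at_right_less[of "0::real"]])
  have r: "(w \<longlongrightarrow> c) (at_right 0)"
    unfolding c_def
  proof (rule stein_tendsto_right_0[OF \<sigma> s, where v = v and g = g and w' = w'])
    show "(v \<longlongrightarrow> v 0) (at_right 0)" "(g \<longlongrightarrow> g 0) (at_right 0)"
      using v0 g0 by (auto simp: isCont_def filterlim_at_split)
    show "((\<lambda>x. x powr s * w x) \<longlongrightarrow> 0) (at_right 0)"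
      using w0 by (intro abs_right) (auto simp: filterlim_at_split)
  qed (use w ode in auto)
  \<comment> \<open>Reflection changes the signs of w, g and \<theta> together, so the left limit is
    the same \<open>c\<close>.\<close>
  have "((\<lambda>x. - w (- x)) \<longlongrightarrow> (- g 0 - s * - \<theta> * v 0) / (\<sigma>\<^sup>2 * s)) (at_right 0)"
  proof (rule stein_tendsto_right_0[OF \<sigma> s, where v = "\<lambda>x. v (- x)" and g = "\<lambda>x. - g (- x)" and w' = "\<lambda>x. w' (- x)"])
    show "((\<lambda>x. v (- x)) \<longlongrightarrow> v 0) (at_right 0)" "((\<lambda>x. - g (- x)) \<longlongrightarrow> - g 0) (at_right 0)"
      using v0 g0 filterlim_at_left_to_right[of v "nhds (v 0)" 0] filterlim_at_left_to_right[of g "nhds (g 0)" 0]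
      by (auto simp: isCont_def filterlim_at_split intro!: tendsto_minus)
    show "((\<lambda>x. x powr s * - w (- x)) \<longlongrightarrow> 0) (at_right 0)"
    proof (rule abs_right)
      have "((\<lambda>x. \<bar>- x\<bar> powr s * w (- x)) \<longlongrightarrow> 0) (at_right 0)"
        using w0 filterlim_at_left_to_right[of "\<lambda>x. \<bar>x\<bar> powr s * w x" "nhds 0" 0] by (simp add: filterlim_at_split)
      from tendsto_minus[OF this] show "((\<lambda>x. \<bar>x\<bar> powr s * - w (- x)) \<longlongrightarrow> 0) (at_right 0)" by simp
    qed
    fix x :: real assume x: "x > 0"
    show "((\<lambda>x. - w (- x)) has_real_derivative w' (- x)) (at x)"
      using DERIV_minus[OF DERIV_reflect[OF w[of "- x"]]] x by simp
    show "\<sigma>\<^sup>2 * x * w' (- x) + (\<sigma>\<^sup>2 * s + 2 * - \<theta> * x) * - w (- x) + (s * - \<theta> - x) * v (- x) = - g (- x)"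
      using ode[of "- x"] x by (simp add: algebra_simps)
  qed
  from tendsto_minus[OF this] have "((\<lambda>x. w (- x)) \<longlongrightarrow> c) (at_right 0)"
    by (simp add: c_def minus_divide_left)
  then have "(w \<longlongrightarrow> c) (at_left 0)" by (simp add: filterlim_at_left_to_right)
  with r have wc: "(w \<longlongrightarrow> c) (at 0)" by (simp add: filterlim_at_split)
  \<comment> \<open>By L'Hopital the difference quotient of v at 0 inherits the limit of its
    derivative, so v is differentiable at 0 as well.\<close>
  have "((\<lambda>x. (v x - v 0) / (x - 0)) \<longlongrightarrow> c) (at 0)"
  proof (rule lhopital[where f' = w and g' = "\<lambda>_. 1"])
    show "((\<lambda>x. v x - v 0) \<longlongrightarrow> 0) (at 0)" using v0 by (intro LIM_zero) (simp add: isCont_def)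
    show "((\<lambda>x. x - 0) \<longlongrightarrow> (0::real)) (at 0)" by (intro tendsto_eq_intros) auto
    have "\<forall>\<^sub>F x in at (0::real). x \<noteq> 0" by (simp add: eventually_at_filter)
    then show "\<forall>\<^sub>F x in at (0::real). x - 0 \<noteq> 0" "\<forall>\<^sub>F x in at 0. ((\<lambda>x. v x - v 0) has_real_derivative w x) (at x)"
      using v by (auto elim!: eventually_mono intro!: derivative_eq_intros)
    show "\<forall>\<^sub>F x in at (0::real). ((\<lambda>x. x - 0) has_real_derivative 1) (at x)"
      by (intro always_eventually allI) (auto intro!: derivative_eq_intros)
  qed (use wc in auto)
  then show ?thesis using wc by (auto simp: has_field_derivative_iff)
qed

section \<open>The explicit solution on the two half-lines\<close>

context vg_parameters
begin

text \<open>The variance-gamma density up to a positive constant, in the normalisation of the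
  kernel: exp (b x) P(|x|).\<close>

definition vg_weight where "vg_weight r x = exp (b * x) * ((\<alpha> * \<bar>x\<bar>) powr ((r - 1) / 2) * bessel_K ((r - 1) / 2) (\<alpha> * \<bar>x\<bar>))"

text \<open>The powers of \<alpha> split off from \<open>I\<close> and \<open>P\<close> are
  reciprocal to each other, so they cancel in each product of a kernel with an integral.\<close>

lemma stein_formula_pos:
  assumes r: "r > 0" and x: "x > 0"
  shows "vg_stein_formula r \<theta> \<sigma> g x = 1 / \<sigma>\<^sup>2 * vg_kernel.sol r ((r - 1) / 2) \<alpha> b g x"
proof -
  define \<nu> where "\<nu> = (r - 1) / 2"
  interpret vg_kernel r \<nu> \<alpha> unfolding \<nu>_def by (rule kernel[OF r])
  have I: "t powr (r - 1) * I t = \<alpha> powr (- \<nu>) * (t powr \<nu> * bessel_I \<nu> (\<alpha> * t))" if "t > 0" for t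
  proof -
    have "bessel_I \<nu> (\<alpha> * t) = (\<alpha> * t / 2) powr \<nu> * bessel_E \<nu> ((\<alpha> * t / 2)\<^sup>2)"
      using \<nu>_gt \<alpha>_pos that by (intro bessel_I_eq_bessel_E) auto
    also have "(\<alpha> * t / 2) powr \<nu> = \<alpha> powr \<nu> * t powr \<nu> * 2 powr (- \<nu>)"
      using that \<alpha>_pos by (simp add: powr_mult powr_divide powr_minus field_simps)
    finally show ?thesis using that \<alpha>_pos unfolding I_def r_eq by (simp add: powr_minus field_simps flip: powr_add)
  qed
  have "I x = x powr (1 - r) * (x powr (r - 1) * I x)" using x by (simp add: mult.assoc[symmetric] flip: powr_add)
  also have "\<dots> = \<alpha> powr (- \<nu>) * (x powr (- \<nu>) * bessel_I \<nu> (\<alpha> * x))"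
  proof -
    have "x powr (1 - r) * x powr \<nu> = x powr (- \<nu>)" by (simp add: r_eq flip: powr_add)
    then show ?thesis unfolding I[OF x] by (simp add: mult_ac)
  qed
  finally have Ix: "I x = \<alpha> powr (- \<nu>) * (x powr (- \<nu>) * bessel_I \<nu> (\<alpha> * x))" .
  have Pt: "P t = \<alpha> powr \<nu> * (t powr \<nu> * bessel_K \<nu> (\<alpha> * t))" if "t > 0" for t
    using that \<alpha>_pos by (simp add: P_def powr_mult)
  have Kx: "K x = \<alpha> powr \<nu> * (x powr (- \<nu>) * bessel_K \<nu> (\<alpha> * x))"
  proof -
    have "x powr (1 - r) * x powr \<nu> = x powr (- \<nu>)" by (simp add: r_eq flip: powr_add)
    then show ?thesis unfolding K_def Pt[OF x] by (simp add: mult_ac)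
  qed
  have aa: "\<alpha> powr \<nu> * \<alpha> powr (- \<nu>) = 1" using \<alpha>_pos by (simp flip: powr_add)
  have h: "head b g x = \<alpha> powr (- \<nu>) * (LBINT t=0..x. exp (\<theta> * t / \<sigma>\<^sup>2) * \<bar>t\<bar> powr \<nu> * bessel_I \<nu> (\<alpha> * \<bar>t\<bar>) * g t)"
    unfolding head_def interval_lebesgue_integral_mult_right[symmetric] using x
    by (intro interval_integral_cong) (auto simp: I b_def einterval_def zero_ereal_def mult_ac)
  have t: "tail b g x = \<alpha> powr \<nu> * (LBINT t=x..\<infinity>. exp (\<theta> * t / \<sigma>\<^sup>2) * \<bar>t\<bar> powr \<nu> * bessel_K \<nu> (\<alpha> * \<bar>t\<bar>) * g t)"
    unfolding tail_def interval_lebesgue_integral_mult_right[symmetric] using x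
    by (intro interval_integral_cong) (auto simp: Pt b_def einterval_def mult_ac)
  define H where "H = (LBINT t=0..x. exp (\<theta> * t / \<sigma>\<^sup>2) * \<bar>t\<bar> powr \<nu> * bessel_I \<nu> (\<alpha> * \<bar>t\<bar>) * g t)"
  define T where "T = (LBINT t=x..\<infinity>. exp (\<theta> * t / \<sigma>\<^sup>2) * \<bar>t\<bar> powr \<nu> * bessel_K \<nu> (\<alpha> * \<bar>t\<bar>) * g t)"
  have "sol b g x = - (exp (- b * x) * x powr (- \<nu>) * ((\<alpha> powr \<nu> * \<alpha> powr (- \<nu>)) * (bessel_K \<nu> (\<alpha> * x) * H + bessel_I \<nu> (\<alpha> * x) * T)))"
    unfolding sol_def h t H_def[symmetric] T_def[symmetric] Kx Ix by (simp add: algebra_simps)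
  then have "1 / \<sigma>\<^sup>2 * sol b g x = - (exp (- b * x) * x powr (- \<nu>) / \<sigma>\<^sup>2 * (bessel_K \<nu> (\<alpha> * x) * H + bessel_I \<nu> (\<alpha> * x) * T))"
    unfolding aa by simp
  also have "\<dots> = vg_stein_formula r \<theta> \<sigma> g x"
  proof -
    have "\<bar>x\<bar> = x" using x by simp
    then show ?thesis
      unfolding vg_stein_formula_def Let_def \<alpha>_def[symmetric] \<nu>_def[symmetric] H_def[symmetric] T_def[symmetric]
      by (simp add: b_def powr_minus field_simps add_divide_distrib)
  qed
  finally show ?thesis by (simp add: \<nu>_def)
qed

end

lemma vg_weight_reflect:
  assumes "\<sigma> > 0"
  shows "vg_parameters.vg_weight (- \<theta>) \<sigma> r x = vg_parameters.vg_weight \<theta> \<sigma> r (- x)"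
  using assms
  by (simp add: vg_parameters.vg_weight_def vg_parameters_def vg_parameters.b_def vg_parameters.\<alpha>_def)

context vg_parameters
begin

text \<open>Mean zero makes the integral of g against the weight over (-x, \<infinity>) the negative
  of the one over (-\<infinity>, -x), which reflects into a tail integral from x. Without it the
  formula for negative arguments would involve a growing kernel times a nonvanishing
  integral.\<close>

lemma stein_formula_reflect:
  assumes r: "r > 0" and x: "x > 0" and int: "integrable lborel (\<lambda>t. vg_weight r t * g t)" and mean: "(LINT t|lborel. vg_weight r t * g t) = 0"
  shows "vg_stein_formula r \<theta> \<sigma> g (- x) = vg_stein_formula r (- \<theta>) \<sigma> (\<lambda>t. - g (- t)) x"
proof -
  define \<nu> where "\<nu> = (r - 1) / 2"
  define \<phi> where "\<phi> t = exp (\<theta> * t / \<sigma>\<^sup>2) * \<bar>t\<bar> powr \<nu> * bessel_I \<nu> (\<alpha> * \<bar>t\<bar>) * g t" for t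
  define \<psi> where "\<psi> t = exp (\<theta> * t / \<sigma>\<^sup>2) * \<bar>t\<bar> powr \<nu> * bessel_K \<nu> (\<alpha> * \<bar>t\<bar>) * g t" for t
  have "(LBINT t=0..ereal (- x). \<phi> t) = (LBINT t=- ereal (- x)..- 0. \<phi> (- t))" by (rule interval_integral_reflect)
  also have "\<dots> = - (LBINT t=0..ereal x. \<phi> (- t))" using interval_integral_endpoints_reverse[of "ereal x" 0] by simp
  finally have 1: "(LBINT t=0..ereal (- x). \<phi> t) = (LBINT t=0..ereal x. - \<phi> (- t))"
    by (simp add: interval_lebesgue_integral_uminus)
  have "\<alpha> powr \<nu> * \<psi> t = vg_weight r t * g t" for t
    using \<alpha>_pos by (simp add: \<psi>_def vg_weight_def b_def \<nu>_def powr_mult mult_ac)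
  then have "integrable lborel (\<lambda>t. \<alpha> powr \<nu> * \<psi> t)" "(LINT t|lborel. \<alpha> powr \<nu> * \<psi> t) = 0" using int mean by simp_all
  then have i\<psi>: "integrable lborel \<psi>" "(LINT t|lborel. \<psi> t) = 0" using \<alpha>_pos by auto
  have is\<psi>: "set_integrable lborel S \<psi>" if "S \<in> sets borel" for S
    using i\<psi>(1) set_integrable_subset[of lborel UNIV \<psi> S] that by (simp add: set_integrable_def)
  have "(LBINT t=-\<infinity>..ereal (- x). \<psi> t) + (LBINT t=ereal (- x)..\<infinity>. \<psi> t) = (LBINT t=-\<infinity>..\<infinity>. \<psi> t)"
    by (intro interval_integral_sum) (auto simp: interval_lebesgue_integrable_def min_def max_def intro!: is\<psi>)
  also have "\<dots> = 0" using i\<psi>(2) by (simp add: interval_lebesgue_integral_def einterval_def set_lebesgue_integral_def)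
  finally have "(LBINT t=ereal (- x)..\<infinity>. \<psi> t) = - (LBINT t=-\<infinity>..ereal (- x). \<psi> t)" by simp
  also have "(LBINT t=-\<infinity>..ereal (- x). \<psi> t) = (LBINT t=- ereal (- x)..- (-\<infinity>). \<psi> (- t))" by (rule interval_integral_reflect)
  finally have 2: "(LBINT t=ereal (- x)..\<infinity>. \<psi> t) = (LBINT t=ereal x..\<infinity>. - \<psi> (- t))"
    by (simp add: interval_lebesgue_integral_uminus)
  have \<phi>': "- \<phi> (- t) = exp (- \<theta> * t / \<sigma>\<^sup>2) * \<bar>t\<bar> powr \<nu> * bessel_I \<nu> (\<alpha> * \<bar>t\<bar>) * - g (- t)" for t by (simp add: \<phi>_def)
  have \<psi>': "- \<psi> (- t) = exp (- \<theta> * t / \<sigma>\<^sup>2) * \<bar>t\<bar> powr \<nu> * bessel_K \<nu> (\<alpha> * \<bar>t\<bar>) * - g (- t)" for t by (simp add: \<psi>_def)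
  show ?thesis
    unfolding vg_stein_formula_def Let_def power2_minus \<alpha>_def[symmetric] \<nu>_def[symmetric] \<phi>_def[symmetric] \<psi>_def[symmetric] 1 2
    unfolding \<phi>' \<psi>' by simp
qed

end

context vg_parameters
begin

lemma sqrt_eq: "sqrt (\<theta>\<^sup>2 + \<sigma>\<^sup>2) = \<alpha> * \<sigma>\<^sup>2"
  using \<sigma>_pos by (simp add: \<alpha>_def)

text \<open>The limit at 0 is stated as an integral of the weight because the two half-lines are
  matched through the mean of g.\<close>

lemma stein_half_line:
  assumes r: "r > 0" and cont: "continuous_on {0<..} g" and bd: "\<And>t. t > 0 \<Longrightarrow> \<bar>g t\<bar> \<le> G"
  defines "F \<equiv> vg_stein_formula r \<theta> \<sigma> g"
  shows "\<exists>F1 F2. (\<forall>x>0. (F has_real_derivative F1 x) (at x) \<and> (F1 has_real_derivative F2 x) (at x) \<and>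
      \<sigma>\<^sup>2 * x * F2 x + (\<sigma>\<^sup>2 * r + 2 * \<theta> * x) * F1 x + (r * \<theta> - x) * F x = g x \<and>
      \<bar>F x\<bar> \<le> (2 / r + vg_C r \<theta> \<sigma>) / sqrt (\<theta>\<^sup>2 + \<sigma>\<^sup>2) * G \<and> \<bar>F1 x\<bar> \<le> (2 / r + vg_C r \<theta> \<sigma>) / \<sigma>\<^sup>2 * G)"
    and "(F \<longlongrightarrow> - (vg_kernel.I ((r - 1) / 2) \<alpha> 0 / \<sigma>\<^sup>2 * (LINT t:{0<..}|lborel. vg_weight r t * g t))) (at_right 0)"
proof -
  interpret vg_kernel r "(r - 1) / 2" \<alpha> by (rule kernel[OF r])
  have G: "G \<ge> 0" using bd[of 1] by simp
  have F: "F x = 1 / \<sigma>\<^sup>2 * sol b g x" if "x > 0" for x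
    unfolding F_def by (rule stein_formula_pos[OF r that])
  define F1 where "F1 x = 1 / \<sigma>\<^sup>2 * sol' b g x" for x
  define F2 where "F2 x = 1 / \<sigma>\<^sup>2 * ((g x - (r + 2 * b * x) * sol' b g x - (r * b - (\<alpha>\<^sup>2 - b\<^sup>2) * x) * sol b g x) / x)" for x
  have C1: "0 \<le> G * (2 / r + C1 b) \<and> G * (2 / r + C1 b) \<le> G * (2 / r + vg_C r \<theta> \<sigma>)"
    using sol_bounds(2)[OF b_less cont bd zero_less_one] C1_le[OF r] G by (auto intro!: mult_left_mono)
  have "\<forall>x>0. (F has_real_derivative F1 x) (at x) \<and> (F1 has_real_derivative F2 x) (at x) \<and>
      \<sigma>\<^sup>2 * x * F2 x + (\<sigma>\<^sup>2 * r + 2 * \<theta> * x) * F1 x + (r * \<theta> - x) * F x = g x \<and>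
      \<bar>F x\<bar> \<le> (2 / r + vg_C r \<theta> \<sigma>) / sqrt (\<theta>\<^sup>2 + \<sigma>\<^sup>2) * G \<and> \<bar>F1 x\<bar> \<le> (2 / r + vg_C r \<theta> \<sigma>) / \<sigma>\<^sup>2 * G"
  proof (intro allI impI conjI)
    fix x :: real assume x: "x > 0"
    have "((\<lambda>x. 1 / \<sigma>\<^sup>2 * sol b g x) has_real_derivative F1 x) (at x)"
      unfolding F1_def by (intro DERIV_cmult has_deriv_sol[OF b_less cont bd x])
    then show "(F has_real_derivative F1 x) (at x)"
      by (rule has_field_derivative_transform_within_open[of _ _ _ "{0<..}"]) (use x F in auto)
    show "(F1 has_real_derivative F2 x) (at x)"
      unfolding F1_def[abs_def] F2_def by (intro DERIV_cmult has_deriv_sol'[OF b_less cont bd x])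
    have "\<sigma>\<^sup>2 * x * F2 x = g x - (r + 2 * b * x) * sol' b g x - (r * b - (\<alpha>\<^sup>2 - b\<^sup>2) * x) * sol b g x"
      using x \<sigma>_pos by (simp add: F2_def)
    then show "\<sigma>\<^sup>2 * x * F2 x + (\<sigma>\<^sup>2 * r + 2 * \<theta> * x) * F1 x + (r * \<theta> - x) * F x = g x"
      unfolding F[OF x] F1_def \<alpha>2_b2 unfolding b_def using \<sigma>_pos by (simp add: field_simps)
    have "\<bar>F x\<bar> = 1 / \<sigma>\<^sup>2 * \<bar>sol b g x\<bar>" using \<sigma>_pos by (simp add: F[OF x] abs_mult)
    also have "\<dots> \<le> 1 / \<sigma>\<^sup>2 * (G * (2 / r + C1 b) / \<alpha>)"
      using sol_bounds(1)[OF b_less cont bd x] by (intro mult_left_mono) auto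
    also have "\<dots> \<le> 1 / \<sigma>\<^sup>2 * (G * (2 / r + vg_C r \<theta> \<sigma>) / \<alpha>)"
      using \<alpha>_pos by (intro mult_left_mono[OF divide_right_mono[OF conjunct2[OF C1]]]) auto
    finally show "\<bar>F x\<bar> \<le> (2 / r + vg_C r \<theta> \<sigma>) / sqrt (\<theta>\<^sup>2 + \<sigma>\<^sup>2) * G" unfolding sqrt_eq by (simp add: mult_ac)
    have "\<bar>F1 x\<bar> = 1 / \<sigma>\<^sup>2 * \<bar>sol' b g x\<bar>" using \<sigma>_pos by (simp add: F1_def abs_mult)
    also have "\<dots> \<le> 1 / \<sigma>\<^sup>2 * (G * (2 / r + C1 b))"
      using sol_bounds(2)[OF b_less cont bd x] by (intro mult_left_mono) auto
    also have "\<dots> \<le> 1 / \<sigma>\<^sup>2 * (G * (2 / r + vg_C r \<theta> \<sigma>))"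
      by (intro mult_left_mono[OF conjunct2[OF C1]]) auto
    finally show "\<bar>F1 x\<bar> \<le> (2 / r + vg_C r \<theta> \<sigma>) / \<sigma>\<^sup>2 * G" by (simp add: mult_ac)
  qed
  then show "\<exists>F1 F2. (\<forall>x>0. (F has_real_derivative F1 x) (at x) \<and> (F1 has_real_derivative F2 x) (at x) \<and>
      \<sigma>\<^sup>2 * x * F2 x + (\<sigma>\<^sup>2 * r + 2 * \<theta> * x) * F1 x + (r * \<theta> - x) * F x = g x \<and>
      \<bar>F x\<bar> \<le> (2 / r + vg_C r \<theta> \<sigma>) / sqrt (\<theta>\<^sup>2 + \<sigma>\<^sup>2) * G \<and> \<bar>F1 x\<bar> \<le> (2 / r + vg_C r \<theta> \<sigma>) / \<sigma>\<^sup>2 * G)"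
    by blast
  have "(LBINT t=0..\<infinity>. exp (b * t) * P t * g t) = (LINT t:{0<..}|lborel. exp (b * t) * P t * g t)"
    by (simp add: interval_lebesgue_integral_0_infty)
  also have "\<dots> = (LINT t:{0<..}|lborel. vg_weight r t * g t)"
    by (intro set_lebesgue_integral_cong) (auto simp: vg_weight_def P_def)
  finally have "((\<lambda>x. 1 / \<sigma>\<^sup>2 * sol b g x) \<longlongrightarrow> 1 / \<sigma>\<^sup>2 * - (I 0 * (LINT t:{0<..}|lborel. vg_weight r t * g t))) (at_right 0)"
    using tendsto_sol[OF b_less cont bd] by (intro tendsto_mult tendsto_const) simp
  moreover have "\<forall>\<^sub>F x in at_right 0. 1 / \<sigma>\<^sup>2 * sol b g x = F x"
    using eventually_at_right_less[of 0] by eventually_elim (simp add: F)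
  ultimately have "(F \<longlongrightarrow> 1 / \<sigma>\<^sup>2 * - (I 0 * (LINT t:{0<..}|lborel. vg_weight r t * g t))) (at_right 0)"
    by (rule Lim_transform_eventually)
  then show "(F \<longlongrightarrow> - (I 0 / \<sigma>\<^sup>2 * (LINT t:{0<..}|lborel. vg_weight r t * g t))) (at_right 0)" by simp
qed

end

text \<open>Two half-line solutions, the second for reflected data, are glued at 0. Their limits are
  given by the weighted integrals of g over the two half-lines, which are negatives of each other
  since the mean is 0; the reflected datum -g(-t) restores the sign. The bound on the derivative off
  0 then yields differentiability at 0.\<close>

lemma stein_solution:
  fixes r \<theta> \<sigma> G :: real and g :: "real \<Rightarrow> real"
  assumes r: "r > 0" and \<sigma>: "\<sigma> > 0" and cont: "\<And>x. isCont g x" and bd: "\<And>x. \<bar>g x\<bar> \<le> G"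
    and int: "integrable lborel (\<lambda>t. vg_parameters.vg_weight \<theta> \<sigma> r t * g t)"
    and mean: "(LINT t|lborel. vg_parameters.vg_weight \<theta> \<sigma> r t * g t) = 0"
  defines "f \<equiv> vg_stein_sol r \<theta> \<sigma> g"
  shows "\<exists>f1 f2. (\<forall>x. (f has_real_derivative f1 x) (at x)) \<and> isCont f1 0 \<and>
      (\<forall>x. x \<noteq> 0 \<longrightarrow> (f1 has_real_derivative f2 x) (at x) \<and>
        \<sigma>\<^sup>2 * x * f2 x + (\<sigma>\<^sup>2 * r + 2 * \<theta> * x) * f1 x + (r * \<theta> - x) * f x = g x) \<and>
      (\<forall>x. \<bar>f x\<bar> \<le> (2 / r + vg_C r \<theta> \<sigma>) / sqrt (\<theta>\<^sup>2 + \<sigma>\<^sup>2) * G \<and> \<bar>f1 x\<bar> \<le> (2 / r + vg_C r \<theta> \<sigma>) / \<sigma>\<^sup>2 * G)"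
proof -
  interpret p: vg_parameters \<theta> \<sigma> using \<sigma> by unfold_locales
  interpret m: vg_parameters "- \<theta>" \<sigma> using \<sigma> by unfold_locales
  define B0 where "B0 = (2 / r + vg_C r \<theta> \<sigma>) / sqrt (\<theta>\<^sup>2 + \<sigma>\<^sup>2) * G"
  define B1 where "B1 = (2 / r + vg_C r \<theta> \<sigma>) / \<sigma>\<^sup>2 * G"
  define F where "F = vg_stein_formula r \<theta> \<sigma> g"
  define M where "M = vg_stein_formula r (- \<theta>) \<sigma> (\<lambda>t. - g (- t))"
  have contp: "continuous_on {0<..} g" using cont by (intro continuous_at_imp_continuous_on) auto
  have "isCont (\<lambda>t. - g (- t)) x" for x using cont by (intro continuous_intros isCont_o2[of x uminus g]) auto
  then have contm: "continuous_on {0<..} (\<lambda>t. - g (- t))" by (intro continuous_at_imp_continuous_on) auto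
  have bdm: "\<bar>- g (- t)\<bar> \<le> G" for t using bd[of "- t"] by simp
  obtain F1 F2 where F: "\<And>x. x > 0 \<Longrightarrow> (F has_real_derivative F1 x) (at x)" "\<And>x. x > 0 \<Longrightarrow> (F1 has_real_derivative F2 x) (at x)"
      "\<And>x. x > 0 \<Longrightarrow> \<sigma>\<^sup>2 * x * F2 x + (\<sigma>\<^sup>2 * r + 2 * \<theta> * x) * F1 x + (r * \<theta> - x) * F x = g x"
      "\<And>x. x > 0 \<Longrightarrow> \<bar>F x\<bar> \<le> B0" "\<And>x. x > 0 \<Longrightarrow> \<bar>F1 x\<bar> \<le> B1"
    using p.stein_half_line(1)[OF r contp bd] unfolding F_def B0_def B1_def by blast
  obtain M1 M2 where M: "\<And>x. x > 0 \<Longrightarrow> (M has_real_derivative M1 x) (at x)" "\<And>x. x > 0 \<Longrightarrow> (M1 has_real_derivative M2 x) (at x)"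
      "\<And>x. x > 0 \<Longrightarrow> \<sigma>\<^sup>2 * x * M2 x + (\<sigma>\<^sup>2 * r + 2 * - \<theta> * x) * M1 x + (r * - \<theta> - x) * M x = - g (- x)"
      "\<And>x. x > 0 \<Longrightarrow> \<bar>M x\<bar> \<le> B0" "\<And>x. x > 0 \<Longrightarrow> \<bar>M1 x\<bar> \<le> B1"
    using m.stein_half_line(1)[OF r contm bdm] unfolding M_def B0_def B1_def vg_C_minus power2_minus by blast
  have FM: "F (- x) = M x" if "x > 0" for x
    unfolding F_def M_def by (rule p.stein_formula_reflect[OF r that int mean])
  \<comment> \<open>Common to both half-lines, since the kernel depends on \<theta> only through
    \<theta>^2.\<close>
  define \<kappa> where "\<kappa> = vg_kernel.I ((r - 1) / 2) p.\<alpha> 0 / \<sigma>\<^sup>2"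
  define A where "A = (LINT t:{0<..}|lborel. p.vg_weight r t * g t)"
  have Fr: "(F \<longlongrightarrow> - (\<kappa> * A)) (at_right 0)"
    using p.stein_half_line(2)[OF r contp bd] unfolding F_def \<kappa>_def A_def .
  have "(M \<longlongrightarrow> - (\<kappa> * (LINT t:{0<..}|lborel. m.vg_weight r t * - g (- t)))) (at_right 0)"
    using m.stein_half_line(2)[OF r contm bdm] unfolding M_def \<kappa>_def p.\<alpha>_def m.\<alpha>_def power2_minus .
  also have "(LINT t:{0<..}|lborel. m.vg_weight r t * - g (- t)) = A"
  proof -
    let ?\<psi> = "\<lambda>t. p.vg_weight r t * g t"
    have is\<psi>: "set_integrable lborel S ?\<psi>" if "S \<in> sets borel" for S
      using int set_integrable_subset[of lborel UNIV ?\<psi> S] that by (simp add: set_integrable_def)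
    have "(LINT t|lborel. ?\<psi> t) = (LINT t:{0<..} \<union> {..<0}|lborel. ?\<psi> t)"
      unfolding set_lebesgue_integral_def
    proof (rule integral_cong_AE)
      show m: "?\<psi> \<in> borel_measurable lborel" using int by simp
      then show "(\<lambda>t. indicator ({0<..} \<union> {..<0}) t *\<^sub>R ?\<psi> t) \<in> borel_measurable lborel" by measurable
      show "AE t in lborel. ?\<psi> t = indicator ({0<..} \<union> {..<0}) t *\<^sub>R ?\<psi> t"
        using AE_lborel_singleton[of 0] by eventually_elim (auto simp: indicator_def)
    qed
    also have "\<dots> = A + (LINT t:{..<0}|lborel. ?\<psi> t)"
      unfolding A_def by (intro set_integral_Un is\<psi>) auto
    also have "(LINT t:{..<0}|lborel. ?\<psi> t) = (LINT t|lborel. indicator {..<0} (0 + (- 1) * t) *\<^sub>R ?\<psi> (0 + (- 1) * t))"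
      unfolding set_lebesgue_integral_def by (subst lborel_integral_real_affine[where c = "- 1" and t = 0]) auto
    also have "\<dots> = (LINT t:{0<..}|lborel. - (m.vg_weight r t * - g (- t)))"
      unfolding set_lebesgue_integral_def vg_weight_reflect[OF \<sigma>]
      by (intro Bochner_Integration.integral_cong) (auto simp: indicator_def)
    also have "\<dots> = - (LINT t:{0<..}|lborel. m.vg_weight r t * - g (- t))"
      by (simp add: set_lebesgue_integral_def)
    finally show ?thesis using mean by simp
  qed
  finally have Mr: "(M \<longlongrightarrow> - (\<kappa> * A)) (at_right 0)" .
  have "((\<lambda>x. F (- x)) \<longlongrightarrow> - (\<kappa> * A)) (at_right 0)"
    using Mr by (rule Lim_transform_eventually) (auto intro: eventually_mono[OF eventually_at_right_less[of "0::real"]] simp: FM)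
  then have "(F \<longlongrightarrow> - (\<kappa> * A)) (at_left 0)" by (simp add: filterlim_at_left_to_right)
  with Fr have F0: "(F \<longlongrightarrow> - (\<kappa> * A)) (at 0)" by (simp add: filterlim_at_split)
  then have f0: "f 0 = - (\<kappa> * A)" unfolding f_def vg_stein_sol_def F_def by (simp add: tendsto_Lim)
  have fF: "f x = F x" if "x \<noteq> 0" for x using that by (simp add: f_def vg_stein_sol_def F_def)
  have evF: "\<forall>\<^sub>F x in at 0. F x = f x" by (auto simp: eventually_at_filter fF)
  have fcont: "isCont f 0" unfolding isCont_def f0 using Lim_transform_eventually[OF F0 evF] .
  define w where "w x = (if x > 0 then F1 x else - M1 (- x))" for x
  define w' where "w' x = (if x > 0 then F2 x else M2 (- x))" for x
  have fM: "f x = M (- x)" if "x < 0" for x using FM[of "- x"] fF[of x] that by simp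
  have df: "(f has_real_derivative w x) (at x)" if "x \<noteq> 0" for x
  proof (cases "x > 0")
    case True
    have "(F has_real_derivative w x) (at x)" using F(1)[OF True] True by (simp add: w_def)
    then show ?thesis
      by (rule has_field_derivative_transform_within_open[of _ _ _ "{0<..}"]) (use True fF in auto)
  next
    case False
    then have x: "- x > 0" using that by simp
    have "((\<lambda>x. M (- x)) has_real_derivative w x) (at x)"
      using DERIV_reflect[OF M(1)[OF x]] False by (simp add: w_def)
    then show ?thesis
      by (rule has_field_derivative_transform_within_open[of _ _ _ "{..<0}"]) (use x fM in auto)
  qed
  have dw: "(w has_real_derivative w' x) (at x)" if "x \<noteq> 0" for x
  proof (cases "x > 0")
    case True
    have "(F1 has_real_derivative w' x) (at x)" using F(2)[OF True] True by (simp add: w'_def)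
    then show ?thesis
      by (rule has_field_derivative_transform_within_open[of _ _ _ "{0<..}"]) (use True w_def in auto)
  next
    case False
    then have x: "- x > 0" using that by simp
    have "((\<lambda>x. - M1 (- x)) has_real_derivative w' x) (at x)"
      using DERIV_minus[OF DERIV_reflect[OF M(2)[OF x]]] False by (simp add: w'_def)
    then show ?thesis
      by (rule has_field_derivative_transform_within_open[of _ _ _ "{..<0}"]) (use x w_def in auto)
  qed
  have ode: "\<sigma>\<^sup>2 * x * w' x + (\<sigma>\<^sup>2 * r + 2 * \<theta> * x) * w x + (r * \<theta> - x) * f x = g x" if "x \<noteq> 0" for x
  proof (cases "x > 0")
    case True
    then show ?thesis using F(3)[OF True] by (simp add: w_def w'_def fF)
  next
    case False
    then have x: "- x > 0" using that by simp
    then show ?thesis using M(3)[OF x] by (simp add: w_def w'_def fM algebra_simps)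
  qed
  have wB: "\<bar>w x\<bar> \<le> B1" if "x \<noteq> 0" for x
    using F(5)[of x] M(5)[of "- x"] that by (auto simp: w_def)
  have fB: "\<bar>f x\<bar> \<le> B0" if "x \<noteq> 0" for x
  proof (cases "x > 0")
    case True
    then show ?thesis using F(4)[of x] by (simp add: fF)
  next
    case False
    then show ?thesis using M(4)[of "- x"] that by (simp add: fM)
  qed
  have evB: "\<forall>\<^sub>F x in at 0. \<bar>w x\<bar> \<le> B1" "\<forall>\<^sub>F x in at 0. \<bar>f x\<bar> \<le> B0"
    using wB fB by (auto simp: eventually_at_filter)
  have "((\<lambda>x. \<bar>x\<bar> powr r) \<longlongrightarrow> 0) (at (0::real))"
  proof -
    have "((\<lambda>x. \<bar>x\<bar> powr r) \<longlongrightarrow> \<bar>0\<bar> powr r) (at (0::real))" using r by (intro tendsto_powr' tendsto_intros) auto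
    then show ?thesis by simp
  qed
  then have "((\<lambda>x. \<bar>x\<bar> powr r * w x) \<longlongrightarrow> 0) (at 0)"
    by (rule lim_null_mult_right_bounded[where B = B1]) (use evB in simp)
  then obtain c where c: "(w \<longlongrightarrow> c) (at 0)" "(f has_real_derivative c) (at 0)"
    using stein_deriv_at_0[OF \<sigma> r fcont cont df dw ode] by blast
  define f1 where "f1 = w(0 := c)"
  have f1w: "f1 x = w x" if "x \<noteq> 0" for x using that by (simp add: f1_def)
  have evw: "\<forall>\<^sub>F x in at 0. w x = f1 x" by (auto simp: eventually_at_filter f1w)
  have "(f1 \<longlongrightarrow> c) (at 0)" by (rule Lim_transform_eventually[OF c(1) evw])
  moreover have "f1 0 = c" by (simp add: f1_def)
  ultimately have "isCont f1 0" by (simp add: isCont_def)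
  moreover have "(f has_real_derivative f1 x) (at x)" for x using df c by (simp add: f1_def)
  moreover have "(f1 has_real_derivative w' x) (at x)" if "x \<noteq> 0" for x
    using dw[OF that] by (rule has_field_derivative_transform_within_open[of _ _ _ "- {0}"]) (use that f1w in auto)
  moreover have "\<sigma>\<^sup>2 * x * w' x + (\<sigma>\<^sup>2 * r + 2 * \<theta> * x) * f1 x + (r * \<theta> - x) * f x = g x" if "x \<noteq> 0" for x
    using ode[OF that] f1w[OF that] by simp
  moreover have "\<bar>f x\<bar> \<le> B0" for x
  proof (cases "x = 0")
    case True
    have "((\<lambda>x. \<bar>f x\<bar>) \<longlongrightarrow> \<bar>f 0\<bar>) (at 0)" using fcont by (intro tendsto_rabs) (simp add: isCont_def)
    then show ?thesis using tendsto_upperbound[OF _ evB(2)] True by simp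
  qed (use fB in auto)
  moreover have "\<bar>f1 x\<bar> \<le> B1" for x
  proof (cases "x = 0")
    case True
    have "((\<lambda>x. \<bar>w x\<bar>) \<longlongrightarrow> \<bar>c\<bar>) (at 0)" using c(1) by (rule tendsto_rabs)
    then show ?thesis using tendsto_upperbound[OF _ evB(1)] True by (simp add: f1_def)
  qed (use wB f1w in auto)
  ultimately show ?thesis unfolding B0_def B1_def by (intro exI[of _ f1] exI[of _ w']) auto
qed

section \<open>The recursion over the order of the derivative\<close>

text \<open>With \<open>c k = B\<^sub>k / \<sigma>\<^sup>2\<close> and \<open>\<eta> k = \<parallel>h\<^bsup>(k)\<^esup>\<parallel>\<close> this is the bound for \<open>f\<^bsup>(k)\<^esup>\<close> obtained by
  differentiating the Stein equation.\<close>

fun stein_rec :: "(nat \<Rightarrow> real) \<Rightarrow> real \<Rightarrow> (nat \<Rightarrow> real) \<Rightarrow> real \<Rightarrow> real \<Rightarrow> nat \<Rightarrow> real" where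
  "stein_rec c \<tau> \<eta> \<phi>0 \<phi>1 0 = \<phi>0"
| "stein_rec c \<tau> \<eta> \<phi>0 \<phi>1 (Suc 0) = \<phi>1"
| "stein_rec c \<tau> \<eta> \<phi>0 \<phi>1 (Suc (Suc k)) =
     c (Suc k) * (\<eta> (Suc k) + real (Suc k) * stein_rec c \<tau> \<eta> \<phi>0 \<phi>1 k + real (Suc k) * \<tau> * stein_rec c \<tau> \<eta> \<phi>0 \<phi>1 (Suc k))"

lemma lipschitz_of_bounded_deriv:
  assumes "\<And>x::real. (f has_real_derivative f' x) (at x)" "\<And>x. \<bar>f' x\<bar> \<le> L"
  shows "\<bar>f x - f y\<bar> \<le> L * \<bar>x - y\<bar>"
  using field_differentiable_bound[of UNIV f f' L x y] assms by simp

lemma isCont_of_lipschitz: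
  fixes f :: "real \<Rightarrow> real"
  assumes "\<And>x y. \<bar>f x - f y\<bar> \<le> L * \<bar>x - y\<bar>"
  shows "isCont f x"
proof -
  have "((\<lambda>y. L * \<bar>y - x\<bar>) \<longlongrightarrow> L * \<bar>x - x\<bar>) (at x)" by (intro tendsto_intros)
  then have "((\<lambda>y. L * \<bar>y - x\<bar>) \<longlongrightarrow> 0) (at x)" by simp
  then have "((\<lambda>y. f y - f x) \<longlongrightarrow> 0) (at x)"
    by (rule Lim_null_comparison[rotated]) (simp add: assms)
  then show ?thesis unfolding isCont_def by (rule LIM_zero_cancel)
qed

text \<open>Induction on k with the invariant \<open>Inv k\<close>: the equation for the k-th
  derivative off 0, differentiability across 0, and both bounds. The top derivative of f comes from
  one more application of the estimate, in which \<open>H (n - 1)\<close> is merely Lipschitz; hence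
  the last two claims exclude 0. \<open>H\<close> is kept abstract because \<open>H 0\<close> will
  be the centred function.\<close>

lemma stein_derivatives:
  fixes r \<theta> \<sigma> \<phi>0 \<phi>1 :: real and H :: "nat \<Rightarrow> real \<Rightarrow> real" and \<eta> :: "nat \<Rightarrow> real"
    and f f1 f2 :: "real \<Rightarrow> real" and n :: nat
  defines "c \<equiv> \<lambda>k. (2 / (r + real k) + vg_C (r + real k) \<theta> \<sigma>) / \<sigma>\<^sup>2"
  defines "\<beta> \<equiv> stein_rec c \<bar>\<theta>\<bar> \<eta> \<phi>0 \<phi>1"
  defines "F \<equiv> \<lambda>k. (deriv ^^ k) f"
  assumes r: "r > 0" and \<sigma>: "\<sigma> > 0"
    and H: "\<And>k x. Suc k < n \<Longrightarrow> (H k has_real_derivative H (Suc k) x) (at x)"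
    and Hb: "\<And>k x. k < n \<Longrightarrow> \<bar>H k x\<bar> \<le> \<eta> k" and \<eta>n: "\<eta> n \<ge> 0"
    and lip: "\<And>x y. \<bar>H (n - 1) x - H (n - 1) y\<bar> \<le> \<eta> n * \<bar>x - y\<bar>"
    and N: "negligible N"
    and ae: "\<And>x. x \<notin> N \<Longrightarrow> \<exists>d. (H (n - 1) has_real_derivative d) (at x) \<and> \<bar>d\<bar> \<le> \<eta> n"
    and n: "n \<ge> 1"
    and f: "\<And>x. (f has_real_derivative f1 x) (at x)" and f1: "isCont f1 0"
    and f2: "\<And>x. x \<noteq> 0 \<Longrightarrow> (f1 has_real_derivative f2 x) (at x)"
    and ode: "\<And>x. x \<noteq> 0 \<Longrightarrow> \<sigma>\<^sup>2 * x * f2 x + (\<sigma>\<^sup>2 * r + 2 * \<theta> * x) * f1 x + (r * \<theta> - x) * f x = H 0 x"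
    and fb: "\<And>x. \<bar>f x\<bar> \<le> \<phi>0" "\<And>x. \<bar>f1 x\<bar> \<le> \<phi>1"
  shows "\<And>k x. k < n \<Longrightarrow> (F k has_real_derivative F (Suc k) x) (at x)"
    and "\<And>x. x \<noteq> 0 \<Longrightarrow> (F n has_real_derivative F (Suc n) x) (at x)"
    and "\<And>x. x \<noteq> 0 \<Longrightarrow> \<bar>F (Suc n) x\<bar> \<le> \<beta> (Suc n)"
proof -
  \<comment> \<open>The right-hand side for the k-th derivative. For k = 0 the truncated
    \<open>k - 1\<close> does no harm, as the factor \<open>real k\<close> is 0.\<close>
  define g where "g k x = H k x + real k * F (k - 1) x - real k * \<theta> * F k x" for k x
  define Inv where "Inv k \<longleftrightarrow> (\<forall>j\<le>k. \<forall>x. (F j has_real_derivative F (Suc j) x) (at x)) \<and> isCont (F (Suc k)) 0 \<and>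
     (\<forall>x. x \<noteq> 0 \<longrightarrow> (F (Suc k) has_real_derivative F (Suc (Suc k)) x) (at x)) \<and>
     (\<forall>x. x \<noteq> 0 \<longrightarrow> \<sigma>\<^sup>2 * x * F (Suc (Suc k)) x + (\<sigma>\<^sup>2 * (r + real k) + 2 * \<theta> * x) * F (Suc k) x + ((r + real k) * \<theta> - x) * F k x = g k x) \<and>
     (\<forall>x. \<bar>F k x\<bar> \<le> \<beta> k) \<and> (\<forall>x. \<bar>F (Suc k) x\<bar> \<le> \<beta> (Suc k))" for k
  have dF: "F (Suc k) x = D" if "(F k has_real_derivative D) (at x)" for k x D
    using DERIV_imp_deriv[OF that] by (simp add: F_def)
  have \<beta>_Suc: "\<beta> (Suc (Suc k)) = c (Suc k) * (\<eta> (Suc k) + real (Suc k) * \<beta> k + real (Suc k) * \<bar>\<theta>\<bar> * \<beta> (Suc k))" for k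
    by (simp add: \<beta>_def)
  have Hcont: "isCont (H k) x" if "k < n" for k x
  proof (cases "Suc k < n")
    case True
    then show ?thesis using H by (blast intro: DERIV_isCont)
  next
    case False
    then have k: "k = n - 1" using that by simp
    then show ?thesis using isCont_of_lipschitz[OF lip] by simp
  qed
  \<comment> \<open>The exceptional set is a parameter: it is empty while \<open>H k\<close> is
    differentiable everywhere, and it is \<open>N\<close> for k = n - 1.\<close>
  have step: "\<bar>F (Suc (Suc k)) x\<bar> \<le> \<beta> (Suc (Suc k))"
    if inv: "Inv k" and "negligible N'" and Hlip: "\<And>x y. \<bar>H k x - H k y\<bar> \<le> \<eta> (Suc k) * \<bar>x - y\<bar>"
      and Hae: "\<And>x. x \<notin> N' \<Longrightarrow> \<exists>d. (H k has_real_derivative d) (at x) \<and> \<bar>d\<bar> \<le> \<eta> (Suc k)"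
      and \<eta>0: "\<eta> (Suc k) \<ge> 0" and x: "x \<noteq> 0" for k x N'
  proof -
    have b0: "\<beta> k \<ge> 0" "\<beta> (Suc k) \<ge> 0" using inv unfolding Inv_def by (meson abs_ge_zero order_trans)+
    have FB: "\<bar>F k x\<bar> \<le> \<beta> k" "\<bar>F (Suc k) x\<bar> \<le> \<beta> (Suc k)" for x using inv by (auto simp: Inv_def)
    have Fd: "((\<lambda>x. real k * F (k - 1) x - real k * \<theta> * F k x) has_real_derivative real k * F k x - real k * \<theta> * F (Suc k) x) (at x)" for x
    proof (cases k)
      case (Suc m)
      then have "(F (k - 1) has_real_derivative F k x) (at x)" "(F k has_real_derivative F (Suc k) x) (at x)"
        using inv by (auto simp: Inv_def)
      then show ?thesis by (intro DERIV_diff DERIV_cmult)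
    qed simp
    have Fdb: "\<bar>real k * F k x - real k * \<theta> * F (Suc k) x\<bar> \<le> real k * \<beta> k + real k * \<bar>\<theta>\<bar> * \<beta> (Suc k)" for x
    proof -
      have "\<bar>real k * F k x - real k * \<theta> * F (Suc k) x\<bar> \<le> real k * \<bar>F k x\<bar> + real k * \<bar>\<theta>\<bar> * \<bar>F (Suc k) x\<bar>"
        by (rule order_trans[OF abs_triangle_ineq4]) (simp add: abs_mult)
      also have "\<dots> \<le> real k * \<beta> k + real k * \<bar>\<theta>\<bar> * \<beta> (Suc k)" using FB by (intro add_mono mult_left_mono) auto
      finally show ?thesis .
    qed
    have glip: "\<bar>g k x - g k y\<bar> \<le> (\<eta> (Suc k) + (real k * \<beta> k + real k * \<bar>\<theta>\<bar> * \<beta> (Suc k))) * \<bar>x - y\<bar>" for x y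
    proof -
      have "g k x - g k y = (H k x - H k y) + ((real k * F (k - 1) x - real k * \<theta> * F k x) - (real k * F (k - 1) y - real k * \<theta> * F k y))"
        by (simp add: g_def)
      also have "\<bar>\<dots>\<bar> \<le> \<eta> (Suc k) * \<bar>x - y\<bar> + (real k * \<beta> k + real k * \<bar>\<theta>\<bar> * \<beta> (Suc k)) * \<bar>x - y\<bar>"
        by (rule order_trans[OF abs_triangle_ineq add_mono[OF Hlip lipschitz_of_bounded_deriv[OF Fd Fdb]]])
      finally show ?thesis by (simp add: distrib_right)
    qed
    \<comment> \<open>The derivative of \<open>g k\<close> contributes the coefficient k;
      differentiating the left-hand side adds one more \<open>F k\<close> and one more \<theta>
      \<open>F (Suc k)\<close>, hence k + 1.\<close>
    define G where "G = \<eta> (Suc k) + real (Suc k) * \<beta> k + real (Suc k) * \<bar>\<theta>\<bar> * \<beta> (Suc k)"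
    have G0: "G \<ge> 0" unfolding G_def using \<eta>0 b0 by (intro add_nonneg_nonneg mult_nonneg_nonneg) auto
    have "\<bar>F (Suc (Suc k)) x\<bar> \<le> (2 / (r + real k + 1) + vg_C (r + real k + 1) \<theta> \<sigma>) / \<sigma>\<^sup>2 * G"
    proof (rule stein_deriv_bound[OF \<sigma>, where v = "F k" and w = "F (Suc k)" and ?w1.0 = "F (Suc (Suc k))" and g = "g k" and N = N'
          and B = "max (\<beta> k) (\<beta> (Suc k))" and L = "\<eta> (Suc k) + (real k * \<beta> k + real k * \<bar>\<theta>\<bar> * \<beta> (Suc k))"])
      show "0 < r + real k" using r by simp
      show "\<bar>g k x - g k y\<bar> \<le> (\<eta> (Suc k) + (real k * \<beta> k + real k * \<bar>\<theta>\<bar> * \<beta> (Suc k))) * \<bar>x - y\<bar>" for x y by (rule glip)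
      fix y
      show "\<bar>F k y\<bar> \<le> max (\<beta> k) (\<beta> (Suc k))" "\<bar>F (Suc k) y\<bar> \<le> max (\<beta> k) (\<beta> (Suc k))"
        using FB[of y] by (auto simp: le_max_iff_disj)
      assume "y \<notin> N'"
      then obtain d where d: "(H k has_real_derivative d) (at y)" "\<bar>d\<bar> \<le> \<eta> (Suc k)" using Hae by blast
      have "g k = (\<lambda>x. H k x + (real k * F (k - 1) x - real k * \<theta> * F k x))" by (auto simp: g_def fun_eq_iff)
      then have "(g k has_real_derivative d + (real k * F k y - real k * \<theta> * F (Suc k) y)) (at y)"
        using DERIV_add[OF d(1) Fd] by simp
      moreover have "\<bar>d + (real k * F k y - real k * \<theta> * F (Suc k) y) + F k y - \<theta> * F (Suc k) y\<bar> \<le> G"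
      proof -
        have "\<bar>\<theta> * F (Suc k) y\<bar> \<le> \<bar>\<theta>\<bar> * \<beta> (Suc k)" using FB(2)[of y] by (simp add: abs_mult mult_left_mono)
        then have "\<bar>d + (real k * F k y - real k * \<theta> * F (Suc k) y) + F k y - \<theta> * F (Suc k) y\<bar>
          \<le> \<eta> (Suc k) + (real k * \<beta> k + real k * \<bar>\<theta>\<bar> * \<beta> (Suc k)) + \<beta> k + \<bar>\<theta>\<bar> * \<beta> (Suc k)"
          using d(2) Fdb[of y] FB(1)[of y] by linarith
        then show ?thesis by (simp add: G_def algebra_simps)
      qed
      ultimately show "\<exists>\<gamma>. (g k has_real_derivative \<gamma>) (at y) \<and> \<bar>\<gamma> + F k y - \<theta> * F (Suc k) y\<bar> \<le> G" by blast
    qed (use inv \<open>negligible N'\<close> G0 x in \<open>auto simp: Inv_def\<close>)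
    then show ?thesis unfolding \<beta>_Suc G_def c_def by (simp add: add.assoc add.commute[of 1])
  qed
  have "Inv k" if "k < n" for k
    using that
  proof (induction k)
    case 0
    have F1: "F (Suc 0) = f1" using f by (auto simp: F_def fun_eq_iff DERIV_imp_deriv)
    have F2: "F (Suc (Suc 0)) x = f2 x" if "x \<noteq> 0" for x using dF[of "Suc 0"] f2[OF that] F1 by simp
    show ?case unfolding Inv_def using f f1 f2 ode fb by (auto simp: F1 F2 g_def \<beta>_def) (simp_all add: F_def)
  next
    case (Suc k)
    then have inv: "Inv k" and k: "Suc k < n" by auto
    have Hk: "(H k has_real_derivative H (Suc k) x) (at x)" "\<bar>H (Suc k) x\<bar> \<le> \<eta> (Suc k)" for x using H Hb k by auto
    have FB: "\<bar>F (Suc (Suc k)) x\<bar> \<le> \<beta> (Suc (Suc k))" if "x \<noteq> 0" for x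
    proof (rule step[OF inv negligible_empty lipschitz_of_bounded_deriv[OF Hk] _ _ that])
      show "\<exists>d. (H k has_real_derivative d) (at x) \<and> \<bar>d\<bar> \<le> \<eta> (Suc k)" for x using Hk by blast
      show "0 \<le> \<eta> (Suc k)" using Hk(2) by (meson abs_ge_zero order_trans)
    qed
    have Fk: "(F j has_real_derivative F (Suc j) x) (at x)" if "j \<le> k" for j x using inv that by (auto simp: Inv_def)
    have Fk': "(F (Suc k) has_real_derivative F (Suc (Suc k)) x) (at x)" if "x \<noteq> 0" for x using inv that by (auto simp: Inv_def)
    have dg: "(g k has_real_derivative H (Suc k) x + real k * F k x - real k * \<theta> * F (Suc k) x) (at x)" for x
    proof -
      have "((\<lambda>x. real k * F (k - 1) x) has_real_derivative real k * F k x) (at x)"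
      proof (cases k)
        case (Suc m)
        then show ?thesis using DERIV_cmult[OF Fk[of m x], of "real k"] by simp
      qed simp
      from DERIV_diff[OF DERIV_add[OF Hk(1) this] DERIV_cmult[OF Fk[OF order_refl]]]
      show ?thesis unfolding g_def[abs_def] .
    qed
    have "(F (Suc (Suc k)) has_real_derivative F (Suc (Suc (Suc k))) x) (at x) \<and>
        \<sigma>\<^sup>2 * x * F (Suc (Suc (Suc k))) x + (\<sigma>\<^sup>2 * (r + real (Suc k)) + 2 * \<theta> * x) * F (Suc (Suc k)) x + ((r + real (Suc k)) * \<theta> - x) * F (Suc k) x = g (Suc k) x"
      if x: "x \<noteq> 0" for x
    proof -
      obtain w2 where w2: "(F (Suc (Suc k)) has_real_derivative w2) (at x)"
        "\<sigma>\<^sup>2 * x * w2 + (\<sigma>\<^sup>2 * (r + real k + 1) + 2 * \<theta> * x) * F (Suc (Suc k)) x + ((r + real k + 1) * \<theta> - x) * F (Suc k) x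
          = (H (Suc k) x + real k * F k x - real k * \<theta> * F (Suc k) x) + F k x - \<theta> * F (Suc k) x"
        using stein_differentiate[OF \<sigma>, of "- {0}" x "F (Suc (Suc k))" "r + real k" \<theta> "F (Suc k)" "F k" "g k", OF _ _ _ _ Fk[OF order_refl] Fk'[OF x] dg] inv x
        by (auto simp: Inv_def)
      have "F (Suc (Suc (Suc k))) x = w2" by (rule dF[OF w2(1)])
      then show ?thesis using w2 by (simp add: g_def algebra_simps)
    qed
    note * = this
    \<comment> \<open>The bound off 0 supplies the vanishing weighted limit from which
      differentiability at 0 is deduced, so the estimate precedes the extension to 0.\<close>
    have FB0: "\<forall>\<^sub>F x in at 0. \<bar>F (Suc (Suc k)) x\<bar> \<le> \<beta> (Suc (Suc k))" using FB by (auto simp: eventually_at_filter)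
    have "((\<lambda>x. \<bar>x\<bar> powr (r + real (Suc k))) \<longlongrightarrow> \<bar>0\<bar> powr (r + real (Suc k))) (at (0::real))"
      using r by (intro tendsto_powr' tendsto_intros) auto
    then have "((\<lambda>x. \<bar>x\<bar> powr (r + real (Suc k)) * F (Suc (Suc k)) x) \<longlongrightarrow> 0) (at 0)"
      by (intro lim_null_mult_right_bounded[where B = "\<beta> (Suc (Suc k))"]) (use FB0 in auto)
    moreover have "isCont (g (Suc k)) 0"
      unfolding g_def[abs_def] using Hcont[OF k] inv Fk[OF order_refl] by (intro continuous_intros) (auto simp: Inv_def intro: DERIV_isCont)
    moreover have "isCont (F (Suc k)) 0" using inv by (simp add: Inv_def)
    ultimately obtain d where d: "(F (Suc (Suc k)) \<longlongrightarrow> d) (at 0)" "(F (Suc k) has_real_derivative d) (at 0)"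
      using stein_deriv_at_0[OF \<sigma>, of "r + real (Suc k)" "F (Suc k)" "g (Suc k)" "F (Suc (Suc k))" "F (Suc (Suc (Suc k)))" \<theta>] Fk' * r by auto
    have d0: "F (Suc (Suc k)) 0 = d" by (rule dF[OF d(2)])
    then have "isCont (F (Suc (Suc k))) 0" using d(1) by (simp add: isCont_def)
    moreover have "(F j has_real_derivative F (Suc j) x) (at x)" if "j \<le> Suc k" for j x
      using that Fk[of j x] Fk'[of x] d d0 by (cases "j = Suc k"; cases "x = 0") auto
    moreover have "\<bar>F (Suc (Suc k)) x\<bar> \<le> \<beta> (Suc (Suc k))" for x
    proof (cases "x = 0")
      case True
      have "\<bar>d\<bar> \<le> \<beta> (Suc (Suc k))" by (rule tendsto_upperbound[OF tendsto_rabs[OF d(1)] FB0]) simp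
      then show ?thesis using True d0 by simp
    qed (rule FB)
    ultimately show ?case using * inv unfolding Inv_def by blast
  qed
  note Inv = this
  have inv: "Inv (n - 1)" using n by (intro Inv) auto
  show "(F k has_real_derivative F (Suc k) x) (at x)" if "k < n" for k x
    using inv that by (auto simp: Inv_def)
  show "(F n has_real_derivative F (Suc n) x) (at x)" if "x \<noteq> 0" for x
    using inv that n by (auto simp: Inv_def)
  show "\<bar>F (Suc n) x\<bar> \<le> \<beta> (Suc n)" if "x \<noteq> 0" for x
    using step[OF inv N _ _ _ that] lip ae \<eta>n n by auto
qed

section \<open>The theorem\<close>

lemma deriv_dom_Suc_subset: "deriv_dom (Suc k) g \<subseteq> deriv_dom k g"
  by (auto dest: eventually_nhds_x_imp_x)

lemma deriv_dom_antimono: "k \<le> m \<Longrightarrow> deriv_dom m g \<subseteq> deriv_dom k g"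
  by (rule lift_Suc_antimono_le[of "\<lambda>k. deriv_dom k g"]) (rule deriv_dom_Suc_subset)

lemma deriv_norm_upper:
  assumes "deriv_bounded k g" "x \<in> deriv_dom k g"
  shows "\<bar>(deriv ^^ k) g x\<bar> \<le> deriv_norm k g"
proof -
  obtain B where "\<And>y. y \<in> deriv_dom k g \<Longrightarrow> \<bar>(deriv ^^ k) g y\<bar> \<le> B"
    using assms(1) by (auto simp: deriv_bounded_def bounded_iff)
  then have "bdd_above ((\<lambda>x. \<bar>(deriv ^^ k) g x\<bar>) ` deriv_dom k g)" by (auto simp: bdd_above_def)
  then show ?thesis unfolding deriv_norm_def by (rule cSUP_upper[OF assms(2)])
qed

text \<open>\<open>deriv_norm n h\<close> bounds every value of the derivative of h^(n-1), wherever
  that derivative exists; absolute continuity upgrades this to the Lipschitz bound and to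
  differentiability off a negligible set.\<close>

lemma
  assumes h: "h \<in> Cb n" and n: "n \<ge> 1"
  shows Cb_deriv: "Suc k < n \<Longrightarrow> ((deriv ^^ k) h has_real_derivative (deriv ^^ Suc k) h x) (at x)"
    and Cb_bound: "k < n \<Longrightarrow> \<bar>(deriv ^^ k) h x\<bar> \<le> deriv_norm k h"
    and Cb_differentiable: "(deriv ^^ (n - 1)) h differentiable at x \<Longrightarrow>
      \<exists>d. ((deriv ^^ (n - 1)) h has_real_derivative d) (at x) \<and> \<bar>d\<bar> \<le> deriv_norm n h"
    and Cb_lipschitz: "\<bar>(deriv ^^ (n - 1)) h x - (deriv ^^ (n - 1)) h y\<bar> \<le> deriv_norm n h * \<bar>x - y\<bar>"
    and Cb_negligible: "negligible {x. \<not> (deriv ^^ (n - 1)) h differentiable at x}"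
proof -
  have dom: "deriv_dom (n - 1) h = UNIV" and ac: "\<And>u v. abs_continuous_on {u..v} ((deriv ^^ (n - 1)) h)"
    and bd: "\<And>k. k \<le> n \<Longrightarrow> deriv_bounded k h"
    using h by (auto simp: Cb_def)
  have dom_k: "deriv_dom k h = UNIV" if "k < n" for k
  proof -
    have "k \<le> n - 1" using that by simp
    then show ?thesis using deriv_dom_antimono[of k "n - 1" h] dom by auto
  qed
  show "((deriv ^^ k) h has_real_derivative (deriv ^^ Suc k) h x) (at x)" if "Suc k < n"
    using dom_k[OF that] by (auto simp: DERIV_deriv_iff_field_differentiable)
  show "\<bar>(deriv ^^ k) h x\<bar> \<le> deriv_norm k h" if "k < n"
    using deriv_norm_upper[OF bd, of k x] dom_k that by auto
  have D: "\<bar>D\<bar> \<le> deriv_norm n h" if "((deriv ^^ (n - 1)) h has_real_derivative D) (at x)" for x D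
  proof -
    have n': "n = Suc (n - 1)" using n by simp
    have "x \<in> deriv_dom (Suc (n - 1)) h"
      using that dom by (auto simp: field_differentiable_def)
    then have "\<bar>(deriv ^^ n) h x\<bar> \<le> deriv_norm n h"
      using deriv_norm_upper[OF bd[OF order_refl]] n' by metis
    moreover have "(deriv ^^ n) h x = D"
      using DERIV_imp_deriv[OF that] by (subst n') simp
    ultimately show ?thesis by simp
  qed
  show "\<exists>d. ((deriv ^^ (n - 1)) h has_real_derivative d) (at x) \<and> \<bar>d\<bar> \<le> deriv_norm n h"
    if "(deriv ^^ (n - 1)) h differentiable at x"
    using that D by (auto simp: real_differentiable_def)
  show "\<bar>(deriv ^^ (n - 1)) h x - (deriv ^^ (n - 1)) h y\<bar> \<le> deriv_norm n h * \<bar>x - y\<bar>"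
    by (rule abs_continuous_lipschitz[OF ac D])
  show "negligible {x. \<not> (deriv ^^ (n - 1)) h differentiable at x}"
    by (rule abs_continuous_ae_differentiable[OF ac])
qed

lemma vg_density_eq:
  fixes r \<theta> \<sigma> :: real
  assumes \<sigma>: "\<sigma> > 0" and r: "r > 0"
  obtains c where "c > 0" "\<And>x. vg_density r \<theta> \<sigma> x = c * vg_parameters.vg_weight \<theta> \<sigma> r x"
    "\<And>x. vg_parameters.vg_weight \<theta> \<sigma> r x \<ge> 0"
proof -
  interpret p: vg_parameters \<theta> \<sigma> using \<sigma> by unfold_locales
  define d where "d = 1 / (2 * p.\<alpha>\<^sup>2 * \<sigma>\<^sup>2)"
  have d: "d > 0" using p.\<alpha>_pos \<sigma> by (simp add: d_def)
  have "\<bar>x\<bar> / (2 * sqrt (\<theta>\<^sup>2 + \<sigma>\<^sup>2)) = d * (p.\<alpha> * \<bar>x\<bar>)" for x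
    unfolding p.sqrt_eq d_def using p.\<alpha>_pos \<sigma> by (simp add: field_simps power2_eq_square)
  then have pw: "(\<bar>x\<bar> / (2 * sqrt (\<theta>\<^sup>2 + \<sigma>\<^sup>2))) powr ((r - 1) / 2) = d powr ((r - 1) / 2) * (p.\<alpha> * \<bar>x\<bar>) powr ((r - 1) / 2)" for x
    using d p.\<alpha>_pos by (simp add: powr_mult)
  have K: "bessel_K \<nu> y \<ge> 0" for \<nu> y
    unfolding bessel_K_def interval_lebesgue_integral_def set_lebesgue_integral_def
    by (auto intro!: integral_nonneg mult_nonneg_nonneg simp: zero_ereal_def[symmetric])
  show ?thesis
  proof
    show "1 / (\<sigma> * sqrt pi * Gamma (r / 2)) * d powr ((r - 1) / 2) > 0"
      using \<sigma> r d by (simp add: Gamma_real_pos)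
    show "vg_density r \<theta> \<sigma> x = 1 / (\<sigma> * sqrt pi * Gamma (r / 2)) * d powr ((r - 1) / 2) * p.vg_weight r x" for x
      unfolding vg_density_def pw by (simp add: p.vg_weight_def p.b_def p.\<alpha>_def)
    show "p.vg_weight r x \<ge> 0" for x using K by (simp add: p.vg_weight_def)
  qed
qed

text \<open>The law of Z enters here: centring under M becomes mean zero against the weight, the
  condition under which the explicit formula can be reflected. Dividing by the constant of the
  density is harmless.\<close>

lemma vg_mean_zero:
  fixes r \<theta> \<sigma> G :: real and g :: "real \<Rightarrow> real"
  assumes \<sigma>: "\<sigma> > 0" and r: "r > 0"
    and M: "prob_space M" and Z: "distributed M lborel Z (\<lambda>x. ennreal (vg_density r \<theta> \<sigma> x))"
    and g: "\<And>x. isCont g x" and bd: "\<And>x. \<bar>g x\<bar> \<le> G"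
  shows "integrable lborel (\<lambda>t. vg_parameters.vg_weight \<theta> \<sigma> r t * (g t - (\<integral>\<omega>. g (Z \<omega>) \<partial>M)))"
    and "(LINT t|lborel. vg_parameters.vg_weight \<theta> \<sigma> r t * (g t - (\<integral>\<omega>. g (Z \<omega>) \<partial>M))) = 0"
proof -
  interpret prob_space M by (rule M)
  obtain c where c: "c > 0" "\<And>x. vg_density r \<theta> \<sigma> x = c * vg_parameters.vg_weight \<theta> \<sigma> r x"
    "\<And>x. vg_parameters.vg_weight \<theta> \<sigma> r x \<ge> 0" using vg_density_eq[OF \<sigma> r] by blast
  define E where "E = (\<integral>\<omega>. g (Z \<omega>) \<partial>M)"
  have dens0: "0 \<le> vg_density r \<theta> \<sigma> x" for x using c by simp
  have "continuous_on UNIV g" using g by (simp add: continuous_at_imp_continuous_on)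
  then have gm: "g \<in> borel_measurable borel" by (rule borel_measurable_continuous_onI)
  have Zm: "Z \<in> borel_measurable M" using distributed_measurable[OF Z] by simp
  have int: "integrable M (\<lambda>\<omega>. g (Z \<omega>))"
    by (rule integrable_const_bound[where B = G]) (use bd gm Zm in auto)
  then have intE: "integrable M (\<lambda>\<omega>. g (Z \<omega>) - E)" by simp
  have "(\<integral>\<omega>. g (Z \<omega>) - E \<partial>M) = 0" using int by (simp add: E_def prob_space)
  moreover have "(\<integral>x. vg_density r \<theta> \<sigma> x * (g x - E) \<partial>lborel) = (\<integral>\<omega>. g (Z \<omega>) - E \<partial>M)"
    by (rule distributed_integral[OF Z]) (use gm dens0 in auto)
  ultimately have "(\<integral>x. vg_density r \<theta> \<sigma> x * (g x - E) \<partial>lborel) = 0" by simp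
  then show "(LINT t|lborel. vg_parameters.vg_weight \<theta> \<sigma> r t * (g t - E)) = 0"
    using c(1) by (simp add: c(2) mult.assoc)
  have "integrable lborel (\<lambda>x. vg_density r \<theta> \<sigma> x * (g x - E))"
    using distributed_integrable[OF Z, of "\<lambda>x. g x - E"] gm dens0 intE by simp
  then show "integrable lborel (\<lambda>t. vg_parameters.vg_weight \<theta> \<sigma> r t * (g t - E))"
    using c(1) by (simp add: c(2) mult.assoc)
qed

section \<open>Combinatorics of the index sets\<close>

text \<open>For \<open>m = n - j\<close> these are the members of \<open>\<S>\<^bsub>j,l\<^esub>\<^bsup>(n)\<^esup>\<close> for all \<open>l\<close> together. The recursion in
  \<open>gap_sets_split\<close> removes the minimum \<open>m\<close>.\<close>

definition gap_sets :: "nat \<Rightarrow> nat \<Rightarrow> nat set set" where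
  "gap_sets n m = {M. M \<subseteq> {m..n} \<and> {n, m} \<subseteq> M \<and> (\<forall>i\<in>{m..<n}. M \<inter> {i, i + 1} \<noteq> {})}"

definition gap_weight :: "real \<Rightarrow> (nat \<Rightarrow> real) \<Rightarrow> nat \<Rightarrow> nat set \<Rightarrow> real" where
  "gap_weight \<tau> c m M = (\<Prod>i\<in>M - {m}. (\<tau> * of_bool (i - 1 \<in> M) + of_bool (i - 1 \<notin> M)) * c i)"

definition gap_sum :: "real \<Rightarrow> (nat \<Rightarrow> real) \<Rightarrow> nat \<Rightarrow> nat \<Rightarrow> real" where
  "gap_sum \<tau> c n m = (\<Sum>M\<in>gap_sets n m. gap_weight \<tau> c m M)"

lemma finite_gap_sets: "finite (gap_sets n m)"
  by (rule finite_subset[of _ "Pow {m..n}"]) (auto simp: gap_sets_def)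

lemma gap_sets_empty: "n < m \<Longrightarrow> gap_sets n m = {}"
  by (auto simp: gap_sets_def)

lemma gap_sets_self: "gap_sets n n = {{n}}"
  by (auto simp: gap_sets_def)

lemma gap_sets_split:
  assumes "m < n"
  shows "gap_sets n m = insert m ` gap_sets n (Suc m) \<union> insert m ` gap_sets n (Suc (Suc m))"
proof (intro equalityI subsetI)
  fix M assume "M \<in> gap_sets n m"
  then have M: "M \<subseteq> {m..n}" "n \<in> M" "m \<in> M" "\<And>i. m \<le> i \<Longrightarrow> i < n \<Longrightarrow> i \<in> M \<or> Suc i \<in> M"
    by (auto simp: gap_sets_def)
  have eq: "M = insert m (M - {m})" using M by auto
  show "M \<in> insert m ` gap_sets n (Suc m) \<union> insert m ` gap_sets n (Suc (Suc m))"
  proof (cases "Suc m \<in> M")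
    case True
    have "M - {m} \<in> gap_sets n (Suc m)"
      unfolding gap_sets_def
    proof (intro CollectI conjI ballI)
      show "M - {m} \<subseteq> {Suc m..n}"
      proof
        fix i assume "i \<in> M - {m}"
        then have "i \<in> {m..n}" "i \<noteq> m" using M(1) by auto
        then show "i \<in> {Suc m..n}" by auto
      qed
      show "{n, Suc m} \<subseteq> M - {m}" using M True assms by auto
      show "(M - {m}) \<inter> {i, i + 1} \<noteq> {}" if "i \<in> {Suc m..<n}" for i using M(4)[of i] that by auto
    qed
    then show ?thesis using eq by blast
  next
    case False
    then have "Suc m < n" using M(2) assms by (metis Suc_lessI)
    then have "Suc (Suc m) \<in> M" using M(4)[of "Suc m"] False by auto
    moreover have "M - {m} \<subseteq> {Suc (Suc m)..n}"
    proof
      fix i assume "i \<in> M - {m}"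
      then have "i \<in> {m..n}" "i \<noteq> m" "i \<noteq> Suc m" using M(1) False by auto
      then show "i \<in> {Suc (Suc m)..n}" by auto
    qed
    ultimately have "M - {m} \<in> gap_sets n (Suc (Suc m))"
      unfolding gap_sets_def
    proof (intro CollectI conjI ballI)
      show "{n, Suc (Suc m)} \<subseteq> M - {m}" using M \<open>Suc (Suc m) \<in> M\<close> assms by auto
      show "(M - {m}) \<inter> {i, i + 1} \<noteq> {}" if "i \<in> {Suc (Suc m)..<n}" for i using M(4)[of i] that by auto
    qed
    then show ?thesis using eq by blast
  qed
next
  fix M assume "M \<in> insert m ` gap_sets n (Suc m) \<union> insert m ` gap_sets n (Suc (Suc m))"
  then show "M \<in> gap_sets n m"
  proof (elim UnE imageE)
    fix M' assume M': "M = insert m M'" "M' \<in> gap_sets n (Suc m)"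
    have "M \<inter> {i, i + 1} \<noteq> {}" if "i \<in> {m..<n}" for i
      using that M' by (cases "i = m") (auto simp: gap_sets_def)
    then show ?thesis using M' assms by (auto simp: gap_sets_def)
  next
    fix M' assume M': "M = insert m M'" "M' \<in> gap_sets n (Suc (Suc m))"
    have "M \<inter> {i, i + 1} \<noteq> {}" if "i \<in> {m..<n}" for i
    proof -
      have "i = m \<or> i = Suc m \<or> i \<in> {Suc (Suc m)..<n}" using that by (simp, linarith)
      then consider "i = m" | "i = Suc m" | "i \<in> {Suc (Suc m)..<n}" by blast
      then
      show ?thesis using M' by cases (auto simp: gap_sets_def)
    qed
    then show ?thesis using M' assms by (auto simp: gap_sets_def)
  qed
qed

text \<open>Consecutive elements differ by at most 2, so at least half of the way from m to n is
  paid for by elements. With j = n - m this is the lower end j + 1 - \<lfloor>j/2\<rfloor> of the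
  range of sizes.\<close>

lemma card_gap_sets:
  assumes "M \<in> gap_sets n m"
  shows "n + 2 \<le> m + 2 * card M"
  using assms
proof (induction "n - m" arbitrary: m M rule: less_induct)
  case less
  then have fin: "finite M" and mn: "m \<le> n" by (auto simp: gap_sets_def intro: finite_subset)
  show ?case
  proof (cases "m = n")
    case True
    then show ?thesis using less.prems by (simp add: gap_sets_self)
  next
    case False
    then obtain M' k where M': "M = insert m M'" "M' \<in> gap_sets n k" "k = Suc m \<or> k = Suc (Suc m)"
      using less.prems mn unfolding gap_sets_split[of m n, OF le_neq_implies_less[OF mn False]] by blast
    have "m \<notin> M'" using M' by (auto simp: gap_sets_def)
    then have "card M = Suc (card M')" using M'(1) fin by simp
    moreover have "n + 2 \<le> k + 2 * card M'" using less.hyps[OF _ M'(2)] M'(3) mn False by auto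
    ultimately show ?thesis using M'(3) by auto
  qed
qed

text \<open>The smallest element carries no factor, so adding a new minimum m creates exactly the
  factor of the old minimum k, with \<tau> if k is adjacent to m. The factors of larger elements ask
  for predecessors other than m and stay the same.\<close>

lemma gap_weight_insert:
  assumes M: "M \<in> gap_sets n k" and k: "m < k"
  shows "gap_weight \<tau> c m (insert m M) = (if k = Suc m then \<tau> else 1) * c k * gap_weight \<tau> c k M"
proof -
  have kM: "k \<in> M" "M \<subseteq> {k..n}" "m \<notin> M" "finite M" using M k by (auto simp: gap_sets_def intro: finite_subset)
  define w where "w S i = (\<tau> * of_bool (i - 1 \<in> S) + of_bool (i - 1 \<notin> S)) * c i" for S :: "nat set" and i
  have "gap_weight \<tau> c m (insert m M) = prod (w (insert m M)) M"
    unfolding gap_weight_def w_def using kM(3) by (intro prod.cong) auto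
  also have "\<dots> = w (insert m M) k * prod (w (insert m M)) (M - {k})"
    by (rule prod.remove[OF kM(4,1)])
  also have "prod (w (insert m M)) (M - {k}) = prod (w M) (M - {k})"
  proof (rule prod.cong[OF refl])
    fix i assume "i \<in> M - {k}"
    then have "i \<ge> k" "i \<noteq> k" using kM(2) by auto
    then have "i - 1 \<noteq> m" using k by linarith
    then show "w (insert m M) i = w M i" by (simp add: w_def)
  qed
  also have "prod (w M) (M - {k}) = gap_weight \<tau> c k M" by (simp add: gap_weight_def w_def)
  also have "w (insert m M) k = (if k = Suc m then \<tau> else 1) * c k"
  proof -
    have "k - 1 \<notin> M" using kM(2) k by fastforce
    moreover have "k - 1 = m \<longleftrightarrow> k = Suc m" using k by auto
    ultimately show ?thesis by (simp add: w_def)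
  qed
  finally show ?thesis .
qed

text \<open>The two summands separate the sets by whether they contain \<open>Suc m\<close>. For m +
  1 = n the second summand is 0, no gap set starting above n.\<close>

lemma gap_sum_rec:
  assumes "m < n"
  shows "gap_sum \<tau> c n m = \<tau> * c (Suc m) * gap_sum \<tau> c n (Suc m) + c (Suc (Suc m)) * gap_sum \<tau> c n (Suc (Suc m))"
proof -
  have inj: "inj_on (insert m) (gap_sets n k)" if "m < k" for k
    using that by (intro inj_onI) (auto simp: gap_sets_def dest!: insert_ident[THEN iffD1, rotated 2])
  have "insert m M \<noteq> insert m M'" if "M \<in> gap_sets n (Suc m)" "M' \<in> gap_sets n (Suc (Suc m))" for M M'
  proof -
    have "Suc m \<in> insert m M" "Suc m \<notin> insert m M'" using that by (auto simp: gap_sets_def)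
    then show ?thesis by metis
  qed
  then have "insert m ` gap_sets n (Suc m) \<inter> insert m ` gap_sets n (Suc (Suc m)) = {}" by blast
  then have "gap_sum \<tau> c n m = sum (gap_weight \<tau> c m) (insert m ` gap_sets n (Suc m)) + sum (gap_weight \<tau> c m) (insert m ` gap_sets n (Suc (Suc m)))"
    unfolding gap_sum_def gap_sets_split[OF assms] by (intro sum.union_disjoint) (auto simp: finite_gap_sets)
  also have "\<dots> = \<tau> * c (Suc m) * gap_sum \<tau> c n (Suc m) + c (Suc (Suc m)) * gap_sum \<tau> c n (Suc (Suc m))"
    by (simp add: sum.reindex inj gap_weight_insert gap_sum_def sum_distrib_left)
  finally show ?thesis .
qed

text \<open>Going down from m = n, two unknown terms remain at each stage, at orders m + 1 and m.
  Substituting the recursion for the one of order \<open>Suc (Suc m)\<close> merges coefficients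
  exactly as in \<open>gap_sum_rec\<close>. The start has A n = 1, an empty product, and A (n + 1) =
  0, an empty sum.\<close>

lemma stein_rec_unroll:
  fixes c \<eta> :: "nat \<Rightarrow> real" and \<tau> \<phi>0 \<phi>1 :: real and n m :: nat
  defines "\<beta> \<equiv> stein_rec c \<tau> \<eta> \<phi>0 \<phi>1"
    and "A \<equiv> gap_sum \<tau> (\<lambda>i. real i * c i) n"
  assumes "m \<le> n"
  shows "\<beta> (Suc n) = (\<Sum>k\<in>{m<..n}. A k * c k * \<eta> k) + A m * \<beta> (Suc m) + A (Suc m) * (real (Suc m) * c (Suc m)) * \<beta> m"
  using \<open>m \<le> n\<close>
proof (induction rule: inc_induct)
  case base
  show ?case by (simp add: A_def gap_sum_def gap_sets_self gap_sets_empty gap_weight_def)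
next
  case (step m)
  have A: "A m = \<tau> * (real (Suc m) * c (Suc m)) * A (Suc m) + real (Suc (Suc m)) * c (Suc (Suc m)) * A (Suc (Suc m))"
    unfolding A_def by (rule gap_sum_rec) (use step in simp)
  have \<beta>: "\<beta> (Suc (Suc m)) = c (Suc m) * (\<eta> (Suc m) + real (Suc m) * \<beta> m + real (Suc m) * \<tau> * \<beta> (Suc m))"
    by (simp add: \<beta>_def)
  have "{m<..n} = insert (Suc m) {Suc m<..n}" using step by auto
  then have "(\<Sum>k\<in>{m<..n}. A k * c k * \<eta> k) = A (Suc m) * c (Suc m) * \<eta> (Suc m) + (\<Sum>k\<in>{Suc m<..n}. A k * c k * \<eta> k)"
    by simp
  then show ?case unfolding step.IH A \<beta> by (simp add: algebra_simps)
qed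

text \<open>The sum over l merely groups the gap sets by size; \<open>vg_I j\<close> contains every
  size that occurs, so none is lost.\<close>

lemma sum_vg_A:
  assumes "j \<le> n"
  shows "(\<Sum>l\<in>vg_I j. vg_A r \<theta> \<sigma> n j l) = gap_sum \<bar>\<theta>\<bar> (\<lambda>i. real i * (vg_B r \<theta> \<sigma> i / \<sigma>\<^sup>2)) n (n - j)"
proof -
  have S: "vg_S n j l = {M \<in> gap_sets n (n - j). card M = l}" for l
    by (auto simp: vg_S_def gap_sets_def)
  have "card ` gap_sets n (n - j) \<subseteq> vg_I j"
  proof
    fix l assume "l \<in> card ` gap_sets n (n - j)"
    then obtain M where M: "M \<in> gap_sets n (n - j)" "l = card M" by blast
    have "card M \<le> card {n - j..n}" using M(1) by (intro card_mono) (auto simp: gap_sets_def)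
    moreover have "n + 2 \<le> n - j + 2 * card M" by (rule card_gap_sets[OF M(1)])
    ultimately show "l \<in> vg_I j" using assms M(2) by (auto simp: vg_I_def)
  qed
  then have "(\<Sum>l\<in>vg_I j. \<Sum>M\<in>{M \<in> gap_sets n (n - j). card M = l}. gap_weight \<bar>\<theta>\<bar> (\<lambda>i. real i * (vg_B r \<theta> \<sigma> i / \<sigma>\<^sup>2)) (n - j) M)
    = gap_sum \<bar>\<theta>\<bar> (\<lambda>i. real i * (vg_B r \<theta> \<sigma> i / \<sigma>\<^sup>2)) n (n - j)"
    unfolding gap_sum_def by (intro sum.group) (auto simp: finite_gap_sets vg_I_def)
  then show ?thesis by (simp add: vg_A_def S gap_weight_def)
qed

section \<open>From the recursion to the norm of the last derivative\<close>

lemma deriv_dom_UNIV: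
  assumes "\<And>k x. k < n \<Longrightarrow> ((deriv ^^ k) f has_real_derivative (deriv ^^ Suc k) f x) (at x)" "k \<le> n"
  shows "deriv_dom k f = UNIV"
  using \<open>k \<le> n\<close>
proof (induction k)
  case (Suc k)
  then show ?case using assms(1)[of k] by (auto simp: field_differentiable_def)
qed simp

text \<open>By the mean value theorem each difference quotient at a is a value of the derivative off
  a. This covers the case that the top derivative of f happens to exist at 0, where the equation
  gives no direct bound.\<close>

lemma deriv_le_of_punctured_bound:
  fixes f :: "real \<Rightarrow> real"
  assumes f: "\<And>x. isCont f x" and f': "\<And>x. x \<noteq> a \<Longrightarrow> (f has_real_derivative f' x) (at x)"
    and bound: "\<And>x. x \<noteq> a \<Longrightarrow> \<bar>f' x\<bar> \<le> B" and D: "(f has_real_derivative D) (at a)"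
  shows "\<bar>D\<bar> \<le> B"
proof (rule tendsto_upperbound)
  show "((\<lambda>x. \<bar>(f x - f a) / (x - a)\<bar>) \<longlongrightarrow> \<bar>D\<bar>) (at_right a)"
    using D by (intro tendsto_rabs) (simp add: has_field_derivative_iff filterlim_at_split)
  show "\<forall>\<^sub>F x in at_right a. \<bar>(f x - f a) / (x - a)\<bar> \<le> B"
    using eventually_at_right_less[of a]
  proof eventually_elim
    case (elim x)
    have "continuous_on {a..x} f" using f by (simp add: continuous_at_imp_continuous_on)
    moreover have "f differentiable at z" if "a < z" for z
      using f'[of z] that by (auto simp: real_differentiable_def)
    ultimately obtain l z where z: "a < z" "z < x" "(f has_real_derivative l) (at z)" "f x - f a = (x - a) * l"
      using MVT[OF elim, of f] by blast
    then have "(f x - f a) / (x - a) = f' z" using DERIV_unique[OF z(3) f'[of z]] elim by simp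
    then show ?case using bound[of z] z by simp
  qed
qed simp

theorem mainTheorem5:
  fixes r \<theta> \<sigma> :: real and M :: "'a measure" and Z :: "'a \<Rightarrow> real"
    and n :: nat and h htilde f :: "real \<Rightarrow> real"
  assumes "r > 0" and "\<sigma> > 0"
    and "prob_space M"
    and "distributed M lborel Z (\<lambda>x. ennreal (vg_density r \<theta> \<sigma> x))"
    and "n \<ge> 1" and "h \<in> Cb n"
    and "htilde = (\<lambda>x. h x - (\<integral>\<omega>. h (Z \<omega>) \<partial>M))"
    and "f = vg_stein_sol r \<theta> \<sigma> htilde"
  shows "deriv_dom n f = UNIV \<and> - {0} \<subseteq> deriv_dom (n + 1) f \<and> deriv_bounded (n + 1) f \<and>
    deriv_norm (n + 1) f \<le>
      1 / \<sigma>\<^sup>2 * (\<Sum>j=0..n - 1. (vg_B r \<theta> \<sigma> (n - j) * (\<Sum>l\<in>vg_I j. vg_A r \<theta> \<sigma> n j l))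
                               * deriv_norm (n - j) h)
      + vg_B r \<theta> \<sigma> 0 / \<sigma>\<^sup>2
          * ((\<Sum>l\<in>vg_I n. vg_A r \<theta> \<sigma> n n l)
             + vg_B r \<theta> \<sigma> 1 / sqrt (\<theta>\<^sup>2 + \<sigma>\<^sup>2) * (\<Sum>l\<in>vg_I (n - 1). vg_A r \<theta> \<sigma> n (n - 1) l))
          * (SUP x. \<bar>htilde x\<bar>)"
proof -
  note r = assms(1) and \<sigma> = assms(2) and n = assms(5) and Cb = assms(6)
  define E where "E = (\<integral>\<omega>. h (Z \<omega>) \<partial>M)"
  have ht: "htilde = (\<lambda>x. h x - E)" using assms(7) by (simp add: E_def)
  define G where "G = (SUP x. \<bar>htilde x\<bar>)"
  define L where "L = deriv_norm n h"
  \<comment> \<open>At order 0 the centred function takes the place of h, in \<open>\<eta>\<close>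
    as in \<open>H\<close>; the higher derivatives are those of h.\<close>
  define \<eta> where "\<eta> k = (if k = 0 then G else deriv_norm k h)" for k
  define H where "H k = (if k = 0 then htilde else (deriv ^^ k) h)" for k
  define \<phi>0 where "\<phi>0 = vg_B r \<theta> \<sigma> 0 / sqrt (\<theta>\<^sup>2 + \<sigma>\<^sup>2) * G"
  define \<phi>1 where "\<phi>1 = vg_B r \<theta> \<sigma> 0 / \<sigma>\<^sup>2 * G"
  define \<beta> where "\<beta> = stein_rec (\<lambda>k. vg_B r \<theta> \<sigma> k / \<sigma>\<^sup>2) \<bar>\<theta>\<bar> \<eta> \<phi>0 \<phi>1"
  have hb: "\<bar>h x\<bar> \<le> deriv_norm 0 h" for x using Cb_bound[OF Cb n, of 0 x] n by simp
  have hd: "((deriv ^^ k) h has_real_derivative H (Suc k) x) (at x)" if "Suc k < n" for k x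
    using Cb_deriv[OF Cb n that] by (simp add: H_def)
  have H_eq: "H k x - H k y = (deriv ^^ k) h x - (deriv ^^ k) h y" for k x y
    by (simp add: H_def ht)
  have H_deriv: "(H k has_real_derivative d) (at x)" if "((deriv ^^ k) h has_real_derivative d) (at x)" for k x d
    using that by (auto simp: H_def ht intro!: derivative_eq_intros)
  have hcont: "isCont h x" for x
  proof (cases "n = 1")
    case True
    have "\<bar>h y - h z\<bar> \<le> L * \<bar>y - z\<bar>" for y z
      using Cb_lipschitz[OF Cb n, of y z] True by (simp add: L_def)
    then show ?thesis by (rule isCont_of_lipschitz)
  next
    case False
    then show ?thesis using hd[of 0 x] n by (auto intro: DERIV_isCont)
  qed
  have "\<bar>htilde x\<bar> \<le> deriv_norm 0 h + \<bar>E\<bar>" for x using hb[of x] by (simp add: ht)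
  then have "bdd_above (range (\<lambda>x. \<bar>htilde x\<bar>))" by (auto simp: bdd_above_def)
  then have Gb: "\<bar>htilde x\<bar> \<le> G" for x unfolding G_def by (rule cSUP_upper[OF UNIV_I])
  note mean = vg_mean_zero[OF \<sigma> r assms(3,4) hcont hb, folded E_def, folded fun_cong[OF ht]]
  have htcont: "isCont htilde x" for x unfolding ht using hcont by (intro continuous_intros)
  obtain f1 f2 where f: "\<And>x. (f has_real_derivative f1 x) (at x)" "isCont f1 0"
      "\<And>x. x \<noteq> 0 \<Longrightarrow> (f1 has_real_derivative f2 x) (at x)"
      "\<And>x. x \<noteq> 0 \<Longrightarrow> \<sigma>\<^sup>2 * x * f2 x + (\<sigma>\<^sup>2 * r + 2 * \<theta> * x) * f1 x + (r * \<theta> - x) * f x = htilde x"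
      "\<And>x. \<bar>f x\<bar> \<le> \<phi>0" "\<And>x. \<bar>f1 x\<bar> \<le> \<phi>1"
    using stein_solution[OF r \<sigma> htcont Gb mean]
    unfolding assms(8)[symmetric] \<phi>0_def \<phi>1_def vg_B_def of_nat_0 add_0_right by blast
  \<comment> \<open>Nonnegativity is read off the Lipschitz bound; from the supremum it would
    require exhibiting a point of differentiability.\<close>
  have "0 \<le> \<bar>(deriv ^^ (n - 1)) h 1 - (deriv ^^ (n - 1)) h 0\<bar>" by simp
  also have "\<dots> \<le> L * \<bar>1 - 0\<bar>" unfolding L_def by (rule Cb_lipschitz[OF Cb n])
  finally have L0: "L \<ge> 0" by simp
  have \<eta>n: "\<eta> n = L" using n by (simp add: \<eta>_def L_def)
  have HL: "\<bar>H (n - 1) x - H (n - 1) y\<bar> \<le> \<eta> n * \<bar>x - y\<bar>" for x y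
    unfolding H_eq \<eta>n L_def by (rule Cb_lipschitz[OF Cb n])
  have Hae: "\<exists>d. (H (n - 1) has_real_derivative d) (at x) \<and> \<bar>d\<bar> \<le> \<eta> n"
    if "x \<notin> {x. \<not> (deriv ^^ (n - 1)) h differentiable at x}" for x
    using Cb_differentiable[OF Cb n] H_deriv that unfolding \<eta>n L_def by blast
  have Hd: "(H k has_real_derivative H (Suc k) x) (at x)" if "Suc k < n" for k x
    by (rule H_deriv[OF hd[OF that]])
  have Hb: "\<bar>H k x\<bar> \<le> \<eta> k" if "k < n" for k x
    using Cb_bound[OF Cb n that, of x] Gb by (simp add: H_def \<eta>_def)
  have "H 0 = htilde" by (simp add: H_def)
  note F = stein_derivatives[OF r \<sigma> Hd Hb L0[folded \<eta>n] HL Cb_negligible[OF Cb n] Hae n f(1-4)[folded this] f(5,6), folded vg_B_def, folded \<beta>_def]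
  have dom: "deriv_dom n f = UNIV" by (rule deriv_dom_UNIV[OF F(1)]) auto
  have dom': "- {0} \<subseteq> deriv_dom (n + 1) f"
    using F(2) dom by (auto simp: field_differentiable_def)
  have bound: "\<bar>(deriv ^^ (n + 1)) f x\<bar> \<le> \<beta> (Suc n)" if x: "x \<in> deriv_dom (n + 1) f" for x
  proof (cases "x = 0")
    case True
    have diff: "((deriv ^^ n) f has_real_derivative (deriv ^^ Suc n) f x) (at x)"
      using x by (simp add: DERIV_deriv_iff_field_differentiable)
    have "\<bar>(deriv ^^ Suc n) f 0\<bar> \<le> \<beta> (Suc n)"
    proof (rule deriv_le_of_punctured_bound[OF _ F(2,3)])
      show "isCont ((deriv ^^ n) f) y" for y
        using F(2)[of y] diff True by (cases "y = 0") (auto intro: DERIV_isCont)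
    qed (use diff True in simp_all)
    then show ?thesis using True by simp
  qed (use F(3) in simp)
  have bounded: "deriv_bounded (n + 1) f"
    unfolding deriv_bounded_def bounded_iff using bound by auto
  have norm: "deriv_norm (n + 1) f \<le> \<beta> (Suc n)"
    unfolding deriv_norm_def
  proof (rule cSUP_least)
    show "deriv_dom (n + 1) f \<noteq> {}" using dom' by (auto dest: subsetD[of _ _ 1])
  qed (rule bound)
  have \<beta>: "\<beta> (Suc n) = 1 / \<sigma>\<^sup>2 * (\<Sum>j=0..n - 1. (vg_B r \<theta> \<sigma> (n - j) * (\<Sum>l\<in>vg_I j. vg_A r \<theta> \<sigma> n j l)) * deriv_norm (n - j) h)
      + vg_B r \<theta> \<sigma> 0 / \<sigma>\<^sup>2 * ((\<Sum>l\<in>vg_I n. vg_A r \<theta> \<sigma> n n l)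
         + vg_B r \<theta> \<sigma> 1 / sqrt (\<theta>\<^sup>2 + \<sigma>\<^sup>2) * (\<Sum>l\<in>vg_I (n - 1). vg_A r \<theta> \<sigma> n (n - 1) l)) * G"
  proof -
    define A where "A = gap_sum \<bar>\<theta>\<bar> (\<lambda>i. real i * (vg_B r \<theta> \<sigma> i / \<sigma>\<^sup>2)) n"
    have vgA: "(\<Sum>l\<in>vg_I j. vg_A r \<theta> \<sigma> n j l) = A (n - j)" if "j \<le> n" for j
      unfolding A_def by (rule sum_vg_A[OF that])
    \<comment> \<open>Unrolled down to m = 0, where the bounds for f' and f remain.
      \<open>\<phi>1\<close> brings B_0 / \<sigma>^2, and \<open>\<phi>0\<close> brings B_0 over the
      square root, next to the factor B_1 / \<sigma>^2 of the last step.\<close>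
    have "\<beta> (Suc n) = (\<Sum>k\<in>{0<..n}. A k * (vg_B r \<theta> \<sigma> k / \<sigma>\<^sup>2) * \<eta> k) + A 0 * \<phi>1 + A 1 * (vg_B r \<theta> \<sigma> 1 / \<sigma>\<^sup>2) * \<phi>0"
      using stein_rec_unroll[of 0 n "\<lambda>k. vg_B r \<theta> \<sigma> k / \<sigma>\<^sup>2" "\<bar>\<theta>\<bar>" \<eta> \<phi>0 \<phi>1] by (simp add: \<beta>_def A_def)
    also have "(\<Sum>k\<in>{0<..n}. A k * (vg_B r \<theta> \<sigma> k / \<sigma>\<^sup>2) * \<eta> k)
        = (\<Sum>j=0..n - 1. A (n - j) * (vg_B r \<theta> \<sigma> (n - j) / \<sigma>\<^sup>2) * \<eta> (n - j))"
      by (rule sum.reindex_bij_witness[of _ "\<lambda>j. n - j" "\<lambda>k. n - k"]) (use n in auto)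
    also have "\<dots> = (\<Sum>j=0..n - 1. 1 / \<sigma>\<^sup>2 * ((vg_B r \<theta> \<sigma> (n - j) * (\<Sum>l\<in>vg_I j. vg_A r \<theta> \<sigma> n j l)) * deriv_norm (n - j) h))"
      using n by (intro sum.cong) (auto simp: vgA \<eta>_def)
    also have "\<dots> = 1 / \<sigma>\<^sup>2 * (\<Sum>j=0..n - 1. (vg_B r \<theta> \<sigma> (n - j) * (\<Sum>l\<in>vg_I j. vg_A r \<theta> \<sigma> n j l)) * deriv_norm (n - j) h)"
      by (simp only: sum_distrib_left)
    also have "A 0 * \<phi>1 = vg_B r \<theta> \<sigma> 0 / \<sigma>\<^sup>2 * (\<Sum>l\<in>vg_I n. vg_A r \<theta> \<sigma> n n l) * G"
      by (simp add: vgA \<phi>1_def)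
    also have "A 1 * (vg_B r \<theta> \<sigma> 1 / \<sigma>\<^sup>2) * \<phi>0 = vg_B r \<theta> \<sigma> 0 / \<sigma>\<^sup>2
        * (vg_B r \<theta> \<sigma> 1 / sqrt (\<theta>\<^sup>2 + \<sigma>\<^sup>2) * (\<Sum>l\<in>vg_I (n - 1). vg_A r \<theta> \<sigma> n (n - 1) l)) * G"
      using n by (simp add: vgA \<phi>0_def)
    finally show ?thesis by (simp only: distrib_left distrib_right add.assoc)
  qed
  show ?thesis by (intro conjI dom dom' bounded norm[unfolded \<beta> G_def])
qed

end
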